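(* Let $\Omega$ be the two-dimensional torus, or $\mathbb{R}^2$, or a bounded open regular subset of $\mathbb{R}^2$, and let $b\in L^2_{loc}(\Omega;\mathbb{R}^2)$ satisfy $\operatorname{div} b=0$ in the sense of distributions (and be tangent to $\partial\Omega$ in the case of a bounded domain). Let $H:\Omega\to\mathbb{R}$, $H\in W^{1,2}_{loc}(\Omega)$, be a Hamiltonian of $b$, i.e. $b=\nabla H^{\perp}=(-\partial_{x_2}H,\partial_{x_1}H)$. Let $O$ be the set of points of $\Omega$ having a neighbourhood on which $b$ vanishes (a.e.), let $P$ be the set of points $x\in\Omega$ such that $$(P_x)\qquad \exists\, \xi\in\mathbb{R}^2,\ \alpha>0,\ \epsilon>0\ \text{ such that } b(y)\cdot\xi\ge\alpha \text{ for almost all } y\in B(x,\epsilon),$$ and let $Z=\Omega\setminus(O\cup P)$. Assume that $H$ is continuous, that $Z$ has zero Lebesgue measure in $\mathbb{R}^2$, and that $H(Z)$ has zero Lebesgue measure in $\mathbb{R}$. Then condition (R) holds: for every $u^o\in L^\infty(\Omega)$, every solution $u\in L^\infty([0,\infty)\times\Omega)$ of the transport equation $\partial_t u+b\cdot\nabla_x u=0$ on $[0,\infty)\times\Omega$ with initial condition $u^o$ is a renormalized solution.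
   Context: The vector field $b=b(x)$ is autonomous. $B(x,\epsilon)$ is the open ball of centre $x$ and radius $\epsilon$ (contained in $\Omega$); $\xi,\alpha,\epsilon$ may depend on $x$. Tangency of $b$ to $\partial\Omega$ means that the normal component of $b$ on $\partial\Omega$ vanishes (in the weak sense). Solution: for $u^o\in L^\infty(\Omega)$, a function $u\in L^\infty([0,\infty)\times\Omega)$ is a solution with initial condition $u^o$ if for all $\phi\in C_c^\infty([0,\infty)\times\Omega)$ (test functions need not vanish at $t=0$) $$\int_{[0,\infty)\times\Omega}u\,\big(\partial_t\phi+b\cdot\nabla_x\phi\big)\,dt\,dx=-\int_\Omega u^o(x)\,\phi(0,x)\,dx.$$ Renormalized solution: $u$ is a renormalized solution with initial condition $u^o$ if for every $\beta\in C^1_b(\mathbb{R})$ (differentiable functions $\mathbb{R}\to\mathbb{R}$ with bounded continuous derivative), $\beta(u)$ is a solution with initial condition $\beta(u^o)$. *)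

theory Defs
  imports "HOL-Analysis.Analysis"
begin

section \<open>Smooth functions and gradients\<close>

text \<open>\<open>Ck k S f\<close> is meant for open \<open>S\<close>.\<close>

primrec Ck :: "nat \<Rightarrow> 'a::euclidean_space set \<Rightarrow> ('a \<Rightarrow> real) \<Rightarrow> bool" where
  "Ck 0 S f \<longleftrightarrow> continuous_on S f"
| "Ck (Suc k) S f \<longleftrightarrow>
     f differentiable_on S \<and> (\<forall>e\<in>Basis. Ck k S (\<lambda>x. frechet_derivative f (at x) e))"

definition smooth :: "('a::euclidean_space \<Rightarrow> real) \<Rightarrow> bool" where
  "smooth f \<longleftrightarrow> (\<forall>k. Ck k UNIV f)"

definition supp :: "('a::topological_space \<Rightarrow> real) \<Rightarrow> 'a set" where
  "supp f = closure {x. f x \<noteq> 0}"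

definition grad :: "(real^2 \<Rightarrow> real) \<Rightarrow> real^2 \<Rightarrow> real^2" where
  "grad f x = (\<chi> i. frechet_derivative f (at x) (axis i 1))"

definition perp :: "real^2 \<Rightarrow> real^2" where
  "perp v = vector [- (v $ 2), v $ 1]"

section \<open>Domains\<close>

text \<open>
  The torus is the quotient of the plane by the integer lattice. Functions on it are represented
  by functions on the plane that are periodic in both coordinates, subsets of it by their
  (periodic) preimages in the plane, and integrals over it by integrals over the unit square.
\<close>

datatype planar_domain = Torus | Plane | Bounded "(real^2) set"

fun points :: "planar_domain \<Rightarrow> (real^2) set" where
  "points Torus = UNIV"
| "points Plane = UNIV"
| "points (Bounded W) = W"

fun cell :: "planar_domain \<Rightarrow> (real^2) set" where
  "cell Torus = {x. \<forall>i. 0 \<le> x $ i \<and> x $ i < 1}"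
| "cell Plane = UNIV"
| "cell (Bounded W) = W"

definition periodic :: "(real^2 \<Rightarrow> 'b) \<Rightarrow> bool" where
  "periodic f \<longleftrightarrow> (\<forall>x i. f (x + axis i 1) = f x)"

definition function_on :: "planar_domain \<Rightarrow> (real^2 \<Rightarrow> 'b) \<Rightarrow> bool" where
  "function_on \<Omega> f \<longleftrightarrow> (\<Omega> = Torus \<longrightarrow> periodic f)"

text \<open>
  Regularity of a bounded open set is taken to mean that its boundary is of class \<open>C\<^sup>1\<close>, the set
  lying locally on one side of it.
\<close>

definition C1_boundary :: "(real^2) set \<Rightarrow> bool" where
  "C1_boundary W \<longleftrightarrow>
     (\<forall>p\<in>frontier W. \<exists>U \<rho>. open U \<and> p \<in> U \<and> Ck 1 U \<rho> \<and> (\<forall>x\<in>U. grad \<rho> x \<noteq> 0) \<and>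
        W \<inter> U = {x \<in> U. \<rho> x < 0})"

fun admissible :: "planar_domain \<Rightarrow> bool" where
  "admissible Torus \<longleftrightarrow> True"
| "admissible Plane \<longleftrightarrow> True"
| "admissible (Bounded W) \<longleftrightarrow> bounded W \<and> open W \<and> C1_boundary W"

section \<open>Test functions\<close>

definition test_function :: "planar_domain \<Rightarrow> (real^2 \<Rightarrow> real) \<Rightarrow> bool" where
  "test_function \<Omega> \<phi> \<longleftrightarrow> smooth \<phi> \<and> function_on \<Omega> \<phi> \<and>
     (\<Omega> \<noteq> Torus \<longrightarrow> compact (supp \<phi>) \<and> supp \<phi> \<subseteq> points \<Omega>)"

text \<open>
  Test functions on \<open>[0, \<infinity>) \<times> \<Omega>\<close> are restrictions of compactly supported smooth functions on
  \<open>\<real> \<times> \<Omega>\<close>; in particular they need not vanish at time 0. On the torus, compactness of the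
  support only constrains the time variable.
\<close>

definition spacetime_test_function :: "planar_domain \<Rightarrow> (real \<times> (real^2) \<Rightarrow> real) \<Rightarrow> bool" where
  "spacetime_test_function \<Omega> \<phi> \<longleftrightarrow> smooth \<phi> \<and> (\<forall>t. function_on \<Omega> (\<lambda>x. \<phi> (t, x))) \<and>
     (if \<Omega> = Torus then \<exists>T. \<forall>t x. T < \<bar>t\<bar> \<longrightarrow> \<phi> (t, x) = 0
      else compact (supp \<phi>) \<and> supp \<phi> \<subseteq> UNIV \<times> points \<Omega>)"

section \<open>Function spaces\<close>

definition ess_bounded :: "'a::euclidean_space set \<Rightarrow> ('a \<Rightarrow> real) \<Rightarrow> bool" where
  "ess_bounded S f \<longleftrightarrow> f \<in> borel_measurable (lebesgue_on S) \<and>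
     (\<exists>C. AE x in lebesgue_on S. \<bar>f x\<bar> \<le> C)"

definition Linf :: "planar_domain \<Rightarrow> (real^2 \<Rightarrow> real) \<Rightarrow> bool" where
  "Linf \<Omega> f \<longleftrightarrow> function_on \<Omega> f \<and> ess_bounded (points \<Omega>) f"

definition spacetime_Linf :: "planar_domain \<Rightarrow> (real \<times> (real^2) \<Rightarrow> real) \<Rightarrow> bool" where
  "spacetime_Linf \<Omega> u \<longleftrightarrow>
     (\<forall>t\<ge>0. function_on \<Omega> (\<lambda>x. u (t, x))) \<and> ess_bounded ({0..} \<times> points \<Omega>) u"

definition L2_loc :: "planar_domain \<Rightarrow> (real^2 \<Rightarrow> 'b::euclidean_space) \<Rightarrow> bool" where
  "L2_loc \<Omega> f \<longleftrightarrow> function_on \<Omega> f \<and> f \<in> borel_measurable (lebesgue_on (points \<Omega>)) \<and>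
     (\<forall>K. compact K \<and> K \<subseteq> points \<Omega> \<longrightarrow> integrable (lebesgue_on K) (\<lambda>x. (norm (f x))\<^sup>2))"

definition weak_gradient :: "planar_domain \<Rightarrow> (real^2 \<Rightarrow> real) \<Rightarrow> (real^2 \<Rightarrow> real^2) \<Rightarrow> bool" where
  "weak_gradient \<Omega> f G \<longleftrightarrow> (\<forall>\<phi> i. test_function \<Omega> \<phi> \<longrightarrow>
     (LINT x|lebesgue_on (cell \<Omega>). f x * grad \<phi> x $ i) =
     - (LINT x|lebesgue_on (cell \<Omega>). G x $ i * \<phi> x))"

definition W12_loc :: "planar_domain \<Rightarrow> (real^2 \<Rightarrow> real) \<Rightarrow> bool" where
  "W12_loc \<Omega> f \<longleftrightarrow> L2_loc \<Omega> f \<and> (\<exists>G. L2_loc \<Omega> G \<and> weak_gradient \<Omega> f G)"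

section \<open>Vector fields\<close>

definition divergence_free :: "planar_domain \<Rightarrow> (real^2 \<Rightarrow> real^2) \<Rightarrow> bool" where
  "divergence_free \<Omega> b \<longleftrightarrow> (\<forall>\<phi>. test_function \<Omega> \<phi> \<longrightarrow>
     (LINT x|lebesgue_on (cell \<Omega>). b x \<bullet> grad \<phi> x) = 0)"

text \<open>
  For a divergence-free field the weak normal component on the boundary is the functional
  \<open>\<phi> \<mapsto> \<integral> b \<bullet> \<nabla>\<phi>\<close> on test functions that need not vanish near the boundary. Square integrability
  in the interior does not make this integral meaningful, so its existence is required explicitly.
\<close>

fun tangent_to_boundary :: "planar_domain \<Rightarrow> (real^2 \<Rightarrow> real^2) \<Rightarrow> bool" where
  "tangent_to_boundary Torus b \<longleftrightarrow> True"
| "tangent_to_boundary Plane b \<longleftrightarrow> True"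
| "tangent_to_boundary (Bounded W) b \<longleftrightarrow> (\<forall>\<phi>. smooth \<phi> \<and> compact (supp \<phi>) \<longrightarrow>
     integrable (lebesgue_on W) (\<lambda>x. b x \<bullet> grad \<phi> x) \<and>
     (LINT x|lebesgue_on W. b x \<bullet> grad \<phi> x) = 0)"

definition hamiltonian :: "planar_domain \<Rightarrow> (real^2 \<Rightarrow> real) \<Rightarrow> (real^2 \<Rightarrow> real^2) \<Rightarrow> bool" where
  "hamiltonian \<Omega> H b \<longleftrightarrow> (\<exists>G. L2_loc \<Omega> G \<and> weak_gradient \<Omega> H G \<and>
     (AE x in lebesgue_on (points \<Omega>). b x = perp (G x)))"

definition vanishing_points :: "planar_domain \<Rightarrow> (real^2 \<Rightarrow> real^2) \<Rightarrow> (real^2) set" where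
  "vanishing_points \<Omega> b = {x \<in> points \<Omega>. \<exists>U. open U \<and> x \<in> U \<and> U \<subseteq> points \<Omega> \<and>
     (AE y in lebesgue_on U. b y = 0)}"

definition directed_points :: "planar_domain \<Rightarrow> (real^2 \<Rightarrow> real^2) \<Rightarrow> (real^2) set" where
  "directed_points \<Omega> b = {x \<in> points \<Omega>. \<exists>\<xi> \<alpha> \<epsilon>. \<alpha> > 0 \<and> \<epsilon> > 0 \<and> ball x \<epsilon> \<subseteq> points \<Omega> \<and>
     (AE y in lebesgue_on (ball x \<epsilon>). b y \<bullet> \<xi> \<ge> \<alpha>)}"

definition critical_points :: "planar_domain \<Rightarrow> (real^2 \<Rightarrow> real^2) \<Rightarrow> (real^2) set" where
  "critical_points \<Omega> b = points \<Omega> - (vanishing_points \<Omega> b \<union> directed_points \<Omega> b)"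

section \<open>Solutions of the transport equation\<close>

definition solution ::
  "planar_domain \<Rightarrow> (real^2 \<Rightarrow> real^2) \<Rightarrow> (real^2 \<Rightarrow> real) \<Rightarrow> (real \<times> (real^2) \<Rightarrow> real) \<Rightarrow> bool" where
  "solution \<Omega> b u0 u \<longleftrightarrow> Linf \<Omega> u0 \<and> spacetime_Linf \<Omega> u \<and>
     (\<forall>\<phi>. spacetime_test_function \<Omega> \<phi> \<longrightarrow>
        (LINT (t, x)|lebesgue_on ({0..} \<times> cell \<Omega>).
           u (t, x) * (deriv (\<lambda>s. \<phi> (s, x)) t + b x \<bullet> grad (\<lambda>y. \<phi> (t, y)) x)) =
        - (LINT x|lebesgue_on (cell \<Omega>). u0 x * \<phi> (0, x)))"

definition C1_b :: "(real \<Rightarrow> real) \<Rightarrow> bool" where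
  "C1_b \<beta> \<longleftrightarrow> \<beta> differentiable_on UNIV \<and> continuous_on UNIV (deriv \<beta>) \<and> bounded (range (deriv \<beta>))"

definition renormalized_solution ::
  "planar_domain \<Rightarrow> (real^2 \<Rightarrow> real^2) \<Rightarrow> (real^2 \<Rightarrow> real) \<Rightarrow> (real \<times> (real^2) \<Rightarrow> real) \<Rightarrow> bool" where
  "renormalized_solution \<Omega> b u0 u \<longleftrightarrow>
     (\<forall>\<beta>. C1_b \<beta> \<longrightarrow> solution \<Omega> b (\<beta> \<circ> u0) (\<beta> \<circ> u))"

end

theory Submission
  imports Defs "HOL-Computational_Algebra.Polynomial"
begin

text \<open>
 A solution \<open>u\<close> is extended by its initial value to negative times, where the field is switched
 off; the initial condition then becomes part of a homogeneous equation on \<open>\<real> \<times> \<Omega>\<close>.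

 Near a directed point, say with \<open>b \<bullet> e \<ge> \<alpha> > 0\<close>, the Hamiltonian increases strictly across the
 direction \<open>e\<close>, and \<open>z \<mapsto> (z \<bullet> e, H z)\<close> is a homeomorphism onto a rectangle that carries the measure
 \<open>(b \<bullet> e) dz\<close> to Lebesgue measure. As \<open>b\<close> is orthogonal to the gradient of \<open>H\<close>, the equation
 becomes \<open>\<partial>\<^sub>t (g u) + \<partial>\<^sub>s u = 0\<close> for positive times, with \<open>g = 1 / (b \<bullet> e)\<close>, and \<open>h = H z\<close> is merely
 a parameter. Regularizing \<open>u\<close> in time only, the equation gives a bounded
 derivative in \<open>s\<close>, and the product of a regularized solution with another solution can be
 computed directly. Hence products of solutions are solutions, and by the Weierstrass theorem
 so is \<open>\<beta> \<circ> u\<close> for every continuous \<open>\<beta>\<close>.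

 Where \<open>b\<close> vanishes, \<open>u\<close> is constant in time. The critical points are removed with cut-off
 functions of \<open>H\<close>, whose gradient is not seen by the equation: their levels form a null set,
 and almost every point of a null set of levels is a point near which \<open>b\<close> vanishes.

 The torus is reduced to the plane by periodizing test functions.
\<close>

text \<open>For a field that is merely square integrable, mollifying a solution in space leaves a
  commutator that cannot be controlled. After straightening, the only irregular coefficient is
  \<open>g\<close>, which depends on \<open>(s, h)\<close> and not on time: regularization in time
  commutes with it, and this is why it is enough. The price is paid at time 0, where the field is
  switched on and invariance under time shifts fails. The kernels therefore average over later times
  only, so that at times \<open>t \<ge> 0\<close> they never see the switch. What remains at
  negative times is integrated by parts, and this calls for the averages at time 0 to converge
  weakly to the initial value.

  Square integrability enters through the pairing of \<open>b\<close> with the error in the gradient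
  of a mollified Hamiltonian. This makes \<open>H\<close> a passive variable, which serves twice: in
  the straightened equation and again for the cut-off in the levels of \<open>H\<close>. Products
  come before general \<open>\<beta>\<close> because a product can be tested with one factor
  regularized and the other left rough.\<close>

abbreviation Borel :: "('a::topological_space \<Rightarrow> 'b::topological_space) set" where
 "Borel \<equiv> borel_measurable borel"

abbreviation L1 :: "('a::euclidean_space \<Rightarrow> 'b::{banach, second_countable_topology}) \<Rightarrow> bool" where
 "L1 \<equiv> integrable lborel"

section \<open>Continuously differentiable functions carried together with their gradient\<close>

definition C1 :: "('a::euclidean_space \<Rightarrow> real) \<Rightarrow> ('a \<Rightarrow> 'a) \<Rightarrow> bool" where
 "C1 f g \<longleftrightarrow> (\<forall>x. (f has_derivative (\<lambda>v. g x \<bullet> v)) (at x)) \<and> continuous_on UNIV g"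

lemma C1_D: "C1 f g \<Longrightarrow> (f has_derivative (\<lambda>v. g x \<bullet> v)) (at x)"
 by (simp add: C1_def)

lemma C1_continuous: "C1 f g \<Longrightarrow> continuous_on S f"
 by (meson C1_def continuous_at_imp_continuous_on has_derivative_continuous)

lemma C1_grad_continuous: "C1 f g \<Longrightarrow> continuous_on S g"
 by (meson C1_def continuous_on_subset subset_UNIV)

lemma C1_borel [measurable_dest]: "C1 f g \<Longrightarrow> f \<in> Borel"
 by (simp add: C1_continuous borel_measurable_continuous_onI)

lemma C1_grad_borel [measurable_dest]: "C1 f g \<Longrightarrow> g \<in> Borel"
 by (simp add: C1_grad_continuous borel_measurable_continuous_onI)

lemma C1_unique:
 assumes "C1 f g" "(f has_derivative D) (at x)"
 shows "D v = g x \<bullet> v"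
 using has_derivative_unique[OF assms(2) C1_D[OF assms(1)]] by simp

lemma linear_sum_Basis_inner:
 assumes "linear D"
 shows "(\<Sum>e\<in>Basis. D e *\<^sub>R e) \<bullet> v = (D v :: real)"
proof -
 have "D v = D (\<Sum>e\<in>Basis. (v \<bullet> e) *\<^sub>R e)" by (simp add: euclidean_representation)
 also have "\<dots> = (\<Sum>e\<in>Basis. (v \<bullet> e) * D e)"
  using assms by (simp add: linear_sum linear_scale)
 finally show ?thesis
  by (simp add: inner_sum_left inner_commute[of v] mult.commute)
qed

text \<open>The gradient is the Riesz representative of the derivative. The second conclusion
  evaluates it in an arbitrary direction, so that the sum over the basis never has to be
  expanded.\<close>

lemma C1I:
 assumes D: "\<And>x. (f has_derivative D x) (at x)"
  and c: "\<And>e. e \<in> Basis \<Longrightarrow> continuous_on UNIV (\<lambda>x. D x e)"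
 shows "C1 f (\<lambda>x. \<Sum>e\<in>Basis. D x e *\<^sub>R e)" "(\<Sum>e\<in>Basis. D x e *\<^sub>R e) \<bullet> v = D x v"
proof -
 have lin: "linear (D x)" for x
  using D has_derivative_linear by blast
 show "(\<Sum>e\<in>Basis. D x e *\<^sub>R e) \<bullet> v = D x v"
  by (rule linear_sum_Basis_inner[OF lin])
 show "C1 f (\<lambda>x. \<Sum>e\<in>Basis. D x e *\<^sub>R e)"
  unfolding C1_def linear_sum_Basis_inner[OF lin]
  using D by (auto intro!: continuous_intros c)
qed

lemma C1_const: "C1 (\<lambda>x. c) (\<lambda>x. 0)"
 by (simp add: C1_def)

lemma C1_add: "C1 f f' \<Longrightarrow> C1 g g' \<Longrightarrow> C1 (\<lambda>x. f x + g x) (\<lambda>x. f' x + g' x)"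
 unfolding C1_def by (auto intro!: continuous_intros derivative_eq_intros simp: inner_add_left)

lemma C1_diff: "C1 f f' \<Longrightarrow> C1 g g' \<Longrightarrow> C1 (\<lambda>x. f x - g x) (\<lambda>x. f' x - g' x)"
 unfolding C1_def by (auto intro!: continuous_intros derivative_eq_intros simp: inner_diff_left)

lemma C1_mult:
 assumes "C1 f f'" "C1 g g'"
 shows "C1 (\<lambda>x. f x * g x) (\<lambda>x. f x *\<^sub>R g' x + g x *\<^sub>R f' x)"
proof -
 have "continuous_on UNIV f" "continuous_on UNIV g"
  using assms C1_continuous by blast+
 then show ?thesis
  using assms unfolding C1_def
  by (auto intro!: continuous_intros derivative_eq_intros simp: inner_add_left)
qed

lemma C1_zero_on_open:
 assumes "C1 f g" "open U" "x \<in> U" "\<And>y. y \<in> U \<Longrightarrow> f y = 0"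
 shows "g x = 0"
proof -
 have "(f has_derivative (\<lambda>v. 0)) (at x)"
  by (rule has_derivative_transform_within_open[OF has_derivative_const[of 0]])
   (use assms in auto)
 then have "0 = g x \<bullet> g x" using C1_unique[OF assms(1)] by blast
 then show ?thesis by simp
qed

lemma C1_grad_support:
 assumes "C1 f g" "closed K" "\<And>y. y \<notin> K \<Longrightarrow> f y = 0" "x \<notin> K"
 shows "g x = 0"
 using C1_zero_on_open[OF assms(1), of "- K" x] assms by auto

lemma compact_support_bounded:
 fixes f :: "'a::euclidean_space \<Rightarrow> 'b::euclidean_space"
 assumes "continuous_on UNIV f" "compact K" "\<And>x. x \<notin> K \<Longrightarrow> f x = 0"
 obtains C where "C > 0" "\<And>x. norm (f x) \<le> C"
proof -
 have "bounded (f ` K)"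
  by (intro compact_imp_bounded compact_continuous_image continuous_on_subset[OF assms(1)] assms) simp
 then obtain C where C: "C > 0" "\<forall>x\<in>K. norm (f x) \<le> C"
  unfolding bounded_pos by auto
 show thesis
 proof (rule that[OF C(1)])
  show "norm (f x) \<le> C" for x
   using C assms(3)[of x] by (cases "x \<in> K") auto
 qed
qed

section \<open>Smooth functions\<close>

text \<open>Induction on \<open>k\<close>, carried out for all members of \<open>F\<close> at once,
  gives \<open>Ck k\<close> for each of them. Smoothness is thus reduced to finding a family that is
  closed under partial derivatives.\<close>

lemma smooth_coinduct:
 assumes "f \<in> F"
  and diff: "\<And>f x. f \<in> F \<Longrightarrow> f differentiable at x"
  and cl: "\<And>f e. f \<in> F \<Longrightarrow> e \<in> Basis \<Longrightarrow> (\<lambda>x. frechet_derivative f (at x) e) \<in> F"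
 shows "smooth f"
proof -
 have "\<forall>f\<in>F. Ck k UNIV f" for k
 proof (induction k)
  case 0
  then show ?case
   using diff by (auto intro!: continuous_at_imp_continuous_on differentiable_imp_continuous_within)
 next
  case (Suc k)
  then show ?case using diff cl by (auto simp: differentiable_on_def)
 qed
 then show ?thesis using assms(1) by (auto simp: smooth_def)
qed

lemma Ck_SucD: "Ck (Suc k) S f \<Longrightarrow> Ck k S f"
proof (induction k arbitrary: f)
 case 0
 then show ?case by (simp add: differentiable_imp_continuous_on)
next
 case (Suc k)
 from Suc.prems have "f differentiable_on S"
  "\<forall>e\<in>Basis. Ck (Suc k) S (\<lambda>x. frechet_derivative f (at x) e)"
  unfolding Ck.simps(2)[of "Suc k"] by blast+
 then show ?case using Suc.IH unfolding Ck.simps(2)[of k] by blast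
qed

text \<open>Derivatives are unique, so on the whole space any family of them may be exhibited. The
  closure properties can then be proved with derivative rules instead of computations with
  \<open>frechet_derivative\<close>.\<close>

lemma Ck_Suc_UNIV:
 "Ck (Suc k) UNIV f \<longleftrightarrow> (\<exists>D. (\<forall>x. (f has_derivative D x) (at x)) \<and> (\<forall>e\<in>Basis. Ck k UNIV (\<lambda>x. D x e)))"
  (is "?L \<longleftrightarrow> ?R")
proof
 assume ?L
 then show ?R
  by (intro exI[of _ "\<lambda>x. frechet_derivative f (at x)"])
   (auto simp: differentiable_on_def frechet_derivative_works)
next
 assume ?R
 then obtain D where D: "\<And>x. (f has_derivative D x) (at x)" "\<And>e. e\<in>Basis \<Longrightarrow> Ck k UNIV (\<lambda>x. D x e)"
  by blast
 have "D x = frechet_derivative f (at x)" for x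
  using D(1) frechet_derivative_at by blast
 with D show ?L by (auto simp: differentiable_on_def differentiable_def)
qed

lemma Ck_const: "Ck k UNIV (\<lambda>x. c)"
proof (induction k arbitrary: c)
 case (Suc k)
 then show ?case unfolding Ck_Suc_UNIV
  by (intro exI[of _ "\<lambda>x v. 0"]) auto
qed simp

lemma Ck_add: "Ck k UNIV f \<Longrightarrow> Ck k UNIV g \<Longrightarrow> Ck k UNIV (\<lambda>x. f x + g x)"
proof (induction k arbitrary: f g)
 case (Suc k)
 then obtain D E where "\<forall>x. (f has_derivative D x) (at x)" "\<forall>e\<in>Basis. Ck k UNIV (\<lambda>x. D x e)"
   "\<forall>x. (g has_derivative E x) (at x)" "\<forall>e\<in>Basis. Ck k UNIV (\<lambda>x. E x e)"
  unfolding Ck_Suc_UNIV by blast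
 then show ?case unfolding Ck_Suc_UNIV
  by (intro exI[of _ "\<lambda>x v. D x v + E x v"]) (auto intro!: Suc.IH has_derivative_add)
qed (auto intro: continuous_intros)

lemma Ck_mult: "Ck k UNIV f \<Longrightarrow> Ck k UNIV g \<Longrightarrow> Ck k UNIV (\<lambda>x. f x * g x)"
proof (induction k arbitrary: f g)
 case (Suc k)
 then obtain D E where *: "\<forall>x. (f has_derivative D x) (at x)" "\<forall>e\<in>Basis. Ck k UNIV (\<lambda>x. D x e)"
   "\<forall>x. (g has_derivative E x) (at x)" "\<forall>e\<in>Basis. Ck k UNIV (\<lambda>x. E x e)"
  unfolding Ck_Suc_UNIV by blast
 \<comment> \<open>The product rule also contains the undifferentiated factors, at one order
   less.\<close>
 have "Ck k UNIV f" "Ck k UNIV g" using Suc.prems Ck_SucD by blast+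
 with * show ?case unfolding Ck_Suc_UNIV
  by (intro exI[of _ "\<lambda>x v. f x * E x v + D x v * g x"])
   (auto intro!: Suc.IH Ck_add has_derivative_mult)
qed (auto intro: continuous_intros)

lemma Ck_prod: "finite I \<Longrightarrow> (\<And>i. i \<in> I \<Longrightarrow> Ck k UNIV (f i)) \<Longrightarrow> Ck k UNIV (\<lambda>x. \<Prod>i\<in>I. f i x)"
proof (induction I rule: finite_induct)
 case empty
 then show ?case by (simp add: Ck_const)
next
 case (insert i I)
 then show ?case using Ck_mult[of k "f i" "\<lambda>x. \<Prod>i\<in>I. f i x"] by simp
qed

lemma Ck_comp_inner:
 fixes f :: "real \<Rightarrow> real" and i :: "'a::euclidean_space"
 shows "Ck k UNIV f \<Longrightarrow> Ck k UNIV (\<lambda>x. f (x \<bullet> i + c))"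
proof (induction k arbitrary: f)
 case 0
 then have "continuous_on UNIV f" by simp
 then have "continuous_on UNIV (\<lambda>x::'a. f (x \<bullet> i + c))"
  by (rule continuous_on_compose2[of UNIV f]) (auto intro!: continuous_intros)
 then show ?case by simp
next
 case (Suc k)
 then obtain D where D: "\<And>x. (f has_derivative D x) (at x)" "Ck k UNIV (\<lambda>x. D x 1)"
  unfolding Ck_Suc_UNIV by (metis Basis_real_def singletonI)
 have D1: "D x v = D x 1 * v" for x v
  using linear_scale[OF has_derivative_linear[OF D(1)], of x v 1] by simp
 have "((\<lambda>x. f (x \<bullet> i + c)) has_derivative (\<lambda>v. D (x \<bullet> i + c) (v \<bullet> i))) (at x)" for x
  by (rule has_derivative_compose[OF _ D(1)]) (auto intro!: derivative_eq_intros)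
 moreover have "Ck k UNIV (\<lambda>x. D (x \<bullet> i + c) (e \<bullet> i))" for e
  by (subst D1) (intro Ck_mult Suc.IH D Ck_const)
 ultimately show ?case unfolding Ck_Suc_UNIV
  by (intro exI[of _ "\<lambda>x v. D (x \<bullet> i + c) (v \<bullet> i)"]) auto
qed

text \<open>The functions \<open>p(1/x) exp(-1/x)\<close>, continued by 0 to the left. The
  polynomial is a parameter so that the class is closed under differentiation.\<close>

definition flat :: "real poly \<Rightarrow> real \<Rightarrow> real" where
 "flat p x = (if x > 0 then poly p (1/x) * exp (- (1/x)) else 0)"

lemma poly_exp_tendsto_0: "((\<lambda>x. poly p x * exp (- x)) \<longlongrightarrow> (0::real)) at_top"
proof -
 have "((\<lambda>x. \<Sum>i\<le>degree p. coeff p i * (x ^ i / exp x)) \<longlongrightarrow> (\<Sum>i\<le>degree p. coeff p i * 0)) at_top"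
  by (intro tendsto_intros tendsto_power_div_exp_0)
 then show ?thesis
  by (simp add: poly_altdef exp_minus field_simps sum_distrib_left sum_distrib_right
    sum_divide_distrib)
qed

lemma flat_tendsto_0: "(flat p \<longlongrightarrow> 0) (at 0)"
proof (rule filterlim_split_at_real)
 show "(flat p \<longlongrightarrow> 0) (at_left 0)"
  by (rule tendsto_eventually) (auto simp: flat_def eventually_at_filter)
 have "((\<lambda>x. poly p (1/x) * exp (- (1/x))) \<longlongrightarrow> 0) (at_right 0)"
  using filterlim_compose[OF poly_exp_tendsto_0 filterlim_inverse_at_top_right, of p]
  by (simp add: inverse_eq_divide)
 then show "(flat p \<longlongrightarrow> 0) (at_right 0)"
  by (rule Lim_transform_eventually) (auto simp: flat_def eventually_at_filter)
qed

text \<open>With \<open>y = 1/x\<close>, the derivative of \<open>p(y) exp(-y)\<close> in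
  \<open>x\<close> is \<open>y^2 (p(y) - p'(y)) exp(-y)\<close>. The two \<open>pCons 0\<close>
  multiply by \<open>y^2\<close>.\<close>

definition flat' :: "real poly \<Rightarrow> real poly" where
 "flat' p = pCons 0 (pCons 0 (p - pderiv p))"

lemma flat_deriv: "(flat p has_field_derivative flat (flat' p) x) (at x)"
proof (cases "x = 0")
 case True
 \<comment> \<open>At 0 the difference quotient is itself a flat function, for the polynomial
   \<open>y p(y)\<close>, so its limit is already known.\<close>
 have "(\<lambda>h. (flat p (0 + h) - flat p 0) / h) = flat (pCons 0 p)"
  by (auto simp: flat_def fun_eq_iff field_simps)
 then have "(flat p has_field_derivative 0) (at 0)"
  using flat_tendsto_0[of "pCons 0 p"] by (simp add: DERIV_def)
 then show ?thesis using True by (simp add: flat_def)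
next
 case False
 show ?thesis
 proof (cases "x > 0")
  case True
  have "((\<lambda>x. poly p (1/x) * exp (- (1/x))) has_field_derivative flat (flat' p) x) (at x)"
   using True
   by (auto intro!: derivative_eq_intros DERIV_chain2[OF poly_DERIV]
    simp: flat_def flat'_def field_simps power2_eq_square)
  then show ?thesis
   by (rule has_field_derivative_transform_within_open[where S="{0<..}"]) (use True in \<open>auto simp: flat_def\<close>)
 next
  case F: False
  have "((\<lambda>x::real. 0) has_field_derivative flat (flat' p) x) (at x)"
   using F by (simp add: flat_def)
  then show ?thesis
   by (rule has_field_derivative_transform_within_open[where S="{..<0}"]) (use F False in \<open>auto simp: flat_def\<close>)
 qed
qed

lemma smooth_flat: "smooth (flat p)"
proof (rule smooth_coinduct[of _ "range (\<lambda>(p, c) x. c * flat p x)"])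
 show "flat p \<in> range (\<lambda>(p, c) x. c * flat p x)"
  by (rule image_eqI[of _ _ "(p, 1)"]) auto
 have D: "((\<lambda>x. c * flat p x) has_derivative (\<lambda>h. c * flat (flat' p) x * h)) (at x)" for c p x
  using DERIV_cmult[OF flat_deriv, of c] by (simp add: has_field_derivative_def)
 then show "f differentiable at x" if "f \<in> range (\<lambda>(p, c) x. c * flat p x)" for f x
  using that by (auto simp: differentiable_def)
 show "(\<lambda>x. frechet_derivative f (at x) e) \<in> range (\<lambda>(p, c) x. c * flat p x)"
  if "f \<in> range (\<lambda>(p, c) x. c * flat p x)" "e \<in> Basis" for f e
 proof -
  obtain p c where f: "f = (\<lambda>x. c * flat p x)" using \<open>f \<in> _\<close> by auto
  have "(\<lambda>x. frechet_derivative f (at x) e) = (\<lambda>x. c * flat (flat' p) x)"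
   unfolding f using that by (auto simp: frechet_derivative_at[OF D, symmetric])
  then show ?thesis by (intro image_eqI[of _ _ "(flat' p, c)"]) auto
 qed
qed

lemma mollifier_bump_exists:
 fixes r :: real
 assumes "r > 0"
 obtains K :: "'a::euclidean_space \<Rightarrow> real"
 where "smooth K" "\<And>x. 0 \<le> K x" "\<And>x. r \<le> norm x \<Longrightarrow> K x = 0" "K 0 > 0"
proof -
 \<comment> \<open>Every coordinate is at most \<open>s\<close> in absolute value on the support,
   one factor of the product for each sign. The norm is bounded by the sum over the coordinates,
   hence by \<open>DIM * s = r / 2\<close>.\<close>
 define s where "s = r / (2 * DIM('a))"
 have s: "s > 0" using assms by (simp add: s_def)
 define K where "K = (\<lambda>x::'a. \<Prod>i\<in>Basis. flat 1 (x \<bullet> i + s) * flat 1 (x \<bullet> (- i) + s))"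
 have "smooth K"
  unfolding smooth_def K_def using smooth_flat[of 1]
  by (intro allI Ck_prod Ck_mult Ck_comp_inner) (auto simp: smooth_def)
 moreover have "0 \<le> K x" for x
  by (auto simp: K_def flat_def intro!: prod_nonneg)
 moreover have "K x = 0" if "r \<le> norm x" for x
 proof (rule ccontr)
  assume "K x \<noteq> 0"
  then have *: "\<bar>x \<bullet> i\<bar> \<le> s" if "i \<in> Basis" for i
   using that by (force simp: K_def flat_def split: if_splits)
  have "norm x \<le> (\<Sum>i\<in>Basis. \<bar>x \<bullet> i\<bar>)" by (rule norm_le_l1)
  also have "\<dots> \<le> (\<Sum>i\<in>(Basis::'a set). s)" by (rule sum_mono) (use * in auto)
  also have "\<dots> < r" using assms by (simp add: s_def)
  finally show False using that by simp
 qed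
 moreover have "K 0 > 0" using s by (auto simp: K_def flat_def intro!: prod_pos)
 ultimately show thesis using that by blast
qed

lemma smooth_C1:
 assumes "smooth f"
 shows "C1 f (\<lambda>x. \<Sum>e\<in>Basis. frechet_derivative f (at x) e *\<^sub>R e)"
proof -
 have 1: "Ck (Suc 0) UNIV f" using assms by (simp only: smooth_def)
 show ?thesis
  by (rule C1I(1)) (use 1 in \<open>auto simp: differentiable_on_def frechet_derivative_works\<close>)
qed

lemma smooth_partial:
 assumes "smooth f" "e \<in> Basis" shows "smooth (\<lambda>x. frechet_derivative f (at x) e)"
 unfolding smooth_def
proof
 fix k
 have "Ck (Suc k) UNIV f" using assms by (simp only: smooth_def)
 then show "Ck k UNIV (\<lambda>x. frechet_derivative f (at x) e)" using assms by simp
qed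

lemma inverse_Suc_tendsto_0: "(\<lambda>n. 1 / (real n + 1)) \<longlonglongrightarrow> 0"
 using LIMSEQ_inverse_real_of_nat by (simp add: inverse_eq_divide add.commute)

section \<open>Convolution\<close>

text \<open>The second factor may be vector-valued: the gradient of \<open>conv f K\<close> is then
  \<open>conv f k\<close>, where \<open>k\<close> is the gradient of \<open>K\<close>.\<close>

definition conv :: "('a::euclidean_space \<Rightarrow> real) \<Rightarrow> ('a \<Rightarrow> 'b::euclidean_space) \<Rightarrow> 'a \<Rightarrow> 'b" where
 "conv f K x = (LBINT y. f y *\<^sub>R K (x - y))"

lemma lborel_reflect: "distr lborel borel (\<lambda>y. x - y) = (lborel :: 'a::euclidean_space measure)"
 using lborel_affine[of "-1" x] by (simp add: density_1)

lemma integral_reflect_lborel: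
 fixes g :: "'a::euclidean_space \<Rightarrow> 'b::{banach, second_countable_topology}"
 assumes [measurable]: "g \<in> Borel"
 shows "(LBINT y. g (x - y)) = (LBINT y. g y)"
proof -
 have "(LBINT y. g y) = (\<integral>y. g y \<partial>distr lborel borel (\<lambda>y. x - y))"
  by (simp add: lborel_reflect)
 also have "\<dots> = (LBINT y. g (x - y))" by (rule integral_distr) auto
 finally show ?thesis ..
qed

lemma integrable_reflect_lborel:
 fixes g :: "'a::euclidean_space \<Rightarrow> 'b::{banach, second_countable_topology}"
 assumes [measurable]: "g \<in> Borel"
 shows "L1 (\<lambda>y. g (x - y)) \<longleftrightarrow> L1 g"
 using integrable_distr_eq[of "\<lambda>y. x - y" lborel borel g] by (simp add: lborel_reflect)

lemma lborel_translate: "distr lborel borel (\<lambda>y. y + x) = (lborel :: 'a::euclidean_space measure)"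
 using lborel_affine[of 1 x] by (simp add: density_1 add.commute)

lemma integral_translate_lborel:
 fixes g :: "'a::euclidean_space \<Rightarrow> 'b::{banach, second_countable_topology}"
 assumes [measurable]: "g \<in> Borel"
 shows "(LBINT y. g (y + x)) = (LBINT y. g y)"
proof -
 have "(LBINT y. g y) = (\<integral>y. g y \<partial>distr lborel borel (\<lambda>y. y + x))"
  by (simp add: lborel_translate)
 also have "\<dots> = (LBINT y. g (y + x))" by (rule integral_distr) auto
 finally show ?thesis ..
qed

lemma nn_integral_translate_lborel:
 fixes g :: "'a::euclidean_space \<Rightarrow> ennreal"
 assumes [measurable]: "g \<in> Borel"
 shows "(\<integral>\<^sup>+y. g (y + x) \<partial>lborel) = (\<integral>\<^sup>+y. g y \<partial>lborel)"
proof -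
 have "(\<integral>\<^sup>+y. g y \<partial>lborel) = (\<integral>\<^sup>+y. g y \<partial>distr lborel borel (\<lambda>y. y + x))"
  by (simp add: lborel_translate)
 also have "\<dots> = (\<integral>\<^sup>+y. g (y + x) \<partial>lborel)" by (rule nn_integral_distr) auto
 finally show ?thesis ..
qed

lemma integrable_translate_lborel:
 fixes g :: "'a::euclidean_space \<Rightarrow> 'b::{banach, second_countable_topology}"
 assumes [measurable]: "g \<in> Borel"
 shows "L1 (\<lambda>y. g (y + x)) \<longleftrightarrow> L1 g"
 using integrable_distr_eq[of "\<lambda>y. y + x" lborel borel g] by (simp add: lborel_translate)

lemma conv_swap:
 assumes [measurable]: "f \<in> Borel" "K \<in> Borel"
 shows "conv f K x = (LBINT y. f (x - y) *\<^sub>R K y)"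
 unfolding conv_def
 by (subst integral_reflect_lborel[of "\<lambda>y. f y *\<^sub>R K (x - y)" x, symmetric]) simp_all

lemma C1_frechet: "C1 f g \<Longrightarrow> frechet_derivative f (at x) v = g x \<bullet> v"
 using frechet_derivative_at[OF C1_D[of f g x]] by metis

lemma uniformly_continuous_cball:
 fixes k :: "'a::euclidean_space \<Rightarrow> 'b::euclidean_space"
 assumes "continuous_on UNIV k" "e > 0"
 obtains d where "d > 0" "\<And>u v. norm u \<le> R \<Longrightarrow> norm v \<le> R \<Longrightarrow> norm (v - u) < d \<Longrightarrow> norm (k v - k u) < e"
proof -
 have "uniformly_continuous_on (cball 0 R) k"
  by (rule compact_uniformly_continuous[OF continuous_on_subset[OF assms(1)]]) auto
 then obtain d where "d > 0" "\<forall>u\<in>cball 0 R. \<forall>v\<in>cball 0 R. dist v u < d \<longrightarrow> dist (k v) (k u) < e"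
  using assms(2) unfolding uniformly_continuous_on_def by blast
 then show thesis
  using that[of d] by (simp add: dist_norm[symmetric] Ball_def)
qed

lemma continuous_bounded_on_cball:
 fixes k :: "'a::euclidean_space \<Rightarrow> 'b::euclidean_space"
 assumes "continuous_on UNIV k"
 obtains C where "C > 0" "\<And>x. x \<in> cball 0 R \<Longrightarrow> norm (k x) \<le> C"
proof -
 have "bounded (k ` cball 0 R)"
  using assms by (meson compact_cball compact_continuous_image compact_imp_bounded continuous_on_subset subset_UNIV)
 then show thesis using that unfolding bounded_pos by auto
qed

context
 fixes f :: "'a::euclidean_space \<Rightarrow> real" and R :: real
 assumes f: "L1 f" and supp: "\<And>y. y \<notin> cball 0 R \<Longrightarrow> f y = 0"
begin

lemma conv_factor_borel: "f \<in> Borel"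
 using borel_measurable_integrable[OF f] by simp

lemma conv_integrable:
 fixes k :: "'a \<Rightarrow> 'b::euclidean_space"
 assumes k: "continuous_on UNIV k"
 shows "L1 (\<lambda>y. f y *\<^sub>R k (x - y))"
proof -
 obtain C where C: "C > 0" "\<And>z. z \<in> cball 0 (norm x + R) \<Longrightarrow> norm (k z) \<le> C"
  using continuous_bounded_on_cball[OF k] by blast
 have [measurable]: "k \<in> Borel" using k borel_measurable_continuous_onI by blast
 have "norm (f y *\<^sub>R k (x - y)) \<le> norm (C * f y)" for y
 proof (cases "y \<in> cball 0 R")
  case True
  then have "x - y \<in> cball 0 (norm x + R)"
   using norm_triangle_ineq4[of x y] by auto
  then have "\<bar>f y\<bar> * norm (k (x - y)) \<le> \<bar>f y\<bar> * C" using C(2) by (intro mult_left_mono) auto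
  then show ?thesis using C(1) by (simp add: abs_mult mult.commute)
 qed (simp add: supp)
 then show ?thesis
  using conv_factor_borel
  by (intro Bochner_Integration.integrable_bound[OF integrable_mult_right[OF f, of C]]) auto
qed

lemma conv_bound_diff:
 fixes k :: "'a \<Rightarrow> 'b::euclidean_space"
 assumes "L1 (\<lambda>y. f y *\<^sub>R g y)" "0 \<le> e"
  "\<And>y. y \<in> cball 0 R \<Longrightarrow> norm (g y :: 'b) \<le> e"
 shows "norm (LBINT y. f y *\<^sub>R g y) \<le> e * (LBINT y. \<bar>f y\<bar>)"
proof -
 have "norm (f y *\<^sub>R g y) \<le> e * \<bar>f y\<bar>" for y
 proof (cases "y \<in> cball 0 R")
  case True
  then show ?thesis using assms(3)[OF True] by (auto simp: mult.commute[of e] intro!: mult_left_mono)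
 qed (simp add: supp)
 then have "norm (LBINT y. f y *\<^sub>R g y) \<le> (LBINT y. e * \<bar>f y\<bar>)"
  using f assms by (intro Bochner_Integration.integral_norm_bound_integral[of lborel "\<lambda>y. f y *\<^sub>R g y" "\<lambda>y. e * \<bar>f y\<bar>"]) auto
 then show ?thesis by simp
qed

lemma conv_continuous:
 fixes k :: "'a \<Rightarrow> 'b::euclidean_space"
 assumes k: "continuous_on UNIV k"
 shows "continuous_on UNIV (conv f k)"
 unfolding continuous_on_iff
proof (intro ballI allI impI)
 fix x :: 'a and e :: real assume e: "e > 0"
 \<comment> \<open>The mass of \<open>f\<close>, increased by 1 so that it can be divided by even if
   \<open>f\<close> vanishes.\<close>
 define A where "A = (LBINT y. \<bar>f y\<bar>) + 1"
 have A: "A > 0" "(LBINT y. \<bar>f y\<bar>) < A"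
  by (auto simp: A_def intro!: add_nonneg_pos Bochner_Integration.integral_nonneg)
 obtain d where d: "d > 0" "\<And>u v. norm u \<le> norm x + R + 1 \<Longrightarrow> norm v \<le> norm x + R + 1
   \<Longrightarrow> norm (v - u) < d \<Longrightarrow> norm (k v - k u) < e / A"
  using uniformly_continuous_cball[OF k divide_pos_pos[OF e A(1)]] by blast
 show "\<exists>d>0. \<forall>x'\<in>UNIV. dist x' x < d \<longrightarrow> dist (conv f k x') (conv f k x) < e"
 proof (intro exI[of _ "min d 1"] conjI ballI impI)
  fix x' assume x': "dist x' x < min d 1"
  have "norm (LBINT y. f y *\<^sub>R (k (x' - y) - k (x - y))) \<le> (e / A) * (LBINT y. \<bar>f y\<bar>)"
  proof (rule conv_bound_diff)
   show "L1 (\<lambda>y. f y *\<^sub>R (k (x' - y) - k (x - y)))"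
    unfolding scaleR_diff_right
    by (intro Bochner_Integration.integrable_diff conv_integrable k)
   show "0 \<le> e / A" using e A by simp
   show "norm (k (x' - y) - k (x - y)) \<le> e / A" if "y \<in> cball 0 R" for y
   proof -
    have "norm (x' - y) \<le> norm x + R + 1"
     using that x' norm_triangle_ineq[of "x' - x" "x - y"] norm_triangle_ineq4[of x y]
     by (auto simp: dist_norm)
    moreover have "norm (x - y) \<le> norm x + R + 1"
     using that norm_triangle_ineq4[of x y] by auto
    ultimately show ?thesis
     using d(2)[of "x - y" "x' - y"] x' by (simp add: dist_norm)
   qed
  qed
  also have "\<dots> < (e / A) * A" using A e by (intro mult_strict_left_mono) auto
  also have "\<dots> = e" using A by simp
  also have "(LBINT y. f y *\<^sub>R (k (x' - y) - k (x - y))) = conv f k x' - conv f k x"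
   unfolding scaleR_diff_right conv_def
   by (intro Bochner_Integration.integral_diff conv_integrable k)
  finally show "dist (conv f k x') (conv f k x) < e" by (simp add: dist_norm)
 qed (use d in auto)
qed

text \<open>By the mean value inequality and the uniform continuity of \<open>k\<close> on a ball,
  the remainder of the linearization of \<open>K\<close> at \<open>x - y\<close> is at most
  \<open>e / A\<close> times the increment, uniformly for \<open>y\<close> in the support of
  \<open>f\<close>. Integrating against \<open>f\<close> gives the remainder of the
  convolution.\<close>

lemma conv_C1_bounded_support:
 assumes K: "C1 K k"
 shows "C1 (conv f K) (conv f k)"
 unfolding C1_def
proof (intro conjI allI)
 have k: "continuous_on UNIV k" and Kc: "continuous_on UNIV K"
  using K by (auto intro: C1_grad_continuous C1_continuous)
 show "continuous_on UNIV (conv f k)" by (rule conv_continuous[OF k])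
 fix x
 show "(conv f K has_derivative (\<lambda>v. conv f k x \<bullet> v)) (at x)"
  unfolding has_derivative_at_alt
 proof (intro conjI allI impI)
  show "bounded_linear (\<lambda>v. conv f k x \<bullet> v)" by (rule bounded_linear_inner_right)
  fix e :: real assume e: "e > 0"
  define A where "A = (LBINT y. \<bar>f y\<bar>) + 1"
  have A: "A > 0" "(LBINT y. \<bar>f y\<bar>) < A"
   by (auto simp: A_def intro!: add_nonneg_pos Bochner_Integration.integral_nonneg)
 obtain d where d: "d > 0" "\<And>u v. norm u \<le> norm x + R + 1 \<Longrightarrow> norm v \<le> norm x + R + 1
   \<Longrightarrow> norm (v - u) < d \<Longrightarrow> norm (k v - k u) < e / A"
  using uniformly_continuous_cball[OF k divide_pos_pos[OF e A(1)]] by blast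
  show "\<exists>d>0. \<forall>x'. norm (x' - x) < d \<longrightarrow>
    norm (conv f K x' - conv f K x - conv f k x \<bullet> (x' - x)) \<le> e * norm (x' - x)"
  proof (intro exI[of _ "min d 1"] conjI allI impI)
   fix x' assume x': "norm (x' - x) < min d 1"
   let ?g = "\<lambda>y. K (x' - y) - K (x - y) - k (x - y) \<bullet> (x' - x)"
   have int: "L1 (\<lambda>y. f y *\<^sub>R (K (x' - y) :: real))" "L1 (\<lambda>y. f y *\<^sub>R (K (x - y)))"
    "L1 (\<lambda>y. (f y *\<^sub>R k (x - y)) \<bullet> (x' - x))"
    by (intro conv_integrable Kc k integrable_inner_left)+
   have "norm (LBINT y. f y *\<^sub>R ?g y) \<le> (e / A * norm (x' - x)) * (LBINT y. \<bar>f y\<bar>)"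
   proof (rule conv_bound_diff)
    show "L1 (\<lambda>y. f y *\<^sub>R ?g y)"
     using int by (simp add: right_diff_distrib)
    show "0 \<le> e / A * norm (x' - x)" using e A by simp
    show "norm (?g y) \<le> e / A * norm (x' - x)" if y: "y \<in> cball 0 R" for y
    proof -
     have n: "norm (x - y) \<le> norm x + R"
      using y norm_triangle_ineq4[of x y] by auto
     have "norm (K (x' - y) - K (x - y) - (k (x - y)) \<bullet> (x' - y - (x - y))) \<le> norm (x' - y - (x - y)) * (e / A)"
     proof (rule differentiable_bound_linearization[of "x - y" "x' - y" "ball (x - y) (min d 1)" K "\<lambda>z v. k z \<bullet> v" "x - y" "e / A"])
      show "(K has_derivative (\<bullet>) (k z)) (at z within ball (x - y) (min d 1))" if "z \<in> ball (x - y) (min d 1)" for z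
       using K has_derivative_at_withinI unfolding C1_def by blast
      show "onorm ((\<lambda>v. k z \<bullet> v) - (\<lambda>v. k (x - y) \<bullet> v)) \<le> e / A" if z: "z \<in> ball (x - y) (min d 1)" for z
       unfolding fun_diff_def
      proof (rule onorm_bound)
       fix v
       have "norm z \<le> norm x + R + 1"
        using z n norm_triangle_ineq[of "z - (x - y)" "x - y"] by (auto simp: dist_norm norm_minus_commute)
       then have "norm (k z - k (x - y)) \<le> e / A"
        using d(2)[of "x - y" z] n z by (simp add: dist_norm norm_minus_commute[of z])
       then show "norm (k z \<bullet> v - k (x - y) \<bullet> v) \<le> e / A * norm v"
        using Cauchy_Schwarz_ineq2[of "k z - k (x - y)" v] mult_right_mono[of "norm (k z - k (x - y))" "e / A" "norm v"]
        by (simp add: inner_diff_left)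
      qed (use e A in auto)
      show "x - y + t *\<^sub>R (x' - y - (x - y)) \<in> ball (x - y) (min d 1)" if t: "t \<in> {0..1}" for t :: real
      proof -
       have "norm (t *\<^sub>R (x' - x)) \<le> 1 * norm (x' - x)"
        unfolding norm_scaleR using t by (intro mult_right_mono) auto
       then show ?thesis using x' by (auto simp: dist_norm)
      qed
      show "x - y \<in> ball (x - y) (min d 1)" using d by auto
     qed
     then show ?thesis by (simp add: mult.commute)
    qed
   qed
   also have "\<dots> \<le> (e / A * norm (x' - x)) * A" using A e by (intro mult_left_mono) auto
   also have "\<dots> = e * norm (x' - x)" using A by simp
   also have "(LBINT y. f y *\<^sub>R ?g y) = conv f K x' - conv f K x - conv f k x \<bullet> (x' - x)"
    unfolding conv_def using int
    by (simp add: right_diff_distrib integral_inner_left[symmetric] conv_integrable[OF k] del: integral_inner_left)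
   finally show "norm (conv f K x' - conv f K x - conv f k x \<bullet> (x' - x)) \<le> e * norm (x' - x)" .
  qed (use d in auto)
 qed
qed

end

text \<open>Only values of \<open>f\<close> within distance \<open>r\<close> of \<open>x\<close>
  enter. Locally integrable factors are thereby reduced to integrable ones of bounded
  support.\<close>

lemma conv_truncate:
 assumes supp: "\<And>z. z \<notin> cball 0 r \<Longrightarrow> K z = 0" and x: "norm x + r \<le> R"
 shows "conv f K x = conv (\<lambda>y. indicator (cball 0 R) y * f y) K x"
 unfolding conv_def
proof (rule Bochner_Integration.integral_cong[OF refl])
 fix y
 show "f y *\<^sub>R K (x - y) = (indicator (cball 0 R) y * f y) *\<^sub>R K (x - y)"
 proof (cases "x - y \<in> cball 0 r")
  case True
  then have "norm y \<le> R" using x norm_triangle_ineq3[of x y] norm_triangle_ineq2[of y x]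
   by (auto simp: norm_minus_commute)
  then show ?thesis by simp
 qed (use supp in simp)
qed

lemma conv_C1:
 fixes f :: "'a::euclidean_space \<Rightarrow> real"
 assumes f: "\<And>R. L1 (\<lambda>y. indicator (cball 0 R) y * f y)"
  and K: "C1 K k" and supp: "\<And>z. z \<notin> cball 0 r \<Longrightarrow> K z = 0"
 shows "C1 (conv f K) (conv f k)"
proof -
 have suppk: "k z = 0" if "z \<notin> cball 0 r" for z
  using C1_grad_support[OF K closed_cball supp that] by blast
 have *: "(conv f K has_derivative (\<lambda>v. conv f k x \<bullet> v)) (at x) \<and> isCont (conv f k) x" for x
 proof -
  \<comment> \<open>One radius serves the whole unit ball around \<open>x\<close>: the truncated
    convolution must agree with \<open>conv f K\<close> near \<open>x\<close>, not only at
    \<open>x\<close>.\<close>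
  define R where "R = norm x + 1 + r"
  let ?f = "\<lambda>y. indicator (cball 0 R) y * f y"
  have C: "C1 (conv ?f K) (conv ?f k)"
   by (rule conv_C1_bounded_support[OF f _ K, of R]) auto
  have eq: "norm y + r \<le> R" if "y \<in> ball x 1" for y
   using that norm_triangle_ineq2[of y x] by (auto simp: R_def dist_norm norm_minus_commute)
  have "(conv f K has_derivative (\<lambda>v. conv ?f k x \<bullet> v)) (at x)"
   by (rule has_derivative_transform_within_open[OF C1_D[OF C] open_ball[of x 1]])
    (use conv_truncate[of r K _ R f] supp eq in auto)
  moreover have "conv ?f k x = conv f k x"
   using conv_truncate[of r k x R f] suppk eq[of x] by auto
  moreover have "isCont (conv f k) x"
  proof -
   have "isCont (conv ?f k) x" using C1_grad_continuous[OF C, of UNIV] continuous_on_eq_continuous_at by blast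
   moreover have "\<forall>\<^sub>F y in nhds x. conv ?f k y = conv f k y"
   proof (rule eventually_mono)
    show "\<forall>\<^sub>F y in nhds x. y \<in> ball x 1" by (rule eventually_nhds_in_open) auto
    show "conv ?f k y = conv f k y" if "y \<in> ball x 1" for y
     using conv_truncate[of r k y R f] suppk eq[OF that] by auto
   qed
   ultimately show ?thesis using isCont_cong by fastforce
  qed
  ultimately show ?thesis by simp
 qed
 then show ?thesis unfolding C1_def by (auto intro: continuous_at_imp_continuous_on)
qed

text \<open>Each partial derivative of \<open>conv f K\<close> is the convolution of
  \<open>f\<close> with the partial derivative of \<open>K\<close>, so the convolutions of
  \<open>f\<close> with smooth functions supported in the ball form a family closed under
  differentiation.\<close>

lemma conv_smooth:
 fixes f :: "'a::euclidean_space \<Rightarrow> real"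
 assumes f: "\<And>R. L1 (\<lambda>y. indicator (cball 0 R) y * f y)"
  and K: "smooth K" "\<And>z. z \<notin> cball 0 r \<Longrightarrow> K z = 0"
 shows "smooth (conv f K)"
proof (rule smooth_coinduct[of _ "{conv f K |K. smooth K \<and> (\<forall>z. z \<notin> cball 0 r \<longrightarrow> K z = 0)}"])
 show "conv f K \<in> {conv f K |K. smooth K \<and> (\<forall>z. z \<notin> cball 0 r \<longrightarrow> K z = 0)}"
  using K by blast
next
 fix g x assume "g \<in> {conv f K |K. smooth K \<and> (\<forall>z. z \<notin> cball 0 r \<longrightarrow> K z = 0)}"
 then obtain K where K: "g = conv f K" "smooth K" "\<And>z. z \<notin> cball 0 r \<Longrightarrow> K z = 0" by blast
 show "g differentiable at x"
  using conv_C1[OF f smooth_C1[OF K(2)] K(3)] unfolding K(1) C1_def differentiable_def by blast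
next
 fix g and e :: 'a
 assume e: "e \<in> Basis" and "g \<in> {conv f K |K. smooth K \<and> (\<forall>z. z \<notin> cball 0 r \<longrightarrow> K z = 0)}"
 then obtain K where K: "g = conv f K" "smooth K" "\<And>z. z \<notin> cball 0 r \<Longrightarrow> K z = 0" by blast
 let ?k = "\<lambda>x. \<Sum>e\<in>Basis. frechet_derivative K (at x) e *\<^sub>R e"
 let ?K = "\<lambda>x. frechet_derivative K (at x) e"
 have C: "C1 K ?k" by (rule smooth_C1[OF K(2)])
 have ke: "?k x \<bullet> e = ?K x" for x
  by (rule C1_frechet[OF C, symmetric])
 have z: "?k z = 0" if "z \<notin> cball 0 r" for z
  using C1_grad_support[OF C closed_cball K(3) that] by blast
 have C': "C1 g (conv f ?k)" unfolding K(1) by (rule conv_C1[OF f C K(3)])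
 have "frechet_derivative g (at x) e = conv f ?K x" for x
 proof -
  have "frechet_derivative g (at x) e = conv f ?k x \<bullet> e"
   by (rule C1_frechet[OF C'])
  also have "\<dots> = conv f ?K x"
  proof -
   define R where "R = norm x + r"
   let ?f = "\<lambda>y. indicator (cball 0 R) y * f y"
   have "conv f ?k x = conv ?f ?k x" by (rule conv_truncate[of r _ x R f, OF z]) (auto simp: R_def)
   moreover have "conv f ?K x = conv ?f ?K x"
    by (rule conv_truncate[of r _ x R f]) (auto simp: R_def ke[symmetric] z)
   moreover have "L1 (\<lambda>y. ?f y *\<^sub>R ?k (x - y))"
    by (rule conv_integrable[OF f, of R]) (auto intro: C1_grad_continuous[OF C])
   ultimately show ?thesis
    by (simp add: conv_def integral_inner_left[symmetric] ke del: integral_inner_left)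
  qed
  finally show ?thesis .
 qed
 moreover have "?K z = 0" if "z \<notin> cball 0 r" for z
  using z[OF that] ke[of z] by simp
 ultimately show "(\<lambda>x. frechet_derivative g (at x) e) \<in> {conv f K |K. smooth K \<and> (\<forall>z. z \<notin> cball 0 r \<longrightarrow> K z = 0)}"
  using smooth_partial[OF K(2) e] by blast
qed

section \<open>Mollifiers\<close>

definition mollifier :: "real \<Rightarrow> ('a::euclidean_space \<Rightarrow> real) \<Rightarrow> bool" where
 "mollifier r K \<longleftrightarrow> smooth K \<and> (\<forall>x. 0 \<le> K x) \<and> (\<forall>x. x \<notin> cball 0 r \<longrightarrow> K x = 0)
   \<and> L1 K \<and> (LBINT x. K x) = 1"

lemma compact_support_integrable:
 fixes f :: "'a::euclidean_space \<Rightarrow> 'b::euclidean_space"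
 assumes "continuous_on UNIV f" "\<And>x. x \<notin> K \<Longrightarrow> f x = 0" "compact K"
 shows "L1 f"
proof -
 have "L1 (\<lambda>x. indicator K x *\<^sub>R f x)"
  using borel_integrable_compact[of K f] assms continuous_on_subset by blast
 moreover have "(\<lambda>x. indicator K x *\<^sub>R f x) = f" using assms(2) by (auto simp: indicator_def)
 ultimately show ?thesis by simp
qed

lemma mollifier_exists:
 assumes "r > 0"
 obtains K :: "'a::euclidean_space \<Rightarrow> real" where "mollifier r K"
proof -
 obtain K :: "'a \<Rightarrow> real" where K: "smooth K" "\<And>x. 0 \<le> K x" "\<And>x. r \<le> norm x \<Longrightarrow> K x = 0" "K 0 > 0"
  using mollifier_bump_exists[OF assms] by blast
 have c: "continuous_on UNIV K" using C1_continuous[OF smooth_C1[OF K(1)]] .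
 have i: "L1 K"
  by (rule compact_support_integrable[OF c _ compact_cball[of 0 r]]) (use K in auto)
 define I where "I = (LBINT x. K x)"
 have "I \<noteq> 0"
 proof
  assume "I = 0"
  then have "AE x in lborel. K x = 0"
   using integral_nonneg_eq_0_iff_AE[OF i] K(2) by (simp add: I_def)
  define U where "U = {x. K x > 0}"
  have o: "open U" unfolding U_def using open_Collect_less[of "\<lambda>x. 0" K] c by simp
  have "AE x in lborel. x \<notin> U"
   using \<open>AE x in lborel. K x = 0\<close> by (rule eventually_mono) (simp add: U_def)
  then have "U \<in> null_sets lborel"
   using AE_iff_null_sets[of U lborel] borel_open[OF o] by simp
  then have "negligible U"
   unfolding negligible_iff_null_sets by (rule null_sets_completionI)
  then show False using open_not_negligible[OF o] K(4) by (auto simp: U_def)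
 qed
 moreover have "I \<ge> 0" unfolding I_def using K(2) by (intro Bochner_Integration.integral_nonneg) auto
 ultimately have I: "I > 0" by simp
 have "smooth (\<lambda>x. (1 / I) * K x)"
  using K(1) unfolding smooth_def by (intro allI Ck_mult Ck_const) auto
 then have "mollifier r (\<lambda>x. (1 / I) * K x)"
  unfolding mollifier_def using K I i by (auto simp: I_def[symmetric])
 then show thesis using that by blast
qed

lemma mollifier_C1: "mollifier r K \<Longrightarrow> \<exists>k. C1 K k"
 using smooth_C1 unfolding mollifier_def by blast

section \<open>Continuity of translations and mollification in the mean\<close>

lemma compact_support_translation:
 fixes g :: "'a::euclidean_space \<Rightarrow> real"
 assumes g: "continuous_on UNIV g" "\<And>x. x \<notin> cball 0 R \<Longrightarrow> g x = 0" and e: "e > 0"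
 shows "\<exists>d>0. \<forall>y. norm y < d \<longrightarrow> (\<integral>\<^sup>+x. ennreal \<bar>g (x + y) - g x\<bar> \<partial>lborel) \<le> ennreal e"
proof -
 \<comment> \<open>A shift shorter than 1 keeps the difference supported in the ball of radius
   \<open>R + 1\<close>. The summand 1 makes \<open>m\<close> positive.\<close>
 define m where "m = measure lborel (cball (0::'a) (R + 1)) + 1"
 have m: "m > 0" by (simp add: m_def add_nonneg_pos)
 obtain d where d: "d > 0" "\<And>u v. norm u \<le> R + 2 \<Longrightarrow> norm v \<le> R + 2
   \<Longrightarrow> norm (v - u) < d \<Longrightarrow> norm (g v - g u) < e / m"
  using uniformly_continuous_cball[OF g(1) divide_pos_pos[OF e m]] by blast
 show ?thesis
 proof (intro exI[of _ "min d 1"] conjI allI impI)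
  fix y :: 'a assume y: "norm y < min d 1"
  have bnd: "\<bar>g (x + y) - g x\<bar> \<le> (e / m) * indicator (cball 0 (R + 1)) x" for x
  proof (cases "norm x \<le> R + 1")
   case True
   moreover have "norm (x + y) \<le> R + 2"
    using True y norm_triangle_ineq[of x y] by simp
   ultimately show ?thesis
    using d(2)[of x "x + y"] y by simp
  next
   case False
   moreover have "norm (x + y) > R"
    using False y norm_triangle_ineq2[of x "- y"] by simp
   ultimately show ?thesis using g(2)[of x] g(2)[of "x + y"] by simp
  qed
  have mono: "ennreal \<bar>g (x + y) - g x\<bar> \<le> ennreal (e / m) * indicator (cball 0 (R + 1)) x" for x
   using ennreal_leI[OF bnd[of x]] by (cases "x \<in> cball 0 (R + 1)") simp_all
  have "(\<integral>\<^sup>+x. ennreal \<bar>g (x + y) - g x\<bar> \<partial>lborel)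
    \<le> (\<integral>\<^sup>+x. ennreal (e / m) * indicator (cball (0::'a) (R + 1)) x \<partial>lborel)"
   by (intro nn_integral_mono mono)
  also have "\<dots> = ennreal (e / m) * emeasure lborel (cball (0::'a) (R + 1))"
   by (simp add: nn_integral_cmult_indicator)
  also have "\<dots> = ennreal ((e / m) * measure lborel (cball (0::'a) (R + 1)))"
  proof -
   have "emeasure lborel (cball (0::'a) (R + 1)) = ennreal (measure lborel (cball (0::'a) (R + 1)))"
    by (rule emeasure_eq_ennreal_measure) (use emeasure_lborel_cball_finite[of "0::'a" "R + 1"] in auto)
   then show ?thesis using e m by (simp only: ennreal_mult[symmetric] measure_nonneg divide_nonneg_pos less_imp_le)
  qed
  also have "\<dots> \<le> ennreal ((e / m) * m)"
   using e m by (intro ennreal_leI mult_left_mono) (auto simp: m_def)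
  finally show "(\<integral>\<^sup>+x. ennreal \<bar>g (x + y) - g x\<bar> \<partial>lborel) \<le> ennreal e" using m by simp
 qed (use d in auto)
qed

text \<open>Truncation in space and in value at once, which turns any Borel function into a bounded
  integrable one of bounded support.\<close>

definition trunc :: "nat \<Rightarrow> ('a::euclidean_space \<Rightarrow> real) \<Rightarrow> 'a \<Rightarrow> real" where
 "trunc n f x = indicator (cball 0 (real n)) x * max (- real n) (min (real n) (f x))"

lemma trunc_measurable [measurable]:
 assumes [measurable]: "f \<in> Borel"
 shows "trunc n f \<in> Borel"
proof -
 have [measurable]: "cball 0 (real n) \<in> sets borel" by simp
 show ?thesis unfolding trunc_def[abs_def] by measurable
qed

lemma trunc_le: "\<bar>trunc n f x\<bar> \<le> \<bar>f x\<bar>" "\<bar>trunc n f x\<bar> \<le> real n"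
 "x \<notin> cball 0 (real n) \<Longrightarrow> trunc n f x = 0" "\<bar>trunc n f x - f x\<bar> \<le> \<bar>f x\<bar>"
 by (auto simp: trunc_def indicator_def max_def min_def)

lemma trunc_tendsto: "(\<lambda>n. trunc n f x) \<longlonglongrightarrow> f x"
proof -
 obtain N where N: "max (norm x) \<bar>f x\<bar> < real N" using reals_Archimedean2 by blast
 have "\<forall>\<^sub>F n in sequentially. trunc n f x = f x"
  using eventually_ge_at_top[of N]
 proof (rule eventually_mono)
  fix n assume "n \<ge> N"
  then have "real N \<le> real n" by simp
  then have "norm x \<le> real n" "f x \<le> real n" "- real n \<le> f x" using N by linarith+
  then show "trunc n f x = f x" by (simp add: trunc_def)
 qed
 then show ?thesis by (rule tendsto_eventually)
qed

lemma trunc_integrable: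
 fixes f :: "'a::euclidean_space \<Rightarrow> real"
 assumes [measurable]: "f \<in> Borel"
 shows "L1 (trunc n f)"
proof (rule Bochner_Integration.integrable_bound[of _ "\<lambda>x. real n * indicator (cball 0 (real n)) x"])
 show "L1 (\<lambda>x::'a. real n * indicator (cball 0 (real n)) x)"
  by (intro integrable_mult_right integrable_real_indicator) (auto simp: emeasure_lborel_cball_finite[unfolded infinity_ennreal_def])
 show "AE x in lborel. norm (trunc n f x) \<le> norm (real n * indicator (cball 0 (real n)) x :: real)"
  by (auto simp: trunc_def indicator_def max_def min_def)
qed measurable

lemma L1_trunc:
 fixes f :: "'a::euclidean_space \<Rightarrow> real"
 assumes f: "L1 f"
 shows "(\<lambda>n. (LBINT x. \<bar>trunc n f x - f x\<bar>)) \<longlonglongrightarrow> 0"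
proof -
 have [measurable]: "f \<in> Borel" using borel_measurable_integrable[OF f] by simp
 have "(\<lambda>n. (LBINT x. \<bar>trunc n f x - f x\<bar>)) \<longlonglongrightarrow> integral\<^sup>L (lborel :: 'a measure) (\<lambda>x. 0)"
 proof (rule integral_dominated_convergence[where w="\<lambda>x. \<bar>f x\<bar>"])
  have "(\<lambda>n. \<bar>trunc n f x - f x\<bar>) \<longlonglongrightarrow> 0" for x
   using tendsto_rabs[OF tendsto_diff[OF trunc_tendsto[of f x] tendsto_const[of "f x"]]] by simp
  then show "AE x in lborel. (\<lambda>n. \<bar>trunc n f x - f x\<bar>) \<longlonglongrightarrow> 0" by simp
 qed (use f trunc_le(4)[of _ f] in \<open>auto intro!: AE_I2\<close>)
 then show ?thesis by simp
qed

lemma L2_trunc: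
 fixes f :: "'a::euclidean_space \<Rightarrow> real"
 assumes [measurable]: "f \<in> Borel" and f: "L1 (\<lambda>x. (f x)\<^sup>2)"
 shows "(\<lambda>n. (LBINT x. (trunc n f x - f x)\<^sup>2)) \<longlonglongrightarrow> 0"
proof -
 have "(\<lambda>n. (LBINT x. (trunc n f x - f x)\<^sup>2)) \<longlonglongrightarrow> integral\<^sup>L (lborel :: 'a measure) (\<lambda>x. 0)"
 proof (rule integral_dominated_convergence[where w="\<lambda>x. (f x)\<^sup>2"])
  have "(\<lambda>n. (trunc n f x - f x)\<^sup>2) \<longlonglongrightarrow> 0" for x
   using tendsto_power[OF tendsto_diff[OF trunc_tendsto[of f x] tendsto_const[of "f x"]], of 2] by simp
  then show "AE x in lborel. (\<lambda>n. (trunc n f x - f x)\<^sup>2) \<longlonglongrightarrow> 0" by simp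
  show "AE x in lborel. norm ((trunc n f x - f x)\<^sup>2) \<le> (f x)\<^sup>2" for n
   using trunc_le(4)[of n f] by (auto simp: abs_le_square_iff)
 qed (use f in auto)
 then show ?thesis by simp
qed

lemma L1_dense_continuous:
 fixes f :: "'a::euclidean_space \<Rightarrow> real"
 assumes f: "L1 f" and e: "e > 0"
 obtains g R where "continuous_on UNIV g" "\<And>x. x \<notin> cball 0 R \<Longrightarrow> g x = 0"
  "(LBINT x. \<bar>g x - f x\<bar>) < e" "L1 g"
proof -
 have [measurable]: "f \<in> Borel" using borel_measurable_integrable[OF f] by simp
 have "\<forall>\<^sub>F n in sequentially. (LBINT x. \<bar>trunc n f x - f x\<bar>) < e / 2"
  by (rule order_tendstoD(2)[OF L1_trunc[OF f]]) (use e in simp)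
 then obtain n where n: "(LBINT x. \<bar>trunc n f x - f x\<bar>) < e / 2"
  using eventually_happens by fastforce
 let ?f = "trunc n f"
 \<comment> \<open>\<open>measurable_on\<close> supplies continuous functions that converge almost
   everywhere, but with neither a bound nor a common support.\<close>
 have "?f measurable_on UNIV"
  by (simp add: measurable_on_iff_borel_measurable lebesgue_on_UNIV_eq measurable_completion)
 then obtain N g where N: "negligible N" and g: "\<And>k. continuous_on UNIV (g k)"
  and lim: "\<And>x. x \<notin> N \<Longrightarrow> (\<lambda>k. g k x) \<longlonglongrightarrow> ?f x"
  unfolding measurable_on_def by auto
 \<comment> \<open>A continuous cut-off, equal to 1 on the ball of radius \<open>n\<close>. Together
   with clipping to \<open>[-n, n]\<close> it leaves the limit unchanged and provides the dominating
   function.\<close>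
 define c where "c = (\<lambda>x::'a. max 0 (min 1 (real n + 1 - norm x)))"
 define h where "h k x = c x * max (- real n) (min (real n) (g k x))" for k x
 have hc: "continuous_on UNIV (h k)" for k
  unfolding h_def c_def by (intro continuous_intros g)
 then have [measurable]: "h k \<in> Borel" for k
  using borel_measurable_continuous_onI by blast
 have h0: "h k x = 0" if "x \<notin> cball 0 (real n + 1)" for k x
  using that by (simp add: h_def c_def)
 have hi: "L1 (h k)" for k
  by (rule compact_support_integrable[OF hc _ compact_cball]) (rule h0)
 have hlim: "(\<lambda>k. h k x) \<longlonglongrightarrow> ?f x" if "x \<notin> N" for x
 proof -
  have "(\<lambda>k. h k x) \<longlonglongrightarrow> c x * max (- real n) (min (real n) (?f x))"
   unfolding h_def by (intro tendsto_intros lim that)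
  moreover have "c x * max (- real n) (min (real n) (?f x)) = ?f x"
   by (auto simp: trunc_def c_def indicator_def max_def min_def)
  ultimately show ?thesis by simp
 qed
 have hb: "\<bar>h k x\<bar> \<le> real n * indicator (cball 0 (real n + 1)) x" for k x
 proof (cases "x \<in> cball 0 (real n + 1)")
  case True
  have "\<bar>h k x\<bar> \<le> 1 * real n" unfolding h_def abs_mult
   by (rule mult_mono) (auto simp: c_def)
  then show ?thesis using True by simp
 qed (simp add: h0)
 have "(\<lambda>k. (LBINT x. \<bar>h k x - ?f x\<bar>)) \<longlonglongrightarrow> integral\<^sup>L (lborel :: 'a measure) (\<lambda>x. 0)"
 proof (rule integral_dominated_convergence[where w="\<lambda>x. 2 * real n * indicator (cball 0 (real n + 1)) x"])
  have "AE x in lborel. x \<notin> N"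
   using N AE_not_in[of N lebesgue] by (simp add: negligible_iff_null_sets AE_completion_iff)
  then show "AE x in lborel. (\<lambda>k. \<bar>h k x - ?f x\<bar>) \<longlonglongrightarrow> 0"
  proof (rule eventually_mono)
   fix x assume "x \<notin> N"
   then show "(\<lambda>k. \<bar>h k x - ?f x\<bar>) \<longlonglongrightarrow> 0"
    using tendsto_rabs[OF tendsto_diff[OF hlim[of x] tendsto_const[of "?f x"]]] by simp
  qed
  show "AE x in lborel. norm \<bar>h k x - ?f x\<bar> \<le> 2 * real n * indicator (cball 0 (real n + 1)) x" for k
  proof (rule AE_I2)
   fix x
   have "\<bar>?f x\<bar> \<le> real n * indicator (cball 0 (real n + 1)) x"
    using trunc_le(2)[of n f x] trunc_le(3)[of x n f] by (auto simp: indicator_def)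
   then show "norm \<bar>h k x - ?f x\<bar> \<le> 2 * real n * indicator (cball 0 (real n + 1)) x"
    using hb[of k x] by simp
  qed
  show "L1 (\<lambda>x::'a. 2 * real n * indicator (cball 0 (real n + 1)) x)"
   by (intro integrable_mult_right integrable_real_indicator) (auto simp: emeasure_lborel_cball_finite[unfolded infinity_ennreal_def])
 qed auto
 then have "\<forall>\<^sub>F k in sequentially. (LBINT x. \<bar>h k x - ?f x\<bar>) < e / 2"
  using e by (intro order_tendstoD(2)) auto
 then obtain k where k: "(LBINT x. \<bar>h k x - ?f x\<bar>) < e / 2"
  using eventually_happens by fastforce
 have "(LBINT x. \<bar>h k x - f x\<bar>) \<le> (LBINT x. \<bar>h k x - ?f x\<bar> + \<bar>?f x - f x\<bar>)"
  using hi f trunc_integrable[of f n] by (intro integral_mono) auto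
 also have "\<dots> = (LBINT x. \<bar>h k x - ?f x\<bar>) + (LBINT x. \<bar>?f x - f x\<bar>)"
  using hi f trunc_integrable[of f n] by (intro Bochner_Integration.integral_add) auto
 also have "\<dots> < e" using k n by simp
 finally show thesis using that[OF hc h0 _ hi] by blast
qed

lemma L1_translation:
 fixes f :: "'a::euclidean_space \<Rightarrow> real"
 assumes f: "L1 f" and e: "e > 0"
 shows "\<exists>d>0. \<forall>y. norm y < d \<longrightarrow> (LBINT x. \<bar>f (x + y) - f x\<bar>) \<le> e"
proof -
 have [measurable]: "f \<in> Borel" using borel_measurable_integrable[OF f] by simp
 obtain g R where g: "continuous_on UNIV g" "\<And>x. x \<notin> cball 0 R \<Longrightarrow> g x = 0"
  "(LBINT x. \<bar>g x - f x\<bar>) < e / 3" "L1 g"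
  using L1_dense_continuous[OF f, of "e / 3"] e by auto
 have [measurable]: "g \<in> Borel" using g(1) borel_measurable_continuous_onI by blast
 obtain d where d: "d > 0" "\<And>y. norm y < d \<Longrightarrow> (\<integral>\<^sup>+x. ennreal \<bar>g (x + y) - g x\<bar> \<partial>lborel) \<le> ennreal (e / 3)"
  using compact_support_translation[of g R "e / 3"] g(1,2) e by auto
 show ?thesis
 proof (intro exI[of _ d] conjI allI impI)
  fix y :: 'a assume y: "norm y < d"
  have ft: "L1 (\<lambda>x. f (x + y))" and gt: "L1 (\<lambda>x. g (x + y))"
   using f g(4) by (simp_all add: integrable_translate_lborel)
  have 1: "(LBINT x. \<bar>g (x + y) - g x\<bar>) \<le> e / 3"
   using d(2)[OF y] gt g(4) e by (subst (asm) nn_integral_eq_integral) (auto simp: ennreal_le_iff)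
  have 2: "(LBINT x. \<bar>g (x + y) - f (x + y)\<bar>) = (LBINT x. \<bar>g x - f x\<bar>)"
   by (rule integral_translate_lborel[of "\<lambda>x. \<bar>g x - f x\<bar>"]) measurable
  have "(LBINT x. \<bar>f (x + y) - f x\<bar>)
    \<le> (LBINT x. (\<bar>g (x + y) - f (x + y)\<bar> + \<bar>g (x + y) - g x\<bar>) + \<bar>g x - f x\<bar>)"
   using f g(4) ft gt by (intro integral_mono) auto
  also have "\<dots> = ((LBINT x. \<bar>g (x + y) - f (x + y)\<bar>) + (LBINT x. \<bar>g (x + y) - g x\<bar>)) + (LBINT x. \<bar>g x - f x\<bar>)"
   using f g(4) ft gt by simp
  also have "\<dots> \<le> e" using 1 2 g(3) by simp
  finally show "(LBINT x. \<bar>f (x + y) - f x\<bar>) \<le> e" .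
 qed (use d in auto)
qed

lemma square_integrable_diff:
 fixes f g :: "'a \<Rightarrow> real"
 assumes [measurable]: "f \<in> borel_measurable M" "g \<in> borel_measurable M"
  and "integrable M (\<lambda>x. (f x)\<^sup>2)" "integrable M (\<lambda>x. (g x)\<^sup>2)"
 shows "integrable M (\<lambda>x. (f x - g x)\<^sup>2)"
proof (rule Bochner_Integration.integrable_bound[of _ "\<lambda>x. 2 * (f x)\<^sup>2 + 2 * (g x)\<^sup>2"])
 have "(f x - g x)\<^sup>2 \<le> 2 * (f x)\<^sup>2 + 2 * (g x)\<^sup>2" for x
  using zero_le_power2[of "f x + g x"] by (simp add: power2_eq_square algebra_simps)
 then show "AE x in M. norm ((f x - g x)\<^sup>2) \<le> norm (2 * (f x)\<^sup>2 + 2 * (g x)\<^sup>2)" by simp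
qed (use assms in auto)

text \<open>After truncation the translation difference is bounded by \<open>2 * (n + 1)\<close>, so
  its square is controlled by its first power and the continuity of translations in
  \<open>L1\<close> applies.\<close>

lemma L2_translation:
 fixes f :: "'a::euclidean_space \<Rightarrow> real"
 assumes [measurable]: "f \<in> Borel" and f: "L1 (\<lambda>x. (f x)\<^sup>2)" and e: "e > 0"
 shows "\<exists>d>0. \<forall>y. norm y < d \<longrightarrow> (LBINT x. (f (x + y) - f x)\<^sup>2) \<le> e"
proof -
 have "\<forall>\<^sub>F n in sequentially. (LBINT x. (trunc n f x - f x)\<^sup>2) < e / 12"
  by (rule order_tendstoD(2)[OF L2_trunc[OF _ f]]) (use e in auto)
 then obtain n where n: "(LBINT x. (trunc n f x - f x)\<^sup>2) < e / 12"
  using eventually_happens by fastforce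
 let ?g = "trunc n f"
 have gi: "L1 ?g" by (rule trunc_integrable) simp
 have g2: "L1 (\<lambda>x. (?g x)\<^sup>2)"
  by (rule Bochner_Integration.integrable_bound[OF f])
   (use trunc_le(1)[of n f] in \<open>auto simp: abs_le_square_iff\<close>)
 \<comment> \<open>The splitting below has three terms and costs a factor 3: the two truncation
   errors receive \<open>e / 4\<close> each and this term \<open>e / 2\<close>.\<close>
 obtain d where d: "d > 0" "\<And>y. norm y < d \<Longrightarrow> (LBINT x. \<bar>?g (x + y) - ?g x\<bar>) \<le> e / (12 * (real n + 1))"
  using L1_translation[OF gi, of "e / (12 * (real n + 1))"] e by (auto simp: divide_pos_pos)
 show ?thesis
 proof (intro exI[of _ d] conjI allI impI)
  fix y :: 'a assume y: "norm y < d"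
  have gt: "L1 (\<lambda>x. ?g (x + y))" and f2t: "L1 (\<lambda>x. (f (x + y))\<^sup>2)"
   and g2t: "L1 (\<lambda>x. (?g (x + y))\<^sup>2)"
   using f gi g2 integrable_translate_lborel[of "\<lambda>x. (f x)\<^sup>2" y] integrable_translate_lborel[of "\<lambda>x. (?g x)\<^sup>2" y]
    integrable_translate_lborel[of ?g y] by auto
  have 1: "(?g (x + y) - ?g x)\<^sup>2 \<le> 2 * (real n + 1) * \<bar>?g (x + y) - ?g x\<bar>" for x
  proof -
   have "\<bar>?g (x + y) - ?g x\<bar> \<le> 2 * (real n + 1)"
    using trunc_le(2)[of n f x] trunc_le(2)[of n f "x + y"] by simp
   then have "\<bar>?g (x + y) - ?g x\<bar> * \<bar>?g (x + y) - ?g x\<bar> \<le> 2 * (real n + 1) * \<bar>?g (x + y) - ?g x\<bar>"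
    by (intro mult_right_mono) auto
   then show ?thesis by (simp add: power2_eq_square)
  qed
  have 2: "(LBINT x. (?g (x + y) - f (x + y))\<^sup>2) = (LBINT x. (?g x - f x)\<^sup>2)"
   by (rule integral_translate_lborel[of "\<lambda>x. (?g x - f x)\<^sup>2"]) measurable
  have ints: "L1 (\<lambda>x. (?g (x + y) - f (x + y))\<^sup>2)" "L1 (\<lambda>x. (?g x - f x)\<^sup>2)"
   "L1 (\<lambda>x. \<bar>?g (x + y) - ?g x\<bar>)" "L1 (\<lambda>x. (f (x + y) - f x)\<^sup>2)"
   using f f2t g2 g2t gi gt by (auto intro!: square_integrable_diff)
  have "(f (x + y) - f x)\<^sup>2 \<le> 3 * (?g (x + y) - f (x + y))\<^sup>2 +
     6 * (real n + 1) * \<bar>?g (x + y) - ?g x\<bar> + 3 * (?g x - f x)\<^sup>2" for x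
  proof -
   have sq: "(c - a + b)\<^sup>2 \<le> 3 * a\<^sup>2 + 3 * b\<^sup>2 + 3 * c\<^sup>2" for a b c :: real
    using zero_le_power2[of "a + b"] zero_le_power2[of "a + c"] zero_le_power2[of "b - c"]
    by (simp add: power2_eq_square algebra_simps)
   have "(f (x + y) - f x)\<^sup>2 = ((?g x - f x) - (?g (x + y) - f (x + y)) + (?g (x + y) - ?g x))\<^sup>2"
    by simp
   also have "\<dots> \<le> 3 * (?g (x + y) - f (x + y))\<^sup>2 + 3 * (?g (x + y) - ?g x)\<^sup>2 + 3 * (?g x - f x)\<^sup>2"
    by (rule sq)
   finally show ?thesis using 1[of x] by (simp add: algebra_simps)
  qed
  then have "(LBINT x. (f (x + y) - f x)\<^sup>2) \<le> (LBINT x. 3 * (?g (x + y) - f (x + y))\<^sup>2 +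
     6 * (real n + 1) * \<bar>?g (x + y) - ?g x\<bar> + 3 * (?g x - f x)\<^sup>2)"
   using ints by (intro integral_mono) auto
  also have "\<dots> = 3 * (LBINT x. (?g (x + y) - f (x + y))\<^sup>2) +
    6 * (real n + 1) * (LBINT x. \<bar>?g (x + y) - ?g x\<bar>) + 3 * (LBINT x. (?g x - f x)\<^sup>2)"
   using ints by simp
  also have "\<dots> \<le> 3 * (e / 12) + 6 * (real n + 1) * (e / (12 * (real n + 1))) + 3 * (e / 12)"
   using n d(2)[OF y] unfolding 2 by (intro add_mono mult_left_mono) auto
  also have "\<dots> = e" by (simp add: field_simps)
  finally show "(LBINT x. (f (x + y) - f x)\<^sup>2) \<le> e" .
 qed (use d in auto)
qed

section \<open>Probability kernels and weak convergence of averages\<close>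

definition kernel :: "real \<Rightarrow> ('a::euclidean_space \<Rightarrow> real) \<Rightarrow> bool" where
 "kernel r K \<longleftrightarrow> K \<in> Borel \<and> (\<forall>x. 0 \<le> K x) \<and> (\<forall>x. x \<notin> cball 0 r \<longrightarrow> K x = 0)
   \<and> L1 K \<and> (LBINT x. K x) = 1"

lemma mollifier_kernel: "mollifier r K \<Longrightarrow> kernel r K"
 using mollifier_C1[of r K] C1_borel by (auto simp: mollifier_def kernel_def)

text \<open>Fubini moves the average from the merely bounded \<open>F\<close> onto the integrable
  weight \<open>m\<close>, whose translations are continuous in the mean. The map \<open>E\<close>
  allows an average over some of the variables only, such as time alone, or with a reflected
  argument.\<close>

lemma weak_mollification:
 fixes m F :: "'a::euclidean_space \<Rightarrow> real" and K :: "'b::euclidean_space \<Rightarrow> real" and E :: "'b \<Rightarrow> 'a"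
 assumes m: "L1 m" and [measurable]: "F \<in> Borel" "E \<in> Borel"
  and C: "\<And>x. \<bar>F x\<bar> \<le> C" and K: "kernel r K"
  and e: "\<And>y. norm y \<le> r \<Longrightarrow> (LBINT x. \<bar>m (x + E y) - m x\<bar>) \<le> e"
 shows "\<bar>(LBINT x. m x * (LBINT y. F (x - E y) * K y)) - (LBINT x. m x * F x)\<bar> \<le> C * e"
proof -
 have [measurable]: "m \<in> Borel" using borel_measurable_integrable[OF m] by simp
 have Km [measurable]: "K \<in> Borel" and K0: "\<And>x. 0 \<le> K x" "\<And>x. x \<notin> cball 0 r \<Longrightarrow> K x = 0"
  and Ki: "L1 K" and K1: "(LBINT x. K x) = 1"
  using K unfolding kernel_def by auto
 have C0: "C \<ge> 0" using C[of 0] by linarith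
 have FC: "\<bar>a * F x\<bar> \<le> \<bar>C * a\<bar>" for a x
  using mult_right_mono[OF C[of x], of "\<bar>a\<bar>"] C0 by (simp add: abs_mult mult.commute)
 have mF: "L1 (\<lambda>x. m x * F x)"
  by (rule Bochner_Integration.integrable_bound[OF integrable_mult_right[OF m, of C]])
   (use FC in auto)
 have mF': "L1 (\<lambda>x. m (x + z) * F x)" for z
  by (rule Bochner_Integration.integrable_bound[of lborel "\<lambda>x. C * m (x + z)"])
   (use FC m in \<open>auto simp: integrable_translate_lborel\<close>)
 have i2: "integrable (lborel \<Otimes>\<^sub>M lborel) (\<lambda>(x, y). m x * (F (x - E y) * K y))"
 proof (rule Bochner_Integration.integrable_bound)
  show "integrable (lborel \<Otimes>\<^sub>M lborel) (\<lambda>(x, y). C * (m x * K y))"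
  proof (rule lborel_pair.Fubini_integrable)
   have "(\<lambda>x. (LBINT y. norm (case (x, y) of (x, y) \<Rightarrow> C * (m x * K y)))) = (\<lambda>x. \<bar>C * m x\<bar> * (LBINT y. \<bar>K y\<bar>))"
    by (auto simp: abs_mult mult.assoc[symmetric])
   then show "L1 (\<lambda>x. (LBINT y. norm (case (x, y) of (x, y) \<Rightarrow> C * (m x * K y))))"
    using m by simp
  qed (use Ki in auto)
  show "AE p in lborel \<Otimes>\<^sub>M lborel. norm (case p of (x, y) \<Rightarrow> m x * (F (x - E y) * K y))
    \<le> norm (case p of (x, y) \<Rightarrow> C * (m x * K y))"
  proof (rule AE_I2, clarsimp simp: abs_mult)
   fix x y
   have "\<bar>F (x - E y)\<bar> * (\<bar>m x\<bar> * \<bar>K y\<bar>) \<le> C * (\<bar>m x\<bar> * \<bar>K y\<bar>)"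
    by (rule mult_right_mono[OF C]) simp
   then show "\<bar>m x\<bar> * (\<bar>F (x - E y)\<bar> * \<bar>K y\<bar>) \<le> \<bar>C\<bar> * (\<bar>m x\<bar> * \<bar>K y\<bar>)"
    using C0 by (simp add: mult.left_commute)
  qed
 qed measurable
 have "(LBINT x. m x * (LBINT y. F (x - E y) * K y))
   = (LBINT x. (LBINT y. m x * (F (x - E y) * K y)))"
  by simp
 also have "\<dots> = (LBINT y. (LBINT x. m x * (F (x - E y) * K y)))"
  using lborel_pair.Fubini_integral[OF i2] by simp
 also have "\<dots> = (LBINT y. K y * (LBINT x. m (x + E y) * F x))"
 proof (rule Bochner_Integration.integral_cong[OF refl])
  fix y
  have "(LBINT x. m x * (F (x - E y) * K y)) = (LBINT x. K y * (m x * F (x - E y)))"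
   by (simp add: mult_ac)
  also have "\<dots> = K y * (LBINT x. m x * F (x - E y))" by simp
  also have "(LBINT x. m x * F (x - E y)) = (LBINT x. m (x + E y) * F x)"
   using integral_translate_lborel[of "\<lambda>x. m x * F (x - E y)" "E y"] by simp
  finally show "(LBINT x. m x * (F (x - E y) * K y)) = K y * (LBINT x. m (x + E y) * F x)" .
 qed
 finally have 1: "(LBINT x. m x * (LBINT y. F (x - E y) * K y))
   = (LBINT y. K y * (LBINT x. m (x + E y) * F x))" .
 let ?J = "\<lambda>y. (LBINT x. m (x + E y) * F x)" and ?I = "(LBINT x. m x * F x)"
 have Jm [measurable]: "?J \<in> Borel"
 proof -
  have "(\<lambda>y. (LBINT x. m (x + E y) * F x)) \<in> borel_measurable lborel"
   by (rule lborel.borel_measurable_lebesgue_integral) measurable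
  then show ?thesis by simp
 qed
 have Jb: "\<bar>?J y - ?I\<bar> \<le> C * e" if "norm y \<le> r" for y
 proof -
  have "?J y - ?I = (LBINT x. (m (x + E y) - m x) * F x)"
   using mF mF' by (simp add: left_diff_distrib)
  also have "\<bar>\<dots>\<bar> \<le> (LBINT x. C * \<bar>m (x + E y) - m x\<bar>)"
  proof (rule order_trans[OF integral_abs_bound integral_mono])
   show "L1 (\<lambda>x. \<bar>(m (x + E y) - m x) * F x\<bar>)"
    using Bochner_Integration.integrable_diff[OF mF'[of "E y"] mF] by (simp add: left_diff_distrib)
   show "L1 (\<lambda>x. C * \<bar>m (x + E y) - m x\<bar>)"
    using m by (auto simp: integrable_translate_lborel)
   show "\<bar>(m (x + E y) - m x) * F x\<bar> \<le> C * \<bar>m (x + E y) - m x\<bar>" for x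
    using mult_left_mono[OF C[of x], of "\<bar>m (x + E y) - m x\<bar>"] by (simp add: abs_mult mult.commute)
  qed
  also have "\<dots> \<le> C * e" using e[OF that] C0 by (simp add: mult_left_mono)
  finally show ?thesis .
 qed
 have KJ: "L1 (\<lambda>y. K y * (?J y - ?I))"
 proof (rule Bochner_Integration.integrable_bound[OF integrable_mult_right[OF Ki, of "C * e"]])
  show "AE y in lborel. norm (K y * (?J y - ?I)) \<le> norm (C * e * K y)"
  proof (rule AE_I2)
   fix y show "norm (K y * (?J y - ?I)) \<le> norm (C * e * K y)"
   proof (cases "norm y \<le> r")
    case True
    have "K y * \<bar>?J y - ?I\<bar> \<le> K y * (C * e)" using Jb[OF True] K0 by (intro mult_left_mono) auto
    also have "\<dots> \<le> \<bar>C * e * K y\<bar>" by (metis abs_ge_self mult.commute)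
    finally show ?thesis using K0(1)[of y] by (simp only: abs_mult real_norm_def abs_of_nonneg)
   qed (use K0(2)[of y] in simp)
  qed
 qed measurable
 have "(LBINT y. K y * ?J y) - ?I = (LBINT y. K y * (?J y - ?I))"
 proof -
  have "(LBINT y. K y * ?J y) = (LBINT y. K y * (?J y - ?I) + K y * ?I)"
   by (simp add: algebra_simps)
  also have "\<dots> = (LBINT y. K y * (?J y - ?I)) + (LBINT y. K y * ?I)"
   using KJ Ki by (intro Bochner_Integration.integral_add) auto
  finally show ?thesis by (simp add: K1)
 qed
 also have "\<bar>\<dots>\<bar> \<le> (LBINT y. (C * e) * K y)"
 proof (rule order_trans[OF integral_abs_bound integral_mono])
  show "\<bar>K y * (?J y - ?I)\<bar> \<le> (C * e) * K y" for y
  proof (cases "norm y \<le> r")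
   case True
   have "K y * \<bar>?J y - ?I\<bar> \<le> K y * (C * e)" using Jb[OF True] K0 by (intro mult_left_mono) auto
   then show ?thesis using K0(1)[of y] by (simp add: abs_mult mult.commute)
  qed (use K0(2)[of y] in simp)
 qed (use KJ Ki in auto)
 also have "\<dots> = C * e" by (simp add: K1)
 finally show ?thesis unfolding 1 .
qed

lemma weak_mollification_tendsto:
 fixes m F :: "'a::euclidean_space \<Rightarrow> real" and K :: "nat \<Rightarrow> 'b::euclidean_space \<Rightarrow> real" and E :: "'b \<Rightarrow> 'a"
 assumes m: "L1 m" and F: "F \<in> Borel" and E: "linear E" "\<And>y. norm (E y) \<le> norm y"
  and C: "\<And>x. \<bar>F x\<bar> \<le> C" and K: "\<And>n. kernel (r n) (K n)" and r: "r \<longlonglongrightarrow> 0"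
 shows "(\<lambda>n. (LBINT x. m x * (LBINT y. F (x - E y) * K n y))) \<longlonglongrightarrow> (LBINT x. m x * F x)"
proof (rule LIMSEQ_I)
 fix e :: real assume e: "e > 0"
 have C0: "C \<ge> 0" using C[of 0] by linarith
 have Em: "E \<in> Borel"
  using E(1) linear_continuous_on linear_conv_bounded_linear borel_measurable_continuous_onI by blast
 obtain d where d: "d > 0" "\<And>y. norm y < d \<Longrightarrow> (LBINT x. \<bar>m (x + y) - m x\<bar>) \<le> e / (2 * (C + 1))"
  using L1_translation[OF m, of "e / (2 * (C + 1))"] e C0 by auto
 obtain N where N: "\<And>n. n \<ge> N \<Longrightarrow> \<bar>r n\<bar> < d"
  using LIMSEQ_D[OF r d(1)] by auto
 show "\<exists>N. \<forall>n\<ge>N. norm ((LBINT x. m x * (LBINT y. F (x - E y) * K n y)) - (LBINT x. m x * F x)) < e"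
 proof (intro exI[of _ N] allI impI)
  fix n assume n: "n \<ge> N"
  have "\<bar>(LBINT x. m x * (LBINT y. F (x - E y) * K n y)) - (LBINT x. m x * F x)\<bar> \<le> C * (e / (2 * (C + 1)))"
  proof (rule weak_mollification[OF m F Em C K])
   fix y :: 'b assume "norm y \<le> r n"
   then have "norm (E y) < d" using E(2)[of y] N[OF n] by linarith
   then show "(LBINT x. \<bar>m (x + E y) - m x\<bar>) \<le> e / (2 * (C + 1))" by (rule d(2))
  qed
  also have "\<dots> \<le> e / 2" using C0 e by (simp add: field_simps)
  also have "\<dots> < e" using e by simp
  finally show "norm ((LBINT x. m x * (LBINT y. F (x - E y) * K n y)) - (LBINT x. m x * F x)) < e"
   by simp
 qed
qed

text \<open>Expand the variance of \<open>g\<close> under the density \<open>K\<close>, which is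
  nonnegative.\<close>

lemma kernel_Jensen:
 fixes g K :: "'a::euclidean_space \<Rightarrow> real"
 assumes K: "kernel r K" and g: "L1 (\<lambda>y. g y * K y)" "L1 (\<lambda>y. (g y)\<^sup>2 * K y)"
 shows "(LBINT y. g y * K y)\<^sup>2 \<le> (LBINT y. (g y)\<^sup>2 * K y)"
proof -
 define c where "c = (LBINT y. g y * K y)"
 have K': "L1 K" "(LBINT y. K y) = 1" "\<And>y. 0 \<le> K y"
  using K by (auto simp: kernel_def)
 have "0 \<le> (LBINT y. (g y - c)\<^sup>2 * K y)"
  using K' by (intro Bochner_Integration.integral_nonneg) auto
 also have "\<dots> = (LBINT y. ((g y)\<^sup>2 * K y - 2 * c * (g y * K y)) + c\<^sup>2 * K y)"
  by (rule Bochner_Integration.integral_cong) (auto simp: power2_eq_square algebra_simps)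
 also have "\<dots> = (LBINT y. (g y)\<^sup>2 * K y) - 2 * c * c + c\<^sup>2"
  using g K' by (simp add: c_def)
 finally show ?thesis by (simp add: c_def power2_eq_square)
qed

text \<open>By Jensen the squared error at \<open>x\<close> is at most the \<open>K\<close>-average
  of the squared translation differences. Tonelli then integrates in \<open>x\<close> first, where
  each difference contributes at most \<open>e\<close>.\<close>

lemma L2_mollification:
 fixes f :: "'a::euclidean_space \<Rightarrow> real"
 assumes f1: "L1 f" and f2: "L1 (\<lambda>x. (f x)\<^sup>2)"
  and K: "mollifier r K"
  and e: "0 \<le> e" "\<And>y. norm y \<le> r \<Longrightarrow> (LBINT x. (f (x + y) - f x)\<^sup>2) \<le> e"
 shows "(\<integral>\<^sup>+x. ennreal ((conv f K x - f x)\<^sup>2) \<partial>lborel) \<le> ennreal e"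
proof -
 have [measurable]: "f \<in> Borel" using borel_measurable_integrable[OF f1] by simp
 obtain k where k: "C1 K k" using mollifier_C1[OF K] by blast
 have Kc: "continuous_on UNIV K" by (rule C1_continuous[OF k])
 have Kk: "kernel r K" by (rule mollifier_kernel[OF K])
 have [measurable]: "K \<in> Borel" and K0: "\<And>x. 0 \<le> K x" "\<And>x. x \<notin> cball 0 r \<Longrightarrow> K x = 0"
  and Ki: "L1 K" and K1: "(LBINT x. K x) = 1"
  using Kk unfolding kernel_def by auto
 obtain C where C: "C > 0" "\<And>x. norm (K x) \<le> C"
  using compact_support_bounded[OF Kc compact_cball[of 0 r] K0(2)] by blast
 have KC: "K x \<le> C" for x using C(2)[of x] by simp
 have bnd: "L1 (\<lambda>y. g (x - y) * K y)" if "L1 g" for g :: "'a \<Rightarrow> real" and x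
 proof (rule Bochner_Integration.integrable_bound)
  have [measurable]: "g \<in> Borel" using borel_measurable_integrable[OF that] by simp
  show "L1 (\<lambda>y. C * g (x - y))" using that by (simp add: integrable_reflect_lborel)
  show "(\<lambda>y. g (x - y) * K y) \<in> borel_measurable lborel" by measurable
  show "AE y in lborel. norm (g (x - y) * K y) \<le> norm (C * g (x - y))"
   using C K0(1) by (auto simp: abs_mult mult.commute[of C] intro!: mult_left_mono)
 qed
 have i1: "L1 (\<lambda>y. (f (x - y) - f x) * K y)" for x
  using bnd[OF f1, of x] Ki by (simp add: left_diff_distrib)
 have i2: "L1 (\<lambda>y. (f (x - y) - f x)\<^sup>2 * K y)" for x
 proof -
  have "L1 (\<lambda>y. (f (x - y))\<^sup>2 * K y - 2 * f x * (f (x - y) * K y) + (f x)\<^sup>2 * K y)"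
   using bnd[OF f1, of x] bnd[OF f2, of x] Ki by auto
  then show ?thesis by (simp add: power2_eq_square algebra_simps)
 qed
 have "(conv f K x - f x)\<^sup>2 \<le> (LBINT y. (f (x - y) - f x)\<^sup>2 * K y)" for x
 proof -
  have "conv f K x - f x = (LBINT y. (f (x - y) - f x) * K y)"
   using bnd[OF f1, of x] Ki K1 by (simp add: conv_swap left_diff_distrib)
  then show ?thesis using kernel_Jensen[OF Kk i1 i2] by simp
 qed
 then have "(\<integral>\<^sup>+x. ennreal ((conv f K x - f x)\<^sup>2) \<partial>lborel)
   \<le> (\<integral>\<^sup>+x. ennreal (LBINT y. (f (x - y) - f x)\<^sup>2 * K y) \<partial>lborel)"
  by (intro nn_integral_mono ennreal_leI)
 also have "\<dots> = (\<integral>\<^sup>+x. (\<integral>\<^sup>+y. ennreal ((f (x - y) - f x)\<^sup>2 * K y) \<partial>lborel) \<partial>lborel)"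
  using i2 K0 by (simp add: nn_integral_eq_integral)
 also have "\<dots> = (\<integral>\<^sup>+y. (\<integral>\<^sup>+x. ennreal ((f (x - y) - f x)\<^sup>2 * K y) \<partial>lborel) \<partial>lborel)"
  by (rule lborel_pair.Fubini') measurable
 also have "\<dots> \<le> (\<integral>\<^sup>+y. ennreal (e * K y) \<partial>lborel)"
 proof (rule nn_integral_mono)
  fix y
  show "(\<integral>\<^sup>+x. ennreal ((f (x - y) - f x)\<^sup>2 * K y) \<partial>lborel) \<le> ennreal (e * K y)"
  proof (cases "norm y \<le> r")
   case True
   have "L1 (\<lambda>x. (f (x + (- y)) - f x)\<^sup>2)"
    using f2 integrable_translate_lborel[of "\<lambda>x. (f x)\<^sup>2" "- y"]
    by (intro square_integrable_diff) auto
   then have "(\<integral>\<^sup>+x. ennreal ((f (x - y) - f x)\<^sup>2) \<partial>lborel) = ennreal (LBINT x. (f (x + (- y)) - f x)\<^sup>2)"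
    by (simp add: nn_integral_eq_integral)
   also have "\<dots> \<le> ennreal e" using e(2)[of "- y"] True by (intro ennreal_leI) simp
   finally have "(\<integral>\<^sup>+x. ennreal ((f (x - y) - f x)\<^sup>2) \<partial>lborel) \<le> ennreal e" .
   then show ?thesis using K0(1)[of y] e(1)
    by (simp add: ennreal_mult nn_integral_multc mult_right_mono)
  qed (use K0(2)[of y] in simp)
 qed
 also have "\<dots> = ennreal e"
  using Ki K0(1) K1 e(1) by (subst nn_integral_eq_integral) auto
 finally show ?thesis .
qed

section \<open>Test functions composed with the Hamiltonian\<close>

lemma fst_borel_measurable [measurable]: "fst \<in> Borel"
 by (intro borel_measurable_continuous_onI continuous_intros)

lemma snd_borel_measurable [measurable]: "snd \<in> Borel"
 by (intro borel_measurable_continuous_onI continuous_intros)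

lemma integrable_tensor:
 fixes f :: "'a::euclidean_space \<Rightarrow> real" and g :: "'b::euclidean_space \<Rightarrow> real"
 assumes f: "L1 f" and g: "L1 g"
 shows "L1 (\<lambda>p. f (fst p) * g (snd p))"
proof -
 have [measurable]: "f \<in> Borel" "g \<in> Borel"
  using borel_measurable_integrable[OF f] borel_measurable_integrable[OF g] by simp_all
 have "integrable (lborel \<Otimes>\<^sub>M lborel) (\<lambda>p. f (fst p) * g (snd p))"
 proof (rule lborel_pair.Fubini_integrable)
  have "(\<lambda>x. (LBINT y. norm (f (fst (x, y)) * g (snd (x, y))))) = (\<lambda>x. \<bar>f x\<bar> * (LBINT y. \<bar>g y\<bar>))"
   by (auto simp: abs_mult)
  then show "L1 (\<lambda>x. (LBINT y. norm (f (fst (x, y)) * g (snd (x, y)))))"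
   using f by simp
 qed (use g in auto)
 then show ?thesis by (simp add: lborel_prod)
qed

lemma integral_tensor:
 fixes f :: "'a::euclidean_space \<Rightarrow> real" and g :: "'b::euclidean_space \<Rightarrow> real"
 assumes f: "L1 f" and g: "L1 g"
 shows "(LBINT p. f (fst p) * g (snd p)) = (LBINT x. f x) * (LBINT y. g y)"
proof -
 have "integrable (lborel \<Otimes>\<^sub>M lborel) (\<lambda>p. f (fst p) * g (snd p))"
  using integrable_tensor[OF f g] by (simp add: lborel_prod)
 from lborel_pair.integral_fst'[OF this] show ?thesis
  by (simp add: lborel_prod)
qed

lemma integrable_indicator_compact:
 "compact K \<Longrightarrow> L1 (indicator K :: 'a::euclidean_space \<Rightarrow> real)"
 using emeasure_bounded_finite[of K] compact_imp_bounded[of K]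
 by (intro integrable_real_indicator) (auto simp: borel_compact)

text \<open>The inverse of \<open>perp\<close>: if \<open>b = perp G\<close>, then
  \<open>G = rot b\<close>. The gradient of the Hamiltonian is therefore written
  \<open>rot b\<close> throughout.\<close>

definition rot :: "real^2 \<Rightarrow> real^2" where
 "rot v = vector [v $ 2, - (v $ 1)]"

lemma rot_orthogonal: "rot v \<bullet> v = 0"
 by (simp add: rot_def inner_vec_def sum_2)

lemma rot_linear: "linear rot"
 by (rule linearI) (simp_all add: rot_def vec_eq_iff forall_2)

lemma rot_continuous: "continuous_on S rot"
 using rot_linear linear_continuous_on linear_conv_bounded_linear by blast

lemma rot_measurable [measurable]: "rot \<in> Borel"
 by (rule borel_measurable_continuous_onI[OF rot_continuous])

lemma norm_rot [simp]: "norm (rot v) = norm v"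
 by (simp add: rot_def norm_eq_sqrt_inner inner_vec_def sum_2)

text \<open>In arbitrary dimension, since it serves two purposes: the divergence condition on
  \<open>b\<close> in the plane, and the transport equation as the vanishing divergence of a field
  on space-time.\<close>

definition divfree :: "'a::euclidean_space set \<Rightarrow> ('a \<Rightarrow> 'a) \<Rightarrow> bool" where
 "divfree S B \<longleftrightarrow> (\<forall>f g K. C1 f g \<longrightarrow> compact K \<longrightarrow> K \<subseteq> S \<longrightarrow> (\<forall>x. x \<notin> K \<longrightarrow> f x = 0)
   \<longrightarrow> (LBINT x. B x \<bullet> g x) = 0)"

lemma divfreeD:
 assumes "divfree S B" "C1 f g" "compact K" "K \<subseteq> S" "\<And>x. x \<notin> K \<Longrightarrow> f x = 0"
 shows "(LBINT x. B x \<bullet> g x) = 0"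
 using assms unfolding divfree_def by blast

lemma compact_subset_cball:
 fixes K :: "'a::euclidean_space set"
 assumes "compact K" obtains R where "K \<subseteq> cball 0 R"
 using compact_imp_bounded[OF assms] unfolding bounded_iff by (metis mem_cball_0 subsetI)

lemma compact_fst_image: "compact K \<Longrightarrow> compact (fst ` K)"
 by (intro compact_continuous_image continuous_intros)

lemma compact_snd_image: "compact K \<Longrightarrow> compact (snd ` K)"
 by (intro compact_continuous_image continuous_intros)

lemma compact_neighbourhood:
 fixes K :: "'a::euclidean_space set"
 assumes "compact K" "open V" "K \<subseteq> V"
 obtains r K' where "r > 0" "compact K'" "K' \<subseteq> V" "\<And>x y. x \<in> K \<Longrightarrow> dist x y \<le> r \<Longrightarrow> y \<in> K'" "K \<subseteq> K'"
proof -
 obtain e where e: "e > 0" "(\<Union>x\<in>K. ball x e) \<subseteq> V"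
  using compact_subset_open_imp_ball_epsilon_subset[OF assms] by blast
 let ?K' = "{x + y |x y. x \<in> K \<and> y \<in> cball 0 (e / 2)}"
 show thesis
 proof (rule that[of "e / 2" ?K'])
  show "compact ?K'" by (intro compact_sums assms compact_cball)
  show "?K' \<subseteq> V"
  proof
   fix z assume "z \<in> ?K'"
   then obtain x y where "z = x + y" "x \<in> K" "norm y \<le> e / 2" by auto
   then have "z \<in> ball x e" using e(1) by (auto simp: dist_norm)
   then show "z \<in> V" using e \<open>x \<in> K\<close> by blast
  qed
  show mem: "y \<in> ?K'" if "x \<in> K" "dist x y \<le> e / 2" for x y
   using that by (intro CollectI exI[of _ x] exI[of _ "y - x"]) (auto simp: dist_norm norm_minus_commute)
  show "K \<subseteq> ?K'" using mem e(1) by fastforce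
 qed (use e in simp)
qed

text \<open>On a compact set the bound \<open>t \<le> 1 + t^2\<close> suffices.\<close>

lemma integrable_norm_of_square:
 fixes h :: "'a::euclidean_space \<Rightarrow> 'b::euclidean_space"
 assumes "compact K" and [measurable]: "h \<in> Borel"
  and "L1 (\<lambda>x. indicator K x * (norm (h x))\<^sup>2)"
 shows "L1 (\<lambda>x. indicator K x * norm (h x))"
proof -
 have [measurable]: "K \<in> sets borel" using assms borel_compact by blast
 have "norm (indicator K x * norm (h x)) \<le> norm (indicator K x + indicator K x * (norm (h x))\<^sup>2 :: real)" for x
 proof -
  have "norm (h x) \<le> 1 + (norm (h x))\<^sup>2"
   using zero_le_power2[of "norm (h x) - 1"] by (simp add: power2_eq_square algebra_simps, smt (verit) mult_nonneg_nonneg norm_ge_zero)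
  then show ?thesis by (auto simp: indicator_def)
 qed
 then show ?thesis
  by (intro Bochner_Integration.integrable_bound[OF Bochner_Integration.integrable_add[OF
     integrable_indicator_compact[OF assms(1)] assms(3)]]) auto
qed

text \<open>The problem for Borel functions and \<open>C1\<close> test functions, freed from domains
  and periodicity. \<open>H_weak\<close> says that \<open>rot b\<close> is the weak gradient of
  \<open>H\<close>.\<close>

locale ham_field =
 fixes V :: "(real^2) set" and b :: "real^2 \<Rightarrow> real^2" and H :: "real^2 \<Rightarrow> real"
 assumes V_open: "open V" and b_borel [measurable]: "b \<in> Borel"
  and b_L2: "\<And>K. compact K \<Longrightarrow> K \<subseteq> V \<Longrightarrow> L1 (\<lambda>x. indicator K x * (norm (b x))\<^sup>2)"
  and H_borel [measurable]: "H \<in> Borel" and H_cont: "continuous_on V H"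
  and H_weak: "\<And>f g K v. C1 f g \<Longrightarrow> compact K \<Longrightarrow> K \<subseteq> V \<Longrightarrow> (\<And>x. x \<notin> K \<Longrightarrow> f x = 0) \<Longrightarrow>
   (LBINT x. H x * (g x \<bullet> v)) = - (LBINT x. (rot (b x) \<bullet> v) * f x)"
  and b_div: "divfree V b"
begin

lemma b_L1:
 assumes "compact K" "K \<subseteq> V"
 shows "L1 (\<lambda>x. indicator K x * norm (b x))"
 by (rule integrable_norm_of_square[OF assms(1) _ b_L2[OF assms]]) measurable

text \<open>Mollify \<open>H\<close>, cut off to a neighbourhood \<open>K'\<close> of
  \<open>K\<close>. Continuity of \<open>H\<close> gives the uniform bound on \<open>K\<close>; the
  gradient of the mollification is there the mollification of \<open>rot b\<close>, which converges
  in the mean square.\<close>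

lemma H_approx:
 assumes K: "compact K" "K \<subseteq> V" and e: "e > 0"
 obtains H' \<gamma> where "C1 H' \<gamma>" "\<And>x. x \<in> K \<Longrightarrow> \<bar>H' x - H x\<bar> \<le> e"
  "(\<integral>\<^sup>+x. indicator K x * ennreal ((norm (\<gamma> x - rot (b x)))\<^sup>2) \<partial>lborel) \<le> ennreal e"
proof -
 obtain r K' where r: "r > 0" "compact K'" "K' \<subseteq> V" "\<And>x y. x \<in> K \<Longrightarrow> dist x y \<le> r \<Longrightarrow> y \<in> K'" "K \<subseteq> K'"
  using compact_neighbourhood[OF K(1) V_open K(2)] by blast
 have K'm [measurable]: "K' \<in> sets borel" "K \<in> sets borel" using r(2) K borel_compact by blast+
 obtain R where R: "K' \<subseteq> cball 0 R" using compact_subset_cball[OF r(2)] by blast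
 define Hh where "Hh x = indicator K' x * H x" for x
 have Hc: "continuous_on K' H" using H_cont r(3) continuous_on_subset by blast
 have [measurable]: "Hh \<in> Borel" unfolding Hh_def by measurable
 have Hi: "L1 Hh"
  using borel_integrable_compact[OF r(2) Hc] by (simp add: Hh_def[abs_def])
 have Hs: "Hh y = 0" if "y \<notin> cball 0 R" for y using that R by (auto simp: Hh_def indicator_def)
 define G where "G v x = indicator K' x * (rot (b x) \<bullet> v)" for v x
 have [measurable]: "G v \<in> Borel" for v unfolding G_def by measurable
 have Gi: "L1 (G v)" if "norm v = 1" for v
 proof (rule Bochner_Integration.integrable_bound[OF b_L1[OF r(2,3)]])
  show "AE x in lborel. norm (G v x) \<le> norm (indicator K' x * norm (b x))"
   using Cauchy_Schwarz_ineq2[of "rot (b _)" v] that by (auto simp: G_def indicator_def intro!: AE_I2)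
 qed measurable
 have G2: "L1 (\<lambda>x. (G v x)\<^sup>2)" if "norm v = 1" for v
 proof (rule Bochner_Integration.integrable_bound[OF b_L2[OF r(2,3)]])
  have "(rot (b x) \<bullet> v)\<^sup>2 \<le> (norm (b x))\<^sup>2" for x
   using Cauchy_Schwarz_ineq2[of "rot (b x)" v] that by (simp add: abs_le_square_iff[symmetric])
  then show "AE x in lborel. norm ((G v x)\<^sup>2) \<le> norm (indicator K' x * (norm (b x))\<^sup>2)"
   by (auto simp: G_def indicator_def intro!: AE_I2)
 qed measurable
 \<comment> \<open>Half of \<open>e\<close> for each of the two components of the gradient.\<close>
 have "\<exists>d>0. \<forall>v\<in>Basis. \<forall>y. norm y < d \<longrightarrow> (LBINT x. (G v (x + y) - G v x)\<^sup>2) \<le> e / 2"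
 proof -
  have "\<forall>v\<in>(Basis::(real^2) set). \<exists>d>0. \<forall>y. norm y < d \<longrightarrow> (LBINT x. (G v (x + y) - G v x)\<^sup>2) \<le> e / 2"
   using L2_translation[OF _ G2, of _ "e / 2"] e by auto
  from bchoice[OF this] obtain d where d: "\<forall>v\<in>(Basis::(real^2) set). d v > 0 \<and> (\<forall>y. norm y < d v \<longrightarrow> (LBINT x. (G v (x + y) - G v x)\<^sup>2) \<le> e / 2)"
   by blast
  then show ?thesis
   by (intro exI[of _ "Min (d ` Basis)"]) auto
 qed
 then obtain d where d: "d > 0" "\<And>v y. v \<in> Basis \<Longrightarrow> norm y < d \<Longrightarrow> (LBINT x. (G v (x + y) - G v x)\<^sup>2) \<le> e / 2"
  by blast
 have "uniformly_continuous_on K' H" by (rule compact_uniformly_continuous[OF Hc r(2)])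
 then obtain d' where d': "d' > 0" "\<And>x y. x \<in> K' \<Longrightarrow> y \<in> K' \<Longrightarrow> dist y x < d' \<Longrightarrow> dist (H y) (H x) < e"
  using e unfolding uniformly_continuous_on_def by metis
 \<comment> \<open>Below \<open>r\<close> the kernel stays inside \<open>K'\<close>, below
   \<open>d\<close> the gradient is within its mean square tolerance, below \<open>d'\<close> the
   oscillation of \<open>H\<close> is less than \<open>e\<close>.\<close>
 define s where "s = min r (min d d') / 2"
 have s: "s > 0" "s < r" "s < d" "s < d'" using r d d' by (auto simp: s_def min_def)
 obtain \<kappa> :: "real^2 \<Rightarrow> real" where \<kappa>: "mollifier s \<kappa>" using mollifier_exists[OF s(1)] by blast
 obtain k where k: "C1 \<kappa> k" using mollifier_C1[OF \<kappa>] by blast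
 have \<kappa>0: "\<And>x. 0 \<le> \<kappa> x" "\<And>x. x \<notin> cball 0 s \<Longrightarrow> \<kappa> x = 0" "L1 \<kappa>" "(LBINT x. \<kappa> x) = 1"
  using \<kappa> by (auto simp: mollifier_def)
 have k0: "k x = 0" if "x \<notin> cball 0 s" for x
  using C1_grad_support[OF k closed_cball \<kappa>0(2) that] by blast
 have kc: "continuous_on UNIV k" and \<kappa>c: "continuous_on UNIV \<kappa>"
  using k C1_grad_continuous C1_continuous by blast+
 have [measurable]: "\<kappa> \<in> Borel" using k C1_borel by blast
 have C: "C1 (conv Hh \<kappa>) (conv Hh k)" by (rule conv_C1_bounded_support[OF Hi Hs k])
 have near: "y \<in> K'" if "x \<in> K" "x - y \<in> cball 0 s" for x y
  using r(4)[OF that(1), of y] that(2) s by (auto simp: dist_norm norm_minus_commute[of x y])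
 have 1: "\<bar>conv Hh \<kappa> x - H x\<bar> \<le> e" if x: "x \<in> K" for x
 proof -
  have i: "L1 (\<lambda>y. Hh y *\<^sub>R \<kappa> (x - y))"
   by (rule conv_integrable[OF Hi Hs \<kappa>c])
  have i': "L1 (\<lambda>y. \<kappa> (x - y))" "(LBINT y. \<kappa> (x - y)) = 1"
   using \<kappa>0 by (simp_all add: integrable_reflect_lborel integral_reflect_lborel)
  have "conv Hh \<kappa> x - H x = (LBINT y. Hh y * \<kappa> (x - y)) - (LBINT y. H x * \<kappa> (x - y))"
   using i' by (simp add: conv_def)
  also have "\<dots> = (LBINT y. (Hh y - H x) * \<kappa> (x - y))"
   using i i' by (simp add: left_diff_distrib)
  also have "\<bar>\<dots>\<bar> \<le> (LBINT y. e * \<kappa> (x - y))"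
  proof (rule order_trans[OF integral_abs_bound integral_mono])
   show "L1 (\<lambda>y. \<bar>(Hh y - H x) * \<kappa> (x - y)\<bar>)"
    using i i' by (simp add: left_diff_distrib)
   show "\<bar>(Hh y - H x) * \<kappa> (x - y)\<bar> \<le> e * \<kappa> (x - y)" for y
   proof (cases "x - y \<in> cball 0 s")
    case True
    have "dist (H y) (H x) < e"
     using d'(2)[of x y] near[OF x True] r(5) x True s by (auto simp: dist_norm norm_minus_commute)
    then have "\<bar>Hh y - H x\<bar> \<le> e" using near[OF x True] by (simp add: Hh_def dist_norm)
    then show ?thesis using \<kappa>0(1)[of "x - y"] by (simp add: abs_mult mult_right_mono)
   qed (simp add: \<kappa>0)
  qed (use i' in auto)
  also have "\<dots> = e" using i' by simp
  finally show ?thesis .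
 qed
 \<comment> \<open>The weak gradient of \<open>H\<close> is tested with the mollifier centred at
   \<open>x\<close>, which moves the derivative from the kernel to \<open>H\<close>. For
   \<open>x\<close> in \<open>K\<close> the kernel lives in \<open>K'\<close>, so the cut-off of
   \<open>H\<close> makes no difference.\<close>
 have 2: "conv Hh k x \<bullet> v = conv (G v) \<kappa> x" if x: "x \<in> K" and v: "norm v = 1" for x v
 proof -
  have C1': "C1 (\<lambda>y. \<kappa> (x - y)) (\<lambda>y. - k (x - y))"
   unfolding C1_def
  proof (intro conjI allI)
   fix y
   have "((\<lambda>y. \<kappa> (x - y)) has_derivative (\<lambda>v. k (x - y) \<bullet> (0 - v))) (at y)"
    by (rule has_derivative_compose[OF _ C1_D[OF k]]) (auto intro!: derivative_eq_intros)
   moreover have "(\<bullet>) (- k (x - y)) = (\<lambda>v. k (x - y) \<bullet> (0 - v))" by auto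
   ultimately show "((\<lambda>y. \<kappa> (x - y)) has_derivative (\<bullet>) (- k (x - y))) (at y)" by simp
   show "continuous_on UNIV (\<lambda>y. - k (x - y))"
    by (intro continuous_intros continuous_on_compose2[OF kc]) auto
  qed
  have "(LBINT y. H y * ((- k (x - y)) \<bullet> v)) = - (LBINT y. (rot (b y) \<bullet> v) * \<kappa> (x - y))"
  proof (rule H_weak[OF C1'])
   show "compact (cball x s)" by simp
   show "cball x s \<subseteq> V" 
   proof
    fix y assume "y \<in> cball x s"
    then have "x - y \<in> cball 0 s" by (simp add: dist_norm[of x y])
    then show "y \<in> V" using near[OF x] r(3) by blast
   qed
   show "\<kappa> (x - y) = 0" if "y \<notin> cball x s" for y
    by (rule \<kappa>0(2)) (use that in \<open>simp add: dist_norm[of x y]\<close>)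
  qed
  moreover have "H y * ((- k (x - y)) \<bullet> v) = - (Hh y * (k (x - y) \<bullet> v))" for y
   using near[OF x, of y] k0[of "x - y"] by (cases "x - y \<in> cball 0 s") (auto simp: Hh_def)
  moreover have "(rot (b y) \<bullet> v) * \<kappa> (x - y) = G v y * \<kappa> (x - y)" for y
   using near[OF x, of y] \<kappa>0(2)[of "x - y"] by (cases "x - y \<in> cball 0 s") (auto simp: G_def)
  ultimately have "(LBINT y. Hh y * (k (x - y) \<bullet> v)) = (LBINT y. G v y * \<kappa> (x - y))"
   by (simp only: Bochner_Integration.integral_minus neg_equal_iff_equal)
  moreover have "conv Hh k x \<bullet> v = (LBINT y. (Hh y *\<^sub>R k (x - y)) \<bullet> v)"
   unfolding conv_def by (rule integral_inner_left[symmetric]) (use conv_integrable[OF Hi Hs kc] in auto)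
  ultimately show ?thesis by (simp add: conv_def)
 qed
 have "(\<integral>\<^sup>+x. indicator K x * ennreal ((norm (conv Hh k x - rot (b x)))\<^sup>2) \<partial>lborel)
   \<le> (\<integral>\<^sup>+x. (\<Sum>v\<in>Basis. ennreal ((conv (G v) \<kappa> x - G v x)\<^sup>2)) \<partial>lborel)"
 proof (rule nn_integral_mono)
  fix x
  show "indicator K x * ennreal ((norm (conv Hh k x - rot (b x)))\<^sup>2) \<le> (\<Sum>v\<in>Basis. ennreal ((conv (G v) \<kappa> x - G v x)\<^sup>2))"
  proof (cases "x \<in> K")
   case True
   have "(norm (conv Hh k x - rot (b x)))\<^sup>2 = (\<Sum>v\<in>Basis. ((conv Hh k x - rot (b x)) \<bullet> v)\<^sup>2)"
    by (subst power2_norm_eq_inner, subst euclidean_inner) (simp add: power2_eq_square)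
   also have "\<dots> = (\<Sum>v\<in>Basis. (conv (G v) \<kappa> x - G v x)\<^sup>2)"
    using True r(5) by (intro sum.cong) (auto simp: inner_diff_left 2 G_def)
   finally show ?thesis using True by (simp add: sum_ennreal)
  qed simp
 qed
 also have "\<dots> = (\<Sum>v\<in>Basis. (\<integral>\<^sup>+x. ennreal ((conv (G v) \<kappa> x - G v x)\<^sup>2) \<partial>lborel))"
 proof (rule nn_integral_sum)
  fix v :: "real^2" assume v: "v \<in> Basis"
  have "G v y = 0" if "y \<notin> cball 0 R" for y using that R by (auto simp: G_def indicator_def)
  then have "C1 (conv (G v) \<kappa>) (conv (G v) k)"
   by (intro conv_C1_bounded_support[OF Gi _ k]) (use v in auto)
  then have [measurable]: "conv (G v) \<kappa> \<in> Borel" by (rule C1_borel)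
  show "(\<lambda>x. ennreal ((conv (G v) \<kappa> x - G v x)\<^sup>2)) \<in> borel_measurable lborel" by measurable
 qed
 also have "\<dots> \<le> (\<Sum>v\<in>(Basis::(real^2) set). ennreal (e / 2))"
  using s(3) d(2) e by (intro sum_mono L2_mollification[OF Gi G2 \<kappa>]) auto
 also have "\<dots> = ennreal e" using e by (subst sum_ennreal) auto
 finally show thesis using that[OF C 1] by blast
qed

end

text \<open>
 The field is switched off at negative times, where a solution is constant in time and equal to
 its initial value.
\<close>

definition cfield :: "(real^2 \<Rightarrow> real^2) \<Rightarrow> real \<times> (real^2) \<Rightarrow> real \<times> (real^2)" where
 "cfield b p = (1, indicator {0..} (fst p) *\<^sub>R b (snd p))"

text \<open>\<open>M\<close> localizes in space only. Test functions range over all times, on both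
  sides of 0, so the equation also records how \<open>w\<close> passes through the switching
  time.\<close>

definition transp :: "(real^2) set \<Rightarrow> (real^2 \<Rightarrow> real^2) \<Rightarrow> (real \<times> (real^2) \<Rightarrow> real) \<Rightarrow> bool" where
 "transp M b w \<longleftrightarrow> divfree (UNIV \<times> M) (\<lambda>p. w p *\<^sub>R cfield b p)"

lemma cfield_measurable [measurable]:
 assumes [measurable]: "b \<in> Borel"
 shows "cfield b \<in> Borel"
 unfolding cfield_def[abs_def] by measurable

lemma norm_cfield: "norm (cfield b p) \<le> 1 + norm (b (snd p))"
 unfolding cfield_def by (rule order_trans[OF norm_Pair_le]) (auto simp: indicator_def)

context ham_field
begin

text \<open>The support is enclosed in the product of a time interval and a compact set of the
  plane, on which \<open>1 + norm b\<close> is integrable.\<close>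

lemma integrable_cfield:
 fixes K :: "(real \<times> (real^2)) set"
 assumes K: "compact K" "K \<subseteq> UNIV \<times> V"
  and [measurable]: "F \<in> Borel"
  and F: "\<And>p. p \<notin> K \<Longrightarrow> F p = 0" "\<And>p. p \<in> K \<Longrightarrow> \<bar>F p\<bar> \<le> C * (1 + norm (b (snd p)))"
 shows "L1 F"
proof -
 obtain T where T: "fst ` K \<subseteq> cball 0 T"
  using compact_subset_cball[OF compact_fst_image[OF K(1)]] by blast
 have cK: "compact (snd ` K)" by (rule compact_snd_image[OF K(1)])
 have sK: "snd ` K \<subseteq> V" using K(2) by auto
 have i: "L1 (\<lambda>x. C * (indicator (snd ` K) x + indicator (snd ` K) x * norm (b x)))"
  by (intro integrable_mult_right Bochner_Integration.integrable_add integrable_indicator_compact[OF cK] b_L1[OF cK sK])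
 have i2: "L1 (\<lambda>p. indicator (cball (0::real) T) (fst p) *
   (C * (indicator (snd ` K) (snd p) + indicator (snd ` K) (snd p) * norm (b (snd p)))))"
  by (rule integrable_tensor[OF integrable_indicator_compact[of "cball (0::real) T"] i]) simp
 show ?thesis
 proof (rule Bochner_Integration.integrable_bound[OF i2])
  show "AE p in lborel. norm (F p) \<le> norm (indicator (cball (0::real) T) (fst p) *
   (C * (indicator (snd ` K) (snd p) + indicator (snd ` K) (snd p) * norm (b (snd p)))))"
  proof (rule AE_I2)
   fix p
   show "norm (F p) \<le> norm (indicator (cball (0::real) T) (fst p) *
   (C * (indicator (snd ` K) (snd p) + indicator (snd ` K) (snd p) * norm (b (snd p)))))"
   proof (cases "p \<in> K")
    case True
    then have "fst p \<in> cball 0 T" "snd p \<in> snd ` K" using T by auto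
    then show ?thesis using F(2)[OF True] by simp
   qed (simp add: F)
  qed
 qed simp
qed

text \<open>Since \<open>rot b\<close> is orthogonal to \<open>b\<close>, the product
  \<open>\<gamma> \<bullet> b\<close> equals \<open>(\<gamma> - rot b) \<bullet> b\<close> and is at
  most \<open>e * |b|^2 + |\<gamma> - rot b|^2 / e\<close>. This is the place where the square
  integrability of \<open>b\<close> matches that of the gradient of \<open>H\<close>.\<close>

lemma rot_b_approx_null:
 assumes K: "compact K" "K \<subseteq> V" and e: "e > 0" and [measurable]: "\<gamma> \<in> Borel"
  and \<gamma>: "(\<integral>\<^sup>+x. indicator K x * ennreal ((norm (\<gamma> x - rot (b x)))\<^sup>2) \<partial>lborel) \<le> ennreal (e\<^sup>2)"
 shows "L1 (\<lambda>x. indicator K x * \<bar>\<gamma> x \<bullet> b x\<bar>)"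
  "(LBINT x. indicator K x * \<bar>\<gamma> x \<bullet> b x\<bar>) \<le> e * ((LBINT x. indicator K x * (norm (b x))\<^sup>2) + 1)"
proof -
 have [measurable]: "K \<in> sets borel" using K borel_compact by blast
 let ?g = "\<lambda>x. indicator K x * (norm (\<gamma> x - rot (b x)))\<^sup>2 :: real"
 have eq: "ennreal (?g x) = indicator K x * ennreal ((norm (\<gamma> x - rot (b x)))\<^sup>2)" for x
  by (auto simp: indicator_def)
 have g: "L1 ?g"
  unfolding integrable_iff_bounded using \<gamma>
  by (auto simp: eq[symmetric] le_less_trans[OF _ ennreal_less_top] top_unique less_top[symmetric])
 have gi: "(LBINT x. ?g x) \<le> e\<^sup>2"
  using \<gamma> unfolding eq[symmetric] by (subst (asm) nn_integral_eq_integral[OF g]) auto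
 have pt: "indicator K x * \<bar>\<gamma> x \<bullet> b x\<bar> \<le> e * (indicator K x * (norm (b x))\<^sup>2) + (1 / e) * ?g x" for x
 proof (cases "x \<in> K")
  case True
  let ?a = "norm (\<gamma> x - rot (b x))" and ?c = "norm (b x)"
  have "\<bar>\<gamma> x \<bullet> b x\<bar> = \<bar>(\<gamma> x - rot (b x)) \<bullet> b x\<bar>" by (simp add: inner_diff_left rot_orthogonal)
  also have "\<dots> \<le> ?a * ?c" by (rule Cauchy_Schwarz_ineq2)
  also have "\<dots> \<le> e * ?c\<^sup>2 + (1 / e) * ?a\<^sup>2"
  proof -
   have "0 \<le> (e * ?c - ?a)\<^sup>2 + e * ?a * ?c" using e by simp
   then have "e * (?a * ?c) \<le> e * (e * ?c\<^sup>2) + ?a\<^sup>2"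
    by (simp add: power2_eq_square algebra_simps)
   also have "\<dots> = e * (e * ?c\<^sup>2 + (1 / e) * ?a\<^sup>2)" using e by (simp add: distrib_left)
   finally show ?thesis using e by simp
  qed
  finally show ?thesis using True by simp
 qed simp
 have ii: "L1 (\<lambda>x. e * (indicator K x * (norm (b x))\<^sup>2) + (1 / e) * ?g x)"
  using g b_L2[OF K] by auto
 show i: "L1 (\<lambda>x. indicator K x * \<bar>\<gamma> x \<bullet> b x\<bar>)"
 proof (rule Bochner_Integration.integrable_bound[OF ii])
  show "AE x in lborel. norm (indicator K x * \<bar>\<gamma> x \<bullet> b x\<bar>)
    \<le> norm (e * (indicator K x * (norm (b x))\<^sup>2) + (1 / e) * ?g x)"
  proof (rule AE_I2)
   fix x
   have "norm (indicator K x * \<bar>\<gamma> x \<bullet> b x\<bar>) = indicator K x * \<bar>\<gamma> x \<bullet> b x\<bar>" by (simp add: abs_mult)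
   then show "norm (indicator K x * \<bar>\<gamma> x \<bullet> b x\<bar>)
     \<le> norm (e * (indicator K x * (norm (b x))\<^sup>2) + (1 / e) * ?g x)"
    using order_trans[OF pt[of x] abs_ge_self] by (simp only: real_norm_def)
  qed
 qed measurable
 have "(LBINT x. indicator K x * \<bar>\<gamma> x \<bullet> b x\<bar>) \<le> (LBINT x. e * (indicator K x * (norm (b x))\<^sup>2) + (1 / e) * ?g x)"
  by (rule integral_mono[OF i ii pt])
 also have "\<dots> = e * (LBINT x. indicator K x * (norm (b x))\<^sup>2) + (1 / e) * (LBINT x. ?g x)"
  using g b_L2[OF K] by simp
 also have "\<dots> \<le> e * (LBINT x. indicator K x * (norm (b x))\<^sup>2) + (1 / e) * e\<^sup>2"
  using gi e by (intro add_left_mono mult_left_mono) auto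
 also have "\<dots> = e * ((LBINT x. indicator K x * (norm (b x))\<^sup>2) + 1)"
  using e by (simp add: power2_eq_square algebra_simps)
 finally show "(LBINT x. indicator K x * \<bar>\<gamma> x \<bullet> b x\<bar>) \<le> e * ((LBINT x. indicator K x * (norm (b x))\<^sup>2) + 1)" .
qed

text \<open>Since \<open>b\<close> is orthogonal to the gradient of \<open>H\<close>, the value of \<open>H\<close> can be used as a passive
 extra variable of the test functions.\<close>

lemma transp_H:
 fixes \<Phi> :: "real \<times> (real^2) \<times> real \<Rightarrow> real"
 assumes w: "transp M b w" and M: "M \<subseteq> V" and [measurable]: "w \<in> Borel"
  and C: "\<And>p. \<bar>w p\<bar> \<le> C" and \<Phi>: "C1 \<Phi> \<Gamma>" and K: "compact K" "K \<subseteq> UNIV \<times> M"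
  and supp: "\<And>t x h. (t, x) \<notin> K \<Longrightarrow> \<Phi> (t, x, h) = 0"
 shows "(LBINT p. w p * (\<Gamma> (fst p, snd p, H (snd p)) \<bullet> (1, indicator {0..} (fst p) *\<^sub>R b (snd p), 0))) = 0"
proof -
 have KV: "K \<subseteq> UNIV \<times> V" using K M by auto
 have C0: "C \<ge> 0" using C[of 0] by linarith
 define L where "L = snd ` K"
 have cL: "compact L" unfolding L_def
  by (rule compact_snd_image[OF K(1)])
 have LV: "L \<subseteq> V" using KV by (auto simp: L_def)
 have [measurable]: "L \<in> sets borel" "K \<in> sets borel" using cL K borel_compact by blast+
 obtain T where T: "fst ` K \<subseteq> cball 0 T"
  using compact_subset_cball[OF compact_fst_image[OF K(1)]] by blast
 \<comment> \<open>The rate is squared to fit \<open>rot_b_approx_null\<close>: with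
   \<open>e = 1 / (n + 1)\<close> that lemma leaves an error of order \<open>e\<close>.\<close>
 define P where "P n H' \<gamma> \<longleftrightarrow> C1 H' \<gamma> \<and> (\<forall>x\<in>L. \<bar>H' x - H x\<bar> \<le> (1 / (real n + 1))\<^sup>2) \<and>
  (\<integral>\<^sup>+x. indicator L x * ennreal ((norm (\<gamma> x - rot (b x)))\<^sup>2) \<partial>lborel) \<le> ennreal ((1 / (real n + 1))\<^sup>2)" for n H' \<gamma>
 have "\<exists>H' \<gamma>. P n H' \<gamma>" for n
 proof -
  have pos: "(1 / (real n + 1))\<^sup>2 > 0" by (simp add: add_nonneg_pos)
  show ?thesis unfolding P_def by (rule H_approx[OF cL LV pos]) blast
 qed
 then obtain Hn \<gamma> where "\<And>n. P n (Hn n) (\<gamma> n)" by metis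
 then have Hn: "\<And>n. C1 (Hn n) (\<gamma> n)" "\<And>n x. x \<in> L \<Longrightarrow> \<bar>Hn n x - H x\<bar> \<le> (1 / (real n + 1))\<^sup>2"
  "\<And>n. (\<integral>\<^sup>+x. indicator L x * ennreal ((norm (\<gamma> n x - rot (b x)))\<^sup>2) \<partial>lborel) \<le> ennreal ((1 / (real n + 1))\<^sup>2)"
  unfolding P_def by blast+
 have [measurable]: "Hn n \<in> Borel" "\<gamma> n \<in> Borel" for n
  using Hn(1) C1_borel C1_grad_borel by blast+
 have \<Gamma>c: "continuous_on UNIV \<Gamma>" using C1_grad_continuous[OF \<Phi>] .
 have [measurable]: "\<Gamma> \<in> Borel" using C1_grad_borel[OF \<Phi>] .
 have supp\<Gamma>: "\<Gamma> (t, x, h) = 0" if "(t, x) \<notin> K" for t x h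
 proof (rule C1_zero_on_open[OF \<Phi>, of "(\<lambda>(t, x, h). (t, x)) -` (- K)"])
  show "open ((\<lambda>(t, x, h). (t, x)) -` (- K) :: (real \<times> (real^2) \<times> real) set)"
   using K compact_imp_closed by (intro open_vimage) (auto simp: split_beta' intro!: continuous_intros)
 qed (use that supp in auto)
 have "continuous_on L H" using H_cont LV continuous_on_subset by blast
 then have "bounded (H ` L)" using cL compact_continuous_image compact_imp_bounded by blast
 then obtain B where B: "\<And>x. x \<in> L \<Longrightarrow> \<bar>H x\<bar> \<le> B" unfolding bounded_iff by auto
 have one: "(1 / (real n + 1))\<^sup>2 \<le> 1" for n
  by (rule power_le_one) auto
 have HB: "\<bar>Hn n x\<bar> \<le> B + 1" if "x \<in> L" for n x
  using Hn(2)[OF that, of n] B[OF that] one[of n] by linarith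
 \<comment> \<open>A compact set containing \<open>(t, x, Hn n x)\<close> for every \<open>n\<close>
   and every \<open>(t, x)\<close> in \<open>K\<close>, so that \<open>\<Gamma>\<close> has one
   bound for all \<open>n\<close>.\<close>
 define S where "S = (\<lambda>(p, h). (fst p, snd p, h)) ` (K \<times> cball (0::real) (B + 1))"
 have "compact S" unfolding S_def
  by (intro compact_continuous_image compact_Times K compact_cball) (auto simp: split_beta' intro!: continuous_intros)
 then have "bounded (\<Gamma> ` S)"
  by (intro compact_imp_bounded compact_continuous_image continuous_on_subset[OF \<Gamma>c]) auto
 then obtain A where A0: "A > 0" and A': "\<And>z. z \<in> S \<Longrightarrow> norm (\<Gamma> z) \<le> A"
  unfolding bounded_pos by auto
 have A: "norm (\<Gamma> (t, x, h)) \<le> A" if "(t, x) \<in> K" "\<bar>h\<bar> \<le> B + 1" for t x h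
  by (rule A') (use that in \<open>auto simp: S_def intro!: image_eqI[of _ _ "((t, x), h)"]\<close>)
 let ?c = "\<lambda>p::real \<times> (real^2). (1, indicator {0..} (fst p) *\<^sub>R b (snd p), 0) :: real \<times> (real^2) \<times> real"
 have cn: "norm (?c p) \<le> 1 + norm (b (snd p))" for p
  using norm_Pair_le[of "1::real" "(indicator {0..} (fst p) *\<^sub>R b (snd p), 0::real)"]
  by (auto simp: norm_Pair indicator_def split: if_splits)
 have [measurable]: "?c \<in> Borel" by measurable
 let ?D = "\<lambda>n p v. \<Gamma> (fst p, snd p, Hn n (snd p)) \<bullet> (fst v, snd v, \<gamma> n (snd p) \<bullet> snd v)"
 have eqn: "(LBINT p. w p * ?D n p (cfield b p)) = 0" for n
 proof -
  have D: "((\<lambda>p. \<Phi> (fst p, snd p, Hn n (snd p))) has_derivative ?D n p) (at p)" for p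
  proof (rule has_derivative_compose[OF _ C1_D[OF \<Phi>]])
   have "((\<lambda>p. Hn n (snd p)) has_derivative (\<lambda>v. \<gamma> n (snd p) \<bullet> snd v)) (at p)"
    by (rule has_derivative_compose[OF _ C1_D[OF Hn(1)]]) (auto intro!: derivative_eq_intros)
   then show "((\<lambda>p. (fst p, snd p, Hn n (snd p))) has_derivative (\<lambda>v. (fst v, snd v, \<gamma> n (snd p) \<bullet> snd v))) (at p)"
    by (auto intro!: derivative_eq_intros)
  qed
  have Hc: "continuous_on UNIV (Hn n)" "continuous_on UNIV (\<gamma> n)"
   using Hn(1) C1_continuous C1_grad_continuous by blast+
  have cont: "continuous_on UNIV (\<lambda>p. ?D n p e)" for e
   by (intro continuous_intros continuous_on_compose2[OF \<Gamma>c] continuous_on_compose2[OF Hc(1)] continuous_on_compose2[OF Hc(2)]) auto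
  have "(LBINT p. (w p *\<^sub>R cfield b p) \<bullet> (\<Sum>e\<in>Basis. ?D n p e *\<^sub>R e)) = 0"
   by (rule divfreeD[OF w[unfolded transp_def] C1I(1)[OF D cont] K]) (auto intro: supp)
  moreover have "(w p *\<^sub>R cfield b p) \<bullet> (\<Sum>e\<in>Basis. ?D n p e *\<^sub>R e) = w p * ?D n p (cfield b p)" for p
   using C1I(2)[OF D cont, of p "cfield b p"] by (simp add: inner_commute)
  ultimately show ?thesis by (simp only:)
 qed
 \<comment> \<open>The chain rule splits the tested equation: in \<open>?A\<close> the extra
   variable is frozen, while \<open>?B\<close> contains the derivative of \<open>Hn n\<close> along
   \<open>b\<close> and tends to 0.\<close>
 let ?A = "\<lambda>n p. w p * (\<Gamma> (fst p, snd p, Hn n (snd p)) \<bullet> ?c p)"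
 let ?B = "\<lambda>n p. w p * (\<Gamma> (fst p, snd p, Hn n (snd p)) \<bullet> (0, 0, \<gamma> n (snd p) \<bullet> (indicator {0..} (fst p) *\<^sub>R b (snd p))))"
 let ?dom = "\<lambda>p. indicator K p * (C * A * (1 + norm (b (snd p))))"
 have domm: "?dom \<in> Borel" by measurable
 have dom: "L1 ?dom"
  by (rule integrable_cfield[OF K(1) KV domm, of "C * A"]) (use C0 A0 in auto)
 have pt: "\<bar>w p * (\<Gamma> (fst p, snd p, h) \<bullet> ?c p)\<bar> \<le> ?dom p" if "snd p \<in> L \<Longrightarrow> \<bar>h\<bar> \<le> B + 1" for p h
 proof (cases "p \<in> K")
  case True
  then have "norm (\<Gamma> (fst p, snd p, h)) \<le> A" using that A[of "fst p" "snd p" h] by (auto simp: L_def)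
  then have "\<bar>\<Gamma> (fst p, snd p, h) \<bullet> ?c p\<bar> \<le> A * (1 + norm (b (snd p)))"
   by (intro order_trans[OF Cauchy_Schwarz_ineq2 mult_mono]) (use cn A0 in auto)
  then have "\<bar>w p\<bar> * \<bar>\<Gamma> (fst p, snd p, h) \<bullet> ?c p\<bar> \<le> C * (A * (1 + norm (b (snd p))))"
   using C C0 by (intro mult_mono) auto
  then show ?thesis using True by (simp add: abs_mult mult.assoc)
 next
  case False
  then show ?thesis using supp\<Gamma>[of "fst p" "snd p" h] by simp
 qed
 have Am [measurable]: "?A n \<in> Borel" "?B n \<in> Borel" for n
  by measurable
 have iA: "L1 (?A n)" for n
  by (rule Bochner_Integration.integrable_bound[OF dom])
   (use pt HB in \<open>auto intro!: AE_I2 order_trans[OF _ abs_ge_self]\<close>)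
 have limA: "(\<lambda>n. (LBINT p. ?A n p)) \<longlonglongrightarrow> (LBINT p. w p * (\<Gamma> (fst p, snd p, H (snd p)) \<bullet> ?c p))"
 proof (rule integral_dominated_convergence[OF _ _ dom])
  show "AE p in lborel. (\<lambda>n. ?A n p) \<longlonglongrightarrow> w p * (\<Gamma> (fst p, snd p, H (snd p)) \<bullet> ?c p)"
  proof (rule AE_I2)
   fix p :: "real \<times> (real^2)"
   show "(\<lambda>n. ?A n p) \<longlonglongrightarrow> w p * (\<Gamma> (fst p, snd p, H (snd p)) \<bullet> ?c p)"
   proof (cases "p \<in> K")
    case True
    then have sL: "snd p \<in> L" by (auto simp: L_def)
    have "(\<lambda>n. Hn n (snd p)) \<longlonglongrightarrow> H (snd p)"
    proof (rule LIM_zero_cancel, rule tendsto_rabs_zero_cancel, rule tendsto_sandwich[of "\<lambda>_. 0" _ _ "\<lambda>n. (1 / (real n + 1))\<^sup>2"])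
     show "(\<lambda>n. (1 / (real n + 1))\<^sup>2) \<longlonglongrightarrow> 0"
      using tendsto_power[OF LIMSEQ_inverse_real_of_nat, of 2] by (simp add: inverse_eq_divide add.commute)
    qed (use Hn(2)[OF sL] in auto)
    moreover have "isCont \<Gamma> (fst p, snd p, H (snd p))" using \<Gamma>c continuous_on_eq_continuous_at by blast
    ultimately have "(\<lambda>n. \<Gamma> (fst p, snd p, Hn n (snd p))) \<longlonglongrightarrow> \<Gamma> (fst p, snd p, H (snd p))"
     by (intro isCont_tendsto_compose[where g=\<Gamma>] tendsto_intros)
    then show ?thesis by (intro tendsto_intros)
   next
    case False
    then show ?thesis using supp\<Gamma>[of "fst p" "snd p"] by simp
   qed
  qed
  show "AE p in lborel. norm (?A n p) \<le> ?dom p" for n using pt HB by (intro AE_I2) auto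
  show "(\<lambda>p. w p * (\<Gamma> (fst p, snd p, H (snd p)) \<bullet> ?c p)) \<in> borel_measurable lborel"
   by measurable
 qed simp
 define S2 where "S2 = (LBINT x. indicator L x * (norm (b x))\<^sup>2) + 1"
 have Bb: "L1 (?B n) \<and> \<bar>(LBINT p. ?B n p)\<bar> \<le> (C * A * measure lborel (cball (0::real) T) * S2) * (1 / (real n + 1))" for n
 proof -
  let ?g = "\<lambda>x. indicator L x * \<bar>\<gamma> n x \<bullet> b x\<bar>"
  have g: "L1 ?g" "(LBINT x. ?g x) \<le> (1 / (real n + 1)) * S2"
   using rot_b_approx_null[OF cL LV _ _ Hn(3), of n] unfolding S2_def by auto
  have i: "L1 (\<lambda>p. indicator (cball (0::real) T) (fst p) * (C * A * ?g (snd p)))"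
   by (rule integrable_tensor[OF integrable_indicator_compact]) (use g in auto)
  have ptB: "norm (?B n p) \<le> indicator (cball (0::real) T) (fst p) * (C * A * ?g (snd p))" for p
  proof (cases "p \<in> K")
   case True
   then have m: "fst p \<in> cball 0 T" "snd p \<in> L" using T by (auto simp: L_def)
   have "norm (\<Gamma> (fst p, snd p, Hn n (snd p))) \<le> A" using True HB[OF m(2), of n] A[of "fst p" "snd p"] by auto
   moreover have "norm (0::real, 0::real^2, \<gamma> n (snd p) \<bullet> (indicator {0..} (fst p) *\<^sub>R b (snd p))) \<le> \<bar>\<gamma> n (snd p) \<bullet> b (snd p)\<bar>"
    by (auto simp: norm_Pair indicator_def)
   ultimately have "\<bar>\<Gamma> (fst p, snd p, Hn n (snd p)) \<bullet> (0, 0, \<gamma> n (snd p) \<bullet> (indicator {0..} (fst p) *\<^sub>R b (snd p)))\<bar>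
     \<le> A * \<bar>\<gamma> n (snd p) \<bullet> b (snd p)\<bar>"
    by (intro order_trans[OF Cauchy_Schwarz_ineq2 mult_mono]) (use A0 in auto)
   then have "\<bar>w p\<bar> * \<bar>\<Gamma> (fst p, snd p, Hn n (snd p)) \<bullet> (0, 0, \<gamma> n (snd p) \<bullet> (indicator {0..} (fst p) *\<^sub>R b (snd p)))\<bar>
     \<le> C * (A * \<bar>\<gamma> n (snd p) \<bullet> b (snd p)\<bar>)"
    using C C0 by (intro mult_mono) auto
   then show ?thesis using m by (simp add: abs_mult mult.assoc)
  next
   case False
   then have "?B n p = 0" using supp\<Gamma>[of "fst p" "snd p"] by simp
   moreover have "0 \<le> indicator (cball (0::real) T) (fst p) * (C * A * ?g (snd p))" using C0 A0 by (simp add: indicator_def)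
   ultimately show ?thesis by (simp only: norm_zero)
  qed
  have iB: "L1 (?B n)"
   by (rule Bochner_Integration.integrable_bound[OF i]) (use ptB in \<open>auto intro!: AE_I2 order_trans[OF _ abs_ge_self]\<close>)
  have "norm (LBINT p. ?B n p) \<le> (LBINT p. indicator (cball (0::real) T) (fst p) * (C * A * ?g (snd p)))"
   by (intro order_trans[OF integral_norm_bound integral_mono] integrable_norm iB i ptB)
  also have "\<dots> = measure lborel (cball (0::real) T) * (C * A * (LBINT x. ?g x))"
   using g by (subst integral_tensor[OF integrable_indicator_compact]) auto
  also have "\<dots> \<le> measure lborel (cball (0::real) T) * (C * A * ((1 / (real n + 1)) * S2))"
   using g C0 A0 by (intro mult_left_mono) auto
  finally show ?thesis using iB by (simp add: mult_ac)
 qed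
 have "(\<lambda>n. (LBINT p. ?B n p)) \<longlonglongrightarrow> 0"
 proof (rule tendsto_rabs_zero_cancel, rule tendsto_sandwich[of "\<lambda>_. 0"])
  show "(\<lambda>n. (C * A * measure lborel (cball (0::real) T) * S2) * (1 / (real n + 1))) \<longlonglongrightarrow> 0"
   using tendsto_mult[OF tendsto_const LIMSEQ_inverse_real_of_nat] by (simp add: inverse_eq_divide add.commute)
 qed (use Bb in auto)
 moreover have "(LBINT p. ?A n p) = - (LBINT p. ?B n p)" for n
 proof -
  have "w p * ?D n p (cfield b p) = ?A n p + ?B n p" for p
   unfolding distrib_left[symmetric] inner_add_right[symmetric] by (simp add: cfield_def)
  then have "(LBINT p. ?A n p + ?B n p) = 0" using eqn[of n] by simp
  then show ?thesis using iA[of n] Bb[of n] by simp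
 qed
 ultimately have "(\<lambda>n. (LBINT p. ?A n p)) \<longlonglongrightarrow> 0" using tendsto_minus by fastforce
 then show ?thesis using LIMSEQ_unique[OF limA] by simp
qed

end

section \<open>Straightening the level sets of the Hamiltonian\<close>

lemma vec2_continuous: "continuous_on UNIV (\<lambda>q::real \<times> real. vector [fst q, snd q] :: real^2)"
proof -
 have "(\<lambda>q::real \<times> real. vector [fst q, snd q] :: real^2) = (\<lambda>q. fst q *\<^sub>R axis 1 1 + snd q *\<^sub>R axis 2 1)"
  by (auto simp: fun_eq_iff vec_eq_iff forall_2 axis_def)
 then show ?thesis by (simp only:) (intro continuous_intros)
qed

lemma lborel_vec2: "distr lborel borel (\<lambda>q. vector [fst q, snd q] :: real^2) = lborel"
proof -
 have [measurable]: "(\<lambda>q::real \<times> real. vector [fst q, snd q] :: real^2) \<in> Borel"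
  by (rule borel_measurable_continuous_onI[OF vec2_continuous])
 have "lborel = distr lborel borel (\<lambda>q. vector [fst q, snd q] :: real^2)"
 proof (rule lborel_eqI)
  fix l u :: "real^2" assume le: "\<And>b. b \<in> Basis \<Longrightarrow> l \<bullet> b \<le> u \<bullet> b"
  have "l \<bullet> axis i 1 \<le> u \<bullet> axis i 1" for i by (rule le) auto
  then have le': "l $ i \<le> u $ i" for i by (simp add: inner_axis)
  have "(\<lambda>q. vector [fst q, snd q] :: real^2) -` box l u = {l$1<..<u$1} \<times> {l$2<..<u$2}"
   by (auto simp: mem_box_cart forall_2)
  then have "emeasure (distr lborel borel (\<lambda>q. vector [fst q, snd q] :: real^2)) (box l u)
    = emeasure (lborel \<Otimes>\<^sub>M lborel) ({l$1<..<u$1} \<times> {l$2<..<u$2})"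
   by (subst emeasure_distr) (auto simp: lborel_prod)
  also have "\<dots> = ennreal ((u$1 - l$1) * (u$2 - l$2))"
   using le' by (subst lborel.emeasure_pair_measure_Times) (auto simp: ennreal_mult)
  also have "(u$1 - l$1) * (u$2 - l$2) = (\<Prod>b\<in>Basis. (u - l) \<bullet> b)"
  proof -
   have B: "(Basis :: (real^2) set) = {axis 1 1, axis 2 1}"
    by (auto simp: Basis_vec_def UNIV_2)
   have "axis 1 (1::real) \<noteq> (axis 2 1 :: real^2)" by (simp add: axis_eq_axis)
   then show ?thesis unfolding B by (simp add: inner_axis)
  qed
  finally show "emeasure (distr lborel borel (\<lambda>q. vector [fst q, snd q] :: real^2)) (box l u) = (\<Prod>b\<in>Basis. (u - l) \<bullet> b)" .
 qed simp
 then show ?thesis ..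
qed

lemma lborel_orthogonal:
 fixes f :: "real^'n::{finite,wellorder} \<Rightarrow> real^'n::_"
 assumes f: "orthogonal_transformation f"
 shows "distr lborel borel f = lborel"
proof -
 have [measurable]: "f \<in> Borel"
  using f orthogonal_transformation_linear linear_continuous_on linear_conv_bounded_linear borel_measurable_continuous_onI by blast
 have "lborel = distr lborel borel f"
 proof (rule lborel_eqI)
  fix l u :: "real^'n::_" assume le: "\<And>b. b \<in> Basis \<Longrightarrow> l \<bullet> b \<le> u \<bullet> b"
  have g: "orthogonal_transformation (inv f)" by (rule orthogonal_transformation_inv[OF f])
  have eq: "f -` box l u = inv f ` box l u"
   using orthogonal_transformation_bij[OF f] by (rule bij_vimage_eq_inv_image)
  have m: "f -` box l u \<in> sets borel" using measurable_sets[of f borel borel "box l u"] by simp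
  have lm: "box l u \<in> lmeasurable" by (rule lmeasurable_box)
  have "emeasure (distr lborel borel f) (box l u) = emeasure lborel (f -` box l u)"
   by (subst emeasure_distr) auto
  also have "\<dots> = emeasure lebesgue (inv f ` box l u)"
   using m by (simp add: eq[symmetric])
  also have "\<dots> = ennreal (measure lebesgue (inv f ` box l u))"
   by (rule emeasure_eq_ennreal_measure)
    (use fmeasurableD2[OF measurable_orthogonal_image[OF g lm]] in auto)
  also have "\<dots> = ennreal (measure lebesgue (box l u))"
   by (simp add: measure_orthogonal_image[OF g lm])
  also have "\<dots> = emeasure lebesgue (box l u)"
   by (rule emeasure_eq_ennreal_measure[symmetric]) (use fmeasurableD2[OF lm] in auto)
  also have "\<dots> = (\<Prod>b\<in>Basis. (u - l) \<bullet> b)"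
   using emeasure_lborel_box[OF le] by simp
  finally show "emeasure (distr lborel borel f) (box l u) = (\<Prod>b\<in>Basis. (u - l) \<bullet> b)" .
 qed simp
 then show ?thesis ..
qed

lemma rot_inner: "rot v \<bullet> rot w = v \<bullet> w"
 by (simp add: rot_def inner_vec_def sum_2)

text \<open>The frame \<open>(e, rot e)\<close> is orthonormal, so passing to its coordinates
  preserves Lebesgue measure; Tonelli then slices along the direction \<open>rot e\<close>.\<close>

lemma nn_integral_coords:
 fixes F :: "real^2 \<Rightarrow> ennreal"
 assumes e: "norm e = 1" and [measurable]: "F \<in> Borel"
 shows "(\<integral>\<^sup>+z. F z \<partial>lborel) = (\<integral>\<^sup>+s. \<integral>\<^sup>+t. F (p + s *\<^sub>R e + t *\<^sub>R rot e) \<partial>lborel \<partial>lborel)"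
proof -
 let ?f = "\<lambda>v::real^2. v$1 *\<^sub>R e + v$2 *\<^sub>R rot e"
 let ?g = "\<lambda>q. vector [fst q, snd q] :: real^2"
 have ee: "e \<bullet> e = 1" using e by (simp add: norm_eq_1)
 have "orthogonal_transformation ?f"
  unfolding orthogonal_transformation_def
 proof (intro conjI allI)
  show "linear ?f" by (rule linearI) (simp_all add: algebra_simps)
  show "?f v \<bullet> ?f w = v \<bullet> w" for v w
   by (simp add: inner_add_left inner_add_right rot_orthogonal rot_inner ee inner_commute[of e "rot e"])
    (simp add: inner_vec_def sum_2)
 qed
 from lborel_orthogonal[OF this] have f: "distr lborel borel ?f = lborel" .
 have [measurable]: "?f \<in> Borel"
  by (intro borel_measurable_continuous_onI continuous_intros)
 have [measurable]: "?g \<in> Borel"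
  by (rule borel_measurable_continuous_onI[OF vec2_continuous])
 have "(\<integral>\<^sup>+z. F z \<partial>lborel) = (\<integral>\<^sup>+z. F (z + p) \<partial>lborel)"
  by (rule nn_integral_translate_lborel[symmetric]) simp
 also have "\<dots> = (\<integral>\<^sup>+z. F (z + p) \<partial>distr lborel borel ?f)" by (simp only: f)
 also have "\<dots> = (\<integral>\<^sup>+v. F (?f v + p) \<partial>lborel)" by (rule nn_integral_distr) measurable
 also have "\<dots> = (\<integral>\<^sup>+v. F (?f v + p) \<partial>distr lborel borel ?g)" by (simp only: lborel_vec2)
 also have "\<dots> = (\<integral>\<^sup>+q. F (?f (?g q) + p) \<partial>lborel)" by (rule nn_integral_distr) measurable
 also have "\<dots> = (\<integral>\<^sup>+q. F (p + fst q *\<^sub>R e + snd q *\<^sub>R rot e) \<partial>(lborel \<Otimes>\<^sub>M lborel))"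
  by (simp add: lborel_prod add.commute add.left_commute)
 also have "\<dots> = (\<integral>\<^sup>+s. \<integral>\<^sup>+t. F (p + fst (s, t) *\<^sub>R e + snd (s, t) *\<^sub>R rot e) \<partial>lborel \<partial>lborel)"
  by (rule lborel.nn_integral_fst[symmetric]) measurable
 finally show ?thesis by simp
qed

lemma null_open_interval_empty:
 fixes S :: "real set"
 assumes "open S" "AE s in lborel. s \<notin> S"
 shows "S = {}"
proof (rule ccontr)
 assume "S \<noteq> {}"
 have "S \<in> null_sets lborel" using assms AE_iff_null_sets[of S lborel] by auto
 then have "negligible S" unfolding negligible_iff_null_sets by (rule null_sets_completionI)
 then show False using open_not_negligible[OF assms(1) \<open>S \<noteq> {}\<close>] by simp
qed

text \<open>The radius is \<open>2 * r\<close> so that the square of points with both coordinates at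
  most \<open>r\<close> in absolute value, in the frame \<open>(e, rot e)\<close> at
  \<open>p\<close>, lies in the ball.\<close>

locale directed_field = ham_field +
 fixes p e :: "real^2" and \<alpha> r :: real
 assumes e: "norm e = 1" and \<alpha>: "\<alpha> > 0" and r: "r > 0" and ball: "cball p (2 * r) \<subseteq> V"
  and dir: "AE z in lborel. z \<in> cball p (2 * r) \<longrightarrow> \<alpha> \<le> b z \<bullet> e"
begin

definition zz :: "real \<Rightarrow> real \<Rightarrow> real^2" where "zz s t = p + s *\<^sub>R e + t *\<^sub>R rot e"

abbreviation "k z \<equiv> b z \<bullet> e"

lemma ee: "e \<bullet> e = 1" "rot e \<bullet> rot e = 1" "e \<bullet> rot e = 0" "rot e \<bullet> e = 0"
 using e by (simp_all add: norm_eq_1 rot_inner rot_orthogonal inner_commute[of e "rot e"])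

lemma zz_continuous: "continuous_on UNIV (\<lambda>q. zz (fst q) (snd q))"
 unfolding zz_def by (intro continuous_intros)

lemma zz_measurable [measurable]:
 assumes [measurable]: "f \<in> borel_measurable M" "g \<in> borel_measurable M"
 shows "(\<lambda>x. zz (f x) (g x)) \<in> borel_measurable M"
 unfolding zz_def by measurable

lemma zz_inner: "zz s t \<bullet> e = p \<bullet> e + s" "(zz s t - p) \<bullet> e = s" "(zz s t - p) \<bullet> rot e = t"
 by (simp_all add: zz_def inner_add_left ee)

lemma zz_in_cball: "\<bar>s\<bar> \<le> r \<Longrightarrow> \<bar>t\<bar> \<le> r \<Longrightarrow> zz s t \<in> cball p (2 * r)"
 using norm_triangle_ineq[of "s *\<^sub>R e" "t *\<^sub>R rot e"] e
 by (subst mem_cball, subst dist_commute) (simp add: zz_def dist_norm add.assoc)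

lemma zz_surj: "z = zz ((z - p) \<bullet> e) ((z - p) \<bullet> rot e)"
proof -
 have 1: "e $ 1 * e $ 1 + e $ 2 * e $ 2 = 1" using ee(1) by (simp add: inner_vec_def sum_2)
 have "(z - p) = ((z - p) \<bullet> e) *\<^sub>R e + ((z - p) \<bullet> rot e) *\<^sub>R rot e"
 proof -
  define w where "w = z - p"
  have "w $ 1 = (w $ 1 * e $ 1 + w $ 2 * e $ 2) * e $ 1 + (w $ 1 * e $ 2 - w $ 2 * e $ 1) * e $ 2"
   using 1 by algebra
  moreover have "w $ 2 = (w $ 1 * e $ 1 + w $ 2 * e $ 2) * e $ 2 - (w $ 1 * e $ 2 - w $ 2 * e $ 1) * e $ 1"
   using 1 by algebra
  ultimately have "w = (w \<bullet> e) *\<^sub>R e + (w \<bullet> rot e) *\<^sub>R rot e"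
   by (simp add: vec_eq_iff forall_2 inner_vec_def sum_2 rot_def)
  then show ?thesis by (simp add: w_def)
 qed
 then show ?thesis unfolding zz_def by (metis add.assoc add.commute diff_add_cancel)
qed

lemma zz_surj_cball_norm: "\<bar>(z - p) \<bullet> e\<bar> \<le> r \<Longrightarrow> \<bar>(z - p) \<bullet> rot e\<bar> \<le> r \<Longrightarrow> z \<in> cball p (2 * r)"
 using zz_in_cball[of "(z - p) \<bullet> e" "(z - p) \<bullet> rot e"] zz_surj[of z] by simp

text \<open>Lines transverse to the field on which \<open>H\<close> is a primitive of
  \<open>k\<close>. This is the right derivative because \<open>rot\<close> is an isometry: the
  gradient of \<open>H\<close> along \<open>rot e\<close> is
  \<open>rot b \<bullet> rot e = b \<bullet> e\<close>.\<close>

definition good_line :: "real \<Rightarrow> bool" where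
 "good_line s \<longleftrightarrow>
   L1 (\<lambda>t. indicator {-r..r} t * k (zz s t)) \<and>
   (AE t in lborel. t \<in> {-r..r} \<longrightarrow> \<alpha> \<le> k (zz s t)) \<and>
   (\<forall>t1 t2. - r \<le> t1 \<longrightarrow> t1 \<le> t2 \<longrightarrow> t2 \<le> r \<longrightarrow>
    H (zz s t2) - H (zz s t1) = (LBINT t. indicator {t1..t2} t * k (zz s t)))"

text \<open>Absolute continuity of a Sobolev function on almost every line. The mollified
  Hamiltonians satisfy the fundamental theorem of calculus on every line, and Tonelli, applied to
  the sum of all their gradient errors, shows that on almost every line the errors tend to 0 in the
  mean.\<close>

lemma AE_good_line:
 "AE s in lborel. \<bar>s\<bar> \<le> r \<longrightarrow> good_line s"
proof -
 let ?B = "cball p (2 * r)"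
 have [measurable]: "?B \<in> sets borel" by simp
 have slices: "(\<integral>\<^sup>+z. F z \<partial>lborel) = (\<integral>\<^sup>+s. \<integral>\<^sup>+t. F (zz s t) \<partial>lborel \<partial>lborel)"
  if "F \<in> Borel" for F :: "real^2 \<Rightarrow> ennreal"
  unfolding zz_def by (rule nn_integral_coords[OF e that])
 have mm: "(\<lambda>s. \<integral>\<^sup>+t. F (zz s t) \<partial>lborel) \<in> borel_measurable lborel"
  if [measurable]: "F \<in> Borel" for F :: "real^2 \<Rightarrow> ennreal"
  by (rule lborel.borel_measurable_nn_integral) measurable
 let ?F1 = "\<lambda>z. ennreal (indicator ?B z * norm (b z))"
 have "(\<integral>\<^sup>+z. ?F1 z \<partial>lborel) < \<infinity>"
  using b_L1[OF compact_cball ball] by (simp add: integrable_iff_bounded abs_mult)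
 then have "(\<integral>\<^sup>+s. \<integral>\<^sup>+t. ?F1 (zz s t) \<partial>lborel \<partial>lborel) \<noteq> \<infinity>"
  by (subst (asm) slices) auto
 then have A1: "AE s in lborel. (\<integral>\<^sup>+t. ?F1 (zz s t) \<partial>lborel) \<noteq> \<infinity>"
  by (intro nn_integral_PInf_AE mm) auto
 define Bad where "Bad = {z \<in> ?B. b z \<bullet> e < \<alpha>}"
 have [measurable]: "Bad \<in> sets borel" unfolding Bad_def by measurable
 have "AE z in lborel. z \<notin> Bad" using dir by eventually_elim (auto simp: Bad_def)
 then have "(\<integral>\<^sup>+z. indicator Bad z \<partial>lborel) = 0"
  by (subst nn_integral_0_iff_AE) (auto elim!: eventually_mono simp: indicator_def)
 then have "(\<integral>\<^sup>+s. \<integral>\<^sup>+t. indicator Bad (zz s t) \<partial>lborel \<partial>lborel) = 0"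
  by (subst (asm) slices) auto
 then have A2: "AE s in lborel. (\<integral>\<^sup>+t. indicator Bad (zz s t) \<partial>lborel) = 0"
  by (subst (asm) nn_integral_0_iff_AE) (auto intro: mm)
 \<comment> \<open>The geometric rate makes the errors summable, so that they tend to 0 on almost every line.\<close>
 define \<eta> where "\<eta> n = (1/2::real) ^ n" for n
 have \<eta>: "\<eta> n > 0" for n by (simp add: \<eta>_def)
 define P where "P n H' \<gamma> \<longleftrightarrow> C1 H' \<gamma> \<and> (\<forall>x\<in>?B. \<bar>H' x - H x\<bar> \<le> (\<eta> n)\<^sup>2) \<and>
  (\<integral>\<^sup>+x. indicator ?B x * ennreal ((norm (\<gamma> x - rot (b x)))\<^sup>2) \<partial>lborel) \<le> ennreal ((\<eta> n)\<^sup>2)" for n H' \<gamma>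
 have "\<exists>H' \<gamma>. P n H' \<gamma>" for n
  unfolding P_def by (rule H_approx[OF compact_cball ball, of "(\<eta> n)\<^sup>2"]) (use \<eta>[of n] in simp, blast)
 then obtain Hn \<gamma> where "\<And>n. P n (Hn n) (\<gamma> n)" by metis
 then have Hn: "\<And>n. C1 (Hn n) (\<gamma> n)" "\<And>n x. x \<in> ?B \<Longrightarrow> \<bar>Hn n x - H x\<bar> \<le> (\<eta> n)\<^sup>2"
  "\<And>n. (\<integral>\<^sup>+x. indicator ?B x * ennreal ((norm (\<gamma> n x - rot (b x)))\<^sup>2) \<partial>lborel) \<le> ennreal ((\<eta> n)\<^sup>2)"
  unfolding P_def by blast+
 have [measurable]: "\<gamma> n \<in> Borel" for n using Hn(1) C1_grad_borel by blast
 define F where "F n z = ennreal (indicator ?B z * \<bar>\<gamma> n z \<bullet> rot e - k z\<bar>)" for n z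
 have [measurable]: "F n \<in> Borel" for n unfolding F_def by measurable
 define m where "m = measure lborel ?B"
 have emB: "emeasure lborel ?B = ennreal m"
  unfolding m_def by (rule emeasure_eq_ennreal_measure) (use emeasure_lborel_cball_finite[of p "2*r"] in auto)
 have m0: "m \<ge> 0" by (simp add: m_def)
 \<comment> \<open>The bound \<open>a \<le> \<eta> + a^2 / \<eta>\<close> turns a mean square error
   of order \<open>\<eta>^2\<close> into a mean error of order \<open>\<eta>\<close>; the constant
   \<open>m\<close> is the area of the ball.\<close>
 have Fb: "(\<integral>\<^sup>+z. F n z \<partial>lborel) \<le> ennreal ((m + 1) * \<eta> n)" for n
 proof -
  have pt: "F n z \<le> ennreal (\<eta> n) * indicator ?B z + ennreal (1 / \<eta> n) * (indicator ?B z * ennreal ((norm (\<gamma> n z - rot (b z)))\<^sup>2))" for z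
  proof (cases "z \<in> ?B")
   case True
   let ?a = "norm (\<gamma> n z - rot (b z))"
   have "\<bar>\<gamma> n z \<bullet> rot e - k z\<bar> = \<bar>(\<gamma> n z - rot (b z)) \<bullet> rot e\<bar>" by (simp add: inner_diff_left rot_inner)
   also have "\<dots> \<le> ?a * norm (rot e)" by (rule Cauchy_Schwarz_ineq2)
   also have "\<dots> = ?a" using e by simp
   also have "\<dots> \<le> \<eta> n + (1 / \<eta> n) * ?a\<^sup>2"
   proof -
    have "0 \<le> (\<eta> n - ?a)\<^sup>2 + \<eta> n * ?a" using \<eta>[of n] by simp
    then have "\<eta> n * ?a \<le> \<eta> n * \<eta> n + ?a\<^sup>2" by (simp add: power2_eq_square algebra_simps)
    also have "\<dots> = \<eta> n * (\<eta> n + (1 / \<eta> n) * ?a\<^sup>2)" using \<eta>[of n] by (simp add: distrib_left)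
    finally show ?thesis using \<eta>[of n] by simp
   qed
   finally have "ennreal \<bar>\<gamma> n z \<bullet> rot e - k z\<bar> \<le> ennreal (\<eta> n + (1 / \<eta> n) * ?a\<^sup>2)" by (rule ennreal_leI)
   also have "\<dots> = ennreal (\<eta> n) + ennreal (1 / \<eta> n) * ennreal (?a\<^sup>2)"
    using \<eta>[of n] by (simp add: ennreal_plus ennreal_mult[symmetric] del: ennreal_plus[symmetric])
   finally show ?thesis using True by (simp add: F_def)
  qed (simp add: F_def)
  have "(\<integral>\<^sup>+z. F n z \<partial>lborel) \<le> (\<integral>\<^sup>+z. ennreal (\<eta> n) * indicator ?B z + ennreal (1 / \<eta> n) * (indicator ?B z * ennreal ((norm (\<gamma> n z - rot (b z)))\<^sup>2)) \<partial>lborel)"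
   by (intro nn_integral_mono pt)
  also have "\<dots> = (\<integral>\<^sup>+z. ennreal (\<eta> n) * indicator ?B z \<partial>lborel) + (\<integral>\<^sup>+z. ennreal (1 / \<eta> n) * (indicator ?B z * ennreal ((norm (\<gamma> n z - rot (b z)))\<^sup>2)) \<partial>lborel)"
   by (rule nn_integral_add) measurable
  also have "\<dots> = ennreal (\<eta> n) * ennreal m + ennreal (1 / \<eta> n) * (\<integral>\<^sup>+z. indicator ?B z * ennreal ((norm (\<gamma> n z - rot (b z)))\<^sup>2) \<partial>lborel)"
   by (subst nn_integral_cmult) (simp_all add: nn_integral_cmult_indicator emB)
  also have "\<dots> \<le> ennreal (\<eta> n) * ennreal m + ennreal (1 / \<eta> n) * ennreal ((\<eta> n)\<^sup>2)"
   by (intro add_left_mono mult_left_mono Hn(3)) auto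
  also have "\<dots> = ennreal (\<eta> n * m + (1 / \<eta> n) * (\<eta> n)\<^sup>2)"
  proof -
   have "ennreal (\<eta> n) * ennreal m = ennreal (\<eta> n * m)"
    "ennreal (1 / \<eta> n) * ennreal ((\<eta> n)\<^sup>2) = ennreal (1 / \<eta> n * (\<eta> n)\<^sup>2)"
    using \<eta>[of n] m0 by (intro ennreal_mult[symmetric]; simp)+
   then show ?thesis using \<eta>[of n] m0 by (simp only:) (rule ennreal_plus[symmetric]; simp)
  qed
  also have "\<eta> n * m + (1 / \<eta> n) * (\<eta> n)\<^sup>2 = (m + 1) * \<eta> n"
   using \<eta>[of n] by (simp add: power2_eq_square algebra_simps)
  finally show ?thesis .
 qed
 have "(\<integral>\<^sup>+s. (\<Sum>n. \<integral>\<^sup>+t. F n (zz s t) \<partial>lborel) \<partial>lborel) = (\<Sum>n. \<integral>\<^sup>+s. \<integral>\<^sup>+t. F n (zz s t) \<partial>lborel \<partial>lborel)"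
  by (rule nn_integral_suminf) (rule mm, simp)
 also have "\<dots> = (\<Sum>n. \<integral>\<^sup>+z. F n z \<partial>lborel)" by (subst slices) auto
 also have "\<dots> \<le> (\<Sum>n. ennreal ((m + 1) * \<eta> n))" by (rule suminf_le[OF Fb]) auto
 also have "\<dots> = ennreal (\<Sum>n. (m + 1) * \<eta> n)"
  using m0 unfolding \<eta>_def by (intro suminf_ennreal2 summable_mult summable_geometric) auto
 finally have "(\<integral>\<^sup>+s. (\<Sum>n. \<integral>\<^sup>+t. F n (zz s t) \<partial>lborel) \<partial>lborel) \<noteq> \<infinity>"
  by (metis ennreal_neq_top infinity_ennreal_def top_unique)
 then have A3: "AE s in lborel. (\<Sum>n. \<integral>\<^sup>+t. F n (zz s t) \<partial>lborel) \<noteq> \<infinity>"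
  by (intro nn_integral_PInf_AE) (auto intro!: borel_measurable_suminf mm)
 show ?thesis
  using A1 A2 A3
 proof eventually_elim
  fix s
  assume a1: "(\<integral>\<^sup>+t. ?F1 (zz s t) \<partial>lborel) \<noteq> \<infinity>"
   and a2: "(\<integral>\<^sup>+t. indicator Bad (zz s t) \<partial>lborel) = 0"
   and a3: "(\<Sum>n. \<integral>\<^sup>+t. F n (zz s t) \<partial>lborel) \<noteq> \<infinity>"
  show "\<bar>s\<bar> \<le> r \<longrightarrow> good_line s" unfolding good_line_def
  proof (intro impI conjI allI)
   assume s: "\<bar>s\<bar> \<le> r"
   have inB: "zz s t \<in> ?B" if "t \<in> {-r..r}" for t using zz_in_cball[OF s, of t] that by auto
   show ki: "L1 (\<lambda>t. indicator {-r..r} t * k (zz s t))"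
    unfolding integrable_iff_bounded
   proof
    have "(\<integral>\<^sup>+t. ennreal (norm (indicator {-r..r} t * k (zz s t))) \<partial>lborel) \<le> (\<integral>\<^sup>+t. ?F1 (zz s t) \<partial>lborel)"
    proof (intro nn_integral_mono ennreal_leI)
     fix t
     show "norm (indicator {-r..r} t * k (zz s t)) \<le> indicator ?B (zz s t) * norm (b (zz s t))"
     proof (cases "t \<in> {-r..r}")
      case True
      then show ?thesis using inB[OF True] Cauchy_Schwarz_ineq2[of "b (zz s t)" e] e by simp
     qed simp
    qed
    also have "\<dots> < \<infinity>" using a1 by (simp add: less_top[symmetric])
    finally show "(\<integral>\<^sup>+t. ennreal (norm (indicator {-r..r} t * k (zz s t))) \<partial>lborel) < \<infinity>" .
   qed measurable
   have "AE t in lborel. indicator Bad (zz s t) = (0::ennreal)"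
    using a2 by (subst (asm) nn_integral_0_iff_AE) auto
   then show "AE t in lborel. t \<in> {-r..r} \<longrightarrow> \<alpha> \<le> k (zz s t)"
   proof eventually_elim
    fix t assume "indicator Bad (zz s t) = (0::ennreal)"
    then show "t \<in> {-r..r} \<longrightarrow> \<alpha> \<le> k (zz s t)"
     using inB[of t] by (auto simp: Bad_def indicator_def split: if_splits)
   qed
   fix t1 t2 assume t: "- r \<le> t1" "t1 \<le> t2" "t2 \<le> r"
   define c where "c n = (\<integral>\<^sup>+t. F n (zz s t) \<partial>lborel)" for n
   have cfin: "c n \<noteq> \<infinity>" for n
   proof -
    have "suminf c < top" using a3 unfolding c_def[abs_def] by (simp add: less_top[symmetric])
    then have "c n < top" by (rule ennreal_suminf_lessD)
    then show ?thesis by simp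
   qed
   then have ce: "ennreal (enn2real (c n)) = c n" for n by (simp add: ennreal_enn2real less_top)
   have "summable (\<lambda>n. enn2real (c n))"
    by (rule summable_suminf_not_top) (use a3 in \<open>auto simp: ce c_def[symmetric]\<close>)
   then have c0: "(\<lambda>n. enn2real (c n)) \<longlonglongrightarrow> 0" by (rule summable_LIMSEQ_zero)
   have sub: "L1 (\<lambda>t. indicator {t1..t2} t * k (zz s t))"
    by (rule Bochner_Integration.integrable_bound[OF ki]) (use t in \<open>auto simp: indicator_def intro!: AE_I2\<close>)
   have est: "\<bar>(H (zz s t2) - H (zz s t1)) - (LBINT t. indicator {t1..t2} t * k (zz s t))\<bar> \<le> 2 * (\<eta> n)\<^sup>2 + enn2real (c n)" for n
   proof -
    let ?g = "\<lambda>t. \<gamma> n (zz s t) \<bullet> rot e"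
    have gc: "continuous_on {t1..t2} ?g"
     unfolding zz_def by (intro continuous_intros continuous_on_compose2[OF C1_grad_continuous[OF Hn(1), of UNIV]]) auto
    have der: "((\<lambda>t. Hn n (zz s t)) has_vector_derivative ?g t) (at t within {t1..t2})" for t
    proof -
     have "((\<lambda>t. zz s t) has_derivative (\<lambda>h. h *\<^sub>R rot e)) (at t within {t1..t2})"
      unfolding zz_def by (auto intro!: derivative_eq_intros)
     from has_derivative_compose[OF this C1_D[OF Hn(1)]]
     show ?thesis by (simp add: has_vector_derivative_def)
    qed
    have ftc: "(LBINT t. indicator {t1..t2} t *\<^sub>R ?g t) = Hn n (zz s t2) - Hn n (zz s t1)"
     by (rule integral_FTC_atLeastAtMost[OF t(2) der gc])
    have gi: "L1 (\<lambda>t. indicator {t1..t2} t *\<^sub>R ?g t)"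
     using borel_integrable_compact[OF compact_Icc gc] by (simp add: indicator_def)
    have "\<bar>(LBINT t. indicator {t1..t2} t *\<^sub>R ?g t) - (LBINT t. indicator {t1..t2} t * k (zz s t))\<bar>
     = \<bar>(LBINT t. indicator {t1..t2} t * (?g t - k (zz s t)))\<bar>"
     using gi sub by (simp add: right_diff_distrib)
    also have "\<dots> \<le> (LBINT t. \<bar>indicator {t1..t2} t * (?g t - k (zz s t))\<bar>)"
     by (rule integral_abs_bound)
    also have "\<dots> = enn2real (\<integral>\<^sup>+t. ennreal \<bar>indicator {t1..t2} t * (?g t - k (zz s t))\<bar> \<partial>lborel)"
     by (rule integral_eq_nn_integral) auto
    also have "\<dots> \<le> enn2real (c n)"
    proof (rule enn2real_mono)
     show "(\<integral>\<^sup>+t. ennreal \<bar>indicator {t1..t2} t * (?g t - k (zz s t))\<bar> \<partial>lborel) \<le> c n"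
      unfolding c_def F_def
     proof (intro nn_integral_mono ennreal_leI)
      fix t
      show "\<bar>indicator {t1..t2} t * (?g t - k (zz s t))\<bar> \<le> indicator ?B (zz s t) * \<bar>?g t - k (zz s t)\<bar>"
       using inB[of t] t by (cases "t \<in> {t1..t2}") auto
     qed
     show "c n < top" using cfin[of n] by (simp add: less_top)
    qed
    finally have "\<bar>(Hn n (zz s t2) - Hn n (zz s t1)) - (LBINT t. indicator {t1..t2} t * k (zz s t))\<bar> \<le> enn2real (c n)"
     unfolding ftc .
    moreover have "\<bar>Hn n (zz s t2) - H (zz s t2)\<bar> \<le> (\<eta> n)\<^sup>2" "\<bar>Hn n (zz s t1) - H (zz s t1)\<bar> \<le> (\<eta> n)\<^sup>2"
     using t by (auto intro!: Hn(2) inB)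
    ultimately show ?thesis by linarith
   qed
   have "(\<lambda>n. 2 * (\<eta> n)\<^sup>2 + enn2real (c n)) \<longlonglongrightarrow> 2 * 0\<^sup>2 + 0"
    unfolding \<eta>_def by (intro tendsto_intros c0 LIMSEQ_realpow_zero) auto
   then have "\<bar>(H (zz s t2) - H (zz s t1)) - (LBINT t. indicator {t1..t2} t * k (zz s t))\<bar> \<le> 2 * 0\<^sup>2 + 0"
    by (rule LIMSEQ_le_const) (use est in auto)
   then show "H (zz s t2) - H (zz s t1) = (LBINT t. indicator {t1..t2} t * k (zz s t))" by simp
  qed
 qed
qed

lemma H_zz_continuous: "continuous_on ({-r..r} \<times> {-r..r}) (\<lambda>q. H (zz (fst q) (snd q)))"
 by (rule continuous_on_compose2[OF H_cont continuous_on_subset[OF zz_continuous]])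
  (use zz_in_cball ball in force)+

text \<open>On a good line integrate \<open>k \<ge> \<alpha>\<close>. For fixed \<open>t1\<close>,
  \<open>t2\<close> the parameters \<open>s\<close> violating the inequality form a null set that is
  open by continuity of \<open>H\<close>, hence empty.\<close>

lemma H_increasing:
 assumes "\<bar>s\<bar> < r" "- r \<le> t1" "t1 \<le> t2" "t2 \<le> r"
 shows "\<alpha> * (t2 - t1) \<le> H (zz s t2) - H (zz s t1)"
proof -
 have ae: "AE s in lborel. \<bar>s\<bar> \<le> r \<longrightarrow> \<alpha> * (t2 - t1) \<le> H (zz s t2) - H (zz s t1)"
  using AE_good_line
 proof eventually_elim
  fix s
  assume "\<bar>s\<bar> \<le> r \<longrightarrow> good_line s"
 note a = this[unfolded good_line_def]
  show "\<bar>s\<bar> \<le> r \<longrightarrow> \<alpha> * (t2 - t1) \<le> H (zz s t2) - H (zz s t1)"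
  proof
   assume s: "\<bar>s\<bar> \<le> r"
   have ki: "L1 (\<lambda>t. indicator {-r..r} t * k (zz s t))"
    and k\<alpha>: "AE t in lborel. t \<in> {-r..r} \<longrightarrow> \<alpha> \<le> k (zz s t)"
    and eq: "H (zz s t2) - H (zz s t1) = (LBINT t. indicator {t1..t2} t * k (zz s t))"
    using a s assms by auto
   have sub: "L1 (\<lambda>t. indicator {t1..t2} t * k (zz s t))"
    by (rule Bochner_Integration.integrable_bound[OF ki]) (use assms in \<open>auto simp: indicator_def intro!: AE_I2\<close>)
   have "\<alpha> * (t2 - t1) = (LBINT t. \<alpha> * indicator {t1..t2} t)" using assms by simp
   also have "\<dots> \<le> (LBINT t. indicator {t1..t2} t * k (zz s t))"
   proof (rule integral_mono_AE[OF _ sub])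
    show "AE t in lborel. \<alpha> * indicator {t1..t2} t \<le> indicator {t1..t2} t * k (zz s t)"
     using k\<alpha> by eventually_elim (use assms in \<open>auto simp: indicator_def\<close>)
   qed (use assms in \<open>auto intro!: integrable_real_indicator\<close>)
   finally show "\<alpha> * (t2 - t1) \<le> H (zz s t2) - H (zz s t1)" by (simp add: eq)
  qed
 qed
 let ?S = "{s \<in> {-r<..<r}. H (zz s t2) - H (zz s t1) < \<alpha> * (t2 - t1)}"
 have c: "continuous_on {-r<..<r} (\<lambda>s. H (zz s t))" if "- r \<le> t" "t \<le> r" for t
 proof -
  have "continuous_on {-r<..<r} (\<lambda>s. H (zz (fst (s, t)) (snd (s, t))))"
   by (rule continuous_on_compose2[OF H_zz_continuous]) (use that in \<open>auto intro!: continuous_intros\<close>)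
  then show ?thesis by simp
 qed
 have "continuous_on {-r<..<r} (\<lambda>s. H (zz s t2) - H (zz s t1))"
  using assms by (intro continuous_intros c) auto
 then have "open ({-r<..<r} \<inter> (\<lambda>s. H (zz s t2) - H (zz s t1)) -` {..<\<alpha> * (t2 - t1)})"
  by (intro continuous_open_preimage) auto
 moreover have "{-r<..<r} \<inter> (\<lambda>s. H (zz s t2) - H (zz s t1)) -` {..<\<alpha> * (t2 - t1)} = ?S" by auto
 ultimately have o: "open ?S" by simp
 have "AE s in lborel. s \<notin> ?S" using ae by eventually_elim auto
 then have "?S = {}" by (rule null_open_interval_empty[OF o])
 then have "s \<notin> ?S" by (simp only: empty_iff not_False_eq_True)
 then show ?thesis using assms by auto
qed

end

text \<open>Every transverse line of the strip \<open>|s| < \<delta>\<close> begins below the level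
  \<open>c\<close> and ends above the level \<open>d\<close>. As \<open>H\<close> increases strictly
  along it, each level between them is met exactly once.\<close>

locale straight_field = directed_field +
 fixes \<delta> c d :: real
 assumes \<delta>: "0 < \<delta>" "\<delta> \<le> r"
  and ends: "\<And>s. \<bar>s\<bar> < \<delta> \<Longrightarrow> H (zz s (- r)) < c" "\<And>s. \<bar>s\<bar> < \<delta> \<Longrightarrow> d < H (zz s r)"
begin

definition T :: "real^2 \<Rightarrow> real \<times> real" where "T z = (z \<bullet> e, H z)"

definition N :: "(real^2) set" where
 "N = {z. \<bar>(z - p) \<bullet> e\<bar> < \<delta> \<and> \<bar>(z - p) \<bullet> rot e\<bar> < r \<and> c < H z \<and> H z < d}"

definition D :: "(real \<times> real) set" where
 "D = {p \<bullet> e - \<delta><..<p \<bullet> e + \<delta>} \<times> {c<..<d}"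

lemma N_cball: "N \<subseteq> cball p (2 * r)"
 using zz_surj_cball_norm \<delta> by (auto simp: N_def simp del: mem_cball)

lemma N_V: "N \<subseteq> V"
 using N_cball ball by blast

lemma T_continuous: "continuous_on N T"
 unfolding T_def by (intro continuous_intros continuous_on_subset[OF H_cont N_V])

lemma T_measurable [measurable]: "T \<in> Borel"
 unfolding T_def[abs_def] by measurable

lemma N_open: "open N"
proof -
 let ?U = "{z. \<bar>(z - p) \<bullet> e\<bar> < \<delta>} \<inter> {z. \<bar>(z - p) \<bullet> rot e\<bar> < r}"
 have U: "open ?U"
  by (intro open_Int open_Collect_less continuous_intros)
 have UV: "?U \<subseteq> V" using zz_surj_cball_norm \<delta> ball by force
 have "open (?U \<inter> H -` {c<..<d})"
  by (rule continuous_open_preimage[OF continuous_on_subset[OF H_cont UV] U]) simp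
 moreover have "?U \<inter> H -` {c<..<d} = N" by (auto simp: N_def)
 ultimately show ?thesis by simp
qed

lemma N_sets [measurable]: "N \<in> sets borel"
 using N_open by simp

lemma D_open: "open D" unfolding D_def by (intro open_Times) auto

lemma D_sets [measurable]: "D \<in> sets borel"
 using D_open by simp

lemma T_in_D: "z \<in> N \<Longrightarrow> T z \<in> D"
 by (auto simp: N_def D_def T_def inner_diff_left)

lemma zz_in_N: "zz s t \<in> N \<longleftrightarrow> \<bar>s\<bar> < \<delta> \<and> \<bar>t\<bar> < r \<and> c < H (zz s t) \<and> H (zz s t) < d"
 by (simp add: N_def zz_inner)

lemma H_strict:
 assumes "\<bar>s\<bar> < \<delta>" "- r \<le> t1" "t1 < t2" "t2 \<le> r"
 shows "H (zz s t1) < H (zz s t2)"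
proof -
 have "0 < \<alpha> * (t2 - t1)" using assms \<alpha> by simp
 also have "\<dots> \<le> H (zz s t2) - H (zz s t1)" by (rule H_increasing) (use assms \<delta> in auto)
 finally show ?thesis by simp
qed

lemma H_level:
 assumes s: "\<bar>s\<bar> < \<delta>" and h: "c \<le> h" "h \<le> d"
 obtains t where "- r < t" "t < r" "H (zz s t) = h"
proof -
 have "continuous_on {-r..r} (\<lambda>t. H (zz (fst (s, t)) (snd (s, t))))"
  by (rule continuous_on_compose2[OF H_zz_continuous]) (use s \<delta> in \<open>auto intro!: continuous_intros\<close>)
 then have "continuous_on {-r..r} (\<lambda>t. H (zz s t))" by simp
 then have "\<exists>t\<ge>-r. t \<le> r \<and> H (zz s t) = h"
  using ends[OF s] h r by (intro IVT') auto
 then obtain t where t: "- r \<le> t" "t \<le> r" "H (zz s t) = h" by blast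
 moreover have "t \<noteq> r" "t \<noteq> - r" using t(3) ends[OF s] h by auto
 ultimately show thesis using that[of t] by auto
qed

lemma T_inj: "inj_on T N"
proof (rule inj_onI)
 fix z w assume zw: "z \<in> N" "w \<in> N" and eq: "T z = T w"
 define s where "s = (z - p) \<bullet> e"
 have s': "(w - p) \<bullet> e = s" using eq by (simp add: s_def T_def inner_diff_left)
 have z: "z = zz s ((z - p) \<bullet> rot e)" and w: "w = zz s ((w - p) \<bullet> rot e)"
  using zz_surj[of z] zz_surj[of w] s' by (simp_all add: s_def)
 have s: "\<bar>s\<bar> < \<delta>" and t: "\<bar>(z - p) \<bullet> rot e\<bar> < r" "\<bar>(w - p) \<bullet> rot e\<bar> < r"
  using zw by (auto simp: N_def s_def)
 have "H z = H w" using eq by (simp add: T_def)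
 then have "H (zz s ((z - p) \<bullet> rot e)) = H (zz s ((w - p) \<bullet> rot e))" using z w by simp
 then have "(z - p) \<bullet> rot e = (w - p) \<bullet> rot e"
  using H_strict[OF s, of "(z - p) \<bullet> rot e" "(w - p) \<bullet> rot e"]
   H_strict[OF s, of "(w - p) \<bullet> rot e" "(z - p) \<bullet> rot e"] t
  by (cases "(z - p) \<bullet> rot e" "(w - p) \<bullet> rot e" rule: linorder_cases) (auto simp: abs_less_iff)
 then show "z = w" using z w by simp
qed

lemma T_image: "T ` N = D"
proof (intro equalityI subsetI)
 fix q assume "q \<in> D"
 then obtain x h where q: "q = (x, h)" and x: "\<bar>x - p \<bullet> e\<bar> < \<delta>" and h: "c < h" "h < d"
  by (auto simp: D_def)
 obtain t where t: "- r < t" "t < r" "H (zz (x - p \<bullet> e) t) = h"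
  using H_level[OF x] h by (metis less_imp_le)
 have "zz (x - p \<bullet> e) t \<in> N" using t x h by (auto simp: zz_in_N)
 moreover have "T (zz (x - p \<bullet> e) t) = q" using t by (simp add: T_def q zz_inner)
 ultimately show "q \<in> T ` N" by blast
qed (use T_in_D in auto)

text \<open>Constant outside \<open>D\<close>, so that it is a Borel map defined on all of the
  plane.\<close>

definition Tinv :: "real \<times> real \<Rightarrow> real^2" where
 "Tinv q = (if q \<in> D then inv_into N T q else p)"

lemma Tinv_T: "z \<in> N \<Longrightarrow> Tinv (T z) = z"
 by (simp add: Tinv_def T_in_D T_inj)

lemma T_Tinv: "q \<in> D \<Longrightarrow> T (Tinv q) = q"
 by (metis Tinv_def T_image f_inv_into_f)

lemma Tinv_N: "q \<in> D \<Longrightarrow> Tinv q \<in> N"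
 by (metis Tinv_def T_image inv_into_into)

text \<open>Invariance of domain: \<open>T\<close> is a continuous injection of an open subset of
  the plane into the plane.\<close>

lemma Tinv_continuous: "continuous_on D Tinv"
 using continuous_on_inverse_open[OF N_open T_continuous _ Tinv_T] by (simp add: T_image)

lemma Tinv_measurable [measurable]: "Tinv \<in> Borel"
proof -
 have 1: "(\<lambda>q. if q \<in> D then Tinv q else p) \<in> Borel"
  by (rule borel_measurable_continuous_on_if[OF D_sets Tinv_continuous]) simp
 have "(\<lambda>q. if q \<in> D then Tinv q else p) = Tinv" by (auto simp: Tinv_def)
 then show ?thesis using 1 by simp
qed

lemma k_lower: "AE z in lborel. z \<in> N \<longrightarrow> \<alpha> \<le> k z"
 using dir by eventually_elim (use N_cball in auto)

text \<open>On a good line \<open>H\<close> is a primitive of \<open>k\<close>, so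
  \<open>k dt\<close> is the length element \<open>dh\<close>: the slice of a box receives exactly
  the length of its interval of levels.\<close>

lemma line_measure:
 "AE s in lborel. (\<integral>\<^sup>+t. indicator N (zz s t) * ennreal (k (zz s t)) * indicator (box l u) (T (zz s t)) \<partial>lborel)
   = indicator ({p \<bullet> e - \<delta><..<p \<bullet> e + \<delta>} \<inter> {fst l<..<fst u}) (s + p \<bullet> e) * emeasure lborel ({c<..<d} \<inter> {snd l<..<snd u})"
 using AE_good_line
proof eventually_elim
 fix s
 assume "\<bar>s\<bar> \<le> r \<longrightarrow> good_line s"
 note a = this[unfolded good_line_def]
 let ?A1 = "{p \<bullet> e - \<delta><..<p \<bullet> e + \<delta>} \<inter> {fst l<..<fst u}" and ?A2 = "{c<..<d} \<inter> {snd l<..<snd u}"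
 let ?G = "\<lambda>t. indicator N (zz s t) * ennreal (k (zz s t)) * indicator (box l u) (T (zz s t))"
 have box: "T (zz s t) \<in> box l u \<longleftrightarrow> s + p \<bullet> e \<in> {fst l<..<fst u} \<and> H (zz s t) \<in> {snd l<..<snd u}" for t
  by (cases l; cases u) (auto simp: T_def zz_inner box_prod box_real add.commute mem_box Basis_prod_def)
 have A1: "zz s t \<in> N \<and> T (zz s t) \<in> box l u \<longleftrightarrow> s + p \<bullet> e \<in> ?A1 \<and> \<bar>t\<bar> < r \<and> H (zz s t) \<in> ?A2" for t
  unfolding box zz_in_N by auto
 have G: "?G t = indicator {t. s + p \<bullet> e \<in> ?A1 \<and> \<bar>t\<bar> < r \<and> H (zz s t) \<in> ?A2} t * ennreal (k (zz s t))" for t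
  using A1[of t] by (auto simp: indicator_def)
 show "(\<integral>\<^sup>+t. ?G t \<partial>lborel) = indicator ?A1 (s + p \<bullet> e) * emeasure lborel ?A2"
 proof (cases "s + p \<bullet> e \<in> ?A1 \<and> ?A2 \<noteq> {}")
  case False
  then have "?G t = 0" for t unfolding G by (auto simp: indicator_def)
  moreover have "indicator ?A1 (s + p \<bullet> e) * emeasure lborel ?A2 = 0" using False by auto
  ultimately show ?thesis by (simp only: nn_integral_const mult_zero_left)
 next
  case True
  define h1 h2 where "h1 = max c (snd l)" and "h2 = min d (snd u)"
  have A2: "?A2 = {h1<..<h2}" by (auto simp: h1_def h2_def)
  have h: "h1 < h2" "c \<le> h1" "h2 \<le> d" using True unfolding A2 by (auto simp: h1_def h2_def)
  have s: "\<bar>s\<bar> < \<delta>" using True by auto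
  obtain t1 where t1: "- r < t1" "t1 < r" "H (zz s t1) = h1" using H_level[OF s, of h1] h by auto
  obtain t2 where t2: "- r < t2" "t2 < r" "H (zz s t2) = h2" using H_level[OF s, of h2] h by auto
  have mono: "H (zz s a) < H (zz s b) \<longleftrightarrow> a < b" if "\<bar>a\<bar> < r" "\<bar>b\<bar> < r" for a b
   using H_strict[OF s, of a b] H_strict[OF s, of b a] that
   by (cases a b rule: linorder_cases) (auto simp: abs_less_iff)
  have "t1 < t2" using mono[of t1 t2] t1 t2 h by auto
  have set: "(\<bar>t\<bar> < r \<and> H (zz s t) \<in> ?A2) \<longleftrightarrow> t \<in> {t1<..<t2}" for t
   unfolding A2 using mono[of t1 t] mono[of t t2] t1 t2 by auto
  have ki: "L1 (\<lambda>t. indicator {-r..r} t * k (zz s t))"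
   and k\<alpha>: "AE t in lborel. t \<in> {-r..r} \<longrightarrow> \<alpha> \<le> k (zz s t)"
   and eq: "H (zz s t2) - H (zz s t1) = (LBINT t. indicator {t1..t2} t * k (zz s t))"
   using a s \<delta> t1 t2 \<open>t1 < t2\<close> by auto
  have sub: "L1 (\<lambda>t. indicator {t1..t2} t * k (zz s t))"
   by (rule Bochner_Integration.integrable_bound[OF ki]) (use t1 t2 in \<open>auto simp: indicator_def intro!: AE_I2\<close>)
  \<comment> \<open>The open interval of parameters given by the strict inequalities is replaced by
    the closed one in \<open>good_line\<close>.\<close>
  have n1: "AE t in lborel. t \<noteq> t1" "AE t in lborel. t \<noteq> t2"
   using AE_lborel_singleton by auto
  have "(\<integral>\<^sup>+t. ?G t \<partial>lborel) = (\<integral>\<^sup>+t. ennreal (indicator {t1..t2} t * k (zz s t)) \<partial>lborel)"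
  proof (rule nn_integral_cong_AE)
   show "AE t in lborel. ?G t = ennreal (indicator {t1..t2} t * k (zz s t))"
    using n1
   proof eventually_elim
    fix t assume "t \<noteq> t1" "t \<noteq> t2"
    then have "t \<in> {t1<..<t2} \<longleftrightarrow> t \<in> {t1..t2}" by auto
    then show "?G t = ennreal (indicator {t1..t2} t * k (zz s t))"
     unfolding G using True set[of t] by (auto simp: indicator_def)
   qed
  qed
  also have "\<dots> = ennreal (LBINT t. indicator {t1..t2} t * k (zz s t))"
  proof (rule nn_integral_eq_integral[OF sub])
   show "AE t in lborel. 0 \<le> indicator {t1..t2} t * k (zz s t)"
    using k\<alpha> by eventually_elim (use t1 t2 \<alpha> in \<open>auto simp: indicator_def\<close>)
  qed
  also have "\<dots> = ennreal (h2 - h1)" using eq t1 t2 by simp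
  also have "\<dots> = emeasure lborel ?A2" unfolding A2 using h by simp
  finally show ?thesis using True by simp
 qed
qed

text \<open>Integrating \<open>line_measure\<close> over \<open>s\<close> shows agreement on boxes,
  which are stable under intersection and generate the Borel sets. The weight \<open>k\<close> plays
  the part of a Jacobian determinant, although \<open>T\<close> is only known to be
  continuous.\<close>

lemma measure_straighten:
 "distr (density lborel (\<lambda>z. indicator N z * ennreal (k z))) borel T = density lborel (indicator D)"
proof (rule measure_eqI_generator_eq)
 let ?E = "range (\<lambda>(a, b). box a b :: (real \<times> real) set)"
 let ?M = "distr (density lborel (\<lambda>z. indicator N z * ennreal (k z))) borel T"
 show "Int_stable ?E"
  by (auto simp: Int_stable_def box_Int_box)
 show "?E \<subseteq> Pow UNIV" "sets (density lborel (indicator D)) = sigma_sets UNIV ?E" "sets ?M = sigma_sets UNIV ?E"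
  by (simp_all add: borel_eq_box)
 let ?A = "\<lambda>n::nat. box (- (real n *\<^sub>R One)) (real n *\<^sub>R One) :: (real \<times> real) set"
 show "range ?A \<subseteq> ?E" "(\<Union>i. ?A i) = UNIV"
  unfolding UN_box_eq_UNIV by auto
 have D: "emeasure (density lborel (indicator D)) X = emeasure lborel (D \<inter> X)" if "X \<in> sets borel" for X
  using that by (subst emeasure_density) (auto simp: nn_integral_indicator[symmetric] indicator_inter_arith[symmetric] simp del: nn_integral_indicator)
 have eq: "emeasure ?M (box l u) = emeasure (density lborel (indicator D)) (box l u)" for l u :: "real \<times> real"
 proof -
  let ?A1 = "{p \<bullet> e - \<delta><..<p \<bullet> e + \<delta>} \<inter> {fst l<..<fst u}" and ?A2 = "{c<..<d} \<inter> {snd l<..<snd u}"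
  let ?F = "\<lambda>z. indicator N z * ennreal (k z) * indicator (box l u) (T z)"
  have [measurable]: "?F \<in> Borel" by measurable
  have "emeasure ?M (box l u) = emeasure (density lborel (\<lambda>z. indicator N z * ennreal (k z))) (T -` box l u)"
   by (subst emeasure_distr) auto
  also have "\<dots> = (\<integral>\<^sup>+z. indicator N z * ennreal (k z) * indicator (T -` box l u) z \<partial>lborel)"
   using measurable_sets[OF T_measurable, of "box l u"] by (subst emeasure_density) auto
  also have "\<dots> = (\<integral>\<^sup>+z. ?F z \<partial>lborel)" by (simp add: indicator_def vimage_def)
  also have "\<dots> = (\<integral>\<^sup>+s. \<integral>\<^sup>+t. ?F (zz s t) \<partial>lborel \<partial>lborel)"
   unfolding zz_def by (rule nn_integral_coords[OF e]) simp
  also have "\<dots> = (\<integral>\<^sup>+s. indicator ?A1 (s + p \<bullet> e) * emeasure lborel ?A2 \<partial>lborel)"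
   by (rule nn_integral_cong_AE[OF line_measure])
  also have "\<dots> = (\<integral>\<^sup>+s. indicator ?A1 s * emeasure lborel ?A2 \<partial>lborel)"
   by (rule nn_integral_translate_lborel) simp
  also have "\<dots> = emeasure lborel ?A1 * emeasure lborel ?A2"
   by (subst nn_integral_multc) auto
  also have "\<dots> = emeasure (lborel \<Otimes>\<^sub>M lborel) (?A1 \<times> ?A2)"
   by (subst lborel.emeasure_pair_measure_Times) auto
  also have "?A1 \<times> ?A2 = D \<inter> box l u"
   by (cases l; cases u) (auto simp: D_def mem_box Basis_prod_def)
  finally show ?thesis by (simp add: D lborel_prod)
 qed
 show "emeasure ?M X = emeasure (density lborel (indicator D)) X" if "X \<in> ?E" for X
  using that eq by auto
 show "emeasure ?M (?A i) \<noteq> \<infinity>" for i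
 proof -
  have "emeasure ?M (?A i) \<le> emeasure lborel (?A i)"
   unfolding eq by (subst D, simp) (rule emeasure_mono, auto)
  also have "\<dots> < \<infinity>" by (rule emeasure_lborel_box_finite)
  finally show ?thesis by simp
 qed
qed

lemma nn_integral_straighten:
 fixes F :: "real \<times> real \<Rightarrow> ennreal"
 assumes [measurable]: "F \<in> Borel"
 shows "(\<integral>\<^sup>+z. indicator N z * ennreal (k z) * F (T z) \<partial>lborel) = (\<integral>\<^sup>+q. indicator D q * F q \<partial>lborel)"
proof -
 have "(\<integral>\<^sup>+q. indicator D q * F q \<partial>lborel) = (\<integral>\<^sup>+q. F q \<partial>density lborel (indicator D))"
  by (subst nn_integral_density) auto
 also have "\<dots> = (\<integral>\<^sup>+q. F q \<partial>distr (density lborel (\<lambda>z. indicator N z * ennreal (k z))) borel T)"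
  by (simp only: measure_straighten)
 also have "\<dots> = (\<integral>\<^sup>+z. F (T z) \<partial>density lborel (\<lambda>z. indicator N z * ennreal (k z)))"
  by (rule nn_integral_distr) auto
 also have "\<dots> = (\<integral>\<^sup>+z. indicator N z * ennreal (k z) * F (T z) \<partial>lborel)"
  by (subst nn_integral_density) auto
 finally show ?thesis ..
qed

text \<open>In the straightened picture the points at levels in \<open>A\<close> form a null set of
  horizontal lines. Pulled back they are null for the weight \<open>k\<close>, and
  \<open>k \<ge> \<alpha> > 0\<close> almost everywhere on \<open>N\<close>.\<close>

lemma level_null:
 assumes A: "A \<in> null_sets lborel"
 shows "AE z in lborel. z \<in> N \<longrightarrow> H z \<notin> A"
proof -
 have [measurable]: "A \<in> sets borel" using A by auto
 have UA: "(UNIV :: real set) \<times> A \<in> sets borel"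
  unfolding borel_prod[symmetric] by (rule pair_measureI) auto
 have "emeasure lborel ((UNIV :: real set) \<times> A) = emeasure (lborel \<Otimes>\<^sub>M lborel) ((UNIV :: real set) \<times> A)"
  by (simp add: lborel_prod)
 also have "\<dots> = emeasure lborel (UNIV :: real set) * emeasure lborel A"
  by (rule lborel.emeasure_pair_measure_Times) auto
 also have "\<dots> = 0" using A by (simp add: null_sets_def)
 finally have 0: "emeasure lborel ((UNIV :: real set) \<times> A) = 0" .
 have "(\<integral>\<^sup>+z. indicator N z * ennreal (k z) * indicator (UNIV \<times> A) (T z) \<partial>lborel)
   = (\<integral>\<^sup>+q. indicator D q * indicator (UNIV \<times> A) q \<partial>lborel)"
  by (rule nn_integral_straighten) (use UA in auto)
 also have "\<dots> \<le> (\<integral>\<^sup>+q. indicator ((UNIV :: real set) \<times> A) q \<partial>lborel)"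
  by (intro nn_integral_mono) (auto simp: indicator_def)
 also have "\<dots> = 0" using UA 0 by simp
 finally have "(\<integral>\<^sup>+z. indicator N z * ennreal (k z) * indicator (UNIV \<times> A) (T z) \<partial>lborel) = 0" by simp
 moreover have "(\<lambda>z. indicator N z * ennreal (k z) * indicator (UNIV \<times> A) (T z)) \<in> Borel"
  using UA by measurable
 ultimately have "AE z in lborel. indicator N z * ennreal (k z) * indicator (UNIV \<times> A) (T z) = 0"
  by (subst (asm) nn_integral_0_iff_AE) auto
 then show ?thesis using k_lower
  by eventually_elim (use \<alpha> in \<open>auto simp: T_def indicator_def split: if_splits\<close>)
qed

end

lemma (in ham_field) straight_field_exists:
 assumes p: "\<epsilon> > 0" "ball p \<epsilon> \<subseteq> V" and \<xi>: "\<alpha>0 > 0" "AE z in lborel. z \<in> ball p \<epsilon> \<longrightarrow> \<alpha>0 \<le> b z \<bullet> \<xi>"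
 obtains e \<alpha> r \<delta> c d where "straight_field V b H p e \<alpha> r \<delta> c d" "p \<in> straight_field.N H p e r \<delta> c d"
proof -
 have "\<xi> \<noteq> 0"
 proof
  assume "\<xi> = 0"
  have "AE z in lborel. z \<notin> ball p \<epsilon>"
   by (rule eventually_mono[OF \<xi>(2)]) (use \<xi>(1) \<open>\<xi> = 0\<close> in auto)
  then have "ball p \<epsilon> \<in> null_sets lborel" using AE_iff_null_sets[of "ball p \<epsilon>" lborel] by simp
  then have "negligible (ball p \<epsilon>)" unfolding negligible_iff_null_sets by (rule null_sets_completionI)
  then show False using open_not_negligible[OF open_ball, of p \<epsilon>] p by simp
 qed
 define e where "e = \<xi> /\<^sub>R norm \<xi>"
 define \<alpha> where "\<alpha> = \<alpha>0 / norm \<xi>"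
 \<comment> \<open>So that \<open>cball p (2 * r)\<close> fits into the given ball.\<close>
 define r where "r = \<epsilon> / 4"
 have r: "r > 0" using p by (simp add: r_def)
 have e: "norm e = 1" using \<open>\<xi> \<noteq> 0\<close> by (simp add: e_def)
 have \<alpha>: "\<alpha> > 0" using \<open>\<xi> \<noteq> 0\<close> \<xi>(1) by (simp add: \<alpha>_def)
 have sub: "cball p (2 * r) \<subseteq> ball p \<epsilon>" using p by (auto simp: r_def)
 have df: "directed_field V b H p e \<alpha> r"
 proof unfold_locales
  show "cball p (2 * r) \<subseteq> V" using sub p by blast
  show "AE z in lborel. z \<in> cball p (2 * r) \<longrightarrow> \<alpha> \<le> b z \<bullet> e"
   using \<xi>(2)
  proof eventually_elim
   fix z assume "z \<in> ball p \<epsilon> \<longrightarrow> \<alpha>0 \<le> b z \<bullet> \<xi>"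
   then show "z \<in> cball p (2 * r) \<longrightarrow> \<alpha> \<le> b z \<bullet> e"
    using sub \<open>\<xi> \<noteq> 0\<close> by (auto simp: \<alpha>_def e_def divide_inverse mult.commute intro!: mult_left_mono)
  qed
 qed (use e \<alpha> r in auto)
 interpret directed_field V b H p e \<alpha> r by (rule df)
 have p0: "zz 0 0 = p" by (simp add: zz_def)
 define c d where "c = H p - \<alpha> * r / 2" and "d = H p + \<alpha> * r / 2"
 have up: "H p + \<alpha> * r \<le> H (zz 0 r)" using H_increasing[of 0 0 r] r by (simp add: p0)
 have lo: "H (zz 0 (- r)) \<le> H p - \<alpha> * r" using H_increasing[of 0 "- r" 0] r by (simp add: p0)
 have ar: "\<alpha> * r > 0" using \<alpha> r by simp
 have cont: "continuous_on {-r..r} (\<lambda>s. H (zz s t))" if "t \<in> {-r..r}" for t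
 proof -
  have "continuous_on {-r..r} (\<lambda>s. H (zz (fst (s, t)) (snd (s, t))))"
   by (rule continuous_on_compose2[OF H_zz_continuous]) (use that in \<open>auto intro!: continuous_intros\<close>)
  then show ?thesis by simp
 qed
 obtain d1 where d1: "d1 > 0" "\<And>s. s \<in> {-r..r} \<Longrightarrow> \<bar>s\<bar> < d1 \<Longrightarrow> \<bar>H (zz s r) - H (zz 0 r)\<bar> < \<alpha> * r / 2"
  using cont[of r, unfolded continuous_on_iff, rule_format, of 0 "\<alpha> * r / 2"] r ar by (auto simp: dist_real_def)
 obtain d2 where d2: "d2 > 0" "\<And>s. s \<in> {-r..r} \<Longrightarrow> \<bar>s\<bar> < d2 \<Longrightarrow> \<bar>H (zz s (-r)) - H (zz 0 (-r))\<bar> < \<alpha> * r / 2"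
  using cont[of "-r", unfolded continuous_on_iff, rule_format, of 0 "\<alpha> * r / 2"] r ar by (auto simp: dist_real_def)
 define \<delta> where "\<delta> = min r (min d1 d2)"
 have sf: "straight_field V b H p e \<alpha> r \<delta> c d"
 proof unfold_locales
  show "0 < \<delta>" "\<delta> \<le> r" using r d1 d2 by (auto simp: \<delta>_def)
  show "H (zz s (- r)) < c" if "\<bar>s\<bar> < \<delta>" for s
  proof -
   have "s \<in> {-r..r}" "\<bar>s\<bar> < d2" using that by (auto simp: \<delta>_def abs_less_iff)
   from d2(2)[OF this] show ?thesis using lo ar unfolding c_def abs_less_iff by linarith
  qed
  show "d < H (zz s r)" if "\<bar>s\<bar> < \<delta>" for s
  proof -
   have "s \<in> {-r..r}" "\<bar>s\<bar> < d1" using that by (auto simp: \<delta>_def abs_less_iff)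
   from d1(2)[OF this] show ?thesis using up ar unfolding d_def abs_less_iff by linarith
  qed
 qed
 interpret straight_field V b H p e \<alpha> r \<delta> c d by (rule sf)
 have "p \<in> N" unfolding N_def using r \<delta> ar by (simp add: c_def d_def)
 then show thesis using that sf by blast
qed

section \<open>Products of solutions\<close>

lemma AE_snd:
 fixes P :: "'b::euclidean_space \<Rightarrow> bool"
 assumes "AE z in lborel. P z"
 shows "AE p in (lborel :: ('a::euclidean_space \<times> 'b) measure). P (snd p)"
proof -
 obtain N where N: "\<And>z. z \<in> space lborel - N \<Longrightarrow> P z" "N \<in> null_sets lborel"
  by (rule AE_E3[OF assms]) blast
 have m: "(UNIV :: 'a set) \<times> N \<in> sets borel"
  unfolding borel_prod[symmetric] by (rule pair_measureI) (use N in auto)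
 have "emeasure (lborel \<Otimes>\<^sub>M lborel) ((UNIV :: 'a set) \<times> N) = 0"
  using N by (subst lborel.emeasure_pair_measure_Times) auto
 then have "(UNIV :: 'a set) \<times> N \<in> null_sets lborel"
  using m by (simp add: lborel_prod null_sets_def)
 moreover have "{p \<in> space lborel. \<not> P (snd p)} \<subseteq> (UNIV :: 'a set) \<times> N" using N(1) by force
 ultimately show ?thesis by (rule AE_I')
qed

lemma nn_integral_slices:
 fixes F :: "'a::euclidean_space \<times> 'b::euclidean_space \<Rightarrow> ennreal"
 assumes [measurable]: "F \<in> Borel"
 shows "(\<integral>\<^sup>+x. F x \<partial>lborel) = (\<integral>\<^sup>+t. \<integral>\<^sup>+z. F (t, z) \<partial>lborel \<partial>lborel)"
proof -
 have "F \<in> borel_measurable (lborel \<Otimes>\<^sub>M lborel)" by (simp add: lborel_prod)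
 from lborel.nn_integral_fst[OF this] show ?thesis by (simp add: lborel_prod)
qed

lemma C1_tensor:
 fixes f :: "'a::euclidean_space \<Rightarrow> real" and g :: "'b::euclidean_space \<Rightarrow> real"
 assumes f: "C1 f f'" and g: "C1 g g'"
 shows "C1 (\<lambda>p. f (fst p) * g (snd p)) (\<lambda>p. (g (snd p) *\<^sub>R f' (fst p), f (fst p) *\<^sub>R g' (snd p)))"
 unfolding C1_def
proof (intro conjI allI)
 fix p :: "'a \<times> 'b"
 have 1: "((\<lambda>p. f (fst p)) has_derivative (\<lambda>v. f' (fst p) \<bullet> fst v)) (at p)"
  by (rule has_derivative_compose[OF _ C1_D[OF f]]) (auto intro!: derivative_eq_intros)
 have 2: "((\<lambda>p. g (snd p)) has_derivative (\<lambda>v. g' (snd p) \<bullet> snd v)) (at p)"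
  by (rule has_derivative_compose[OF _ C1_D[OF g]]) (auto intro!: derivative_eq_intros)
 have "(\<bullet>) (g (snd p) *\<^sub>R f' (fst p), f (fst p) *\<^sub>R g' (snd p)) =
   (\<lambda>v. f (fst p) * (g' (snd p) \<bullet> snd v) + f' (fst p) \<bullet> fst v * g (snd p))"
  by (auto simp: fun_eq_iff inner_Pair_0 inner_prod_def mult.commute)
 then show "((\<lambda>p. f (fst p) * g (snd p)) has_derivative (\<bullet>) (g (snd p) *\<^sub>R f' (fst p), f (fst p) *\<^sub>R g' (snd p))) (at p)"
  using has_derivative_mult[OF 1 2] by simp
 show "continuous_on UNIV (\<lambda>p. (g (snd p) *\<^sub>R f' (fst p), f (fst p) *\<^sub>R g' (snd p)))"
  by (intro continuous_intros continuous_on_compose2[OF C1_continuous[OF f, of UNIV]]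
    continuous_on_compose2[OF C1_continuous[OF g, of UNIV]]
    continuous_on_compose2[OF C1_grad_continuous[OF f, of UNIV]]
    continuous_on_compose2[OF C1_grad_continuous[OF g, of UNIV]]) auto
qed

lemma C1_reflect:
 fixes K :: "'a::euclidean_space \<Rightarrow> real"
 assumes k: "C1 K k" shows "C1 (\<lambda>y. K (x - y)) (\<lambda>y. - k (x - y))"
 unfolding C1_def
proof (intro conjI allI)
 fix y
 have "((\<lambda>y. K (x - y)) has_derivative (\<lambda>v. k (x - y) \<bullet> (0 - v))) (at y)"
  by (rule has_derivative_compose[OF _ C1_D[OF k]]) (auto intro!: derivative_eq_intros)
 moreover have "(\<bullet>) (- k (x - y)) = (\<lambda>v. k (x - y) \<bullet> (0 - v))" by auto
 ultimately show "((\<lambda>y. K (x - y)) has_derivative (\<bullet>) (- k (x - y))) (at y)" by simp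
 show "continuous_on UNIV (\<lambda>y. - k (x - y))"
  by (intro continuous_intros continuous_on_compose2[OF C1_grad_continuous[OF k, of UNIV]]) auto
qed

lemma C1_shift:
 fixes K :: "'a::euclidean_space \<Rightarrow> real"
 assumes k: "C1 K k" shows "C1 (\<lambda>y. K (y + x)) (\<lambda>y. k (y + x))"
 unfolding C1_def
proof (intro conjI allI)
 fix y
 have "((\<lambda>y. K (y + x)) has_derivative (\<lambda>v. k (y + x) \<bullet> v)) (at y)"
  by (rule has_derivative_compose[OF _ C1_D[OF k]]) (auto intro!: derivative_eq_intros)
 then show "((\<lambda>y. K (y + x)) has_derivative (\<bullet>) (k (y + x))) (at y)" by simp
 show "continuous_on UNIV (\<lambda>y. k (y + x))"
  by (intro continuous_intros continuous_on_compose2[OF C1_grad_continuous[OF k, of UNIV]]) auto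
qed

text \<open>Mollify the indicator of the closed \<open>r / 2\<close>-neighbourhood of
  \<open>L\<close> at scale \<open>r / 4\<close>: the result is 1 within distance
  \<open>r / 4\<close> of \<open>L\<close> and vanishes beyond \<open>3 * r / 4\<close>.\<close>

lemma cutoff:
 fixes L :: "'a::euclidean_space set"
 assumes L: "compact L" and U: "open U" "L \<subseteq> U"
 obtains \<zeta> \<zeta>' K W where "C1 \<zeta> \<zeta>'" "compact K" "K \<subseteq> U" "\<And>x. x \<notin> K \<Longrightarrow> \<zeta> x = 0"
  "\<And>x. 0 \<le> \<zeta> x" "\<And>x. \<zeta> x \<le> 1" "open W" "L \<subseteq> W" "\<And>x. x \<in> W \<Longrightarrow> \<zeta> x = 1"
proof -
 obtain r K where r: "r > 0" "compact K" "K \<subseteq> U" "\<And>x y. x \<in> L \<Longrightarrow> dist x y \<le> r \<Longrightarrow> y \<in> K" "L \<subseteq> K"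
  using compact_neighbourhood[OF L U] by blast
 define A where "A = {x + y |x y. x \<in> L \<and> y \<in> cball 0 (r / 2)}"
 have cA: "compact A" unfolding A_def by (intro compact_sums L compact_cball)
 have A: "y \<in> A" if "x \<in> L" "dist x y \<le> r / 2" for x y
  unfolding A_def using that by (intro CollectI exI[of _ x] exI[of _ "y - x"]) (auto simp: dist_norm norm_minus_commute)
 have [measurable]: "A \<in> sets borel" using cA borel_compact by blast
 obtain \<kappa> :: "'a \<Rightarrow> real" where \<kappa>: "mollifier (r / 4) \<kappa>" using mollifier_exists[of "r / 4"] r by auto
 obtain k where k: "C1 \<kappa> k" using mollifier_C1[OF \<kappa>] by blast
 have \<kappa>0: "\<And>x. 0 \<le> \<kappa> x" "\<And>x. x \<notin> cball 0 (r / 4) \<Longrightarrow> \<kappa> x = 0" "L1 \<kappa>" "(LBINT x. \<kappa> x) = 1"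
  using \<kappa> by (auto simp: mollifier_def)
 have [measurable]: "\<kappa> \<in> Borel" using k C1_borel by blast
 obtain R where R: "A \<subseteq> cball 0 R" using compact_subset_cball[OF cA] by blast
 let ?\<zeta> = "conv (indicator A) \<kappa>"
 have C: "C1 ?\<zeta> (conv (indicator A) k)"
  by (rule conv_C1_bounded_support[OF integrable_indicator_compact[OF cA] _ k, of R]) (use R in \<open>auto simp: indicator_def\<close>)
 have i: "L1 (\<lambda>y. \<kappa> (x - y))" "(LBINT y. \<kappa> (x - y)) = 1" for x
  using \<kappa>0 by (simp_all add: integrable_reflect_lborel integral_reflect_lborel)
 have i2: "L1 (\<lambda>y. indicator A y * \<kappa> (x - y))" for x
  by (rule Bochner_Integration.integrable_bound[OF i(1)[of x]]) (auto simp: indicator_def)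
 show thesis
 proof (rule that[OF C r(2,3)])
  show "?\<zeta> x = 0" if "x \<notin> K" for x
  proof -
   have "indicator A y * \<kappa> (x - y) = (0::real)" for y
   proof (cases "y \<in> A \<and> x - y \<in> cball 0 (r / 4)")
    case True
    then obtain l z where l: "l \<in> L" "y = l + z" "norm z \<le> r / 2" by (auto simp: A_def)
    have "dist l x \<le> dist l y + dist y x" by (rule dist_triangle)
    also have "\<dots> \<le> r / 2 + r / 4" using l True by (auto simp: dist_norm norm_minus_commute)
    finally have "x \<in> K" using r(1) l(1) by (intro r(4)[of l]) auto
    then show ?thesis using that by simp
   qed (use \<kappa>0(2) in auto)
   then show ?thesis unfolding conv_def real_scaleR_def by (simp only: Bochner_Integration.integral_zero)
  qed
  show "0 \<le> ?\<zeta> x" for x unfolding conv_def using \<kappa>0 by (intro Bochner_Integration.integral_nonneg) auto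
  show "?\<zeta> x \<le> 1" for x
  proof -
   have "?\<zeta> x \<le> (LBINT y. \<kappa> (x - y))" unfolding conv_def
    using i2[of x] i(1)[of x] \<kappa>0(1) by (intro integral_mono) (auto simp: indicator_def)
   then show ?thesis using i by simp
  qed
  show "open (\<Union>l\<in>L. ball l (r / 4))" by auto
  show "L \<subseteq> (\<Union>l\<in>L. ball l (r / 4))" using r(1) by force
  show "?\<zeta> x = 1" if xL: "x \<in> (\<Union>l\<in>L. ball l (r / 4))" for x
  proof -
   obtain l where l: "l \<in> L" "dist l x < r / 4" using xL unfolding UN_iff mem_ball by blast
   have "indicator A y * \<kappa> (x - y) = \<kappa> (x - y)" for y
   proof (cases "x - y \<in> cball 0 (r / 4)")
    case True
    have "dist l y \<le> dist l x + dist x y" by (rule dist_triangle)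
    also have "\<dots> \<le> r / 2" using l True by (auto simp: dist_norm norm_minus_commute)
    finally show ?thesis using A[OF l(1)] by simp
   qed (use \<kappa>0(2) in auto)
   then show ?thesis unfolding conv_def real_scaleR_def using i by (simp only:)
  qed
 qed
qed

section \<open>The equation in straightened coordinates\<close>

context straight_field
begin

text \<open>
 \<open>kk\<close> equals \<open>k\<close> almost everywhere on \<open>N\<close>; its reciprocal \<open>g\<close> is the density of the straightened
 measure.
\<close>

definition kk :: "real^2 \<Rightarrow> real" where "kk z = max \<alpha> (k z)"

definition g :: "real \<times> real \<Rightarrow> real" where "g q = indicator D q / kk (Tinv q)"

lemma kk_ge: "\<alpha> \<le> kk z" by (simp add: kk_def)

lemma kk_pos: "0 < kk z" using kk_ge[of z] \<alpha> by linarith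

lemma kk_measurable [measurable]: "kk \<in> Borel"
 unfolding kk_def[abs_def] by measurable

lemma kk_eq: "AE z in lborel. z \<in> N \<longrightarrow> kk z = k z"
 using k_lower by eventually_elim (auto simp: kk_def)

lemma g_measurable [measurable]: "g \<in> Borel"
 unfolding g_def[abs_def] by measurable

lemma g_bounds: "0 \<le> g q" "g q \<le> 1 / \<alpha>" "q \<notin> D \<Longrightarrow> g q = 0"
proof -
 show "0 \<le> g q" using kk_pos[of "Tinv q"] by (auto simp: g_def)
 show "g q \<le> 1 / \<alpha>" using kk_ge[of "Tinv q"] kk_pos[of "Tinv q"] \<alpha> by (auto simp: g_def indicator_def frac_le)
qed (simp add: g_def)

lemma kk_eq2: "AE x in (lborel :: (real \<times> (real^2)) measure). snd x \<in> N \<longrightarrow> kk (snd x) = k (snd x)"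
 by (rule AE_snd[OF kk_eq])

lemma nn_integral_straighten2:
 fixes F :: "real \<times> (real \<times> real) \<Rightarrow> ennreal"
 assumes [measurable]: "F \<in> Borel"
 shows "(\<integral>\<^sup>+x. indicator N (snd x) * ennreal (kk (snd x)) * F (fst x, T (snd x)) \<partial>lborel)
  = (\<integral>\<^sup>+x. indicator D (snd x) * F x \<partial>lborel)"
proof -
 have "(\<integral>\<^sup>+x. indicator N (snd x) * ennreal (kk (snd x)) * F (fst x, T (snd x)) \<partial>lborel)
   = (\<integral>\<^sup>+t. \<integral>\<^sup>+z. indicator N z * ennreal (kk z) * F (t, T z) \<partial>lborel \<partial>lborel)"
  by (subst nn_integral_slices) auto
 also have "\<dots> = (\<integral>\<^sup>+t. \<integral>\<^sup>+z. indicator N z * ennreal (k z) * F (t, T z) \<partial>lborel \<partial>lborel)"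
 proof (rule nn_integral_cong, rule nn_integral_cong_AE)
  show "AE z in lborel. indicator N z * ennreal (kk z) * F (t, T z) = indicator N z * ennreal (k z) * F (t, T z)" for t
   using kk_eq by eventually_elim (auto simp: indicator_def)
 qed
 also have "\<dots> = (\<integral>\<^sup>+t. \<integral>\<^sup>+q. indicator D q * F (t, q) \<partial>lborel \<partial>lborel)"
  by (intro nn_integral_cong nn_integral_straighten) auto
 also have "\<dots> = (\<integral>\<^sup>+x. indicator D (snd x) * F x \<partial>lborel)"
  by (subst nn_integral_slices) auto
 finally show ?thesis .
qed

lemma measure_straighten2:
 "distr (density lborel (\<lambda>x :: real \<times> (real^2). ennreal (indicator N (snd x) * kk (snd x)))) borel (\<lambda>x. (fst x, T (snd x)))
  = density lborel (\<lambda>x :: real \<times> (real \<times> real). ennreal (indicator D (snd x)))"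
proof (rule measure_eqI)
 fix A assume "A \<in> sets (distr (density lborel (\<lambda>x :: real \<times> (real^2). ennreal (indicator N (snd x) * kk (snd x)))) borel (\<lambda>x. (fst x, T (snd x))))"
 then have [measurable]: "A \<in> sets borel" by simp
 have [measurable]: "(\<lambda>x. (fst x, T (snd x))) -` A \<in> sets borel"
  using measurable_sets[of "\<lambda>x. (fst x, T (snd x))" borel borel A] by simp
 have "emeasure (distr (density lborel (\<lambda>x :: real \<times> (real^2). ennreal (indicator N (snd x) * kk (snd x)))) borel (\<lambda>x. (fst x, T (snd x)))) A
  = (\<integral>\<^sup>+x. ennreal (indicator N (snd x) * kk (snd x)) * indicator ((\<lambda>x. (fst x, T (snd x))) -` A) x \<partial>lborel)"
  by (subst emeasure_distr) (auto simp: emeasure_density)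
 also have "\<dots> = (\<integral>\<^sup>+x. indicator N (snd x) * ennreal (kk (snd x)) * indicator A (fst x, T (snd x)) \<partial>lborel)"
  by (intro nn_integral_cong) (auto simp: indicator_def)
 also have "\<dots> = (\<integral>\<^sup>+x. indicator D (snd x) * indicator A x \<partial>lborel)"
  by (rule nn_integral_straighten2) simp
 also have "\<dots> = emeasure (density lborel (\<lambda>x :: real \<times> (real \<times> real). ennreal (indicator D (snd x)))) A"
  by (subst emeasure_density) (auto simp: ennreal_indicator)
 finally show "emeasure (distr (density lborel (\<lambda>x :: real \<times> (real^2). ennreal (indicator N (snd x) * kk (snd x)))) borel (\<lambda>x. (fst x, T (snd x)))) A
  = emeasure (density lborel (\<lambda>x :: real \<times> (real \<times> real). ennreal (indicator D (snd x)))) A" .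
qed simp

lemma straighten_integral:
 fixes F :: "real \<times> (real \<times> real) \<Rightarrow> real"
 assumes [measurable]: "F \<in> Borel"
 shows "L1 (\<lambda>x. indicator N (snd x) * kk (snd x) * F (fst x, T (snd x))) \<longleftrightarrow>
   L1 (\<lambda>x. indicator D (snd x) * F x)" (is ?A)
  "(LBINT x. indicator N (snd x) * kk (snd x) * F (fst x, T (snd x))) = (LBINT x. indicator D (snd x) * F x)" (is ?B)
proof -
 let ?M = "density lborel (\<lambda>x :: real \<times> (real^2). ennreal (indicator N (snd x) * kk (snd x)))"
 let ?S = "\<lambda>x. (fst x, T (snd x))"
 have nn: "AE x in lborel. 0 \<le> indicator N (snd x) * kk (snd x)" for x :: "real \<times> (real^2)"
  using kk_pos by (auto intro!: AE_I2 simp: less_imp_le)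
 have "L1 (\<lambda>x. indicator N (snd x) * kk (snd x) * F (?S x)) \<longleftrightarrow> integrable ?M (\<lambda>x. F (?S x))"
  by (subst integrable_density) (use kk_pos in \<open>auto intro!: AE_I2 simp: less_imp_le\<close>)
 also have "\<dots> \<longleftrightarrow> integrable (distr ?M borel ?S) F"
  by (rule integrable_distr_eq[symmetric]) auto
 also have "\<dots> \<longleftrightarrow> L1 (\<lambda>x. indicator D (snd x) * F x)"
  unfolding measure_straighten2 by (subst integrable_density) auto
 finally show ?A .
 have "(LBINT x. indicator N (snd x) * kk (snd x) * F (?S x)) = (\<integral>x. F (?S x) \<partial>?M)"
  by (subst integral_density) (use kk_pos in \<open>auto intro!: AE_I2 simp: less_imp_le\<close>)
 also have "\<dots> = (\<integral>x. F x \<partial>distr ?M borel ?S)"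
  by (rule integral_distr[symmetric]) auto
 also have "\<dots> = (LBINT x. indicator D (snd x) * F x)"
  unfolding measure_straighten2 by (subst integral_density) auto
 finally show ?B .
qed

text \<open>Multiplying and dividing by \<open>kk\<close> writes a plain integral over
  \<open>N\<close> as one for the straightened measure. The quotient survives as the density
  \<open>g\<close>, and the indicator of \<open>D\<close> is absorbed in it.\<close>

lemma to_D:
 fixes f :: "real \<times> (real^2) \<Rightarrow> real"
 assumes [measurable]: "f \<in> Borel"
 shows "L1 (\<lambda>x. indicator N (snd x) * f x) \<longleftrightarrow>
   L1 (\<lambda>x. f (fst x, Tinv (snd x)) * g (snd x))"
  "(LBINT x. indicator N (snd x) * f x) = (LBINT x. f (fst x, Tinv (snd x)) * g (snd x))"
proof -
 let ?F = "\<lambda>x. f (fst x, Tinv (snd x)) * g (snd x)"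
 have 1: "indicator N (snd x) * kk (snd x) * ?F (fst x, T (snd x)) = indicator N (snd x) * f x" for x
  using kk_pos[of "snd x"] by (auto simp: indicator_def g_def Tinv_T T_in_D)
 have 2: "indicator D (snd x) * ?F x = ?F x" for x
  using g_bounds(3)[of "snd x"] by (auto simp: indicator_def)
 show "L1 (\<lambda>x. indicator N (snd x) * f x) \<longleftrightarrow>
   L1 (\<lambda>x. f (fst x, Tinv (snd x)) * g (snd x))"
  "(LBINT x. indicator N (snd x) * f x) = (LBINT x. f (fst x, Tinv (snd x)) * g (snd x))"
  using straighten_integral[of ?F] unfolding 1 2 by auto
qed

text \<open>The equation in the coordinates \<open>(t, s, h)\<close>, in which the vector field is horizontal.\<close>

lemma equation_D:
 fixes u :: "real \<times> (real^2) \<Rightarrow> real" and \<Psi> :: "real \<times> (real \<times> real) \<Rightarrow> real"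
 assumes u: "transp N b u" and [measurable]: "u \<in> Borel" and C: "\<And>p. \<bar>u p\<bar> \<le> C"
  and \<Psi>: "C1 \<Psi> \<Gamma>" and K: "compact K" "K \<subseteq> UNIV \<times> D" "\<And>x. x \<notin> K \<Longrightarrow> \<Psi> x = 0"
 shows "(LBINT x. indicator D (snd x) * u (fst x, Tinv (snd x)) *
   (g (snd x) * (\<Gamma> x \<bullet> (1, 0)) + indicator {0..} (fst x) * (\<Gamma> x \<bullet> (0, 1, 0)))) = 0"
proof -
 have [measurable]: "\<Gamma> \<in> Borel" using C1_grad_borel[OF \<Psi>] .
 have \<Gamma>0: "\<Gamma> x = 0" if "x \<notin> K" for x
  using C1_grad_support[OF \<Psi> compact_imp_closed[OF K(1)] K(3) that] .
 define L where "L = Tinv ` snd ` K"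
 have sK: "snd ` K \<subseteq> D" using K(2) by auto
 have cL: "compact L" unfolding L_def
  by (intro compact_continuous_image continuous_on_subset[OF Tinv_continuous sK] compact_snd_image K)
 have LN: "L \<subseteq> N" using sK Tinv_N by (auto simp: L_def)
 \<comment> \<open>As a function of \<open>(t, x, h)\<close> the test function would constrain
   \<open>x\<close> only through \<open>x \<bullet> e\<close>. The cut-off makes its support compact
   in \<open>x\<close>; being 1 near the points that count, it contributes no derivative
   there.\<close>
 obtain \<zeta> \<zeta>' K' W where \<zeta>: "C1 \<zeta> \<zeta>'" "compact K'" "K' \<subseteq> N" "\<And>x. x \<notin> K' \<Longrightarrow> \<zeta> x = 0"
  "open W" "L \<subseteq> W" "\<And>x. x \<in> W \<Longrightarrow> \<zeta> x = 1"
  using cutoff[OF cL N_open LN] by metis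
 have \<zeta>'0: "\<zeta>' x = 0" if "x \<notin> K'" for x
  using C1_grad_support[OF \<zeta>(1) compact_imp_closed[OF \<zeta>(2)] \<zeta>(4) that] .
 have \<zeta>'W: "\<zeta>' x = 0" if "x \<in> W" for x
  using C1_zero_on_open[OF C1_diff[OF \<zeta>(1) C1_const[of 1]] \<zeta>(5) that] \<zeta>(7) by simp
 define \<Phi> where "\<Phi> y = \<zeta> (fst (snd y)) * \<Psi> (fst y, fst (snd y) \<bullet> e, snd (snd y))" for y :: "real \<times> (real^2) \<times> real"
 let ?A = "\<lambda>y :: real \<times> (real^2) \<times> real. (fst y, fst (snd y) \<bullet> e, snd (snd y))"
 let ?D = "\<lambda>y v :: real \<times> (real^2) \<times> real. \<zeta> (fst (snd y)) * (\<Gamma> (?A y) \<bullet> ?A v) + (\<zeta>' (fst (snd y)) \<bullet> fst (snd v)) * \<Psi> (?A y)"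
 have D: "(\<Phi> has_derivative ?D y) (at y)" for y
 proof -
  have 1: "((\<lambda>y. \<zeta> (fst (snd y))) has_derivative (\<lambda>v. \<zeta>' (fst (snd y)) \<bullet> fst (snd v))) (at y)"
   by (rule has_derivative_compose[OF _ C1_D[OF \<zeta>(1)]]) (auto intro!: derivative_eq_intros)
  have 2: "((\<lambda>y. \<Psi> (?A y)) has_derivative (\<lambda>v. \<Gamma> (?A y) \<bullet> ?A v)) (at y)"
   by (rule has_derivative_compose[OF _ C1_D[OF \<Psi>]]) (auto intro!: derivative_eq_intros)
  show ?thesis unfolding \<Phi>_def using has_derivative_mult[OF 1 2] by simp
 qed
 have cont: "continuous_on UNIV (\<lambda>y. ?D y v)" for v
  by (intro continuous_intros continuous_on_compose2[OF C1_continuous[OF \<zeta>(1), of UNIV]]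
    continuous_on_compose2[OF C1_grad_continuous[OF \<zeta>(1), of UNIV]]
    continuous_on_compose2[OF C1_continuous[OF \<Psi>, of UNIV]]
    continuous_on_compose2[OF C1_grad_continuous[OF \<Psi>, of UNIV]]) auto
 obtain R where R: "fst ` K \<subseteq> cball 0 R" using compact_subset_cball[OF compact_fst_image[OF K(1)]] by blast
 have "(LBINT p. u p * ((\<Sum>e\<in>Basis. ?D (fst p, snd p, H (snd p)) e *\<^sub>R e) \<bullet> (1, indicator {0..} (fst p) *\<^sub>R b (snd p), 0))) = 0"
 proof (rule transp_H[OF u N_V _ C C1I(1)[OF D cont]])
  show "compact (cball (0::real) R \<times> K')" by (intro compact_Times compact_cball \<zeta>)
  show "cball (0::real) R \<times> K' \<subseteq> UNIV \<times> N" using \<zeta> by auto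
  show "\<Phi> (t, x, h) = 0" if "(t, x) \<notin> cball (0::real) R \<times> K'" for t x h
  proof (cases "x \<in> K'")
   case True
   then have "(t, x \<bullet> e, h) \<notin> K" using that R by force
   then show ?thesis using K(3) by (simp add: \<Phi>_def)
  qed (use \<zeta>(4) in \<open>simp add: \<Phi>_def\<close>)
 qed simp
 moreover have "(\<Sum>e\<in>Basis. ?D (fst p, snd p, H (snd p)) e *\<^sub>R e) \<bullet> (1, indicator {0..} (fst p) *\<^sub>R b (snd p), 0)
   = indicator N (snd p) * ((\<Gamma> (fst p, T (snd p)) \<bullet> (1, 0)) + indicator {0..} (fst p) * k (snd p) * (\<Gamma> (fst p, T (snd p)) \<bullet> (0, 1, 0)))" for p
 proof -
  obtain t z where p: "p = (t, z)" by (cases p)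
  have "(\<Sum>e\<in>Basis. ?D (fst p, snd p, H (snd p)) e *\<^sub>R e) \<bullet> (1, indicator {0..} (fst p) *\<^sub>R b (snd p), 0)
   = ?D (t, z, H z) (1, indicator {0..} t *\<^sub>R b z, 0)"
   unfolding p fst_conv snd_conv by (rule C1I(2)[OF D cont, of "(t, z, H z)" "(1, indicator {0..} t *\<^sub>R b z, 0)", unfolded fst_conv snd_conv])
  also have "\<dots> = \<zeta> z * (\<Gamma> (t, T z) \<bullet> (1, indicator {0..} t * k z, 0)) + (\<zeta>' z \<bullet> (indicator {0..} t *\<^sub>R b z)) * \<Psi> (t, T z)"
   by (simp add: T_def)
  also have "(1, indicator {0..} t * k z, 0) = (1, 0) + (indicator {0..} t * k z) *\<^sub>R (0, 1, 0::real)"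
   by (simp add: zero_prod_def)
  also have "\<zeta> z * (\<Gamma> (t, T z) \<bullet> ((1, 0) + (indicator {0..} t * k z) *\<^sub>R (0, 1, 0::real))) + (\<zeta>' z \<bullet> (indicator {0..} t *\<^sub>R b z)) * \<Psi> (t, T z)
   = indicator N z * ((\<Gamma> (t, T z) \<bullet> (1, 0)) + indicator {0..} t * k z * (\<Gamma> (t, T z) \<bullet> (0, 1, 0)))"
  proof (cases "z \<in> N \<and> (t, T z) \<in> K")
   case True
   then have "z \<in> L" unfolding L_def by (metis Tinv_T imageI snd_conv)
   then have "z \<in> W" using \<zeta> by blast
   then show ?thesis unfolding inner_add_right inner_scaleR_right using True \<zeta>(7) \<zeta>'W by simp
  next
   case False
   show ?thesis
   proof (cases "(t, T z) \<in> K")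
    case True
    then have "z \<notin> N" using False by simp
    then have "\<zeta> z = 0" "\<zeta>' z = 0" "indicator N z = (0::real)" using \<zeta>(3,4) \<zeta>'0 by auto
    then show ?thesis by simp
   next
    case False
    then have "\<Gamma> (t, T z) = 0" "\<Psi> (t, T z) = 0" using \<Gamma>0 K(3) by blast+
    then show ?thesis by simp
   qed
  qed
  finally show ?thesis by (simp add: p)
 qed
 ultimately have 0: "(LBINT p. u p * (indicator N (snd p) * ((\<Gamma> (fst p, T (snd p)) \<bullet> (1, 0)) + indicator {0..} (fst p) * k (snd p) * (\<Gamma> (fst p, T (snd p)) \<bullet> (0, 1, 0))))) = 0"
  by (simp only:)
 let ?f = "\<lambda>p. u p * ((\<Gamma> (fst p, T (snd p)) \<bullet> (1, 0)) + indicator {0..} (fst p) * kk (snd p) * (\<Gamma> (fst p, T (snd p)) \<bullet> (0, 1, 0)))"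
 have [measurable]: "?f \<in> Borel" by measurable
 have "(LBINT p. indicator N (snd p) * ?f p) = 0"
 proof (subst 0[symmetric], rule integral_cong_AE)
  show "AE p in lborel. indicator N (snd p) * ?f p = u p * (indicator N (snd p) * ((\<Gamma> (fst p, T (snd p)) \<bullet> (1, 0)) + indicator {0..} (fst p) * k (snd p) * (\<Gamma> (fst p, T (snd p)) \<bullet> (0, 1, 0))))"
   using kk_eq2 by eventually_elim (auto simp: indicator_def)
 qed measurable
 then have "(LBINT x. ?f (fst x, Tinv (snd x)) * g (snd x)) = 0"
  by (subst (asm) to_D(2)) auto
 moreover have "?f (fst x, Tinv (snd x)) * g (snd x) = indicator D (snd x) * u (fst x, Tinv (snd x)) *
   (g (snd x) * (\<Gamma> x \<bullet> (1, 0)) + indicator {0..} (fst x) * (\<Gamma> x \<bullet> (0, 1, 0)))" for x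
 proof (cases "snd x \<in> D")
  case True
  \<comment> \<open>Here the Jacobian cancels: the time derivative keeps the weight
    \<open>g\<close>, while the \<open>s\<close>-derivative gets the coefficient 1.\<close>
  have "kk (Tinv (snd x)) * g (snd x) = 1" using True kk_pos[of "Tinv (snd x)"] by (simp add: g_def)
  then have "(a + i * kk (Tinv (snd x)) * s) * g (snd x) = g (snd x) * a + i * s" for a i s :: real
   by (simp add: algebra_simps)
  then show ?thesis using True by (simp add: T_Tinv mult.assoc)
 qed (simp add: g_bounds)
 ultimately show ?thesis by (simp only:)
qed

end

section \<open>Regularization in time\<close>

lemma integral_slices:
 fixes F :: "'a::euclidean_space \<times> 'b::euclidean_space \<Rightarrow> real"
 assumes "L1 F"
 shows "(LBINT x. F x) = (LBINT t. (LBINT z. F (t, z)))"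
  "(LBINT x. F x) = (LBINT z. (LBINT t. F (t, z)))"
proof -
 have i: "integrable (lborel \<Otimes>\<^sub>M lborel) F" using assms by (simp add: lborel_prod)
 show "(LBINT x. F x) = (LBINT t. (LBINT z. F (t, z)))"
  using lborel_pair.integral_fst'[OF i] by (simp add: lborel_prod)
 show "(LBINT x. F x) = (LBINT z. (LBINT t. F (t, z)))"
  using lborel_pair.integral_snd[of "\<lambda>t z. F (t, z)"] i by (simp add: lborel_prod)
qed

lemma integrable_mult_bounded:
 fixes m F :: "'a \<Rightarrow> real"
 assumes m: "integrable M m" and [measurable]: "F \<in> borel_measurable M" and C: "\<And>x. \<bar>F x\<bar> \<le> C"
 shows "integrable M (\<lambda>x. m x * F x)" "integrable M (\<lambda>x. F x * m x)"
proof -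
 have C0: "C \<ge> 0" using C[of undefined] by linarith
 have "\<bar>m x * F x\<bar> \<le> \<bar>C * m x\<bar>" for x
  using mult_left_mono[OF C[of x], of "\<bar>m x\<bar>"] C0 by (simp add: abs_mult mult.commute)
 then show "integrable M (\<lambda>x. m x * F x)"
  using m by (intro Bochner_Integration.integrable_bound[OF integrable_mult_right[OF m, of C]]) auto
 then show "integrable M (\<lambda>x. F x * m x)" by (simp add: mult.commute)
qed

lemma integral_mult_bounded_le:
 fixes m F :: "'a \<Rightarrow> real"
 assumes m: "integrable M m" and F: "F \<in> borel_measurable M" and C: "\<And>x. \<bar>F x\<bar> \<le> C"
 shows "\<bar>\<integral>x. m x * F x \<partial>M\<bar> \<le> C * (\<integral>x. \<bar>m x\<bar> \<partial>M)"
proof -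
 have "\<bar>\<integral>x. m x * F x \<partial>M\<bar> \<le> (\<integral>x. C * \<bar>m x\<bar> \<partial>M)"
 proof (rule order_trans[OF integral_abs_bound integral_mono])
  show "\<bar>m x * F x\<bar> \<le> C * \<bar>m x\<bar>" for x
   using mult_left_mono[OF C[of x], of "\<bar>m x\<bar>"] by (simp add: abs_mult mult.commute)
 qed (use integrable_mult_bounded[OF m F C] m in auto)
 then show ?thesis by simp
qed

definition tconv :: "(real \<times> 'b::euclidean_space \<Rightarrow> real) \<Rightarrow> (real \<Rightarrow> real) \<Rightarrow> real \<times> 'b \<Rightarrow> real" where
 "tconv F f x = (LBINT t. F (fst x - t, snd x) * f t)"

lemma tconv_measurable [measurable]:
 fixes F :: "real \<times> 'b::euclidean_space \<Rightarrow> real"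
 assumes [measurable]: "F \<in> Borel" "f \<in> Borel"
 shows "tconv F f \<in> Borel"
proof -
 have "(\<lambda>x. (LBINT t. F (fst x - t, snd x) * f t)) \<in> Borel"
  by (rule lborel.borel_measurable_lebesgue_integral) measurable
 then show ?thesis by (simp add: tconv_def[abs_def])
qed

lemma tconv_bound:
 fixes F :: "real \<times> 'b::euclidean_space \<Rightarrow> real"
 assumes F [measurable]: "F \<in> Borel" and C: "\<And>x. \<bar>F x\<bar> \<le> C" and f: "L1 f"
 shows "\<bar>tconv F f x\<bar> \<le> C * (LBINT t. \<bar>f t\<bar>)"
proof -
 have "\<bar>(LBINT t. f t * F (fst x - t, snd x))\<bar> \<le> C * (LBINT t. \<bar>f t\<bar>)"
  by (rule integral_mult_bounded_le[OF f _ C]) measurable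
 then show ?thesis by (simp add: tconv_def mult.commute)
qed

lemma conv_tensor:
 fixes F :: "real \<times> 'b::euclidean_space \<Rightarrow> real"
 assumes F [measurable]: "F \<in> Borel" and C: "\<And>x. \<bar>F x\<bar> \<le> C"
  and f: "L1 f" and \<kappa>: "L1 \<kappa>"
 shows "conv F (\<lambda>y. f (fst y) * \<kappa> (snd y)) x = (LBINT q. tconv F f (x - (0, q)) * \<kappa> q)"
proof -
 have [measurable]: "f \<in> Borel" "\<kappa> \<in> Borel"
  using borel_measurable_integrable f \<kappa> by auto
 have i: "L1 (\<lambda>y. F (x - y) * (f (fst y) * \<kappa> (snd y)))"
  by (rule integrable_mult_bounded(2)[OF integrable_tensor[OF f \<kappa>] _ C]) measurable
 have "conv F (\<lambda>y. f (fst y) * \<kappa> (snd y)) x = (LBINT y. F (x - y) * (f (fst y) * \<kappa> (snd y)))"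
  by (subst conv_swap) auto
 also have "\<dots> = (LBINT q. (LBINT t. F (x - (t, q)) * (f t * \<kappa> q)))"
  by (subst integral_slices(2)[OF i]) simp
 also have "\<dots> = (LBINT q. tconv F f (x - (0, q)) * \<kappa> q)"
 proof (rule Bochner_Integration.integral_cong[OF refl])
  fix q
  have "x - (t, q) = (fst (x - (0, q)) - t, snd (x - (0, q)))" for t by (cases x) simp
  then show "(LBINT t. F (x - (t, q)) * (f t * \<kappa> q)) = tconv F f (x - (0, q)) * \<kappa> q"
   unfolding tconv_def by (simp add: mult.assoc[symmetric])
 qed
 finally show ?thesis .
qed

text \<open>A convolution with a product kernel is a time average followed by an average in the
  other variables. Only the second one concentrates: this removes an auxiliary smoothing in
  \<open>(s, h)\<close> while the time kernel \<open>f\<close> is kept.\<close>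

lemma conv_tensor_tendsto:
 fixes F m :: "real \<times> 'b::euclidean_space \<Rightarrow> real"
 assumes m: "L1 m" and F [measurable]: "F \<in> Borel" and C: "\<And>x. \<bar>F x\<bar> \<le> C"
  and f: "L1 f" and \<kappa>: "\<And>n. mollifier (r n) (\<kappa> n)" and r: "r \<longlonglongrightarrow> 0"
 shows "(\<lambda>n. (LBINT x. m x * conv F (\<lambda>y. f (fst y) * \<kappa> n (snd y)) x)) \<longlonglongrightarrow> (LBINT x. m x * tconv F f x)"
proof -
 have [measurable]: "f \<in> Borel" using borel_measurable_integrable f by auto
 have "(\<lambda>n. (LBINT x. m x * (LBINT q. tconv F f (x - (0, q)) * \<kappa> n q))) \<longlonglongrightarrow> (LBINT x. m x * tconv F f x)"
 proof (rule weak_mollification_tendsto[OF m])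
  show "linear (\<lambda>q. (0, q))" by (rule linearI) auto
  show "\<bar>tconv F f x\<bar> \<le> C * (LBINT t. \<bar>f t\<bar>)" for x by (rule tconv_bound[OF F C f])
 qed (use mollifier_kernel[OF \<kappa>] r in \<open>auto simp: norm_Pair\<close>)
 moreover have "L1 (\<kappa> n)" for n using \<kappa>[of n] by (simp add: mollifier_def)
 ultimately show ?thesis by (simp add: conv_tensor[OF F C f])
qed

lemma tconv_tendsto:
 fixes F m :: "real \<times> 'b::euclidean_space \<Rightarrow> real"
 assumes m: "L1 m" and F [measurable]: "F \<in> Borel" and C: "\<And>x. \<bar>F x\<bar> \<le> C"
  and \<rho>: "\<And>n. kernel (r n) (\<rho> n)" and r: "r \<longlonglongrightarrow> 0"
 shows "(\<lambda>n. (LBINT x. m x * tconv F (\<rho> n) x)) \<longlonglongrightarrow> (LBINT x. m x * F x)"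
proof -
 have "(\<lambda>n. (LBINT x. m x * (LBINT t. F (x - (t, 0)) * \<rho> n t))) \<longlonglongrightarrow> (LBINT x. m x * F x)"
 proof (rule weak_mollification_tendsto[OF m F _ _ C \<rho> r])
  show "linear (\<lambda>q. (q, 0))" by (rule linearI) auto
 qed (auto simp: norm_Pair)
 moreover have "tconv F (\<rho> n) x = (LBINT t. F (x - (t, 0)) * \<rho> n t)" for n x
  unfolding tconv_def by (cases x) simp
 ultimately show ?thesis by simp
qed

text \<open>\<open>\<rho>\<close> is a kernel looking into the future and \<open>\<Theta>\<close> a cut-off which decreases from 1 to 0 on
 \<open>[0, \<sigma>]\<close> at the rate given by \<open>\<rho>\<close>.\<close>

definition time_kernel :: "real \<Rightarrow> (real \<Rightarrow> real) \<Rightarrow> (real \<Rightarrow> real) \<Rightarrow> (real \<Rightarrow> real) \<Rightarrow> (real \<Rightarrow> real) \<Rightarrow> bool" where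
 "time_kernel \<sigma> \<rho> \<rho>' \<Theta> \<kappa> \<longleftrightarrow> C1 \<rho> \<rho>' \<and> kernel \<sigma> \<rho> \<and> (\<forall>t. t \<notin> {-\<sigma>..0} \<longrightarrow> \<rho> t = 0) \<and>
  C1 \<Theta> (\<lambda>t. \<kappa> t - \<rho> (- t)) \<and> (\<forall>t\<ge>0. \<kappa> t = 0) \<and> L1 \<kappa> \<and> (LBINT t. \<kappa> t) = 1 \<and>
  (\<forall>t. \<bar>\<Theta> t\<bar> \<le> 1) \<and> (\<forall>t. t \<notin> {-2..\<sigma>} \<longrightarrow> \<Theta> t = 0)"

text \<open>\<open>\<Theta>\<close> mollifies the indicator of the interval from -1 to
  \<open>\<sigma> / 2\<close>. Its derivative is a bump near -1 minus a bump near
  \<open>\<sigma> / 2\<close>, and the latter, read backwards in time, is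
  \<open>\<rho>\<close>.\<close>

lemma time_kernel_exists:
 assumes \<sigma>: "0 < \<sigma>" "\<sigma> \<le> 1"
 obtains \<rho> \<rho>' \<Theta> \<kappa> where "time_kernel \<sigma> \<rho> \<rho>' \<Theta> \<kappa>"
proof -
 obtain \<kappa> :: "real \<Rightarrow> real" where \<kappa>: "mollifier (\<sigma> / 4) \<kappa>" using mollifier_exists[of "\<sigma> / 4"] \<sigma> by auto
 obtain k where k: "C1 \<kappa> k" using mollifier_C1[OF \<kappa>] by blast
 have \<kappa>0: "\<And>x. 0 \<le> \<kappa> x" "\<And>x. \<bar>x\<bar> > \<sigma> / 4 \<Longrightarrow> \<kappa> x = 0" "L1 \<kappa>" "(LBINT x. \<kappa> x) = 1"
  using \<kappa> by (auto simp: mollifier_def)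
 have [measurable]: "\<kappa> \<in> Borel" using k C1_borel by blast
 \<comment> \<open>A bump of radius \<open>\<sigma> / 4\<close> about \<open>- \<sigma> / 2\<close>,
   hence well inside the interval from \<open>- \<sigma>\<close> to 0.\<close>
 define \<rho> where "\<rho> t = \<kappa> (- (\<sigma> / 2) - t)" for t
 define \<Theta> where "\<Theta> = conv (indicator {-1..\<sigma>/2}) \<kappa>"
 have \<rho>: "C1 \<rho> (\<lambda>t. - k (- (\<sigma> / 2) - t))" unfolding \<rho>_def by (rule C1_reflect[OF k])
 have \<rho>0: "\<rho> t = 0" if "t \<notin> {-\<sigma>..0}" for t
  unfolding \<rho>_def by (rule \<kappa>0(2)) (use that \<sigma> in \<open>auto simp: abs_if\<close>)
 have i: "L1 (\<lambda>y. \<kappa> (x - y))" "(LBINT y. \<kappa> (x - y)) = 1" for x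
  using \<kappa>0 by (simp_all add: integrable_reflect_lborel integral_reflect_lborel)
 have ker: "kernel \<sigma> \<rho>"
  unfolding kernel_def
 proof (intro conjI allI impI)
  show "\<rho> \<in> Borel" using \<rho> C1_borel by blast
  show "\<rho> t = 0" if "t \<notin> cball 0 \<sigma>" for t
   by (rule \<rho>0) (use that \<sigma> in \<open>auto simp: abs_if split: if_splits\<close>)
 qed (use \<kappa>0(1) i in \<open>simp_all add: \<rho>_def[abs_def]\<close>)
 have ind: "L1 (indicator {-1..\<sigma>/2} :: real \<Rightarrow> real)"
  by (intro integrable_real_indicator) (use \<sigma> in auto)
 have "C1 \<Theta> (conv (indicator {-1..\<sigma>/2}) k)"
  unfolding \<Theta>_def by (rule conv_C1_bounded_support[OF ind _ k, of 1]) (use \<sigma> in \<open>auto simp: indicator_def\<close>)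
 moreover have "conv (indicator {-1..\<sigma>/2}) k = (\<lambda>t. \<kappa> (t + 1) - \<rho> (- t))"
 proof
  fix t
  have "(LBINT y. indicator {-1..\<sigma>/2} y *\<^sub>R k (t - y)) = (- \<kappa> (t - \<sigma>/2)) - (- \<kappa> (t - (-1)))"
  proof (rule integral_FTC_atLeastAtMost)
   show "((\<lambda>y. - \<kappa> (t - y)) has_vector_derivative k (t - y)) (at y within {-1..\<sigma>/2})" for y
   proof -
    have "((\<lambda>y. \<kappa> (t - y)) has_derivative (\<bullet>) (- k (t - y))) (at y within {-1..\<sigma>/2})"
     using C1_D[OF C1_reflect[OF k]] has_derivative_at_withinI by blast
    from has_derivative_minus[OF this] show ?thesis
     by (simp add: has_vector_derivative_def mult.commute)
   qed
   show "continuous_on {-1..\<sigma>/2} (\<lambda>y. k (t - y))"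
    by (intro continuous_on_compose2[OF C1_grad_continuous[OF k, of UNIV]] continuous_intros) auto
  qed (use \<sigma> in auto)
  then show "conv (indicator {-1..\<sigma>/2}) k t = \<kappa> (t + 1) - \<rho> (- t)"
   by (simp add: conv_def \<rho>_def)
 qed
 ultimately have \<Theta>: "C1 \<Theta> (\<lambda>t. \<kappa> (t + 1) - \<rho> (- t))" by simp
 have i2: "L1 (\<lambda>y. indicator {-1..\<sigma>/2} y * \<kappa> (x - y))" for x
  by (rule Bochner_Integration.integrable_bound[OF i(1)[of x]]) (auto simp: indicator_def)
 have "\<bar>\<Theta> t\<bar> \<le> 1" for t
 proof -
  have "0 \<le> \<Theta> t" unfolding \<Theta>_def conv_def using \<kappa>0 by (intro Bochner_Integration.integral_nonneg) auto
  moreover have "\<Theta> t \<le> (LBINT y. \<kappa> (t - y))" unfolding \<Theta>_def conv_def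
   using i2[of t] i(1)[of t] \<kappa>0(1) by (intro integral_mono) (auto simp: indicator_def)
  ultimately show ?thesis using i by simp
 qed
 moreover have "\<Theta> t = 0" if "t \<notin> {-2..\<sigma>}" for t
 proof -
  have "indicator {-1..\<sigma>/2} y * \<kappa> (t - y) = 0" for y
   using \<kappa>0(2)[of "t - y"] that \<sigma> by (cases "y \<in> {-1..\<sigma>/2}") (auto simp: abs_if)
  then show ?thesis unfolding \<Theta>_def conv_def real_scaleR_def by (simp only: Bochner_Integration.integral_zero)
 qed
 moreover have "\<kappa> (t + 1) = 0" if "t \<ge> 0" for t
  using \<kappa>0(2)[of "t + 1"] that \<sigma> by auto
 moreover have "L1 (\<lambda>t. \<kappa> (t + 1))" "(LBINT t. \<kappa> (t + 1)) = 1"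
  using \<kappa>0 by (simp_all add: integrable_translate_lborel integral_translate_lborel)
 ultimately have "time_kernel \<sigma> \<rho> (\<lambda>t. - k (- (\<sigma> / 2) - t)) \<Theta> (\<lambda>t. \<kappa> (t + 1))"
  unfolding time_kernel_def using \<rho> ker \<rho>0 \<Theta> by blast
 then show thesis using that by blast
qed

section \<open>Weak attainment of the initial value\<close>

locale two_solutions = straight_field +
 fixes u v :: "real \<times> (real^2) \<Rightarrow> real" and C :: real
 assumes u_sol: "transp N b u" and u_borel [measurable]: "u \<in> Borel" and u_bound: "\<And>p. \<bar>u p\<bar> \<le> C"
  and u_neg: "\<And>t z. t < 0 \<Longrightarrow> u (t, z) = u (-1, z)"
  and v_sol: "transp N b v" and v_borel [measurable]: "v \<in> Borel" and v_bound: "\<And>p. \<bar>v p\<bar> \<le> C"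
  and v_neg: "\<And>t z. t < 0 \<Longrightarrow> v (t, z) = v (-1, z)"
begin

definition U0 :: "real \<times> (real \<times> real) \<Rightarrow> real" where
 "U0 x = indicator D (snd x) * u (fst x, Tinv (snd x))"

definition U0g :: "real \<times> (real \<times> real) \<Rightarrow> real" where
 "U0g x = g (snd x) * U0 x"

definition uD :: "real \<times> real \<Rightarrow> real" where "uD q = U0 (-1, q)"

lemma C0: "C \<ge> 0" using u_bound[of undefined] by linarith

lemma U0_measurable [measurable]: "U0 \<in> Borel" "U0g \<in> Borel" "uD \<in> Borel"
proof -
 show [measurable]: "U0 \<in> Borel" unfolding U0_def[abs_def] by measurable
 show "U0g \<in> Borel" unfolding U0g_def[abs_def] by measurable
 show "uD \<in> Borel" unfolding uD_def[abs_def] by measurable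
qed

lemma U0_bound: "\<bar>U0 x\<bar> \<le> C" "\<bar>uD q\<bar> \<le> C" "\<bar>U0g x\<bar> \<le> C / \<alpha>"
proof -
 show 1: "\<bar>U0 x\<bar> \<le> C" for x using u_bound C0 by (auto simp: U0_def indicator_def)
 show "\<bar>uD q\<bar> \<le> C" unfolding uD_def by (rule 1)
 have "\<bar>g (snd x)\<bar> * \<bar>U0 x\<bar> \<le> (1 / \<alpha>) * C"
  using g_bounds[of "snd x"] 1[of x] C0 \<alpha> by (intro mult_mono) auto
 then show "\<bar>U0g x\<bar> \<le> C / \<alpha>" by (simp add: U0g_def abs_mult)
qed

lemma U0_neg: "fst x < 0 \<Longrightarrow> U0 x = uD (snd x)"
 using u_neg[of "fst x"] by (simp add: U0_def uD_def)

text \<open>The equation is tested with \<open>\<Theta>(t) * \<psi>(q)\<close>. The time derivative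
  of \<open>\<Theta>\<close> compares the initial value, seen near time -1, with the average of the
  solution over times up to \<open>\<sigma>\<close>. The \<open>s\<close>-derivative acts only
  during the times from 0 to \<open>\<sigma>\<close> and so contributes at most a multiple of
  \<open>\<sigma>\<close>.\<close>

lemma initial_test:
 assumes tk: "time_kernel \<sigma> \<rho> \<rho>' \<Theta> \<kappa>" and \<sigma>: "\<sigma> > 0"
  and \<psi>: "C1 \<psi> \<psi>'" "compact K" "K \<subseteq> D" "\<And>q. q \<notin> K \<Longrightarrow> \<psi> q = 0"
 shows "\<bar>(LBINT q. \<psi> q * (g q * (tconv U0 \<rho> (0, q) - uD q)))\<bar> \<le> C * \<sigma> * (LBINT q. \<bar>\<psi>' q \<bullet> (1, 0)\<bar>)"
proof -
 have \<rho>C: "C1 \<rho> \<rho>'" and \<rho>k: "kernel \<sigma> \<rho>" and \<rho>0: "\<And>t. t \<notin> {-\<sigma>..0} \<Longrightarrow> \<rho> t = 0"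
  and \<Theta>: "C1 \<Theta> (\<lambda>t. \<kappa> t - \<rho> (- t))" and \<kappa>0: "\<And>t. t \<ge> 0 \<Longrightarrow> \<kappa> t = 0" and \<kappa>i: "L1 \<kappa>" "(LBINT t. \<kappa> t) = 1"
  and \<Theta>1: "\<And>t. \<bar>\<Theta> t\<bar> \<le> 1" and \<Theta>0: "\<And>t. t \<notin> {-2..\<sigma>} \<Longrightarrow> \<Theta> t = 0"
  using tk unfolding time_kernel_def by auto
 have \<rho>i: "L1 \<rho>" using \<rho>k by (simp add: kernel_def)
 have [measurable]: "\<rho> \<in> Borel" "\<psi> \<in> Borel" "\<psi>' \<in> Borel" "\<Theta> \<in> Borel"
  "\<kappa> \<in> Borel"
  using C1_borel[OF \<rho>C] C1_borel[OF \<psi>(1)] C1_grad_borel[OF \<psi>(1)] C1_borel[OF \<Theta>] borel_measurable_integrable[OF \<kappa>i(1)] by auto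
 have \<psi>'0: "\<psi>' q = 0" if "q \<notin> K" for q
  using C1_grad_support[OF \<psi>(1) compact_imp_closed[OF \<psi>(2)] \<psi>(4) that] .
 have \<psi>i: "L1 \<psi>" by (rule compact_support_integrable[OF C1_continuous[OF \<psi>(1)] \<psi>(4,2)])
 have \<psi>'i: "L1 (\<lambda>q. \<psi>' q \<bullet> (1, 0))"
  by (intro integrable_inner_left compact_support_integrable[OF C1_grad_continuous[OF \<psi>(1)] _ \<psi>(2)] \<psi>'0)
 have \<psi>gi: "L1 (\<lambda>q. \<psi> q * g q)"
  by (rule integrable_mult_bounded(1)[OF \<psi>i, of _ "1 / \<alpha>"]) (use g_bounds in auto)
 have \<rho>ri: "L1 (\<lambda>t. \<rho> (- t))"
  using \<rho>i integrable_reflect_lborel[of \<rho> 0] by simp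
 have eq: "(LBINT x. indicator D (snd x) * u (fst x, Tinv (snd x)) *
   (g (snd x) * ((\<psi> (snd x) *\<^sub>R (\<kappa> (fst x) - \<rho> (- fst x)), \<Theta> (fst x) *\<^sub>R \<psi>' (snd x)) \<bullet> (1, 0)) +
   indicator {0..} (fst x) * ((\<psi> (snd x) *\<^sub>R (\<kappa> (fst x) - \<rho> (- fst x)), \<Theta> (fst x) *\<^sub>R \<psi>' (snd x)) \<bullet> (0, 1, 0)))) = 0"
 proof (rule equation_D[OF u_sol u_borel u_bound C1_tensor[OF \<Theta> \<psi>(1)]])
  show "compact ({-2..\<sigma>} \<times> K)" by (intro compact_Times \<psi>(2)) simp
  show "{-2..\<sigma>} \<times> K \<subseteq> UNIV \<times> D" using \<psi>(3) by auto
  show "\<Theta> (fst x) * \<psi> (snd x) = 0" if "x \<notin> {-2..\<sigma>} \<times> K" for x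
   using that \<Theta>0[of "fst x"] \<psi>(4)[of "snd x"] by (cases x) auto
 qed
 \<comment> \<open>The initial value, the average over later times and the horizontal term. In
   \<open>?I1\<close> the solution may be replaced by \<open>uD\<close> because
   \<open>\<kappa>\<close> lives on negative times.\<close>
 let ?I1 = "\<lambda>x :: real \<times> (real \<times> real). \<kappa> (fst x) * (\<psi> (snd x) * g (snd x) * uD (snd x))"
 let ?I2 = "\<lambda>x :: real \<times> (real \<times> real). (\<rho> (- fst x) * (\<psi> (snd x) * g (snd x))) * U0 x"
 let ?I3 = "\<lambda>x :: real \<times> (real \<times> real). (indicator {0..\<sigma>} (fst x) * (\<psi>' (snd x) \<bullet> (1, 0))) * (indicator {0..} (fst x) * \<Theta> (fst x) * U0 x)"
 have \<psi>gu: "L1 (\<lambda>q. \<psi> q * g q * uD q)"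
  by (rule integrable_mult_bounded(1)[OF \<psi>gi _ U0_bound(2)]) simp
 have I1: "L1 ?I1" by (rule integrable_tensor[OF \<kappa>i(1) \<psi>gu])
 have I2: "L1 ?I2"
  by (rule integrable_mult_bounded(1)[OF integrable_tensor[OF \<rho>ri \<psi>gi] _ U0_bound(1)]) simp
 have ind: "L1 (indicator {0..\<sigma>} :: real \<Rightarrow> real)"
  by (intro integrable_real_indicator) (use \<sigma> in auto)
 have b3: "\<bar>indicator {0..} (fst x) * \<Theta> (fst x) * U0 x\<bar> \<le> C" for x
  using mult_mono[OF \<Theta>1[of "fst x"] U0_bound(1)[of x]] by (auto simp: abs_mult indicator_def C0)
 have I3: "L1 ?I3"
  by (rule integrable_mult_bounded(1)[OF integrable_tensor[OF ind \<psi>'i] _ b3]) measurable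
 have pt: "indicator D (snd x) * u (fst x, Tinv (snd x)) *
   (g (snd x) * ((\<psi> (snd x) *\<^sub>R (\<kappa> (fst x) - \<rho> (- fst x)), \<Theta> (fst x) *\<^sub>R \<psi>' (snd x)) \<bullet> (1, 0)) +
   indicator {0..} (fst x) * ((\<psi> (snd x) *\<^sub>R (\<kappa> (fst x) - \<rho> (- fst x)), \<Theta> (fst x) *\<^sub>R \<psi>' (snd x)) \<bullet> (0, 1, 0)))
  = (?I1 x - ?I2 x) + ?I3 x" for x
 proof -
  have 1: "\<kappa> (fst x) * U0 x = \<kappa> (fst x) * uD (snd x)"
   using U0_neg[of x] \<kappa>0[of "fst x"] by (cases "fst x < 0") auto
  have 3: "indicator {0..} (fst x) * \<Theta> (fst x) = indicator {0..\<sigma>} (fst x) * (indicator {0..} (fst x) * \<Theta> (fst x))"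
   using \<Theta>0[of "fst x"] by (auto simp: indicator_def)
  have "indicator D (snd x) * u (fst x, Tinv (snd x)) = U0 x" by (simp add: U0_def)
  then have "indicator D (snd x) * u (fst x, Tinv (snd x)) *
   (g (snd x) * ((\<psi> (snd x) *\<^sub>R (\<kappa> (fst x) - \<rho> (- fst x)), \<Theta> (fst x) *\<^sub>R \<psi>' (snd x)) \<bullet> (1, 0)) +
   indicator {0..} (fst x) * ((\<psi> (snd x) *\<^sub>R (\<kappa> (fst x) - \<rho> (- fst x)), \<Theta> (fst x) *\<^sub>R \<psi>' (snd x)) \<bullet> (0, 1, 0)))
   = U0 x * (g (snd x) * (\<psi> (snd x) * (\<kappa> (fst x) - \<rho> (- fst x))) + indicator {0..} (fst x) * (\<Theta> (fst x) * (\<psi>' (snd x) \<bullet> (1, 0))))"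
   by simp
  also have "\<dots> = (\<kappa> (fst x) * U0 x) * (g (snd x) * \<psi> (snd x)) - ?I2 x + (indicator {0..} (fst x) * \<Theta> (fst x)) * (U0 x * (\<psi>' (snd x) \<bullet> (1, 0)))"
   by (simp add: algebra_simps)
  also have "\<dots> = (?I1 x - ?I2 x) + ?I3 x"
   unfolding 1 by (subst 3) (simp add: algebra_simps)
  finally show ?thesis .
 qed
 have "(LBINT x. ?I1 x) - (LBINT x. ?I2 x) + (LBINT x. ?I3 x) = 0"
  using eq unfolding pt using I1 I2 I3 by simp
 moreover have "(LBINT x. ?I1 x) = (LBINT q. \<psi> q * g q * uD q)"
  by (subst integral_tensor[OF \<kappa>i(1) \<psi>gu]) (simp add: \<kappa>i)
 moreover have "(LBINT x. ?I2 x) = (LBINT q. \<psi> q * g q * tconv U0 \<rho> (0, q))"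
 proof (subst integral_slices(2)[OF I2], rule Bochner_Integration.integral_cong[OF refl])
  fix q
  have "tconv U0 \<rho> (0, q) = (LBINT t. U0 (t, q) * \<rho> (- t))"
   using integral_reflect_lborel[of "\<lambda>t. U0 (t, q) * \<rho> (- t)" 0] by (simp add: tconv_def)
  moreover have "(LBINT t. \<rho> (- fst (t, q)) * (\<psi> (snd (t, q)) * g (snd (t, q))) * U0 (t, q))
   = (LBINT t. (\<psi> q * g q) * (U0 (t, q) * \<rho> (- t)))"
   by (simp add: mult_ac)
  ultimately show "(LBINT t. \<rho> (- fst (t, q)) * (\<psi> (snd (t, q)) * g (snd (t, q))) * U0 (t, q)) = \<psi> q * g q * tconv U0 \<rho> (0, q)"
   by simp
 qed
 moreover have "\<bar>(LBINT x. ?I3 x)\<bar> \<le> C * (\<sigma> * (LBINT q. \<bar>\<psi>' q \<bullet> (1, 0)\<bar>))"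
 proof -
  have "\<bar>(LBINT x. ?I3 x)\<bar> \<le> C * (LBINT x. \<bar>indicator {0..\<sigma>} (fst x) * (\<psi>' (snd x) \<bullet> (1, 0))\<bar>)"
   by (rule integral_mult_bounded_le[OF integrable_tensor[OF ind \<psi>'i] _ b3]) measurable
  also have "(LBINT x. \<bar>indicator {0..\<sigma>} (fst x) * (\<psi>' (snd x) \<bullet> (1, 0))\<bar>) =
    (LBINT x. indicator {0..\<sigma>} (fst x) * \<bar>\<psi>' (snd x) \<bullet> (1, 0)\<bar>)" by (simp add: abs_mult)
  also have "\<dots> = \<sigma> * (LBINT q. \<bar>\<psi>' q \<bullet> (1, 0)\<bar>)"
   by (subst integral_tensor[OF ind integrable_abs[OF \<psi>'i]]) (use \<sigma> in simp)
  finally show ?thesis .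
 qed
 moreover have "(LBINT q. \<psi> q * (g q * (tconv U0 \<rho> (0, q) - uD q))) =
   (LBINT q. \<psi> q * g q * tconv U0 \<rho> (0, q)) - (LBINT q. \<psi> q * g q * uD q)"
 proof -
  have "L1 (\<lambda>q. \<psi> q * g q * tconv U0 \<rho> (0, q))"
   by (rule integrable_mult_bounded(1)[OF \<psi>gi _ tconv_bound[OF _ U0_bound(1) \<rho>i]]) measurable
  then show ?thesis using \<psi>gu by (simp add: right_diff_distrib mult.assoc)
 qed
 ultimately show ?thesis by (simp add: mult.assoc)
qed

text \<open>\<open>initial_test\<close> involves a derivative of the test function, which a merely
  integrable \<open>h\<close> does not have. Mollifying at a fixed scale costs an error that is
  small uniformly in \<open>n\<close>, because the tested differences are bounded; then
  \<open>\<sigma>\<close> tends to 0.\<close>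

lemma initial_weak:
 assumes tk: "\<And>n. time_kernel (\<sigma> n) (\<rho> n) (\<rho>' n) (\<Theta> n) (\<kappa> n)" and \<sigma>: "\<And>n. \<sigma> n > 0" "\<sigma> \<longlonglongrightarrow> 0"
  and h: "L1 h" "compact K" "K \<subseteq> D" "\<And>q. q \<notin> K \<Longrightarrow> h q = 0"
 shows "(\<lambda>n. (LBINT q. h q * (g q * (tconv U0 (\<rho> n) (0, q) - uD q)))) \<longlonglongrightarrow> 0"
proof (rule LIMSEQ_I)
 fix \<eta> :: real assume \<eta>: "\<eta> > 0"
 define B where "B = (1 / \<alpha>) * (2 * C) + 1"
 have B0: "B > 0" using \<alpha> C0 by (simp add: B_def add_nonneg_pos)
 have [measurable]: "h \<in> Borel" using borel_measurable_integrable[OF h(1)] by simp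
 have \<rho>k: "kernel (\<sigma> n) (\<rho> n)" for n using tk[of n] by (simp add: time_kernel_def)
 then have \<rho>i: "L1 (\<rho> n)" "(LBINT t. \<bar>\<rho> n t\<bar>) = 1" for n by (auto simp: kernel_def)
 have \<rho>m [measurable]: "\<rho> n \<in> Borel" for n using borel_measurable_integrable[OF \<rho>i(1)] by simp
 define F where "F n q = g q * (tconv U0 (\<rho> n) (0, q) - uD q)" for n q
 have Fm [measurable]: "F n \<in> Borel" for n unfolding F_def by measurable
 have Fb: "\<bar>F n q\<bar> \<le> B" for n q
 proof -
  have "\<bar>tconv U0 (\<rho> n) (0, q)\<bar> \<le> C" using tconv_bound[OF U0_measurable(1) U0_bound(1) \<rho>i(1)[of n], of "(0, q)"] \<rho>i(2) by simp
  then have "\<bar>tconv U0 (\<rho> n) (0, q) - uD q\<bar> \<le> 2 * C" using U0_bound(2)[of q] by linarith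
  then have "\<bar>g q\<bar> * \<bar>tconv U0 (\<rho> n) (0, q) - uD q\<bar> \<le> (1 / \<alpha>) * (2 * C)"
   using g_bounds[of q] \<alpha> by (intro mult_mono) auto
  then show ?thesis by (simp add: F_def B_def abs_mult)
 qed
 obtain r K' where r: "r > 0" "compact K'" "K' \<subseteq> D" "\<And>x y. x \<in> K \<Longrightarrow> dist x y \<le> r \<Longrightarrow> y \<in> K'"
  using compact_neighbourhood[OF h(2) D_open h(3)] by metis
 obtain d where d: "d > 0" "\<And>y. norm y < d \<Longrightarrow> (LBINT x. \<bar>h (x + y) - h x\<bar>) \<le> \<eta> / (4 * B)"
  using L1_translation[OF h(1), of "\<eta> / (4 * B)"] \<eta> B0 by auto
 define s where "s = min r d / 2"
 have s: "s > 0" "s < r" "s < d" using r d by (auto simp: s_def)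
 obtain \<mu> :: "real \<times> real \<Rightarrow> real" where \<mu>: "mollifier s \<mu>" using mollifier_exists[OF s(1)] by blast
 obtain m where m: "C1 \<mu> m" using mollifier_C1[OF \<mu>] by blast
 have \<mu>0: "\<And>x. 0 \<le> \<mu> x" "\<And>x. x \<notin> cball 0 s \<Longrightarrow> \<mu> x = 0" using \<mu> by (auto simp: mollifier_def)
 have [measurable]: "\<mu> \<in> Borel" "m \<in> Borel" using m C1_borel C1_grad_borel by auto
 have m0: "m x = 0" if "x \<notin> cball 0 s" for x using C1_grad_support[OF m closed_cball \<mu>0(2) that] .
 define A where "A = (LBINT q. \<bar>m q \<bullet> (1, 0)\<bar>)"
 have A0: "A \<ge> 0" by (simp add: A_def)
 \<comment> \<open>The argument \<open>x - (- y)\<close> fits \<open>weak_mollification\<close> for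
   the reflection \<open>E y = - y\<close>. The average of \<open>F n\<close> about \<open>x\<close>
   is then the integral in \<open>initial_test\<close> for the mollifier translated to
   \<open>x\<close>.\<close>
 have inner: "\<bar>(LBINT y. F n (x - (- y)) * \<mu> y)\<bar> \<le> C * \<sigma> n * A" if x: "x \<in> K" for x n
 proof -
  have C1': "C1 (\<lambda>q. \<mu> (q + (- x))) (\<lambda>q. m (q + (- x)))" by (rule C1_shift[OF m])
  have "\<bar>(LBINT q. \<mu> (q + (- x)) * (g q * (tconv U0 (\<rho> n) (0, q) - uD q)))\<bar> \<le> C * \<sigma> n * (LBINT q. \<bar>m (q + (- x)) \<bullet> (1, 0)\<bar>)"
  proof (rule initial_test[OF tk \<sigma>(1) C1'])
   show "compact (cball x s)" by simp
   show "cball x s \<subseteq> D" 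
   proof
    fix y assume "y \<in> cball x s"
    then have "dist x y \<le> r" using s by simp
    then show "y \<in> D" using r(3) r(4)[OF x] by blast
   qed
   show "\<mu> (q + (- x)) = 0" if "q \<notin> cball x s" for q
    by (rule \<mu>0(2)) (use that in \<open>simp add: dist_norm norm_minus_commute\<close>)
  qed
  also have "(LBINT q. \<bar>m (q + (- x)) \<bullet> (1, 0)\<bar>) = A"
   unfolding A_def by (rule integral_translate_lborel[of "\<lambda>q. \<bar>m q \<bullet> (1, 0)\<bar>"]) measurable
  also have "(LBINT q. \<mu> (q + (- x)) * (g q * (tconv U0 (\<rho> n) (0, q) - uD q))) = (LBINT y. F n (x - (- y)) * \<mu> y)"
   using integral_translate_lborel[of "\<lambda>q. \<mu> (q + (- x)) * F n q" x] by (simp add: F_def mult.commute add.commute)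
  finally show ?thesis .
 qed
 define G where "G n x = indicator K x * (LBINT y. F n (x - (- y)) * \<mu> y)" for n x
 have [measurable]: "K \<in> sets borel" using h(2) borel_compact by blast
 have Gm [measurable]: "G n \<in> Borel" for n
 proof -
  have "(\<lambda>x. (LBINT y. F n (x - (- y)) * \<mu> y)) \<in> Borel"
   by (rule lborel.borel_measurable_lebesgue_integral) measurable
  then show ?thesis unfolding G_def by measurable
 qed
 have Gb: "\<bar>G n x\<bar> \<le> C * \<sigma> n * A" for n x
  using inner[of x n] C0 A0 \<sigma>(1)[of n] by (auto simp: G_def indicator_def)
 have est: "\<bar>(LBINT q. h q * F n q)\<bar> \<le> C * \<sigma> n * A * (LBINT q. \<bar>h q\<bar>) + \<eta> / 4" for n
 proof -
  have "\<bar>(LBINT x. h x * (LBINT y. F n (x - (- y)) * \<mu> y)) - (LBINT x. h x * F n x)\<bar> \<le> B * (\<eta> / (4 * B))"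
  proof (rule weak_mollification[OF h(1) Fm _ Fb mollifier_kernel[OF \<mu>]])
   show "(LBINT x. \<bar>h (x + - y) - h x\<bar>) \<le> \<eta> / (4 * B)" if "norm y \<le> s" for y
    by (rule d(2)) (use that s in simp)
  qed measurable
  also have "B * (\<eta> / (4 * B)) = \<eta> / 4" using B0 by simp
  also have "(LBINT x. h x * (LBINT y. F n (x - (- y)) * \<mu> y)) = (LBINT x. h x * G n x)"
   by (rule Bochner_Integration.integral_cong[OF refl]) (use h(4) in \<open>auto simp: G_def indicator_def\<close>)
  finally have 1: "\<bar>(LBINT x. h x * G n x) - (LBINT x. h x * F n x)\<bar> \<le> \<eta> / 4" .
  have "\<bar>(LBINT x. h x * G n x)\<bar> \<le> C * \<sigma> n * A * (LBINT q. \<bar>h q\<bar>)"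
   by (rule integral_mult_bounded_le[OF h(1) _ Gb]) measurable
  then show ?thesis using 1 by linarith
 qed
 have "(\<lambda>n. C * \<sigma> n * A * (LBINT q. \<bar>h q\<bar>) + \<eta> / 4) \<longlonglongrightarrow> C * 0 * A * (LBINT q. \<bar>h q\<bar>) + \<eta> / 4"
  by (intro tendsto_intros \<sigma>)
 then have "\<forall>\<^sub>F n in sequentially. C * \<sigma> n * A * (LBINT q. \<bar>h q\<bar>) + \<eta> / 4 < \<eta>"
  by (rule order_tendstoD(2)) (use \<eta> in simp)
 then obtain n0 where n0: "\<And>n. n \<ge> n0 \<Longrightarrow> C * \<sigma> n * A * (LBINT q. \<bar>h q\<bar>) + \<eta> / 4 < \<eta>"
  unfolding eventually_sequentially by blast
 then show "\<exists>n0. \<forall>n\<ge>n0. norm ((LBINT q. h q * (g q * (tconv U0 (\<rho> n) (0, q) - uD q))) - 0) < \<eta>"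
 proof (intro exI[of _ n0] allI impI)
  fix n assume "n0 \<le> n"
  then have "C * \<sigma> n * A * (LBINT q. \<bar>h q\<bar>) + \<eta> / 4 < \<eta>" by (rule n0)
  then show "norm ((LBINT q. h q * (g q * (tconv U0 (\<rho> n) (0, q) - uD q))) - 0) < \<eta>"
   using est[of n] unfolding F_def by simp
 qed
qed

end

lemma conv_measurable [measurable]:
 fixes F :: "'a::euclidean_space \<Rightarrow> real" and K :: "'a \<Rightarrow> 'b::euclidean_space"
 assumes [measurable]: "F \<in> Borel" "K \<in> Borel"
 shows "conv F K \<in> Borel"
proof -
 have "(\<lambda>x. (LBINT y. F y *\<^sub>R K (x - y))) \<in> Borel"
  by (rule lborel.borel_measurable_lebesgue_integral) measurable
 then show ?thesis by (simp add: conv_def[abs_def])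
qed

lemma conv_bounded:
 fixes F K :: "'a::euclidean_space \<Rightarrow> real"
 assumes F [measurable]: "F \<in> Borel" and C: "\<And>x. \<bar>F x\<bar> \<le> C" and K: "L1 K"
 shows "\<bar>conv F K x\<bar> \<le> C * (LBINT y. \<bar>K y\<bar>)"
proof -
 have [measurable]: "K \<in> Borel" using borel_measurable_integrable[OF K] by simp
 have "\<bar>(LBINT y. K y * F (x - y))\<bar> \<le> C * (LBINT y. \<bar>K y\<bar>)"
  by (rule integral_mult_bounded_le[OF K _ C]) measurable
 then show ?thesis by (subst conv_swap) (auto simp: mult.commute)
qed

lemma conv_inner:
 fixes F :: "'a::euclidean_space \<Rightarrow> real" and K :: "'a \<Rightarrow> 'b::euclidean_space"
 assumes [measurable]: "F \<in> Borel" and C: "\<And>x. \<bar>F x\<bar> \<le> C" and K: "L1 K"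
 shows "conv F K x \<bullet> v = conv F (\<lambda>y. K y \<bullet> v) x"
proof -
 have [measurable]: "K \<in> Borel" using borel_measurable_integrable[OF K] by simp
 have C0: "C \<ge> 0" using C[of undefined] by linarith
 have "L1 (\<lambda>y. K (x - y))" using K by (simp add: integrable_reflect_lborel)
 then have "L1 (\<lambda>y. F y *\<^sub>R K (x - y))"
  by (rule Bochner_Integration.integrable_bound[OF integrable_scaleR_right[of C]])
   (use C C0 in \<open>auto intro!: AE_I2 mult_right_mono\<close>)
 then show ?thesis unfolding conv_def by (subst integral_inner_left[symmetric]) auto
qed

lemma integrable_bounded_support:
 fixes F :: "'a::euclidean_space \<Rightarrow> real"
 assumes [measurable]: "F \<in> Borel" and B: "\<And>x. \<bar>F x\<bar> \<le> B" and S: "compact S" "\<And>x. x \<notin> S \<Longrightarrow> F x = 0"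
 shows "L1 F"
proof (rule Bochner_Integration.integrable_bound[OF integrable_mult_right[OF integrable_indicator_compact[OF S(1)], of B]])
 show "AE x in lborel. norm (F x) \<le> norm (B * indicator S x)"
  using B S(2) by (intro AE_I2) (auto simp: indicator_def intro: order_trans[OF _ abs_ge_self])
qed simp

lemma FTC_negative:
 fixes P :: "real \<Rightarrow> real"
 assumes D: "\<And>t. (P has_real_derivative p t) (at t)" and c: "continuous_on UNIV p"
  and 0: "\<And>t. t \<le> - R \<Longrightarrow> P t = 0" "\<And>t. t < - R \<Longrightarrow> p t = 0" and R: "R > 0"
 shows "(LBINT t. indicator {..<0} t * p t) = P 0"
proof -
 have [measurable]: "p \<in> Borel" by (rule borel_measurable_continuous_onI[OF c])
 have "(LBINT t. indicator {..<0} t * p t) = (LBINT t. indicator {-R..0} t *\<^sub>R p t)"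
 proof (rule integral_cong_AE)
  show "AE t in lborel. indicator {..<0} t * p t = indicator {-R..0} t *\<^sub>R p t"
   using AE_lborel_singleton[of 0]
  proof eventually_elim
   fix t :: real assume "t \<noteq> 0"
   then show "indicator {..<0} t * p t = indicator {-R..0} t *\<^sub>R p t"
    using 0(2)[of t] by (cases "t < - R") (auto simp: indicator_def)
  qed
 qed measurable
 also have "\<dots> = P 0 - P (- R)"
 proof (rule integral_FTC_atLeastAtMost)
  show "(P has_vector_derivative p t) (at t within {-R..0})" for t
   using D[of t] has_field_derivative_at_within has_real_derivative_iff_has_vector_derivative by blast
 qed (use R c continuous_on_subset in auto)
 finally show ?thesis using 0(1)[of "-R"] by simp
qed

section \<open>A regularized solution multiplied by another solution\<close>

context two_solutions
begin

text \<open>The equation tested with the reflected product kernel: the \<open>s\<close>-derivative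
  of the regularization of \<open>u\<close> is minus the regularized time derivative of
  \<open>g u\<close>. Because \<open>\<rho>\<close> looks into the future, the kernel placed at a
  time \<open>t \<ge> 0\<close> only meets times at which the field is switched on.\<close>

lemma horizontal:
 assumes tk: "time_kernel \<sigma> \<rho> \<rho>' \<Theta> \<mu>" and \<kappa>: "mollifier \<epsilon> \<kappa>" "C1 \<kappa> \<kappa>'"
  and x: "0 \<le> fst x" "cball (snd x) \<epsilon> \<subseteq> D"
 shows "conv U0 (\<lambda>y. \<rho> (fst y) * (\<kappa>' (snd y) \<bullet> (1, 0))) x = - conv U0g (\<lambda>y. \<rho>' (fst y) * \<kappa> (snd y)) x"
proof -
 have \<rho>: "C1 \<rho> \<rho>'" and \<rho>0: "\<And>t. t \<notin> {-\<sigma>..0} \<Longrightarrow> \<rho> t = 0" using tk unfolding time_kernel_def by auto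
 have \<rho>'0: "\<rho>' t = 0" if "t \<notin> {-\<sigma>..0}" for t
  using C1_grad_support[OF \<rho> _ \<rho>0 that] by simp
 have \<kappa>0: "\<kappa> q = 0" if "q \<notin> cball 0 \<epsilon>" for q using \<kappa>(1) that unfolding mollifier_def by blast
 have \<kappa>'0: "\<kappa>' q = 0" if "q \<notin> cball 0 \<epsilon>" for q using C1_grad_support[OF \<kappa>(2) closed_cball \<kappa>0 that] .
 have [measurable]: "\<rho> \<in> Borel" "\<rho>' \<in> Borel" "\<kappa> \<in> Borel" "\<kappa>' \<in> Borel"
  using C1_borel[OF \<rho>] C1_grad_borel[OF \<rho>] C1_borel[OF \<kappa>(2)] C1_grad_borel[OF \<kappa>(2)] by auto
 have \<rho>i: "L1 \<rho>" "L1 \<rho>'"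
  using compact_support_integrable[OF C1_continuous[OF \<rho>] \<rho>0 compact_Icc]
   compact_support_integrable[OF C1_grad_continuous[OF \<rho>] \<rho>'0 compact_Icc] by blast+
 have \<kappa>i: "L1 \<kappa>" "L1 (\<lambda>q. \<kappa>' q \<bullet> (1, 0))"
  using compact_support_integrable[OF C1_continuous[OF \<kappa>(2)] \<kappa>0 compact_cball]
   integrable_inner_left[OF compact_support_integrable[OF C1_grad_continuous[OF \<kappa>(2)] \<kappa>'0 compact_cball]] by blast+
 let ?M = "\<lambda>y :: real \<times> (real \<times> real). \<rho> (fst y) * \<kappa> (snd y)"
 let ?M' = "\<lambda>y :: real \<times> (real \<times> real). (\<kappa> (snd y) *\<^sub>R \<rho>' (fst y), \<rho> (fst y) *\<^sub>R \<kappa>' (snd y))"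
 let ?K = "{fst x..fst x + \<sigma>} \<times> cball (snd x) \<epsilon>"
 have eq: "(LBINT y. indicator D (snd y) * u (fst y, Tinv (snd y)) *
   (g (snd y) * (- ?M' (x - y) \<bullet> (1, 0)) + indicator {0..} (fst y) * (- ?M' (x - y) \<bullet> (0, 1, 0)))) = 0"
 proof (rule equation_D[OF u_sol u_borel u_bound C1_reflect[OF C1_tensor[OF \<rho> \<kappa>(2)]]])
  show "compact ?K" by (intro compact_Times compact_cball compact_Icc)
  show "?K \<subseteq> UNIV \<times> D" using x by auto
  show "\<rho> (fst (x - y)) * \<kappa> (snd (x - y)) = 0" if "y \<notin> ?K" for y
  proof (cases "fst (x - y) \<in> {-\<sigma>..0} \<and> snd (x - y) \<in> cball 0 \<epsilon>")
   case True
   then have "y \<in> ?K" by (auto simp: mem_Times_iff dist_norm norm_minus_commute)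
   then show ?thesis using that by simp
  qed (use \<rho>0[of "fst (x - y)"] \<kappa>0[of "snd (x - y)"] in auto)
 qed
 let ?A = "\<lambda>y. U0g y * (\<rho>' (fst (x - y)) * \<kappa> (snd (x - y)))" and ?B = "\<lambda>y. U0 y * (\<rho> (fst (x - y)) * (\<kappa>' (snd (x - y)) \<bullet> (1, 0)))"
 have pt: "indicator D (snd y) * u (fst y, Tinv (snd y)) *
   (g (snd y) * (- ?M' (x - y) \<bullet> (1, 0)) + indicator {0..} (fst y) * (- ?M' (x - y) \<bullet> (0, 1, 0))) = - ?A y - ?B y" for y
 proof -
  have 1: "indicator {0..} (fst y) * \<rho> (fst (x - y)) = \<rho> (fst (x - y))"
   using x(1) \<rho>0[of "fst (x - y)"] by (cases "fst y \<ge> 0") auto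
  have "indicator D (snd y) * u (fst y, Tinv (snd y)) = U0 y" by (simp add: U0_def)
  then have "indicator D (snd y) * u (fst y, Tinv (snd y)) *
   (g (snd y) * (- ?M' (x - y) \<bullet> (1, 0)) + indicator {0..} (fst y) * (- ?M' (x - y) \<bullet> (0, 1, 0)))
   = - U0 y * (g (snd y) * (\<kappa> (snd (x - y)) * \<rho>' (fst (x - y))) + (indicator {0..} (fst y) * \<rho> (fst (x - y))) * (\<kappa>' (snd (x - y)) \<bullet> (1, 0)))"
   by (simp add: algebra_simps)
  also have "\<dots> = - ?A y - ?B y" unfolding 1 by (simp add: U0g_def algebra_simps)
  finally show ?thesis .
 qed
 have i: "L1 (\<lambda>y. \<rho>' (fst (x - y)) * \<kappa> (snd (x - y)))" "L1 (\<lambda>y. \<rho> (fst (x - y)) * (\<kappa>' (snd (x - y)) \<bullet> (1, 0)))"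
  using integrable_reflect_lborel[of "\<lambda>y. \<rho>' (fst y) * \<kappa> (snd y)" x] integrable_tensor[OF \<rho>i(2) \<kappa>i(1)]
   integrable_reflect_lborel[of "\<lambda>y. \<rho> (fst y) * (\<kappa>' (snd y) \<bullet> (1, 0))" x] integrable_tensor[OF \<rho>i(1) \<kappa>i(2)] by auto
 have A: "L1 ?A" by (rule integrable_mult_bounded(2)[OF i(1) _ U0_bound(3)]) simp
 have B: "L1 ?B" by (rule integrable_mult_bounded(2)[OF i(2) _ U0_bound(1)]) simp
 have "- (LBINT y. ?A y) - (LBINT y. ?B y) = 0"
  using eq unfolding pt using A B by simp
 then show ?thesis unfolding conv_def real_scaleR_def by linarith
qed

text \<open>A test function times a \<open>C1\<close> function of
  \<open>(t, z \<bullet> e, H z)\<close> is of the form covered by \<open>transp_H\<close>. The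
  factor \<open>k\<close> is the derivative of \<open>z \<bullet> e\<close> along \<open>b\<close>;
  the derivative in the level contributes nothing.\<close>

lemma test_product:
 assumes \<phi>: "C1 \<phi> \<phi>'" and K: "compact K" "K \<subseteq> UNIV \<times> N" "\<And>p. p \<notin> K \<Longrightarrow> \<phi> p = 0" and W: "C1 W W'"
 shows "(LBINT q. v q * (W (fst q, T (snd q)) * (\<phi>' q \<bullet> cfield b q) +
   \<phi> q * ((W' (fst q, T (snd q)) \<bullet> (1, 0)) + indicator {0..} (fst q) * k (snd q) * (W' (fst q, T (snd q)) \<bullet> (0, 1, 0))))) = 0"
proof -
 define \<Phi> where "\<Phi> y = \<phi> (fst y, fst (snd y)) * W (fst y, fst (snd y) \<bullet> e, snd (snd y))" for y :: "real \<times> (real^2) \<times> real"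
 let ?A = "\<lambda>y :: real \<times> (real^2) \<times> real. (fst y, fst (snd y) \<bullet> e, snd (snd y))"
 let ?P = "\<lambda>y :: real \<times> (real^2) \<times> real. (fst y, fst (snd y))"
 let ?D = "\<lambda>y w :: real \<times> (real^2) \<times> real. \<phi> (?P y) * (W' (?A y) \<bullet> ?A w) + (\<phi>' (?P y) \<bullet> ?P w) * W (?A y)"
 have D: "(\<Phi> has_derivative ?D y) (at y)" for y
 proof -
  have 1: "((\<lambda>y. \<phi> (?P y)) has_derivative (\<lambda>w. \<phi>' (?P y) \<bullet> ?P w)) (at y)"
   by (rule has_derivative_compose[OF _ C1_D[OF \<phi>]]) (auto intro!: derivative_eq_intros)
  have 2: "((\<lambda>y. W (?A y)) has_derivative (\<lambda>w. W' (?A y) \<bullet> ?A w)) (at y)"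
   by (rule has_derivative_compose[OF _ C1_D[OF W]]) (auto intro!: derivative_eq_intros)
  show ?thesis unfolding \<Phi>_def using has_derivative_mult[OF 1 2] by simp
 qed
 have cont: "continuous_on UNIV (\<lambda>y. ?D y w)" for w
  by (intro continuous_intros continuous_on_compose2[OF C1_continuous[OF \<phi>, of UNIV]]
    continuous_on_compose2[OF C1_grad_continuous[OF \<phi>, of UNIV]]
    continuous_on_compose2[OF C1_continuous[OF W, of UNIV]]
    continuous_on_compose2[OF C1_grad_continuous[OF W, of UNIV]]) auto
 have "(LBINT q. v q * ((\<Sum>e\<in>Basis. ?D (fst q, snd q, H (snd q)) e *\<^sub>R e) \<bullet> (1, indicator {0..} (fst q) *\<^sub>R b (snd q), 0))) = 0"
  by (rule transp_H[OF v_sol N_V v_borel v_bound C1I(1)[OF D cont] K(1,2)]) (simp add: \<Phi>_def K(3))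
 moreover have "(\<Sum>e\<in>Basis. ?D (fst q, snd q, H (snd q)) e *\<^sub>R e) \<bullet> (1, indicator {0..} (fst q) *\<^sub>R b (snd q), 0)
   = W (fst q, T (snd q)) * (\<phi>' q \<bullet> cfield b q) +
   \<phi> q * ((W' (fst q, T (snd q)) \<bullet> (1, 0)) + indicator {0..} (fst q) * k (snd q) * (W' (fst q, T (snd q)) \<bullet> (0, 1, 0)))" for q
 proof -
  obtain t z where q: "q = (t, z)" by (cases q)
  have "(\<Sum>e\<in>Basis. ?D (fst q, snd q, H (snd q)) e *\<^sub>R e) \<bullet> (1, indicator {0..} (fst q) *\<^sub>R b (snd q), 0)
   = ?D (t, z, H z) (1, indicator {0..} t *\<^sub>R b z, 0)"
   unfolding q fst_conv snd_conv by (rule C1I(2)[OF D cont, of "(t, z, H z)" "(1, indicator {0..} t *\<^sub>R b z, 0)", unfolded fst_conv snd_conv])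
  also have "\<dots> = \<phi> (t, z) * (W' (t, T z) \<bullet> (1, indicator {0..} t * k z, 0)) + (\<phi>' (t, z) \<bullet> cfield b (t, z)) * W (t, T z)"
   by (simp add: T_def cfield_def)
  also have "(1, indicator {0..} t * k z, 0) = (1, 0) + (indicator {0..} t * k z) *\<^sub>R (0, 1, 0::real)"
   by (simp add: zero_prod_def)
  finally show ?thesis unfolding inner_add_right inner_scaleR_right by (simp add: q)
 qed
 ultimately show ?thesis by (simp only:)
qed

context
 fixes \<phi> :: "real \<times> (real^2) \<Rightarrow> real" and \<phi>' and K :: "(real \<times> (real^2)) set"
 assumes \<phi>: "C1 \<phi> \<phi>'" and K: "compact K" "K \<subseteq> UNIV \<times> N" "\<And>p. p \<notin> K \<Longrightarrow> \<phi> p = 0"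
begin

abbreviation "back x \<equiv> (fst x, Tinv (snd x))"

text \<open>\<open>m1\<close>, \<open>m2\<close> and \<open>m3\<close> are the coefficients of the
  function \<open>W\<close>, of its time derivative and of its \<open>s\<close>-derivative in
  \<open>test_product\<close>, carried over to the coordinates \<open>(t, s, h)\<close>.\<close>

definition m1 :: "real \<times> (real \<times> real) \<Rightarrow> real" where
 "m1 x = v (back x) * (\<phi>' (back x) \<bullet> cfield b (back x)) * g (snd x)"

definition m2 :: "real \<times> (real \<times> real) \<Rightarrow> real" where
 "m2 x = v (back x) * \<phi> (back x) * g (snd x)"

definition m3 :: "real \<times> (real \<times> real) \<Rightarrow> real" where
 "m3 x = v (back x) * \<phi> (back x) * indicator {0..} (fst x) * (kk (Tinv (snd x)) * g (snd x))"

lemma \<phi>'0: "q \<notin> K \<Longrightarrow> \<phi>' q = 0"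
 using C1_grad_support[OF \<phi> compact_imp_closed[OF K(1)] K(3)] .

lemma KV: "K \<subseteq> UNIV \<times> V" using K(2) N_V by blast

lemma K_N: "q \<in> K \<Longrightarrow> snd q \<in> N" using K(2) by auto

lemma \<phi>_meas [measurable]: "\<phi> \<in> Borel" "\<phi>' \<in> Borel"
 using C1_borel[OF \<phi>] C1_grad_borel[OF \<phi>] by auto

lemma ind_N_eq:
 fixes q :: "real \<times> (real^2)"
 shows "(\<And>q. q \<notin> K \<Longrightarrow> f q = 0) \<Longrightarrow> indicator N (snd q) * f q = (f q :: real)"
 using K_N[of q] by (cases "q \<in> K") auto

lemma m_integrable: "L1 m1" "L1 m2" "L1 m3"
proof -
 obtain A where A: "A > 0" "\<And>q. norm (\<phi> q) \<le> A"
  using compact_support_bounded[OF C1_continuous[OF \<phi>] K(1,3)] by blast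
 obtain A' where A': "A' > 0" "\<And>q. norm (\<phi>' q) \<le> A'"
  using compact_support_bounded[OF C1_grad_continuous[OF \<phi>] K(1) \<phi>'0] by blast
 have i1: "L1 (\<lambda>q. v q * (\<phi>' q \<bullet> cfield b q))"
 proof (rule integrable_cfield[OF K(1) KV, of _ "C * A'"])
  fix q :: "real \<times> (real^2)"
  have "\<bar>\<phi>' q \<bullet> cfield b q\<bar> \<le> A' * (1 + norm (b (snd q)))"
   by (rule order_trans[OF Cauchy_Schwarz_ineq2 mult_mono]) (use A' norm_cfield[of b q] in auto)
  then have "\<bar>v q\<bar> * \<bar>\<phi>' q \<bullet> cfield b q\<bar> \<le> C * (A' * (1 + norm (b (snd q))))"
   using v_bound C0 by (intro mult_mono) auto
  then show "\<bar>v q * (\<phi>' q \<bullet> cfield b q)\<bar> \<le> C * A' * (1 + norm (b (snd q)))" by (simp add: abs_mult mult.assoc)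
 qed (use \<phi>'0 in auto)
 have vp: "\<bar>v q\<bar> * \<bar>\<phi> q\<bar> \<le> C * A" for q using v_bound A C0 by (intro mult_mono) auto
 have i2: "L1 (\<lambda>q. v q * \<phi> q)"
 proof (rule integrable_cfield[OF K(1) KV, of _ "C * A"])
  show "\<bar>v q * \<phi> q\<bar> \<le> C * A * (1 + norm (b (snd q)))" for q
   using mult_mono[OF vp[of q], of 1 "1 + norm (b (snd q))"] C0 A by (simp add: abs_mult)
 qed (use K(3) in auto)
 have i3: "L1 (\<lambda>q. v q * \<phi> q * indicator {0..} (fst q) * kk (snd q))"
 proof (rule integrable_cfield[OF K(1) KV, of _ "C * A * (1 + \<alpha>)"])
  fix q :: "real \<times> (real^2)"
  have "\<bar>k (snd q)\<bar> \<le> norm (b (snd q))" using Cauchy_Schwarz_ineq2[of "b (snd q)" e] e by simp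
  then have "kk (snd q) \<le> \<alpha> + norm (b (snd q))" using \<alpha> by (auto simp: kk_def)
  also have "\<dots> \<le> (1 + \<alpha>) * (1 + norm (b (snd q)))" using \<alpha> by (simp add: algebra_simps)
  finally have kb: "\<bar>kk (snd q)\<bar> \<le> (1 + \<alpha>) * (1 + norm (b (snd q)))" using kk_pos[of "snd q"] by simp
  have "(\<bar>v q\<bar> * \<bar>\<phi> q\<bar>) * (\<bar>indicator {0..} (fst q)\<bar> * \<bar>kk (snd q)\<bar>) \<le> (C * A) * (1 * ((1 + \<alpha>) * (1 + norm (b (snd q)))))"
   by (rule mult_mono[OF vp mult_mono[OF _ kb]]) (use C0 A(1) in \<open>auto simp: indicator_def\<close>)
  then show "\<bar>v q * \<phi> q * indicator {0..} (fst q) * kk (snd q)\<bar> \<le> C * A * (1 + \<alpha>) * (1 + norm (b (snd q)))"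
   by (simp add: abs_mult mult.assoc)
 qed (use K(3) in auto)
 have [measurable]: "(\<lambda>q. v q * (\<phi>' q \<bullet> cfield b q)) \<in> Borel" "(\<lambda>q. v q * \<phi> q) \<in> Borel"
  "(\<lambda>q. v q * \<phi> q * indicator {0..} (fst q) * kk (snd q)) \<in> Borel" by measurable
 have "(\<lambda>q. indicator N (snd q) * (v q * (\<phi>' q \<bullet> cfield b q))) = (\<lambda>q. v q * (\<phi>' q \<bullet> cfield b q))"
  using ind_N_eq[of "\<lambda>q. v q * (\<phi>' q \<bullet> cfield b q)"] \<phi>'0 by auto
 then show "L1 m1" using to_D(1)[of "\<lambda>q. v q * (\<phi>' q \<bullet> cfield b q)"] i1 by (simp add: m1_def[abs_def])
 have "(\<lambda>q. indicator N (snd q) * (v q * \<phi> q)) = (\<lambda>q. v q * \<phi> q)"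
  using ind_N_eq[of "\<lambda>q. v q * \<phi> q"] K(3) by auto
 then show "L1 m2" using to_D(1)[of "\<lambda>q. v q * \<phi> q"] i2 by (simp add: m2_def[abs_def])
 have "(\<lambda>q. indicator N (snd q) * (v q * \<phi> q * indicator {0..} (fst q) * kk (snd q))) = (\<lambda>q. v q * \<phi> q * indicator {0..} (fst q) * kk (snd q))"
  using ind_N_eq[of "\<lambda>q. v q * \<phi> q * indicator {0..} (fst q) * kk (snd q)"] K(3) by auto
 then show "L1 m3" using to_D(1)[of "\<lambda>q. v q * \<phi> q * indicator {0..} (fst q) * kk (snd q)"] i3
  by (simp add: m3_def[abs_def] mult.assoc)
qed

text \<open>Take for \<open>W\<close> in \<open>test_product\<close> a smoothing of \<open>u\<close>
  in all of \<open>(t, s, h)\<close>, replace its \<open>s\<close>-derivative by means of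
  \<open>horizontal\<close>, and let the smoothing in \<open>(s, h)\<close> disappear. At
  nonnegative times the two terms with \<open>\<rho>'\<close> then cancel, because \<open>g\<close>
  passes through the time average and \<open>kk * g = 1\<close> on \<open>D\<close>. Only negative
  times are left in the second integral.\<close>

lemma regularized:
 assumes tk: "time_kernel \<sigma> \<rho> \<rho>' \<Theta> \<mu>"
 shows "(LBINT x. m1 x * tconv U0 \<rho> x) + (LBINT x. m2 x * (1 - indicator {0..} (fst x)) * tconv U0 \<rho>' x) = 0"
proof -
 have \<rho>: "C1 \<rho> \<rho>'" and \<rho>0: "\<And>t. t \<notin> {-\<sigma>..0} \<Longrightarrow> \<rho> t = 0" using tk unfolding time_kernel_def by auto
 have \<rho>'0: "\<rho>' t = 0" if "t \<notin> {-\<sigma>..0}" for t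
  using C1_grad_support[OF \<rho> _ \<rho>0 that] by simp
 have \<rho>i: "L1 \<rho>" "L1 \<rho>'"
  using compact_support_integrable[OF C1_continuous[OF \<rho>] \<rho>0 compact_Icc]
   compact_support_integrable[OF C1_grad_continuous[OF \<rho>] \<rho>'0 compact_Icc] by blast+
 have [measurable]: "\<rho> \<in> Borel" "\<rho>' \<in> Borel"
  using C1_borel[OF \<rho>] C1_grad_borel[OF \<rho>] by auto
 have "\<exists>\<kappa> :: real \<times> real \<Rightarrow> real. mollifier (1 / (real n + 1)) \<kappa>" for n
  by (rule mollifier_exists[of "1 / (real n + 1)"]) (auto simp: add_nonneg_pos)
 then obtain \<kappa> :: "nat \<Rightarrow> real \<times> real \<Rightarrow> real" where \<kappa>: "\<And>n. mollifier (1 / (real n + 1)) (\<kappa> n)" by metis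
 then have "\<forall>n. \<exists>k. C1 (\<kappa> n) k" using mollifier_C1 by blast
 then obtain \<kappa>' where \<kappa>': "\<And>n. C1 (\<kappa> n) (\<kappa>' n)" by metis
 have \<kappa>0: "\<kappa> n q = 0" if "q \<notin> cball 0 (1 / (real n + 1))" for q n using \<kappa>[of n] that unfolding mollifier_def by blast
 have \<kappa>'0: "\<kappa>' n q = 0" if "q \<notin> cball 0 (1 / (real n + 1))" for q n using C1_grad_support[OF \<kappa>' closed_cball \<kappa>0 that] .
 have [measurable]: "\<kappa> n \<in> Borel" "\<kappa>' n \<in> Borel" for n
  using C1_borel[OF \<kappa>'] C1_grad_borel[OF \<kappa>'] by auto
 have \<kappa>i: "L1 (\<kappa> n)" "L1 (\<kappa>' n)" for n
  using compact_support_integrable[OF C1_continuous[OF \<kappa>'] \<kappa>0 compact_cball]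
   compact_support_integrable[OF C1_grad_continuous[OF \<kappa>'] \<kappa>'0 compact_cball] by blast+
 have lim0: "(\<lambda>n. 1 / (real n + 1)) \<longlonglongrightarrow> 0" by (rule inverse_Suc_tendsto_0)
 let ?M = "\<lambda>n y :: real \<times> (real \<times> real). \<rho> (fst y) * \<kappa> n (snd y)"
 let ?M' = "\<lambda>n y :: real \<times> (real \<times> real). (\<kappa> n (snd y) *\<^sub>R \<rho>' (fst y), \<rho> (fst y) *\<^sub>R \<kappa>' n (snd y))"
 let ?M1 = "\<lambda>n y :: real \<times> (real \<times> real). \<rho>' (fst y) * \<kappa> n (snd y)"
 have M: "C1 (?M n) (?M' n)" for n by (rule C1_tensor[OF \<rho> \<kappa>'])
 have Mi: "L1 (?M n)" "L1 (?M1 n)" for n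
  using integrable_tensor[OF \<rho>i(1) \<kappa>i(1)] integrable_tensor[OF \<rho>i(2) \<kappa>i(1)] by blast+
 have M0: "?M n y = 0" if "y \<notin> {-\<sigma>..0} \<times> cball 0 (1 / (real n + 1))" for n y
  using that \<rho>0 \<kappa>0 by (cases y) auto
 have cS: "compact ({-\<sigma>..0::real} \<times> cball (0::real\<times>real) (1 / (real n + 1)))" for n
  by (intro compact_Times compact_Icc compact_cball)
 have M'0: "?M' n y = 0" if "y \<notin> {-\<sigma>..0} \<times> cball 0 (1 / (real n + 1))" for n y
  using C1_grad_support[OF M compact_imp_closed[OF cS] M0 that] .
 have M'i: "L1 (?M' n)" for n
  by (rule compact_support_integrable[OF C1_grad_continuous[OF M] M'0 cS])
 let ?W = "\<lambda>n. conv U0 (?M n)" and ?Wt = "\<lambda>n. conv U0 (?M1 n)" and ?Y = "\<lambda>n. conv U0g (?M1 n)"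
 have W: "C1 (?W n) (conv U0 (?M' n))" for n
 proof -
  obtain r where r: "{-\<sigma>..0::real} \<times> cball (0::real\<times>real) (1 / (real n + 1)) \<subseteq> cball 0 r"
   using compact_subset_cball[OF cS] by blast
  show ?thesis
  proof (rule conv_C1[OF _ M])
   show "?M n z = 0" if "z \<notin> cball 0 r" for z using M0 r that by blast
   show "L1 (\<lambda>y. indicator (cball 0 R) y * U0 y)" for R
    by (rule integrable_mult_bounded(1)[OF integrable_indicator_compact[OF compact_cball] _ U0_bound(1)]) simp
  qed
 qed
 have Wt: "conv U0 (?M' n) x \<bullet> (1, 0) = ?Wt n x" for n x
  by (subst conv_inner[OF U0_measurable(1) U0_bound(1) M'i]) (simp add: mult.commute)
 have Ws: "conv U0 (?M' n) x \<bullet> (0, 1, 0) = conv U0 (\<lambda>y. \<rho> (fst y) * (\<kappa>' n (snd y) \<bullet> (1, 0))) x" for n x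
  by (subst conv_inner[OF U0_measurable(1) U0_bound(1) M'i]) simp
 have sKN: "snd ` K \<subseteq> N" using K(2) by auto
 have cT: "compact (T ` snd ` K)"
  by (intro compact_continuous_image continuous_on_subset[OF T_continuous sKN] compact_snd_image K)
 have TD: "T ` snd ` K \<subseteq> D" using sKN T_in_D by auto
 \<comment> \<open>The margin keeps the kernel, centred at points of the straightened support,
   inside \<open>D\<close> once its radius is below \<open>r\<close>.\<close>
 obtain r K' where r: "r > 0" "K' \<subseteq> D" "\<And>x y. x \<in> T ` snd ` K \<Longrightarrow> dist x y \<le> r \<Longrightarrow> y \<in> K'"
  using compact_neighbourhood[OF cT D_open TD] by metis
 have Wm [measurable]: "?W n \<in> Borel" "?Wt n \<in> Borel" "?Y n \<in> Borel" for n
  by (intro conv_measurable; measurable)+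
 have key: "(LBINT x. m1 x * ?W n x) + (LBINT x. m2 x * ?Wt n x) - (LBINT x. m3 x * ?Y n x) = 0"
  if n: "1 / (real n + 1) < r" for n
 proof -
  let ?S = "\<lambda>q :: real \<times> (real^2). (fst q, T (snd q))"
  let ?f = "\<lambda>q. v q * (?W n (?S q) * (\<phi>' q \<bullet> cfield b q) + \<phi> q * (?Wt n (?S q) - indicator {0..} (fst q) * kk (snd q) * ?Y n (?S q)))"
  have fm [measurable]: "?f \<in> Borel" by measurable
  have t: "(LBINT q. v q * (?W n (?S q) * (\<phi>' q \<bullet> cfield b q) +
    \<phi> q * ((conv U0 (?M' n) (?S q) \<bullet> (1, 0)) + indicator {0..} (fst q) * k (snd q) * (conv U0 (?M' n) (?S q) \<bullet> (0, 1, 0))))) = 0"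
   by (rule test_product[OF \<phi> K W])
  have gm [measurable]: "conv U0 (?M' n) \<in> Borel" by (rule C1_grad_borel[OF W])
  have "(LBINT q. ?f q) = 0"
  proof (subst t[symmetric], rule integral_cong_AE)
   show "AE q in lborel. ?f q = v q * (?W n (?S q) * (\<phi>' q \<bullet> cfield b q) +
    \<phi> q * ((conv U0 (?M' n) (?S q) \<bullet> (1, 0)) + indicator {0..} (fst q) * k (snd q) * (conv U0 (?M' n) (?S q) \<bullet> (0, 1, 0))))"
    using kk_eq2
   proof eventually_elim
    fix q :: "real \<times> (real^2)" assume kq: "snd q \<in> N \<longrightarrow> kk (snd q) = k (snd q)"
    \<comment> \<open>The replacement of the \<open>s\<close>-derivative concerns points of the
      support at nonnegative times; at all other points its coefficient vanishes.\<close>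
    show "?f q = v q * (?W n (?S q) * (\<phi>' q \<bullet> cfield b q) +
    \<phi> q * ((conv U0 (?M' n) (?S q) \<bullet> (1, 0)) + indicator {0..} (fst q) * k (snd q) * (conv U0 (?M' n) (?S q) \<bullet> (0, 1, 0))))"
    proof (cases "q \<in> K \<and> 0 \<le> fst q")
     case True
     then have "kk (snd q) = k (snd q)" using kq K_N by blast
     moreover have "conv U0 (?M' n) (?S q) \<bullet> (0, 1, 0) = - ?Y n (?S q)"
      unfolding Ws
     proof (rule horizontal[OF tk \<kappa> \<kappa>'])
      show "0 \<le> fst (?S q)" using True by simp
      show "cball (snd (?S q)) (1 / (real n + 1)) \<subseteq> D"
      proof
       fix y assume "y \<in> cball (snd (?S q)) (1 / (real n + 1))"
       then have "dist (T (snd q)) y \<le> r" using n by simp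
       then show "y \<in> D" using r(2) r(3)[of "T (snd q)" y] True by blast
      qed
     qed
     ultimately show ?thesis unfolding Wt by simp
    next
     case False
     then show ?thesis using K(3)[of q] \<phi>'0[of q] unfolding Wt by (cases "q \<in> K") auto
    qed
   qed
  qed measurable
  moreover have "indicator N (snd q) * ?f q = ?f q" for q
   by (rule ind_N_eq) (use K(3) \<phi>'0 in auto)
  ultimately have "(LBINT q. indicator N (snd q) * ?f q) = 0" by (simp only:)
  then have "(LBINT x. ?f (back x) * g (snd x)) = 0" unfolding to_D(2)[OF fm] .
  moreover have "?f (back x) * g (snd x) = m1 x * ?W n x + m2 x * ?Wt n x - m3 x * ?Y n x" for x
  proof (cases "snd x \<in> D")
   case True
   then have "?S (back x) = x" by (simp add: T_Tinv)
   then show ?thesis unfolding m1_def m2_def m3_def by (simp add: algebra_simps)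
  next
   case False
   then show ?thesis unfolding m1_def m2_def m3_def using g_bounds(3) by simp
  qed
  ultimately have "(LBINT x. m1 x * ?W n x + m2 x * ?Wt n x - m3 x * ?Y n x) = 0" by (simp only:)
  moreover have "L1 (\<lambda>x. m1 x * ?W n x)"
   by (rule integrable_mult_bounded(1)[OF m_integrable(1) _ conv_bounded[OF U0_measurable(1) U0_bound(1) Mi(1)]]) simp
  moreover have "L1 (\<lambda>x. m2 x * ?Wt n x)"
   by (rule integrable_mult_bounded(1)[OF m_integrable(2) _ conv_bounded[OF U0_measurable(1) U0_bound(1) Mi(2)]]) simp
  moreover have "L1 (\<lambda>x. m3 x * ?Y n x)"
   by (rule integrable_mult_bounded(1)[OF m_integrable(3) _ conv_bounded[OF U0_measurable(2) U0_bound(3) Mi(2)]]) simp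
  ultimately show ?thesis by simp
 qed
 have "(\<lambda>n. (LBINT x. m1 x * ?W n x) + (LBINT x. m2 x * ?Wt n x) - (LBINT x. m3 x * ?Y n x)) \<longlonglongrightarrow>
   (LBINT x. m1 x * tconv U0 \<rho> x) + (LBINT x. m2 x * tconv U0 \<rho>' x) - (LBINT x. m3 x * tconv U0g \<rho>' x)"
  by (intro tendsto_diff tendsto_add conv_tensor_tendsto[OF m_integrable(1) U0_measurable(1) U0_bound(1) \<rho>i(1) \<kappa> lim0]
   conv_tensor_tendsto[OF m_integrable(2) U0_measurable(1) U0_bound(1) \<rho>i(2) \<kappa> lim0]
   conv_tensor_tendsto[OF m_integrable(3) U0_measurable(2) U0_bound(3) \<rho>i(2) \<kappa> lim0])
 moreover have "\<forall>\<^sub>F n in sequentially. (LBINT x. m1 x * ?W n x) + (LBINT x. m2 x * ?Wt n x) - (LBINT x. m3 x * ?Y n x) = 0"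
  using order_tendstoD(2)[OF lim0 r(1)] by eventually_elim (rule key)
 ultimately have "(\<lambda>n::nat. 0) \<longlonglongrightarrow> (LBINT x. m1 x * tconv U0 \<rho> x) + (LBINT x. m2 x * tconv U0 \<rho>' x) - (LBINT x. m3 x * tconv U0g \<rho>' x)"
  by (rule Lim_transform_eventually)
 then have 0: "(LBINT x. m1 x * tconv U0 \<rho> x) + (LBINT x. m2 x * tconv U0 \<rho>' x) - (LBINT x. m3 x * tconv U0g \<rho>' x) = 0"
  using LIMSEQ_unique tendsto_const by blast
 \<comment> \<open>No commutator arises here, since \<open>g\<close> does not depend on
   time.\<close>
 have "tconv U0g \<rho>' x = g (snd x) * tconv U0 \<rho>' x" for x
  unfolding tconv_def U0g_def by (simp add: mult.assoc)
 moreover have "m3 x * (g (snd x) * c) = m2 x * indicator {0..} (fst x) * c" for x c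
 proof (cases "snd x \<in> D")
  case True
  then have "kk (Tinv (snd x)) * g (snd x) = 1" using kk_pos[of "Tinv (snd x)"] by (simp add: g_def)
  then show ?thesis by (simp add: m3_def m2_def)
 next
  case False
  then show ?thesis by (simp add: m2_def g_bounds)
 qed
 ultimately have "(LBINT x. m3 x * tconv U0g \<rho>' x) = (LBINT x. m2 x * indicator {0..} (fst x) * tconv U0 \<rho>' x)"
  by (simp only:)
 moreover have "(LBINT x. m2 x * (1 - indicator {0..} (fst x)) * tconv U0 \<rho>' x) =
  (LBINT x. m2 x * tconv U0 \<rho>' x) - (LBINT x. m2 x * indicator {0..} (fst x) * tconv U0 \<rho>' x)"
 proof -
  have 1: "L1 (\<lambda>x. m2 x * tconv U0 \<rho>' x)"
   by (rule integrable_mult_bounded(1)[OF m_integrable(2) _ tconv_bound[OF U0_measurable(1) U0_bound(1) \<rho>i(2)]]) measurable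
  have "L1 (\<lambda>x. (m2 x * tconv U0 \<rho>' x) * indicator {0..} (fst x))"
   by (rule integrable_mult_bounded(1)[OF 1, of _ 1]) (auto simp: indicator_def)
  then have 2: "L1 (\<lambda>x. m2 x * indicator {0..} (fst x) * tconv U0 \<rho>' x)" by (simp add: mult_ac)
  show ?thesis using 1 2 by (simp add: left_diff_distrib right_diff_distrib)
 qed
 ultimately show ?thesis using 0 by simp
qed

end

end

section \<open>Slices of test functions and stability of the equation\<close>

lemma C1_slice_time:
 assumes \<phi>: "C1 \<phi> (\<phi>' :: real \<times> (real^2) \<Rightarrow> _)"
 shows "((\<lambda>t. \<phi> (t, z)) has_real_derivative \<phi>' (t, z) \<bullet> (1, 0)) (at t)"
  "continuous_on UNIV (\<lambda>t. \<phi>' (t, z) \<bullet> (1, 0))"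
proof -
 have "((\<lambda>t. \<phi> (t, z)) has_derivative (\<lambda>v. \<phi>' (t, z) \<bullet> (v, 0))) (at t)"
  by (rule has_derivative_compose[OF _ C1_D[OF \<phi>]]) (auto intro!: derivative_eq_intros)
 moreover have "(\<lambda>v. \<phi>' (t, z) \<bullet> (v, 0)) = (*) (\<phi>' (t, z) \<bullet> (1, 0))"
  by (auto simp: fun_eq_iff inner_prod_def)
 ultimately show "((\<lambda>t. \<phi> (t, z)) has_real_derivative \<phi>' (t, z) \<bullet> (1, 0)) (at t)"
  by (simp add: has_field_derivative_def)
 show "continuous_on UNIV (\<lambda>t. \<phi>' (t, z) \<bullet> (1, 0))"
  by (intro continuous_intros continuous_on_compose2[OF C1_grad_continuous[OF \<phi>, of UNIV]]) auto
qed

lemma C1_slice_space: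
 assumes \<phi>: "C1 \<phi> (\<phi>' :: real \<times> (real^2) \<Rightarrow> _)"
 shows "C1 (\<lambda>z. \<phi> (t, z)) (\<lambda>z. snd (\<phi>' (t, z)))"
 unfolding C1_def
proof (intro conjI allI)
 fix z
 have "((\<lambda>z. \<phi> (t, z)) has_derivative (\<lambda>v. \<phi>' (t, z) \<bullet> (0, v))) (at z)"
  by (rule has_derivative_compose[OF _ C1_D[OF \<phi>]]) (auto intro!: derivative_eq_intros)
 moreover have "(\<lambda>v. \<phi>' (t, z) \<bullet> (0, v)) = (\<bullet>) (snd (\<phi>' (t, z)))"
  by (auto simp: fun_eq_iff inner_prod_def)
 ultimately show "((\<lambda>z. \<phi> (t, z)) has_derivative (\<bullet>) (snd (\<phi>' (t, z)))) (at z)" by simp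
 show "continuous_on UNIV (\<lambda>z. snd (\<phi>' (t, z)))"
  by (intro continuous_intros continuous_on_compose2[OF C1_grad_continuous[OF \<phi>, of UNIV]]) auto
qed

lemma C1_time_integral_zero:
 fixes \<phi> :: "real \<times> (real^2) \<Rightarrow> real"
 assumes \<phi>: "C1 \<phi> \<phi>'" and K: "compact K" "\<And>p. p \<notin> K \<Longrightarrow> \<phi> p = 0"
 shows "(LBINT t. \<phi>' (t, z) \<bullet> (1, 0)) = 0"
proof -
 have \<phi>'0: "\<phi>' q = 0" if "q \<notin> K" for q
  using C1_grad_support[OF \<phi> compact_imp_closed[OF K(1)] K(2) that] .
 obtain R0 where R0: "fst ` K \<subseteq> cball 0 R0" using compact_subset_cball[OF compact_fst_image[OF K(1)]] by blast
 define R where "R = max R0 0 + 1"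
 have R: "R > 0" "\<And>t z. R \<le> \<bar>t\<bar> \<Longrightarrow> (t, z) \<notin> K" using R0 by (force simp: R_def)+
 have "(LBINT t. \<phi>' (t, z) \<bullet> (1, 0)) = (LBINT t. indicator {-R..R} t *\<^sub>R (\<phi>' (t, z) \<bullet> (1, 0)))"
 proof (rule Bochner_Integration.integral_cong[OF refl])
  fix t show "\<phi>' (t, z) \<bullet> (1, 0) = indicator {-R..R} t *\<^sub>R (\<phi>' (t, z) \<bullet> (1, 0))"
   using R(2)[of t z] \<phi>'0[of "(t, z)"] by (cases "t \<in> {-R..R}") (auto simp: abs_if split: if_splits)
 qed
 also have "\<dots> = \<phi> (R, z) - \<phi> (- R, z)"
 proof (rule integral_FTC_atLeastAtMost)
  show "((\<lambda>t. \<phi> (t, z)) has_vector_derivative \<phi>' (t, z) \<bullet> (1, 0)) (at t within {-R..R})" for t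
   using C1_slice_time(1)[OF \<phi>] has_field_derivative_at_within has_real_derivative_iff_has_vector_derivative by blast
  show "continuous_on {-R..R} (\<lambda>t. \<phi>' (t, z) \<bullet> (1, 0))"
   by (rule continuous_on_subset[OF C1_slice_time(2)[OF \<phi>]]) simp
 qed (use R in simp)
 also have "\<dots> = 0" using R K(2) by simp
 finally show ?thesis .
qed

context ham_field
begin

lemma test_integrable:
 assumes \<phi>: "C1 \<phi> \<phi>'" and K: "compact K" "K \<subseteq> UNIV \<times> V" "\<And>p. p \<notin> K \<Longrightarrow> \<phi> p = 0"
  and [measurable]: "w \<in> Borel" and w: "\<And>p. \<bar>w p\<bar> \<le> C"
 shows "L1 (\<lambda>p. w p * (\<phi>' p \<bullet> cfield b p))"
proof -
 have C0: "C \<ge> 0" using w[of undefined] by linarith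
 have \<phi>'0: "\<phi>' q = 0" if "q \<notin> K" for q
  using C1_grad_support[OF \<phi> compact_imp_closed[OF K(1)] K(3) that] .
 have [measurable]: "\<phi>' \<in> Borel" using C1_grad_borel[OF \<phi>] .
 obtain A' where A': "A' > 0" "\<And>q. norm (\<phi>' q) \<le> A'"
  using compact_support_bounded[OF C1_grad_continuous[OF \<phi>] K(1) \<phi>'0] by blast
 show ?thesis
 proof (rule integrable_cfield[OF K(1,2), of _ "C * A'"])
  fix q :: "real \<times> (real^2)"
  have "\<bar>\<phi>' q \<bullet> cfield b q\<bar> \<le> A' * (1 + norm (b (snd q)))"
   by (rule order_trans[OF Cauchy_Schwarz_ineq2 mult_mono]) (use A' norm_cfield[of b q] in auto)
  then have "\<bar>w q\<bar> * \<bar>\<phi>' q \<bullet> cfield b q\<bar> \<le> C * (A' * (1 + norm (b (snd q))))"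
   using w C0 by (intro mult_mono) auto
  then show "\<bar>w q * (\<phi>' q \<bullet> cfield b q)\<bar> \<le> C * A' * (1 + norm (b (snd q)))" by (simp add: abs_mult mult.assoc)
 qed (use \<phi>'0 in auto)
qed

lemma transp_iff:
 "transp M b w \<longleftrightarrow> (\<forall>\<phi> \<phi>' K. C1 \<phi> \<phi>' \<longrightarrow> compact K \<longrightarrow> K \<subseteq> UNIV \<times> M \<longrightarrow> (\<forall>p. p \<notin> K \<longrightarrow> \<phi> p = 0)
   \<longrightarrow> (LBINT p. w p * (\<phi>' p \<bullet> cfield b p)) = 0)"
 unfolding transp_def divfree_def by (simp add: inner_commute)

lemma transpD:
 assumes "transp M b w" "C1 \<phi> \<phi>'" "compact K" "K \<subseteq> UNIV \<times> M" "\<And>p. p \<notin> K \<Longrightarrow> \<phi> p = 0"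
 shows "(LBINT p. w p * (\<phi>' p \<bullet> cfield b p)) = 0"
 using assms unfolding transp_iff by blast

lemma transp_mono: "transp M b w \<Longrightarrow> M' \<subseteq> M \<Longrightarrow> transp M' b w"
 unfolding transp_iff by (meson Sigma_mono order_trans subset_refl)

lemma transp_cmult: "transp M b w \<Longrightarrow> transp M b (\<lambda>p. c * w p)"
 unfolding transp_iff by (auto simp: mult.assoc)

lemma transp_add:
 assumes "M \<subseteq> V" "transp M b w" "transp M b w'"
  and "w \<in> Borel" "\<And>p. \<bar>w p\<bar> \<le> C" "w' \<in> Borel" "\<And>p. \<bar>w' p\<bar> \<le> C'"
 shows "transp M b (\<lambda>p. w p + w' p)"
 unfolding transp_iff
proof (intro allI impI)
 fix \<phi> \<phi>' and K :: "(real \<times> (real^2)) set" assume a: "C1 \<phi> \<phi>'" "compact K" "K \<subseteq> UNIV \<times> M" "\<forall>p. p \<notin> K \<longrightarrow> \<phi> p = 0"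
 have KV: "K \<subseteq> UNIV \<times> V" using a(3) assms(1) by auto
 have i: "L1 (\<lambda>p. w p * (\<phi>' p \<bullet> cfield b p))" "L1 (\<lambda>p. w' p * (\<phi>' p \<bullet> cfield b p))"
  using test_integrable[OF a(1,2) KV _ assms(4,5)] test_integrable[OF a(1,2) KV _ assms(6,7)] a(4) by blast+
 show "(LBINT p. (w p + w' p) * (\<phi>' p \<bullet> cfield b p)) = 0"
  using i transpD[OF assms(2) a(1-3)] transpD[OF assms(3) a(1-3)] a(4) by (simp add: distrib_right)
qed

lemma transp_limit:
 assumes M: "M \<subseteq> V" and w: "\<And>n. transp M b (w n)" "\<And>n. w n \<in> Borel" "\<And>n p. \<bar>w n p\<bar> \<le> C"
  and lim: "\<And>p. (\<lambda>n. w n p) \<longlonglongrightarrow> w' p" and w' [measurable]: "w' \<in> Borel"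
 shows "transp M b w'"
 unfolding transp_iff
proof (intro allI impI)
 fix \<phi> \<phi>' and K :: "(real \<times> (real^2)) set" assume a: "C1 \<phi> \<phi>'" "compact K" "K \<subseteq> UNIV \<times> M" "\<forall>p. p \<notin> K \<longrightarrow> \<phi> p = 0"
 have KV: "K \<subseteq> UNIV \<times> V" using a(3) M by auto
 have [measurable]: "w n \<in> Borel" "\<phi>' \<in> Borel" for n using w(2) C1_grad_borel[OF a(1)] by auto
 have C0: "C \<ge> 0" using w(3)[of undefined undefined] by linarith
 have dom: "L1 (\<lambda>p. C * (\<phi>' p \<bullet> cfield b p))"
  by (rule test_integrable[OF a(1,2) KV, of "\<lambda>_. C" C]) (use a(4) C0 in auto)
 have "(\<lambda>n. (LBINT p. w n p * (\<phi>' p \<bullet> cfield b p))) \<longlonglongrightarrow> (LBINT p. w' p * (\<phi>' p \<bullet> cfield b p))"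
 proof (rule integral_dominated_convergence[where w="\<lambda>p. \<bar>C * (\<phi>' p \<bullet> cfield b p)\<bar>"])
  show "AE p in lborel. (\<lambda>n. w n p * (\<phi>' p \<bullet> cfield b p)) \<longlonglongrightarrow> w' p * (\<phi>' p \<bullet> cfield b p)"
   by (intro AE_I2 tendsto_intros lim)
  show "AE p in lborel. norm (w n p * (\<phi>' p \<bullet> cfield b p)) \<le> \<bar>C * (\<phi>' p \<bullet> cfield b p)\<bar>" for n
   using w(3) C0 by (intro AE_I2) (auto simp: abs_mult intro!: mult_right_mono)
 qed (use dom in auto)
 moreover have "(LBINT p. w n p * (\<phi>' p \<bullet> cfield b p)) = 0" for n
  using transpD[OF w(1) a(1-3)] a(4) by blast
 ultimately have "(\<lambda>n::nat. 0) \<longlonglongrightarrow> (LBINT p. w' p * (\<phi>' p \<bullet> cfield b p))" by (simp only:)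
 then show "(LBINT p. w' p * (\<phi>' p \<bullet> cfield b p)) = 0"
  using LIMSEQ_unique[OF _ tendsto_const] by blast
qed

text \<open>Both parts of the integrand vanish separately: the time derivative after integration in
  \<open>t\<close>, and the spatial part on each time slice because \<open>b\<close> has no
  divergence. Constants are the start of the induction over polynomials.\<close>

lemma transp_one: "transp V b (\<lambda>p. 1)"
 unfolding transp_iff
proof (intro allI impI)
 fix \<phi> \<phi>' and K :: "(real \<times> (real^2)) set" assume a: "C1 \<phi> \<phi>'" "compact K" "K \<subseteq> UNIV \<times> V" "\<forall>p. p \<notin> K \<longrightarrow> \<phi> p = 0"
 have \<phi>'0: "\<phi>' q = 0" if "q \<notin> K" for q
  using C1_grad_support[OF a(1) compact_imp_closed[OF a(2)] _ that] a(4) by blast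
 have [measurable]: "\<phi>' \<in> Borel" using C1_grad_borel[OF a(1)] .
 have i1: "L1 (\<lambda>p. \<phi>' p \<bullet> (1, 0))"
  by (intro integrable_inner_left compact_support_integrable[OF C1_grad_continuous[OF a(1)] \<phi>'0 a(2)])
 have i: "L1 (\<lambda>p. \<phi>' p \<bullet> cfield b p)"
  using test_integrable[OF a(1-3), of "\<lambda>_. 1" 1] a(4) by simp
 have eq: "\<phi>' p \<bullet> cfield b p = \<phi>' p \<bullet> (1, 0) + indicator {0..} (fst p) * (b (snd p) \<bullet> snd (\<phi>' p))" for p
  by (cases "\<phi>' p") (simp add: cfield_def inner_commute)
 have i2: "L1 (\<lambda>p. indicator {0..} (fst p) * (b (snd p) \<bullet> snd (\<phi>' p)))"
  using Bochner_Integration.integrable_diff[OF i i1] unfolding eq by simp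
 have "(LBINT p. \<phi>' p \<bullet> (1, 0)) = (LBINT z. (LBINT t. \<phi>' (t, z) \<bullet> (1, 0)))"
  by (rule integral_slices(2)[OF i1])
 also have "\<dots> = 0" using C1_time_integral_zero[OF a(1,2)] a(4) by simp
 finally have 1: "(LBINT p. \<phi>' p \<bullet> (1, 0)) = 0" .
 have "(LBINT p. indicator {0..} (fst p) * (b (snd p) \<bullet> snd (\<phi>' p))) = (LBINT t. (LBINT z. indicator {0..} t * (b z \<bullet> snd (\<phi>' (t, z)))))"
  using integral_slices(1)[OF i2] by simp
 also have "\<dots> = integral\<^sup>L (lborel :: real measure) (\<lambda>_. 0)"
 proof (rule Bochner_Integration.integral_cong[OF refl])
  fix t :: real
  have "(LBINT z. b z \<bullet> snd (\<phi>' (t, z))) = 0"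
   by (rule divfreeD[OF b_div C1_slice_space[OF a(1)] compact_snd_image[OF a(2)]]) (use a(3,4) in force)+
  then show "(LBINT z. indicator {0..} t * (b z \<bullet> snd (\<phi>' (t, z)))) = 0" by simp
 qed
 finally have 2: "(LBINT p. indicator {0..} (fst p) * (b (snd p) \<bullet> snd (\<phi>' p))) = 0" by simp
 show "(LBINT p. 1 * (\<phi>' p \<bullet> cfield b p)) = 0"
  unfolding mult_1 eq using i1 i2 1 2 by simp
qed

end

section \<open>Removing the time regularization\<close>

context two_solutions
begin

text \<open>In \<open>regularized\<close>, the remainder at negative times is integrated by parts in
  \<open>t\<close>, which is possible since \<open>v\<close> is constant there. This gives a
  boundary term at time 0 and an integral without \<open>\<rho>'\<close>. As the kernel shrinks, the
  boundary term converges by \<open>initial_weak\<close> and cancels against the limit of that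
  integral, so the integral of \<open>m1 * U0\<close> vanishes, which is the equation for
  \<open>u v\<close>.\<close>

lemma product: "transp N b (\<lambda>p. u p * v p)"
 unfolding transp_iff
proof (intro allI impI)
 fix \<phi> \<phi>' and K :: "(real \<times> (real^2)) set" assume a: "C1 \<phi> \<phi>'" "compact K" "K \<subseteq> UNIV \<times> N" "\<forall>p. p \<notin> K \<longrightarrow> \<phi> p = 0"
 have K3: "\<And>p. p \<notin> K \<Longrightarrow> \<phi> p = 0" using a(4) by blast
 note \<phi> = a(1) and K = a(2,3) K3
 have \<phi>'0: "\<phi>' q = 0" if "q \<notin> K" for q
  using C1_grad_support[OF \<phi> compact_imp_closed[OF K(1)] K(3) that] .
 have [measurable]: "\<phi> \<in> Borel" "\<phi>' \<in> Borel"
  using C1_borel[OF \<phi>] C1_grad_borel[OF \<phi>] by auto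
 let ?m1 = "m1 \<phi>'" and ?m2 = "m2 \<phi>"
 note mi = m_integrable[OF \<phi> K]
 obtain A where A: "A > 0" "\<And>q. norm (\<phi> q) \<le> A"
  using compact_support_bounded[OF C1_continuous[OF \<phi>] K(1,3)] by blast
 obtain A' where A': "A' > 0" "\<And>q. norm (\<phi>' q) \<le> A'"
  using compact_support_bounded[OF C1_grad_continuous[OF \<phi>] K(1) \<phi>'0] by blast
 obtain R0 where R0: "fst ` K \<subseteq> cball 0 R0" using compact_subset_cball[OF compact_fst_image[OF K(1)]] by blast
 define R where "R = max R0 0 + 1"
 have R: "R > 0" "\<And>t z. t \<le> - R \<Longrightarrow> (t, z) \<notin> K" and RK: "fst ` K \<subseteq> cball 0 R" using R0 by (force simp: R_def)+
 define Kh where "Kh = T ` snd ` K"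
 have sKN: "snd ` K \<subseteq> N" using K(2) by auto
 have cKh: "compact Kh" unfolding Kh_def
  by (intro compact_continuous_image continuous_on_subset[OF T_continuous sKN] compact_snd_image K)
 have KhD: "Kh \<subseteq> D" unfolding Kh_def using sKN T_in_D by auto
 have inKh: "q \<in> Kh" if "q \<in> D" "(t, Tinv q) \<in> K" for t q
  unfolding Kh_def using that T_Tinv[OF that(1)] by (metis imageI snd_conv)
 define \<sigma> where "\<sigma> n = 1 / (real n + 1)" for n
 have \<sigma>: "0 < \<sigma> n" "\<sigma> n \<le> 1" for n by (auto simp: \<sigma>_def)
 have \<sigma>0: "\<sigma> \<longlonglongrightarrow> 0" unfolding \<sigma>_def by (rule inverse_Suc_tendsto_0)
 have "\<forall>n. \<exists>\<rho> \<rho>' \<Theta> \<mu>. time_kernel (\<sigma> n) \<rho> \<rho>' \<Theta> \<mu>"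
  using time_kernel_exists[OF \<sigma>] by metis
 then obtain \<rho> \<rho>' \<Theta> \<mu> where tk: "\<And>n. time_kernel (\<sigma> n) (\<rho> n) (\<rho>' n) (\<Theta> n) (\<mu> n)" by metis
 have \<rho>: "C1 (\<rho> n) (\<rho>' n)" and \<rho>0: "\<And>t. t \<notin> {-\<sigma> n..0} \<Longrightarrow> \<rho> n t = 0" and \<rho>k: "kernel (\<sigma> n) (\<rho> n)" for n
  using tk[of n] unfolding time_kernel_def by auto
 have \<rho>'0: "\<rho>' n t = 0" if "t \<notin> {-\<sigma> n..0}" for t n
  using C1_grad_support[OF \<rho> _ \<rho>0 that] by simp
 have \<rho>i: "L1 (\<rho> n)" "L1 (\<rho>' n)" for n
  using compact_support_integrable[OF C1_continuous[OF \<rho>] \<rho>0 compact_Icc]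
   compact_support_integrable[OF C1_grad_continuous[OF \<rho>] \<rho>'0 compact_Icc] by blast+
 have [measurable]: "\<rho> n \<in> Borel" "\<rho>' n \<in> Borel" for n
  using C1_borel[OF \<rho>] C1_grad_borel[OF \<rho>] by auto
 \<comment> \<open>\<open>mq\<close> collects what integration by parts leaves at negative times,
   with the derivative moved to \<open>\<phi>\<close>; \<open>h\<close> is the weight of the
   boundary term at time 0.\<close>
 define mq where "mq x = indicator {..<0} (fst x) * (v (-1, Tinv (snd x)) * g (snd x) * (\<phi>' (fst x, Tinv (snd x)) \<bullet> (1, 0)))"
  for x :: "real \<times> (real \<times> real)"
 define h where "h q = indicator D q * (v (-1, Tinv q) * \<phi> (0, Tinv q))" for q
 have [measurable]: "mq \<in> Borel" "h \<in> Borel" unfolding mq_def h_def by measurable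
 have mqi: "L1 mq"
 proof (rule integrable_bounded_support[of _ "C * (1 / \<alpha>) * (A' * norm (1::real, 0::real^2))"])
  show "compact (cball (0::real) R \<times> Kh)" by (intro compact_Times compact_cball cKh)
  show "mq x = 0" if "x \<notin> cball 0 R \<times> Kh" for x
  proof (cases "(fst x, Tinv (snd x)) \<in> K \<and> snd x \<in> D")
   case True
   then have "fst x \<in> cball 0 R" "snd x \<in> Kh" using RK inKh by (force, blast)
   then show ?thesis using that by (cases x) auto
  next
   case False
   then show ?thesis using \<phi>'0[of "(fst x, Tinv (snd x))"] g_bounds(3)[of "snd x"] by (auto simp: mq_def)
  qed
  show "\<bar>mq x\<bar> \<le> C * (1 / \<alpha>) * (A' * norm (1::real, 0::real^2))" for x
  proof -
   have "\<bar>\<phi>' (fst x, Tinv (snd x)) \<bullet> (1, 0)\<bar> \<le> A' * norm (1::real, 0::real^2)"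
    by (rule order_trans[OF Cauchy_Schwarz_ineq2 mult_right_mono]) (use A' in auto)
   then have "\<bar>v (-1, Tinv (snd x))\<bar> * \<bar>g (snd x)\<bar> * \<bar>\<phi>' (fst x, Tinv (snd x)) \<bullet> (1, 0)\<bar> \<le> C * (1 / \<alpha>) * (A' * norm (1::real, 0::real^2))"
    using v_bound g_bounds[of "snd x"] \<alpha> C0 by (intro mult_mono) auto
   moreover have "0 \<le> C * (1 / \<alpha>) * (A' * norm (1::real, 0::real^2))" using C0 \<alpha> A' by simp
   ultimately show ?thesis by (auto simp: mq_def abs_mult indicator_def)
  qed
 qed simp
 have hi: "L1 h"
 proof (rule integrable_bounded_support[of _ "C * A"])
  show "h q = 0" if "q \<notin> Kh" for q using that inKh[of q 0] K(3) by (auto simp: h_def indicator_def)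
  show "\<bar>h q\<bar> \<le> C * A" for q
  proof -
   have "\<bar>v (-1, Tinv q)\<bar> * \<bar>\<phi> (0, Tinv q)\<bar> \<le> C * A" using v_bound A C0 by (intro mult_mono) auto
   then show ?thesis using C0 A by (auto simp: h_def abs_mult indicator_def)
  qed
 qed (use cKh in auto)
 let ?P = "\<lambda>n x. ?m2 x * (1 - indicator {0..} (fst x)) * tconv U0 (\<rho>' n) x"
 let ?Q = "\<lambda>n x. mq x * tconv U0 (\<rho> n) x"
 have Pi: "L1 (?P n)" for n
 proof -
  have "L1 (\<lambda>x. ?m2 x * ((1 - indicator {0..} (fst x)) * tconv U0 (\<rho>' n) x))"
  proof (rule integrable_mult_bounded(1)[OF mi(2), of _ "C * (LBINT t. \<bar>\<rho>' n t\<bar>)"])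
   show "\<bar>(1 - indicator {0..} (fst x)) * tconv U0 (\<rho>' n) x\<bar> \<le> C * (LBINT t. \<bar>\<rho>' n t\<bar>)" for x
    using tconv_bound[OF U0_measurable(1) U0_bound(1) \<rho>i(2)[of n], of x] C0 by (auto simp: indicator_def abs_mult)
  qed measurable
  then show ?thesis by (simp add: mult.assoc)
 qed
 have Qi: "L1 (?Q n)" for n
  by (rule integrable_mult_bounded(1)[OF mqi _ tconv_bound[OF U0_measurable(1) U0_bound(1) \<rho>i(1)]]) measurable
 have DU: "((\<lambda>t. tconv U0 (\<rho> n) (t, q)) has_real_derivative tconv U0 (\<rho>' n) (t, q)) (at t)"
  "continuous_on UNIV (\<lambda>t. tconv U0 (\<rho>' n) (t, q))" "continuous_on UNIV (\<lambda>t. tconv U0 (\<rho> n) (t, q))" for n q t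
 proof -
  have C': "C1 (conv (\<lambda>s. U0 (s, q)) (\<rho> n)) (conv (\<lambda>s. U0 (s, q)) (\<rho>' n))"
  proof (rule conv_C1[OF _ \<rho>])
   show "L1 (\<lambda>y. indicator (cball 0 R) y * U0 (y, q))" for R
    by (rule integrable_mult_bounded(1)[OF integrable_indicator_compact[OF compact_cball], of _ C]) (use U0_bound(1) in auto)
   show "\<rho> n z = 0" if "z \<notin> cball 0 (\<sigma> n)" for z by (rule \<rho>0) (use that \<sigma>(1)[of n] in \<open>auto simp: abs_if split: if_splits\<close>)
  qed
  have e1: "conv (\<lambda>s. U0 (s, q)) (\<rho> n) = (\<lambda>t. tconv U0 (\<rho> n) (t, q))"
   by (rule ext, subst conv_swap) (auto simp: tconv_def)
  have e2: "conv (\<lambda>s. U0 (s, q)) (\<rho>' n) = (\<lambda>t. tconv U0 (\<rho>' n) (t, q))"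
   by (rule ext, subst conv_swap) (auto simp: tconv_def)
  have "(\<bullet>) (tconv U0 (\<rho>' n) (t, q)) = (*) (tconv U0 (\<rho>' n) (t, q))" by (auto simp: fun_eq_iff)
  then show "((\<lambda>t. tconv U0 (\<rho> n) (t, q)) has_real_derivative tconv U0 (\<rho>' n) (t, q)) (at t)"
   using C1_D[OF C', of t] unfolding e1 e2 has_field_derivative_def by simp
  show "continuous_on UNIV (\<lambda>t. tconv U0 (\<rho>' n) (t, q))" using C1_grad_continuous[OF C'] unfolding e2 .
  show "continuous_on UNIV (\<lambda>t. tconv U0 (\<rho> n) (t, q))" using C1_continuous[OF C'] unfolding e1 .
 qed
 have \<phi>c: "continuous_on UNIV (\<lambda>t. \<phi> (t, z))" for z
  by (intro continuous_on_compose2[OF C1_continuous[OF \<phi>, of UNIV]] continuous_intros) auto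
 have gD: "g q = indicator D q * g q" for q using g_bounds(3)[of q] by (cases "q \<in> D") auto
 \<comment> \<open>On the slice over \<open>q\<close> the sum of both integrands is the time
   derivative of \<open>\<phi>\<close> times the time average of \<open>U0\<close>, multiplied by a
   constant; only its value at time 0 remains.\<close>
 have PQ: "(LBINT x. ?P n x) + (LBINT x. ?Q n x) = (LBINT q. h q * (g q * tconv U0 (\<rho> n) (0, q)))" for n
 proof -
  have "(LBINT x. ?P n x) + (LBINT x. ?Q n x) = (LBINT x. ?P n x + ?Q n x)"
   using Pi Qi by simp
  also have "\<dots> = (LBINT q. (LBINT t. ?P n (t, q) + ?Q n (t, q)))"
   by (rule integral_slices(2)) (intro Bochner_Integration.integrable_add Pi Qi)
  also have "\<dots> = (LBINT q. h q * (g q * tconv U0 (\<rho> n) (0, q)))"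
  proof (rule Bochner_Integration.integral_cong[OF refl])
   fix q
   let ?z = "Tinv q"
   let ?p = "\<lambda>t. \<phi> (t, ?z) * tconv U0 (\<rho>' n) (t, q) + (\<phi>' (t, ?z) \<bullet> (1, 0)) * tconv U0 (\<rho> n) (t, q)"
   have pt: "?P n (t, q) + ?Q n (t, q) = (v (-1, ?z) * g q) * (indicator {..<0} t * ?p t)" for t
    using v_neg[of t ?z] by (cases "t < 0") (auto simp: m2_def[OF \<phi> K] mq_def algebra_simps)
   have "(LBINT t. indicator {..<0} t * ?p t) = \<phi> (0, ?z) * tconv U0 (\<rho> n) (0, q)"
   proof (rule FTC_negative[of "\<lambda>t. \<phi> (t, ?z) * tconv U0 (\<rho> n) (t, q)"])
    show "((\<lambda>t. \<phi> (t, ?z) * tconv U0 (\<rho> n) (t, q)) has_real_derivative ?p t) (at t)" for t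
     by (rule DERIV_cong[OF DERIV_mult[OF C1_slice_time(1)[OF \<phi>] DU(1)]]) simp
    show "continuous_on UNIV ?p" by (intro continuous_intros DU \<phi>c C1_slice_time(2)[OF \<phi>])
    show "\<phi> (t, ?z) * tconv U0 (\<rho> n) (t, q) = 0" if "t \<le> - R" for t using R(2)[OF that] K(3) by simp
    show "?p t = 0" if "t < - R" for t using R(2)[of t ?z] that K(3) \<phi>'0 by simp
   qed (rule R)
   then have "(LBINT t. ?P n (t, q) + ?Q n (t, q)) = (v (-1, ?z) * g q) * (\<phi> (0, ?z) * tconv U0 (\<rho> n) (0, q))"
    unfolding pt by simp
   also have "\<dots> = h q * (g q * tconv U0 (\<rho> n) (0, q))"
    by (subst gD) (simp add: h_def)
   finally show "(LBINT t. ?P n (t, q) + ?Q n (t, q)) = h q * (g q * tconv U0 (\<rho> n) (0, q))" .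
  qed
  finally show ?thesis .
 qed
 have mqU: "L1 (\<lambda>x. mq x * U0 x)"
  by (rule integrable_mult_bounded(1)[OF mqi _ U0_bound(1)]) simp
 \<comment> \<open>The same integration with \<open>U0\<close> itself, which at negative times is
   the constant \<open>uD\<close>. This is the limit that the boundary term has to match.\<close>
 have Q0: "(LBINT x. mq x * U0 x) = (LBINT q. h q * (g q * uD q))"
 proof (subst integral_slices(2)[OF mqU], rule Bochner_Integration.integral_cong[OF refl])
  fix q
  let ?z = "Tinv q"
  have pt: "mq (t, q) * U0 (t, q) = (v (-1, ?z) * g q * uD q) * (indicator {..<0} t * (\<phi>' (t, ?z) \<bullet> (1, 0)))" for t
   using U0_neg[of "(t, q)"] by (cases "t < 0") (auto simp: mq_def)
  have "(LBINT t. indicator {..<0} t * (\<phi>' (t, ?z) \<bullet> (1, 0))) = \<phi> (0, ?z)"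
  proof (rule FTC_negative[of "\<lambda>t. \<phi> (t, ?z)"])
   show "\<phi> (t, ?z) = 0" if "t \<le> - R" for t using R(2)[OF that] K(3) by simp
   show "\<phi>' (t, ?z) \<bullet> (1, 0) = 0" if "t < - R" for t using R(2)[of t ?z] that \<phi>'0 by simp
  qed (intro C1_slice_time[OF \<phi>] R)+
  then have "(LBINT t. mq (t, q) * U0 (t, q)) = (v (-1, ?z) * g q * uD q) * \<phi> (0, ?z)"
   unfolding pt by simp
  also have "\<dots> = h q * (g q * uD q)" by (subst gD) (simp add: h_def)
  finally show "(LBINT t. mq (t, q) * U0 (t, q)) = h q * (g q * uD q)" .
 qed
 have \<rho>1: "(LBINT t. \<bar>\<rho> n t\<bar>) = 1" for n using \<rho>k[of n] by (simp add: kernel_def)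
 have gU: "L1 (\<lambda>q. h q * (g q * tconv U0 (\<rho> n) (0, q)))" "L1 (\<lambda>q. h q * (g q * uD q))" for n
 proof -
  show "L1 (\<lambda>q. h q * (g q * tconv U0 (\<rho> n) (0, q)))"
  proof (rule integrable_mult_bounded(1)[OF hi, of _ "(1 / \<alpha>) * C"])
   show "\<bar>g q * tconv U0 (\<rho> n) (0, q)\<bar> \<le> (1 / \<alpha>) * C" for q
    unfolding abs_mult using tconv_bound[OF U0_measurable(1) U0_bound(1) \<rho>i(1)[of n], of "(0, q)"] \<rho>1[of n] g_bounds[of q] \<alpha>
    by (intro mult_mono) auto
  qed measurable
  show "L1 (\<lambda>q. h q * (g q * uD q))"
  proof (rule integrable_mult_bounded(1)[OF hi, of _ "(1 / \<alpha>) * C"])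
   show "\<bar>g q * uD q\<bar> \<le> (1 / \<alpha>) * C" for q
    unfolding abs_mult using U0_bound(2)[of q] g_bounds[of q] \<alpha> by (intro mult_mono) auto
  qed measurable
 qed
 have "(LBINT x. ?m1 x * tconv U0 (\<rho> n) x) = (LBINT x. ?Q n x) - (LBINT x. mq x * U0 x)
   - (LBINT q. h q * (g q * (tconv U0 (\<rho> n) (0, q) - uD q)))" for n
 proof -
  have "(LBINT q. h q * (g q * (tconv U0 (\<rho> n) (0, q) - uD q))) =
   (LBINT q. h q * (g q * tconv U0 (\<rho> n) (0, q))) - (LBINT q. h q * (g q * uD q))"
   using gU by (simp add: right_diff_distrib)
  then show ?thesis using regularized[OF \<phi> K tk[of n]] PQ[of n] Q0 by linarith
 qed
 moreover have "(\<lambda>n. (LBINT x. ?Q n x) - (LBINT x. mq x * U0 x)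
   - (LBINT q. h q * (g q * (tconv U0 (\<rho> n) (0, q) - uD q)))) \<longlonglongrightarrow> (LBINT x. mq x * U0 x) - (LBINT x. mq x * U0 x) - 0"
 proof (intro tendsto_diff tendsto_const)
  show "(\<lambda>n. (LBINT x. ?Q n x)) \<longlonglongrightarrow> (LBINT x. mq x * U0 x)"
   by (rule tconv_tendsto[OF mqi U0_measurable(1) U0_bound(1) \<rho>k \<sigma>0])
  show "(\<lambda>n. (LBINT q. h q * (g q * (tconv U0 (\<rho> n) (0, q) - uD q)))) \<longlonglongrightarrow> 0"
   by (rule initial_weak[OF tk \<sigma>(1) \<sigma>0 hi cKh KhD]) (use inKh[of _ 0] K(3) in \<open>auto simp: h_def indicator_def\<close>)
 qed
 ultimately have "(\<lambda>n. (LBINT x. ?m1 x * tconv U0 (\<rho> n) x)) \<longlonglongrightarrow> 0" by simp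
 moreover have "(\<lambda>n. (LBINT x. ?m1 x * tconv U0 (\<rho> n) x)) \<longlonglongrightarrow> (LBINT x. ?m1 x * U0 x)"
  by (rule tconv_tendsto[OF mi(1) U0_measurable(1) U0_bound(1) \<rho>k \<sigma>0])
 ultimately have z: "(LBINT x. ?m1 x * U0 x) = 0" using LIMSEQ_unique by blast
 let ?f = "\<lambda>q. u q * v q * (\<phi>' q \<bullet> cfield b q)"
 have fm: "?f \<in> Borel" by measurable
 have "(LBINT q. indicator N (snd q) * ?f q) = (LBINT x. ?f (fst x, Tinv (snd x)) * g (snd x))"
  by (rule to_D(2)[OF fm])
 also have "\<dots> = (LBINT x. ?m1 x * U0 x)"
  by (rule Bochner_Integration.integral_cong[OF refl], subst gD) (simp add: m1_def[OF \<phi> K] U0_def)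
 finally have "(LBINT q. indicator N (snd q) * ?f q) = 0" using z by simp
 moreover have "indicator N (snd q) * ?f q = ?f q" for q
  by (rule ind_N_eq[OF \<phi> K]) (use \<phi>'0 in auto)
 ultimately show "(LBINT q. u q * v q * (\<phi>' q \<bullet> cfield b q)) = 0" by (simp only:)
qed

end

context straight_field
begin

text \<open>Functions of \<open>u\<close> inherit constancy at negative times, so
  \<open>product\<close> may be applied again to its own results; this carries the induction over
  polynomials. Approximation is only required on the range of \<open>u\<close>, the interval from
  \<open>-C\<close> to \<open>C\<close>.\<close>

lemma renormalize:
 fixes \<beta> :: "real \<Rightarrow> real"
 assumes u: "transp N b u" and um [measurable]: "u \<in> Borel" and C: "\<And>p. \<bar>u p\<bar> \<le> C"
  and neg: "\<And>t z. t < 0 \<Longrightarrow> u (t, z) = u (-1, z)" and \<beta>: "continuous_on UNIV \<beta>"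
 shows "transp N b (\<lambda>p. \<beta> (u p))"
proof -
 have comp_m: "(\<lambda>p. f (u p)) \<in> Borel" if "continuous_on UNIV f" for f :: "real \<Rightarrow> real"
 proof -
  have [measurable]: "f \<in> Borel" by (rule borel_measurable_continuous_onI[OF that])
  show ?thesis by measurable
 qed
 have comp_b: "\<exists>B. \<forall>p. \<bar>f (u p)\<bar> \<le> B" if fc: "continuous_on UNIV f" for f :: "real \<Rightarrow> real"
 proof -
  obtain B where B: "\<And>x. x \<in> cball 0 C \<Longrightarrow> norm (f x) \<le> B" using continuous_bounded_on_cball[OF fc] by metis
  have "\<bar>f (u p)\<bar> \<le> B" for p using B[of "u p"] C[of p] by simp
  then show ?thesis by blast
 qed
 have pc: "continuous_on UNIV f" if "real_polynomial_function f" for f :: "real \<Rightarrow> real"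
  by (rule continuous_on_polymonial_function) (use that real_polynomial_function_eq in blast)
 have one: "transp N b (\<lambda>p. 1)" by (rule transp_mono[OF transp_one N_V])
 have poly: "transp N b (\<lambda>p. f (u p))" if "real_polynomial_function f" for f :: "real \<Rightarrow> real"
  using that
 proof induction
  case (linear f)
  then have "f x = f 1 * x" for x using linear_scale[OF bounded_linear.linear, of f x 1] by simp
  then have "(\<lambda>p. f (u p)) = (\<lambda>p. f 1 * u p)" by metis
  then show ?case using transp_cmult[OF u, of "f 1"] by simp
 next
  case (const c)
  then show ?case using transp_cmult[OF one, of c] by simp
 next
  case (add f f')
  obtain B B' where "\<And>p. \<bar>f (u p)\<bar> \<le> B" "\<And>p. \<bar>f' (u p)\<bar> \<le> B'" using comp_b pc add.hyps by metis
  then show ?case by (intro transp_add[OF N_V add.IH]) (use comp_m pc add.hyps in auto)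
 next
  case (mult f f')
  obtain B B' where B: "\<And>p. \<bar>f (u p)\<bar> \<le> B" "\<And>p. \<bar>f' (u p)\<bar> \<le> B'" using comp_b pc mult.hyps by metis
  interpret two_solutions V b H p e \<alpha> r \<delta> c d "\<lambda>p. f (u p)" "\<lambda>p. f' (u p)" "max B B'"
  proof unfold_locales
   show "f (u (t, z)) = f (u (-1, z))" "f' (u (t, z)) = f' (u (-1, z))" if "t < 0" for t z using neg[OF that] by auto
   show "\<bar>f (u p)\<bar> \<le> max B B'" "\<bar>f' (u p)\<bar> \<le> max B B'" for p using B[of p] by auto
  qed (use mult.IH comp_m pc mult.hyps in auto)
  show ?case by (rule product)
 qed
 have "\<exists>f. real_polynomial_function f \<and> (\<forall>x\<in>cball 0 C. \<bar>\<beta> x - f x\<bar> < 1 / (real n + 1))" for n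
  by (rule Stone_Weierstrass_real_polynomial_function[of "cball 0 C" \<beta> "1 / (real n + 1)"])
   (use \<beta> continuous_on_subset in \<open>auto simp: add_nonneg_pos\<close>)
 then obtain f where f: "\<And>n. real_polynomial_function (f n)" "\<And>n x. x \<in> cball 0 C \<Longrightarrow> \<bar>\<beta> x - f n x\<bar> < 1 / (real n + 1)"
  by metis
 obtain B where B: "\<And>p. \<bar>\<beta> (u p)\<bar> \<le> B" using comp_b[OF \<beta>] by blast
 have close: "\<bar>\<beta> (u p) - f n (u p)\<bar> < 1 / (real n + 1)" for n p using f(2)[of "u p" n] C[of p] by simp
 show ?thesis
 proof (rule transp_limit[OF N_V poly[OF f(1)] comp_m[OF pc[OF f(1)]]])
  show "\<bar>f n (u p)\<bar> \<le> B + 1" for n p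
  proof -
   have "1 / (real n + 1) \<le> 1" by simp
   then show ?thesis using close[of p n] B[of p] by linarith
  qed
  show "(\<lambda>n. f n (u p)) \<longlonglongrightarrow> \<beta> (u p)" for p
  proof (rule LIM_zero_cancel, rule tendsto_rabs_zero_cancel, rule tendsto_sandwich[of "\<lambda>_. 0" _ _ "\<lambda>n. 1 / (real n + 1)"])
   show "(\<lambda>n. 1 / (real n + 1)) \<longlonglongrightarrow> 0" by (rule inverse_Suc_tendsto_0)
   show "\<forall>\<^sub>F n in sequentially. \<bar>f n (u p) - \<beta> (u p)\<bar> \<le> 1 / (real n + 1)"
    using close[of p] by (intro always_eventually) (auto simp: abs_minus_commute less_imp_le)
  qed auto
  show "(\<lambda>p. \<beta> (u p)) \<in> Borel" by (rule comp_m[OF \<beta>])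
 qed
qed

end

section \<open>From local to global\<close>

text \<open>By Lindelof, countably many of the open sets suffice, so the exceptional null sets add
  up to a null set.\<close>

lemma AE_open_cover:
 fixes S :: "'a::euclidean_space set"
 assumes "\<And>x. x \<in> S \<Longrightarrow> \<exists>U. open U \<and> x \<in> U \<and> (AE z in lborel. z \<in> U \<longrightarrow> Q z)"
 shows "AE z in lborel. z \<in> S \<longrightarrow> Q z"
proof -
 define F where "F = {U. open U \<and> (AE z in lborel. z \<in> U \<longrightarrow> Q z)}"
 obtain F' where F': "F' \<subseteq> F" "countable F'" "\<Union>F' = \<Union>F"
  by (rule Lindelof[of F]) (auto simp: F_def)
 have "S \<subseteq> \<Union>F" using assms by (auto simp: F_def)
 moreover have "AE z in lborel. \<forall>U\<in>F'. z \<in> U \<longrightarrow> Q z"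
  using F' by (subst AE_ball_countable) (auto simp: F_def)
 ultimately show ?thesis using F'(3) by (auto elim!: eventually_mono)
qed

section \<open>Vanishing and directed points, and gluing of local equations\<close>

context ham_field
begin

definition Opts :: "(real^2) set" where
 "Opts = {x \<in> V. \<exists>U. open U \<and> x \<in> U \<and> U \<subseteq> V \<and> (AE y in lborel. y \<in> U \<longrightarrow> b y = 0)}"

definition Ppts :: "(real^2) set" where
 "Ppts = {x \<in> V. \<exists>\<xi> \<alpha> \<epsilon>. \<alpha> > 0 \<and> \<epsilon> > 0 \<and> ball x \<epsilon> \<subseteq> V \<and> (AE y in lborel. y \<in> ball x \<epsilon> \<longrightarrow> \<alpha> \<le> b y \<bullet> \<xi>)}"

lemma Ppts_straight:
 assumes "x \<in> Ppts"
 obtains e \<alpha> r \<delta> c d where "straight_field V b H x e \<alpha> r \<delta> c d" "x \<in> straight_field.N H x e r \<delta> c d"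
proof -
 obtain \<xi> \<alpha> \<epsilon> where *: "\<alpha> > 0" "\<epsilon> > 0" "ball x \<epsilon> \<subseteq> V" "AE y in lborel. y \<in> ball x \<epsilon> \<longrightarrow> \<alpha> \<le> b y \<bullet> \<xi>"
  using assms by (auto simp: Ppts_def)
 show ?thesis by (rule straight_field_exists[OF *(2,3,1,4) that])
qed

lemma Opts_open: "open Opts"
proof (rule openI)
 fix x assume "x \<in> Opts"
 then obtain U where U: "open U" "x \<in> U" "U \<subseteq> V" "AE y in lborel. y \<in> U \<longrightarrow> b y = 0" by (auto simp: Opts_def)
 then have "U \<subseteq> Opts" by (auto simp: Opts_def)
 then show "\<exists>e>0. ball x e \<subseteq> Opts" using U openE by (metis order_trans)
qed

lemma Opts_V: "Opts \<subseteq> V" by (auto simp: Opts_def)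

lemma Ppts_V: "Ppts \<subseteq> V" by (auto simp: Ppts_def)

lemma b_zero_Opts: "AE z in lborel. z \<in> Opts \<longrightarrow> b z = 0"
 by (rule AE_open_cover) (auto simp: Opts_def)

lemma Opts_sets [measurable]: "Opts \<in> sets borel" using Opts_open by simp

lemma Ppts_open: "open Ppts"
proof (rule openI)
 fix x assume "x \<in> Ppts"
 then obtain \<xi> \<alpha> \<epsilon> where *: "\<alpha> > 0" "\<epsilon> > 0" "ball x \<epsilon> \<subseteq> V" "AE y in lborel. y \<in> ball x \<epsilon> \<longrightarrow> \<alpha> \<le> b y \<bullet> \<xi>"
  by (auto simp: Ppts_def)
 have "ball x (\<epsilon> / 2) \<subseteq> Ppts"
 proof
  fix y assume y: "y \<in> ball x (\<epsilon> / 2)"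
  have sub: "ball y (\<epsilon> / 2) \<subseteq> ball x \<epsilon>"
  proof
   fix z assume "z \<in> ball y (\<epsilon> / 2)"
   then show "z \<in> ball x \<epsilon>" using y dist_triangle[of x z y] by simp
  qed
  have "AE z in lborel. z \<in> ball y (\<epsilon> / 2) \<longrightarrow> \<alpha> \<le> b z \<bullet> \<xi>" using *(4) sub by (auto elim!: eventually_mono)
  moreover have "y \<in> V" using y *(2,3) by auto
  ultimately show "y \<in> Ppts" unfolding Ppts_def using * sub
   by (intro CollectI conjI exI[of _ \<xi>] exI[of _ \<alpha>] exI[of _ "\<epsilon> / 2"]) auto
 qed
 then show "\<exists>e>0. ball x e \<subseteq> Ppts" using *(2) half_gt_zero by blast
qed

text \<open>A partition of unity with two members. The cut-off equals 1 near the part of the support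
  outside \<open>B\<close> and is supported in \<open>A\<close>, so \<open>\<phi>\<close> splits
  into test functions for \<open>A\<close> and for \<open>B\<close>.\<close>

lemma transp_union:
 assumes AB: "open A" "open B" "A \<subseteq> V" "B \<subseteq> V" "transp A b w" "transp B b w"
  and [measurable]: "w \<in> Borel" and w: "\<And>p. \<bar>w p\<bar> \<le> C"
 shows "transp (A \<union> B) b w"
 unfolding transp_iff
proof (intro allI impI)
 fix \<phi> \<phi>' and K :: "(real \<times> (real^2)) set"
 assume a: "C1 \<phi> \<phi>'" "compact K" "K \<subseteq> UNIV \<times> (A \<union> B)" "\<forall>p. p \<notin> K \<longrightarrow> \<phi> p = 0"
 define L where "L = snd ` K - B"
 have cL: "compact L" unfolding L_def by (rule compact_diff[OF compact_snd_image[OF a(2)] AB(2)])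
 have LA: "L \<subseteq> A" using a(3) by (auto simp: L_def)
 obtain \<zeta> \<zeta>' K1 W where \<zeta>: "C1 \<zeta> \<zeta>'" "compact K1" "K1 \<subseteq> A" "\<And>x. x \<notin> K1 \<Longrightarrow> \<zeta> x = 0"
  "open W" "L \<subseteq> W" "\<And>x. x \<in> W \<Longrightarrow> \<zeta> x = 1"
  using cutoff[OF cL AB(1) LA] by metis
 define Z where "Z p = \<zeta> (snd p)" for p :: "real \<times> (real^2)"
 obtain Z' where Z: "C1 Z Z'" using C1_tensor[OF C1_const[of 1] \<zeta>(1), where 'a=real] unfolding Z_def by auto
 let ?f1 = "\<lambda>p. \<phi> p * Z p" and ?f2 = "\<lambda>p. \<phi> p * (1 - Z p)"
 let ?g1 = "\<lambda>p. \<phi> p *\<^sub>R Z' p + Z p *\<^sub>R \<phi>' p" and ?g2 = "\<lambda>p. \<phi> p *\<^sub>R (0 - Z' p) + (1 - Z p) *\<^sub>R \<phi>' p"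
 have f1: "C1 ?f1 ?g1" by (rule C1_mult[OF a(1) Z])
 have f2: "C1 ?f2 ?g2" by (rule C1_mult[OF a(1) C1_diff[OF C1_const Z]])
 have cl: "closed (UNIV \<times> K1 :: (real \<times> (real^2)) set)" "closed (UNIV \<times> (- W) :: (real \<times> (real^2)) set)"
  using \<zeta> compact_imp_closed by (auto intro!: closed_Times)
 have c1: "compact (K \<inter> (UNIV \<times> K1))" "compact (K \<inter> (UNIV \<times> (- W)))"
  using compact_Int_closed[OF a(2)] cl by auto
 have z1: "?f1 p = 0" if "p \<notin> K \<inter> (UNIV \<times> K1)" for p
  using that a(4) \<zeta>(4)[of "snd p"] by (cases p) (auto simp: Z_def)
 have z2: "?f2 p = 0" if "p \<notin> K \<inter> (UNIV \<times> (- W))" for p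
  using that a(4) \<zeta>(7)[of "snd p"] by (cases p) (auto simp: Z_def)
 have s1: "K \<inter> (UNIV \<times> K1) \<subseteq> UNIV \<times> A" using \<zeta>(3) by auto
 have s2: "K \<inter> (UNIV \<times> (- W)) \<subseteq> UNIV \<times> B"
 proof
  fix p assume p: "p \<in> K \<inter> (UNIV \<times> (- W))"
  then have "snd p \<in> snd ` K" "snd p \<notin> L" using \<zeta>(6) by auto
  then show "p \<in> UNIV \<times> B" by (cases p) (auto simp: L_def)
 qed
 have i: "L1 (\<lambda>p. w p * (?g1 p \<bullet> cfield b p))" "L1 (\<lambda>p. w p * (?g2 p \<bullet> cfield b p))"
 proof -
  have V: "K \<inter> (UNIV \<times> K1) \<subseteq> UNIV \<times> V" "K \<inter> (UNIV \<times> (- W)) \<subseteq> UNIV \<times> V"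
   using s1 s2 AB(3,4) by blast+
  show "L1 (\<lambda>p. w p * (?g1 p \<bullet> cfield b p))"
   by (rule test_integrable[OF f1 c1(1) V(1) z1 assms(7) w])
  show "L1 (\<lambda>p. w p * (?g2 p \<bullet> cfield b p))"
   by (rule test_integrable[OF f2 c1(2) V(2) z2 assms(7) w])
 qed
 have "(LBINT p. w p * (?g1 p \<bullet> cfield b p)) = 0" "(LBINT p. w p * (?g2 p \<bullet> cfield b p)) = 0"
  using transpD[OF AB(5) f1 c1(1) s1 z1] transpD[OF AB(6) f2 c1(2) s2 z2] by blast+
 moreover have "w p * (\<phi>' p \<bullet> cfield b p) = w p * (?g1 p \<bullet> cfield b p) + w p * (?g2 p \<bullet> cfield b p)" for p
  by (simp add: inner_add_left inner_diff_left algebra_simps)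
 ultimately show "(LBINT p. w p * (\<phi>' p \<bullet> cfield b p)) = 0" using i by simp
qed

text \<open>The spatial projection of the support is compact, so finitely many of the open sets
  cover it; \<open>transp_union\<close> joins them one at a time.\<close>

lemma transp_cover:
 assumes loc: "\<And>x. x \<in> M \<Longrightarrow> \<exists>N. open N \<and> x \<in> N \<and> N \<subseteq> V \<and> transp N b w"
  and w: "w \<in> Borel" "\<And>p. \<bar>w p\<bar> \<le> C"
 shows "transp M b w"
 unfolding transp_iff
proof (intro allI impI)
 fix \<phi> \<phi>' and K :: "(real \<times> (real^2)) set"
 assume a: "C1 \<phi> \<phi>'" "compact K" "K \<subseteq> UNIV \<times> M" "\<forall>p. p \<notin> K \<longrightarrow> \<phi> p = 0"
 define F where "F = {N. open N \<and> N \<subseteq> V \<and> transp N b w}"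
 have "snd ` K \<subseteq> M" using a(3) by auto
 then have cov: "snd ` K \<subseteq> \<Union>F" unfolding F_def using loc by blast
 obtain F' where F': "F' \<subseteq> F" "finite F'" "snd ` K \<subseteq> \<Union>F'"
  by (rule compactE[OF compact_snd_image[OF a(2)] cov]) (auto simp: F_def)
 have "\<Union>F' \<in> F" using F'(2,1)
 proof (induction F' rule: finite_induct)
  case empty
  have "transp {} b w" unfolding transp_iff
  proof (intro allI impI)
   fix \<phi> \<phi>' and K :: "(real \<times> (real^2)) set"
   assume a: "C1 \<phi> \<phi>'" "K \<subseteq> UNIV \<times> {}" "\<forall>p. p \<notin> K \<longrightarrow> \<phi> p = 0"
   have "\<phi>' p = 0" for p by (rule C1_zero_on_open[OF a(1) open_UNIV]) (use a in auto)
   then show "(LBINT p. w p * (\<phi>' p \<bullet> cfield b p)) = 0"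
    by (simp only: inner_zero_left mult_zero_right Bochner_Integration.integral_zero)
  qed
  then show ?case by (simp add: F_def)
 next
  case (insert N F'')
  then have "N \<in> F" "\<Union>F'' \<in> F" by auto
  then have *: "open N" "N \<subseteq> V" "transp N b w" "open (\<Union>F'')" "\<Union>F'' \<subseteq> V" "transp (\<Union>F'') b w"
   by (simp_all add: F_def)
  have "transp (N \<union> \<Union>F'') b w" by (rule transp_union[OF *(1,4,2,5,3,6) w])
  moreover have "open (N \<union> \<Union>F'')" "N \<union> \<Union>F'' \<subseteq> V" using * by auto
  ultimately show ?case unfolding F_def Union_insert by blast
 qed
 then have t: "transp (\<Union>F') b w" by (simp add: F_def)
 have KF: "K \<subseteq> UNIV \<times> \<Union>F'"
 proof
  fix p assume "p \<in> K"
  then have "snd p \<in> \<Union>F'" using F'(3) by blast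
  then show "p \<in> UNIV \<times> \<Union>F'" by (simp add: mem_Times_iff)
 qed
 show "(LBINT p. w p * (\<phi>' p \<bullet> cfield b p)) = 0"
  by (rule transpD[OF t a(1,2) KF]) (use a(4) in blast)
qed

text \<open>Where \<open>b\<close> vanishes, the equation tested with a translated mollifier says
  that mollifications of \<open>w\<close> have zero time derivative. They agree with their own
  shifts to negative times, and the equality passes to \<open>w\<close> in the limit.\<close>

lemma vanishing_stationary:
 assumes w: "transp V b w" and wm [measurable]: "w \<in> Borel" and C: "\<And>p. \<bar>w p\<bar> \<le> C"
  and neg: "\<And>t z. t < 0 \<Longrightarrow> w (t, z) = w (-1, z)"
 shows "AE x in lborel. x \<in> UNIV \<times> Opts \<longrightarrow> w x = w (-1, snd x)"
proof (rule AE_open_cover)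
 fix x0 :: "real \<times> (real^2)" assume "x0 \<in> UNIV \<times> Opts"
 then have z0: "snd x0 \<in> Opts" by auto
 obtain r0 where r0: "r0 > 0" "ball (snd x0) r0 \<subseteq> Opts" using Opts_open z0 openE by blast
 \<comment> \<open>The set \<open>B\<close> has spatial radius \<open>r\<close>. Mollifiers of
   radius below \<open>r\<close> then see at most the ball of radius \<open>2 * r\<close>, which is
   still contained in \<open>Opts\<close>.\<close>
 define r where "r = r0 / 3"
 have r: "r > 0" "cball (snd x0) (2 * r) \<subseteq> Opts" using r0 by (auto simp: r_def)
 define B where "B = cball (fst x0) 1 \<times> cball (snd x0) r"
 have cB: "compact B" unfolding B_def by (intro compact_Times compact_cball)
 have [measurable]: "B \<in> sets borel" using cB borel_compact by blast
 \<comment> \<open>Large enough to shift all times of \<open>B\<close> to negative ones, where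
   \<open>w\<close> has its initial value.\<close>
 define S where "S = \<bar>fst x0\<bar> + 4"
 define F where "F x = w x - w (x - (S, 0))" for x
 have Fm [measurable]: "F \<in> Borel" unfolding F_def by measurable
 have Fb: "\<bar>F x\<bar> \<le> 2 * C" for x using C[of x] C[of "x - (S, 0)"] by (auto simp: F_def)
 have FB: "F x = w x - w (-1, snd x)" if "x \<in> B" for x
 proof -
  have "fst x - S < 0" using that by (auto simp: B_def S_def dist_real_def)
  then show ?thesis using neg[of "fst x - S" "snd x"] by (cases x) (simp add: F_def)
 qed
 \<comment> \<open>\<open>F\<close> will be integrated against its own restriction to
   \<open>B\<close>, so that a vanishing limit forces the integral of its square over
   \<open>B\<close> to be 0.\<close>
 define m where "m x = indicator B x * F x" for x
 have mi: "L1 m" unfolding m_def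
  by (rule integrable_mult_bounded(1)[OF integrable_indicator_compact[OF cB] _ Fb]) simp
 have "\<exists>\<kappa> :: real \<times> (real^2) \<Rightarrow> real. mollifier (1 / (real n + 1)) \<kappa>" for n
  by (rule mollifier_exists[of "1 / (real n + 1)"]) (auto simp: add_nonneg_pos)
 then obtain \<kappa> :: "nat \<Rightarrow> real \<times> (real^2) \<Rightarrow> real" where \<kappa>: "\<And>n. mollifier (1 / (real n + 1)) (\<kappa> n)" by metis
 have lim0: "(\<lambda>n. 1 / (real n + 1)) \<longlonglongrightarrow> 0" by (rule inverse_Suc_tendsto_0)
 have lim: "(\<lambda>n. (LBINT x. m x * (LBINT y. F (x - y) * \<kappa> n y))) \<longlonglongrightarrow> (LBINT x. m x * F x)"
  by (rule weak_mollification_tendsto[OF mi Fm linear_id[unfolded id_def] _ Fb mollifier_kernel[OF \<kappa>] lim0]) simp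
 have zero: "m x * (LBINT y. F (x - y) * \<kappa> n y) = 0" if n: "1 / (real n + 1) < r" for n x
 proof (cases "x \<in> B")
  case True
  obtain k where k: "C1 (\<kappa> n) k" using mollifier_C1[OF \<kappa>] by blast
  let ?e = "1 / (real n + 1)"
  have \<kappa>0: "\<kappa> n q = 0" if "q \<notin> cball 0 ?e" for q using \<kappa>[of n] that unfolding mollifier_def by blast
  have k0: "k q = 0" if "q \<notin> cball 0 ?e" for q using C1_grad_support[OF k closed_cball \<kappa>0 that] .
  have [measurable]: "\<kappa> n \<in> Borel" "k \<in> Borel" using C1_borel[OF k] C1_grad_borel[OF k] by auto
  have \<kappa>i: "L1 (\<kappa> n)" "L1 k"
   using compact_support_integrable[OF C1_continuous[OF k] \<kappa>0 compact_cball]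
    compact_support_integrable[OF C1_grad_continuous[OF k] k0 compact_cball] by blast+
  have Cc: "C1 (conv w (\<kappa> n)) (conv w k)"
  proof (rule conv_C1[OF _ k \<kappa>0])
   show "L1 (\<lambda>y. indicator (cball 0 R) y * w y)" for R
    by (rule integrable_mult_bounded(1)[OF integrable_indicator_compact[OF compact_cball] _ C]) simp
  qed
  have der: "((\<lambda>t. conv w (\<kappa> n) (t, snd x)) has_real_derivative 0) (at t)" for t
  proof -
   have "(LBINT y. w y * ((- k ((t, snd x) - y)) \<bullet> cfield b y)) = 0"
   proof (rule transpD[OF w C1_reflect[OF k]])
    show "compact (cball (t, snd x) ?e)" by simp
    show "cball (t, snd x) ?e \<subseteq> UNIV \<times> V"
    proof
     fix y assume y: "y \<in> cball (t, snd x) ?e"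
     have "dist (snd x) (snd y) \<le> ?e" using y dist_snd_le[of "(t, snd x)" y] by simp
     then have "snd y \<in> cball (snd x0) (2 * r)" using True n dist_triangle[of "snd x0" "snd y" "snd x"]
      by (auto simp: B_def)
     then show "y \<in> UNIV \<times> V" using r(2) Opts_V by (cases y) auto
    qed
    show "\<kappa> n ((t, snd x) - y) = 0" if "y \<notin> cball (t, snd x) ?e" for y
     by (rule \<kappa>0) (use that in \<open>simp add: dist_norm[of _ y]\<close>)
   qed
   also have "(LBINT y. w y * ((- k ((t, snd x) - y)) \<bullet> cfield b y)) = (LBINT y. - (w y * (k ((t, snd x) - y) \<bullet> (1, 0))))"
   proof (rule integral_cong_AE)
    have "AE y in (lborel :: (real \<times> (real^2)) measure). snd y \<in> Opts \<longrightarrow> b (snd y) = 0"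
     by (rule AE_snd[OF b_zero_Opts])
    then show "AE y in lborel. w y * ((- k ((t, snd x) - y)) \<bullet> cfield b y) = - (w y * (k ((t, snd x) - y) \<bullet> (1, 0)))"
    proof eventually_elim
     fix y :: "real \<times> (real^2)" assume by0: "snd y \<in> Opts \<longrightarrow> b (snd y) = 0"
     show "w y * ((- k ((t, snd x) - y)) \<bullet> cfield b y) = - (w y * (k ((t, snd x) - y) \<bullet> (1, 0)))"
     proof (cases "y \<in> cball (t, snd x) ?e")
      case yT: True
      have "dist (snd x) (snd y) \<le> ?e" using yT dist_snd_le[of "(t, snd x)" y] by simp
      then have "snd y \<in> cball (snd x0) (2 * r)" using True n dist_triangle[of "snd x0" "snd y" "snd x"]
       by (auto simp: B_def)
      then have "b (snd y) = 0" using r(2) by0 by auto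
      then show ?thesis by (simp add: cfield_def)
     next
      case False
      then have "k ((t, snd x) - y) = 0" by (intro k0) (simp add: dist_norm[of _ y])
      then show ?thesis by simp
     qed
    qed
   qed measurable
   finally have "conv w (\<lambda>y. k y \<bullet> (1, 0)) (t, snd x) = 0" by (simp add: conv_def)
   then have z: "conv w k (t, snd x) \<bullet> (1, 0) = 0" by (subst conv_inner[OF wm C \<kappa>i(2)])
   show ?thesis using C1_slice_time(1)[OF Cc, of "snd x" t] unfolding z .
  qed
  have const: "conv w (\<kappa> n) (fst x, snd x) = conv w (\<kappa> n) (fst x - S, snd x)"
   using DERIV_isconst_all[of "\<lambda>t. conv w (\<kappa> n) (t, snd x)"] der by blast
  have ii: "L1 (\<lambda>y. w (x' - y) * \<kappa> n y)" for x'
   by (rule integrable_mult_bounded(2)[OF \<kappa>i(1) _ C]) measurable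
  have "(LBINT y. F (x - y) * \<kappa> n y) = (LBINT y. w (x - y) * \<kappa> n y - w ((x - (S, 0)) - y) * \<kappa> n y)"
  proof (rule Bochner_Integration.integral_cong[OF refl])
   fix y
   have "x - y - (S, 0) = x - (S, 0) - y" by (simp add: algebra_simps)
   then show "F (x - y) * \<kappa> n y = w (x - y) * \<kappa> n y - w ((x - (S, 0)) - y) * \<kappa> n y"
    by (simp only: F_def left_diff_distrib)
  qed
  also have "\<dots> = conv w (\<kappa> n) x - conv w (\<kappa> n) (x - (S, 0))"
   using ii[of x] ii[of "x - (S, 0)"] by (simp add: conv_swap)
  also have "\<dots> = 0" using const by (cases x) simp
  finally show ?thesis by simp
 qed (simp add: m_def)
 have "\<forall>\<^sub>F n in sequentially. (LBINT x. m x * (LBINT y. F (x - y) * \<kappa> n y)) = 0"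
  using order_tendstoD(2)[OF lim0 r(1)]
 proof eventually_elim
  fix n assume "1 / (real n + 1) < r"
  from zero[OF this] show "(LBINT x. m x * (LBINT y. F (x - y) * \<kappa> n y)) = 0"
   by (simp only: Bochner_Integration.integral_zero)
 qed
 then have "(\<lambda>n::nat. 0) \<longlonglongrightarrow> (LBINT x. m x * F x)" by (rule Lim_transform_eventually[OF lim])
 then have "(LBINT x. m x * F x) = 0" using LIMSEQ_unique[OF _ tendsto_const] by blast
 moreover have "L1 (\<lambda>x. m x * F x)"
  by (rule integrable_mult_bounded(1)[OF mi _ Fb]) simp
 moreover have "m x * F x = indicator B x * (F x)\<^sup>2" for x by (simp add: m_def power2_eq_square)
 ultimately have "AE x in lborel. indicator B x * (F x)\<^sup>2 = 0"
  by (subst (asm) integral_nonneg_eq_0_iff_AE) auto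
 then have AEB: "AE x in lborel. x \<in> B \<longrightarrow> w x = w (-1, snd x)"
  by eventually_elim (use FB in \<open>auto simp: indicator_def\<close>)
 show "\<exists>U. open U \<and> x0 \<in> U \<and> (AE z in lborel. z \<in> U \<longrightarrow> w z = w (-1, snd z))"
 proof (intro exI[of _ "ball (fst x0) 1 \<times> ball (snd x0) r"] conjI)
  show "open (ball (fst x0) 1 \<times> ball (snd x0) r)" by (intro open_Times open_ball)
  show "x0 \<in> ball (fst x0) 1 \<times> ball (snd x0) r" using r by (cases x0) auto
  show "AE z in lborel. z \<in> ball (fst x0) 1 \<times> ball (snd x0) r \<longrightarrow> w z = w (-1, snd z)"
   using AEB by eventually_elim (auto simp: B_def)
 qed
qed

end

text \<open>\<open>T'\<close> is the adjoint of \<open>T\<close>, which carries gradients back along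
  \<open>T\<close>.\<close>

lemma C1_linear:
 fixes T :: "'a::euclidean_space \<Rightarrow> 'b::euclidean_space"
 assumes f: "C1 f f'" and T: "bounded_linear T" and T': "\<And>v w. T' w \<bullet> v = w \<bullet> T v" "continuous_on UNIV T'"
 shows "C1 (\<lambda>x. f (T x)) (\<lambda>x. T' (f' (T x)))"
 unfolding C1_def
proof (intro conjI allI)
 show "((\<lambda>x. f (T x)) has_derivative (\<bullet>) (T' (f' (T x)))) (at x)" for x
  using has_derivative_compose[OF bounded_linear_imp_has_derivative[OF T] C1_D[OF f], of x UNIV] unfolding T'(1) .
 show "continuous_on UNIV (\<lambda>x. T' (f' (T x)))"
  by (intro continuous_on_compose2[OF T'(2)] continuous_on_compose2[OF C1_grad_continuous[OF f, of UNIV]]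
    linear_continuous_on T) auto
qed

section \<open>Removal of the critical points\<close>

locale global_solution = ham_field +
 fixes w :: "real \<times> (real^2) \<Rightarrow> real" and C :: real and \<beta> :: "real \<Rightarrow> real"
 assumes w_transp: "transp V b w" and w_borel [measurable]: "w \<in> Borel"
  and w_bound: "\<And>p. \<bar>w p\<bar> \<le> C" and w_neg: "\<And>t z. t < 0 \<Longrightarrow> w (t, z) = w (-1, z)"
  and \<beta>_cont: "continuous_on UNIV \<beta>"
begin

lemma \<beta>_borel [measurable]: "\<beta> \<in> Borel"
 by (rule borel_measurable_continuous_onI[OF \<beta>_cont])

lemma \<beta>_bounded: obtains B where "B > 0" "\<And>p. \<bar>\<beta> (w p)\<bar> \<le> B"
proof -
 obtain B where "B > 0" "\<And>x. x \<in> cball 0 C \<Longrightarrow> norm (\<beta> x) \<le> B"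
  using continuous_bounded_on_cball[OF \<beta>_cont] by metis
 then show ?thesis using that w_bound by auto
qed

text \<open>On \<open>Opts\<close> the function \<open>w\<close> does not depend on time and the
  field is a pure time derivative, so each line in the time direction contributes 0. The factor
  \<open>s\<close> may be discontinuous because no spatial derivative is taken; it will be the
  indicator of the critical levels.\<close>

lemma vanishing_integral_zero:
 fixes s :: "real^2 \<Rightarrow> real"
 assumes \<phi>: "C1 \<phi> \<phi>'" and K: "compact K" "\<And>p. p \<notin> K \<Longrightarrow> \<phi> p = 0"
  and s [measurable]: "s \<in> Borel" and S: "\<And>z. \<bar>s z\<bar> \<le> 1"
 shows "(LBINT p. indicator Opts (snd p) * s (snd p) * \<beta> (w p) * (\<phi>' p \<bullet> cfield b p)) = 0"
proof -
 have [measurable]: "\<phi>' \<in> Borel" using C1_grad_borel[OF \<phi>] .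
 have \<phi>'0: "\<phi>' q = 0" if "q \<notin> K" for q
  using C1_grad_support[OF \<phi> compact_imp_closed[OF K(1)] K(2) that] .
 obtain B where B: "B > 0" "\<And>p. \<bar>\<beta> (w p)\<bar> \<le> B" using \<beta>_bounded by blast
 let ?G = "\<lambda>z. indicator Opts z * s z * \<beta> (w (-1, z))"
 have i: "L1 (\<lambda>p. (\<phi>' p \<bullet> (1, 0)) * ?G (snd p))"
 proof (rule integrable_mult_bounded(1)[of _ _ _ B])
  show "L1 (\<lambda>p. \<phi>' p \<bullet> (1, 0))"
   by (intro integrable_inner_left compact_support_integrable[OF C1_grad_continuous[OF \<phi>] \<phi>'0 K(1)])
  show "\<bar>?G (snd p)\<bar> \<le> B" for p :: "real \<times> (real^2)"
  proof -
   have "\<bar>s (snd p)\<bar> * \<bar>\<beta> (w (-1, snd p))\<bar> \<le> 1 * B" by (intro mult_mono S B) auto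
   then show ?thesis using B(1) by (auto simp: indicator_def abs_mult)
  qed
 qed measurable
 have "(LBINT p. indicator Opts (snd p) * s (snd p) * \<beta> (w p) * (\<phi>' p \<bullet> cfield b p)) = (LBINT p. (\<phi>' p \<bullet> (1, 0)) * ?G (snd p))"
 proof (rule integral_cong_AE)
  show "AE p in lborel. indicator Opts (snd p) * s (snd p) * \<beta> (w p) * (\<phi>' p \<bullet> cfield b p) = (\<phi>' p \<bullet> (1, 0)) * ?G (snd p)"
   using vanishing_stationary[OF w_transp w_borel w_bound, OF w_neg, simplified] AE_snd[OF b_zero_Opts]
  proof eventually_elim
   case (elim p)
   show ?case
   proof (cases "snd p \<in> Opts")
    case True
    then have "b (snd p) = 0" "w p = w (-1, snd p)" using elim by (auto simp: mem_Times_iff)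
    moreover from this(1) have "cfield b p = (1, 0)" by (simp add: cfield_def)
    ultimately show ?thesis by simp
   qed simp
  qed
 qed measurable
 also have "\<dots> = (LBINT z. (LBINT t. (\<phi>' (t, z) \<bullet> (1, 0)) * ?G z))"
  using integral_slices(2)[OF i] by simp
 also have "\<dots> = integral\<^sup>L (lborel :: (real^2) measure) (\<lambda>_. 0)"
 proof (rule Bochner_Integration.integral_cong[OF refl])
  fix z
  have "(LBINT t. (\<phi>' (t, z) \<bullet> (1, 0)) * ?G z) = (LBINT t. \<phi>' (t, z) \<bullet> (1, 0)) * ?G z"
   by (rule integral_mult_left_zero)
  then show "(LBINT t. (\<phi>' (t, z) \<bullet> (1, 0)) * ?G z) = 0" using C1_time_integral_zero[OF \<phi> K] by simp
 qed
 finally show ?thesis by simp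
qed

lemma renormalize_noncritical: "transp (Opts \<union> Ppts) b (\<lambda>p. \<beta> (w p))"
proof -
 obtain B where B: "B > 0" "\<And>p. \<bar>\<beta> (w p)\<bar> \<le> B" using \<beta>_bounded by blast
 have O: "transp Opts b (\<lambda>p. \<beta> (w p))"
  unfolding transp_iff
 proof (intro allI impI)
  fix \<phi> \<phi>' and K :: "(real \<times> (real^2)) set"
  assume a: "C1 \<phi> \<phi>'" "compact K" "K \<subseteq> UNIV \<times> Opts" "\<forall>p. p \<notin> K \<longrightarrow> \<phi> p = 0"
  have \<phi>'0: "\<phi>' q = 0" if "q \<notin> K" for q
   using C1_grad_support[OF a(1) compact_imp_closed[OF a(2)] _ that] a(4) by blast
  have "\<beta> (w p) * (\<phi>' p \<bullet> cfield b p) = indicator Opts (snd p) * 1 * \<beta> (w p) * (\<phi>' p \<bullet> cfield b p)" for p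
   using \<phi>'0[of p] a(3) by (cases "p \<in> K") (auto simp: mem_Times_iff)
  then show "(LBINT p. \<beta> (w p) * (\<phi>' p \<bullet> cfield b p)) = 0"
   using vanishing_integral_zero[OF a(1,2), of "\<lambda>_. 1"] a(4) by (simp only:) simp
 qed
 show ?thesis
 proof (rule transp_cover[OF _ _ B(2)])
  fix x assume "x \<in> Opts \<union> Ppts"
  then show "\<exists>N. open N \<and> x \<in> N \<and> N \<subseteq> V \<and> transp N b (\<lambda>p. \<beta> (w p))"
  proof
   assume "x \<in> Ppts"
   then obtain e \<alpha>' r \<delta> c d where sf: "straight_field V b H x e \<alpha>' r \<delta> c d" "x \<in> straight_field.N H x e r \<delta> c d"
  by (rule Ppts_straight)
   interpret straight_field V b H x e \<alpha>' r \<delta> c d by (rule sf(1))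
   show ?thesis using N_open N_V sf(2) renormalize[OF transp_mono[OF w_transp N_V] w_borel w_bound w_neg \<beta>_cont] by blast
  qed (use O Opts_open Opts_V in blast)
 qed measurable
qed

lemma Ppts_level_null:
 assumes "A \<in> null_sets lborel"
 shows "AE z in lborel. z \<in> Ppts \<longrightarrow> H z \<notin> A"
proof (rule AE_open_cover)
 fix x assume "x \<in> Ppts"
 then obtain e \<alpha>' r \<delta> c d where sf: "straight_field V b H x e \<alpha>' r \<delta> c d" "x \<in> straight_field.N H x e r \<delta> c d"
  by (rule Ppts_straight)
 interpret straight_field V b H x e \<alpha>' r \<delta> c d by (rule sf(1))
 show "\<exists>U. open U \<and> x \<in> U \<and> (AE z in lborel. z \<in> U \<longrightarrow> H z \<notin> A)"
  using N_open sf(2) level_null[OF assms] by blast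
qed

text \<open>
 The test function is cut off both in space and in the value of \<open>H\<close>: away from the null set of
 critical values the remaining level sets avoid the critical points, and on the critical levels
 only the points where \<open>b\<close> vanishes contribute.
\<close>

theorem renormalize_global:
 assumes Z: "V - (Opts \<union> Ppts) \<in> null_sets lborel" and HZ: "H ` (V - (Opts \<union> Ppts)) \<in> null_sets lebesgue"
 shows "transp V b (\<lambda>p. \<beta> (w p))"
 unfolding transp_iff
proof (intro allI impI)
 fix \<phi> \<phi>' and K :: "(real \<times> (real^2)) set"
 assume a: "C1 \<phi> \<phi>'" "compact K" "K \<subseteq> UNIV \<times> V" "\<forall>p. p \<notin> K \<longrightarrow> \<phi> p = 0"
 note \<phi> = a(1)
 have K0: "\<phi> p = 0" if "p \<notin> K" for p using a(4) that by blast
 have \<phi>'0: "\<phi>' q = 0" if "q \<notin> K" for q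
  using C1_grad_support[OF \<phi> compact_imp_closed[OF a(2)] K0 that] .
 have [measurable]: "\<phi>' \<in> Borel" using C1_grad_borel[OF \<phi>] .
 obtain B where B: "B > 0" "\<And>p. \<bar>\<beta> (w p)\<bar> \<le> B" using \<beta>_bounded by blast
 define M where "M = Opts \<union> Ppts"
 have M: "open M" "M \<subseteq> V" using Opts_open Ppts_open Opts_V Ppts_V by (auto simp: M_def)
 define L where "L = snd ` K"
 have L: "compact L" "L \<subseteq> V" using compact_snd_image[OF a(2)] a(3) by (auto simp: L_def)
 have inL: "snd p \<in> L" if "p \<in> K" for p using that by (auto simp: L_def)
 \<comment> \<open>Only the critical levels met by the support matter. In contrast to the set of all
   critical levels, this set is known to be compact, which the cut-offs in \<open>H\<close>
   require.\<close>
 define A where "A = H ` (L - M)"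
 have cA: "compact A" unfolding A_def
  by (intro compact_continuous_image compact_diff L M continuous_on_subset[OF H_cont]) (use L in auto)
 have clA: "closed A" and [measurable]: "A \<in> sets borel" using cA compact_imp_closed borel_compact by auto
 have "A \<subseteq> H ` (V - (Opts \<union> Ppts))" using L by (auto simp: A_def M_def)
 then have "A \<in> null_sets lebesgue" using HZ null_sets_completion_subset by blast
 then have A0: "A \<in> null_sets lborel" by (simp add: null_sets_def)
 let ?I = "\<lambda>p. \<beta> (w p) * (\<phi>' p \<bullet> cfield b p)"
 have Ii: "L1 ?I"
  by (rule test_integrable[OF \<phi> a(2,3) K0 _ B(2)]) auto
 define e where "e n = 1 / (real n + 1)" for n
 have e: "0 < e n" for n by (auto simp: e_def)
 have e0: "e \<longlonglongrightarrow> 0" unfolding e_def by (rule inverse_Suc_tendsto_0)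
 \<comment> \<open>Each \<open>\<zeta> n\<close> is 1 near \<open>A\<close> and vanishes at distance
   \<open>e n\<close> or more from it. Consequently \<open>1 - \<zeta> n\<close> removes a whole
   neighbourhood of the critical levels and converges pointwise to the indicator of the
   complement.\<close>
 have "\<exists>\<zeta> \<zeta>' W. C1 \<zeta> \<zeta>' \<and> (\<forall>h. 0 \<le> \<zeta> h \<and> \<zeta> h \<le> 1) \<and> open W \<and> A \<subseteq> W \<and> (\<forall>h\<in>W. \<zeta> h = 1)
   \<and> (\<forall>h. h \<notin> (\<Union>a\<in>A. ball a (e n)) \<longrightarrow> \<zeta> h = 0)" for n
 proof -
  have "open (\<Union>a\<in>A. ball a (e n))" "A \<subseteq> (\<Union>a\<in>A. ball a (e n))" using e by auto
  from cutoff[OF cA this] show ?thesis by (smt (verit) subset_iff)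
 qed
 then obtain \<zeta> \<zeta>' W where \<zeta>: "\<And>n. C1 (\<zeta> n) (\<zeta>' n)" "\<And>n h. 0 \<le> \<zeta> n h" "\<And>n h. \<zeta> n h \<le> 1" "\<And>n. open (W n)" "\<And>n. A \<subseteq> W n"
  "\<And>n h. h \<in> W n \<Longrightarrow> \<zeta> n h = 1" "\<And>n h. h \<notin> (\<Union>a\<in>A. ball a (e n)) \<Longrightarrow> \<zeta> n h = 0" by metis
 have [measurable]: "\<zeta> n \<in> Borel" for n using C1_borel[OF \<zeta>(1)] .
 have lim: "(\<lambda>n. 1 - \<zeta> n h) \<longlonglongrightarrow> 1 - indicator A h" for h
 proof (cases "h \<in> A")
  case True
  then have "\<zeta> n h = 1" for n using \<zeta>(5,6) by blast
  then show ?thesis using True by simp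
 next
  case False
  then obtain d where d: "d > 0" "ball h d \<inter> A = {}"
   using clA by (metis closed_def Compl_iff openE disjoint_eq_subset_Compl)
  have "\<forall>\<^sub>F n in sequentially. 1 - \<zeta> n h = 1"
   using order_tendstoD(2)[OF e0 d(1)]
  proof eventually_elim
   case (elim n)
   have "h \<notin> (\<Union>a\<in>A. ball a (e n))" using d(2) elim by (auto simp: disjoint_iff dist_commute)
   then show ?case using \<zeta>(7) by simp
  qed
  then show ?thesis using False by (simp add: tendsto_eventually)
 qed
 have zero: "(LBINT p. (1 - \<zeta> n (H (snd p))) * ?I p) = 0" for n
 proof -
  \<comment> \<open>The part of the support left over by the cut-off in \<open>H\<close>. It is
    compact and free of critical points, so there is room for a spatial cut-off \<open>\<xi>\<close>
    inside \<open>M\<close>.\<close>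
  define L' where "L' = L \<inter> H -` (- W n)"
  have "closed L'" unfolding L'_def
   by (rule continuous_closed_preimage[OF continuous_on_subset[OF H_cont L(2)]])
    (use L(1) \<zeta>(4) compact_imp_closed in auto)
  then have L': "compact L'" using L(1) by (metis L'_def compact_Int_closed inf.left_idem)
  have L'M: "L' \<subseteq> M" using \<zeta>(5)[of n] by (auto simp: L'_def A_def)
  obtain \<xi> \<xi>' Q X where \<xi>: "C1 \<xi> \<xi>'" "compact Q" "Q \<subseteq> M" "\<And>x. x \<notin> Q \<Longrightarrow> \<xi> x = 0" "open X" "L' \<subseteq> X" "\<And>x. x \<in> X \<Longrightarrow> \<xi> x = 1"
   using cutoff[OF L' M(1) L'M] by metis
  have \<xi>'0: "\<xi>' x = 0" if "x \<in> X" for x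
   using C1_zero_on_open[OF C1_diff[OF \<xi>(1) C1_const[of 1]] \<xi>(5) that] \<xi>(7) by simp
  define \<psi> where "\<psi> h = 1 - \<zeta> n h" for h
  have \<psi>: "C1 \<psi> (\<lambda>h. 0 - \<zeta>' n h)" unfolding \<psi>_def[abs_def] by (rule C1_diff[OF C1_const \<zeta>(1)])
  have c1: "C1 (\<lambda>q. \<phi> (fst q, fst (snd q))) (\<lambda>q. (fst (\<phi>' (fst q, fst (snd q))), snd (\<phi>' (fst q, fst (snd q))), 0::real))"
   by (rule C1_linear[OF \<phi>, of "\<lambda>q. (fst q, fst (snd q))" "\<lambda>w. (fst w, snd w, 0)"])
    (auto intro!: bounded_linear_intros continuous_intros simp: inner_prod_def)
  have c2: "C1 (\<lambda>q::real \<times> (real^2) \<times> real. \<xi> (fst (snd q))) (\<lambda>q. (0, \<xi>' (fst (snd q)), 0))"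
   by (rule C1_linear[OF \<xi>(1), of "\<lambda>q. fst (snd q)" "\<lambda>w. (0, w, 0)"])
    (auto intro!: bounded_linear_intros continuous_intros simp: inner_prod_def)
  have c3: "C1 (\<lambda>q::real \<times> (real^2) \<times> real. \<psi> (snd (snd q))) (\<lambda>q. (0, 0, 0 - \<zeta>' n (snd (snd q))))"
   by (rule C1_linear[OF \<psi>, of "\<lambda>q. snd (snd q)" "\<lambda>w. (0, 0, w)"])
    (auto intro!: bounded_linear_intros continuous_intros simp: inner_prod_def)
  have cK: "compact (K \<inter> (UNIV \<times> Q))"
   by (intro compact_Int_closed a(2) closed_Times closed_UNIV compact_imp_closed[OF \<xi>(2)])
  have sK: "K \<inter> (UNIV \<times> Q) \<subseteq> UNIV \<times> M" using \<xi>(3) by auto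
  have s: "(\<phi> (fst (t, x, h), fst (snd (t, x, h))) * \<xi> (fst (snd (t, x, h)))) * \<psi> (snd (snd (t, x, h))) = 0"
   if "(t, x) \<notin> K \<inter> (UNIV \<times> Q)" for t x h
   using that K0 \<xi>(4) by auto
  \<comment> \<open>The right side is the integrand of \<open>transp_H\<close> for
    \<open>\<phi> * \<xi> * \<psi>\<close>, where \<open>\<psi>\<close> takes the extra variable.
    Wherever \<open>\<psi>\<close> and \<open>\<phi>\<close> both survive, \<open>\<xi>\<close> is
    locally 1 and its gradient drops out; the derivative of \<open>\<psi>\<close> is paired with
    0.\<close>
  have eq: "(1 - \<zeta> n (H (snd p))) * ?I p = \<beta> (w p) * (((\<phi> (fst (fst p, snd p, H (snd p)), fst (snd (fst p, snd p, H (snd p)))) *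
    \<xi> (fst (snd (fst p, snd p, H (snd p))))) *\<^sub>R (0, 0, 0 - \<zeta>' n (snd (snd (fst p, snd p, H (snd p))))) +
    \<psi> (snd (snd (fst p, snd p, H (snd p)))) *\<^sub>R (\<phi> (fst (fst p, snd p, H (snd p)), fst (snd (fst p, snd p, H (snd p)))) *\<^sub>R (0, \<xi>' (fst (snd (fst p, snd p, H (snd p)))), 0) +
    \<xi> (fst (snd (fst p, snd p, H (snd p)))) *\<^sub>R (fst (\<phi>' (fst (fst p, snd p, H (snd p)), fst (snd (fst p, snd p, H (snd p))))),
    snd (\<phi>' (fst (fst p, snd p, H (snd p)), fst (snd (fst p, snd p, H (snd p))))), 0::real))) \<bullet> (1, indicator {0..} (fst p) *\<^sub>R b (snd p), 0))" for p
  proof (cases "p \<in> K \<and> H (snd p) \<notin> W n")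
   case True
   then have "snd p \<in> L'" using inL[of p] by (simp add: L'_def)
   then have "snd p \<in> X" using \<xi>(6) by blast
   then have "\<xi> (snd p) = 1" "\<xi>' (snd p) = 0" using \<xi>(7) \<xi>'0 by auto
   then show ?thesis by (simp add: \<psi>_def cfield_def inner_prod_def algebra_simps)
  next
   case False
   then have "\<psi> (H (snd p)) = 0 \<or> \<phi> p = 0 \<and> \<phi>' p = 0" using \<zeta>(6)[of "H (snd p)" n] K0[of p] \<phi>'0[of p] by (cases "p \<in> K") (auto simp: \<psi>_def)
   then show ?thesis by (auto simp: \<psi>_def inner_prod_def)
  qed
  show ?thesis unfolding eq
   by (rule transp_H[OF renormalize_noncritical[folded M_def] M(2) _ B(2) C1_mult[OF C1_mult[OF c1 c2] c3] cK sK s]) measurable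
 qed
 have "(\<lambda>n. (LBINT p. (1 - \<zeta> n (H (snd p))) * ?I p)) \<longlonglongrightarrow> (LBINT p. (1 - indicator A (H (snd p))) * ?I p)"
 proof (rule integral_dominated_convergence[where w="\<lambda>p. \<bar>?I p\<bar>"])
  show "AE p in lborel. (\<lambda>n. (1 - \<zeta> n (H (snd p))) * ?I p) \<longlonglongrightarrow> (1 - indicator A (H (snd p))) * ?I p"
   by (intro AE_I2 tendsto_mult lim tendsto_const)
  show "AE p in lborel. norm ((1 - \<zeta> n (H (snd p))) * ?I p) \<le> \<bar>?I p\<bar>" for n
  proof (intro AE_I2)
   fix p :: "real \<times> (real^2)"
   have "\<bar>1 - \<zeta> n (H (snd p))\<bar> \<le> 1" using \<zeta>(2,3)[of n "H (snd p)"] by auto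
   then have "\<bar>1 - \<zeta> n (H (snd p))\<bar> * \<bar>?I p\<bar> \<le> 1 * \<bar>?I p\<bar>" by (intro mult_right_mono) auto
   then show "norm ((1 - \<zeta> n (H (snd p))) * ?I p) \<le> \<bar>?I p\<bar>" by (simp add: abs_mult)
  qed
 qed (use Ii in auto)
 then have 1: "(LBINT p. (1 - indicator A (H (snd p))) * ?I p) = 0"
  unfolding zero using LIMSEQ_unique[OF _ tendsto_const] by blast
 \<comment> \<open>Almost every point at a level in \<open>A\<close> belongs to \<open>Opts\<close>:
   the critical points are a null set, and the directed points meet a null set of levels in a null
   set.\<close>
 have "(LBINT p. indicator A (H (snd p)) * ?I p) = (LBINT p. indicator Opts (snd p) * indicator A (H (snd p)) * \<beta> (w p) * (\<phi>' p \<bullet> cfield b p))"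
 proof (rule integral_cong_AE)
  have "AE z in lborel. z \<notin> V - (Opts \<union> Ppts)" using AE_not_in[OF Z] .
  from AE_snd[where 'a=real, OF this] AE_snd[where 'a=real, OF Ppts_level_null[OF A0]]
  show "AE p in lborel. indicator A (H (snd p)) * ?I p = indicator Opts (snd p) * indicator A (H (snd p)) * \<beta> (w p) * (\<phi>' p \<bullet> cfield b p)"
  proof eventually_elim
   case (elim p)
   show ?case
   proof (cases "p \<in> K")
    case True
    then have "snd p \<in> V" using a(3) by auto
    then show ?thesis using elim by (auto simp: indicator_def)
   qed (simp add: \<phi>'0)
  qed
 qed measurable
 also have "\<dots> = 0" by (rule vanishing_integral_zero[OF \<phi> a(2) K0]) (auto simp: indicator_def)
 finally have 2: "(LBINT p. indicator A (H (snd p)) * ?I p) = 0" .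
 have i: "L1 (\<lambda>p. (1 - indicator A (H (snd p))) * ?I p)" "L1 (\<lambda>p. indicator A (H (snd p)) * ?I p)"
  by (rule integrable_mult_bounded(2)[OF Ii, of "\<lambda>p. 1 - indicator A (H (snd p))" 1]
    integrable_mult_bounded(2)[OF Ii, of "\<lambda>p. indicator A (H (snd p))" 1]; simp add: indicator_def)+
 have "?I p = (1 - indicator A (H (snd p))) * ?I p + indicator A (H (snd p)) * ?I p" for p by (simp add: algebra_simps)
 then have "(LBINT p. ?I p) = (LBINT p. (1 - indicator A (H (snd p))) * ?I p + indicator A (H (snd p)) * ?I p)" by simp
 also have "\<dots> = 0" using 1 2 i by simp
 finally show "(LBINT p. ?I p) = 0" .
qed

end

section \<open>Reduction to smooth test functions\<close>

lemma kernel_conv: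
 fixes h :: "'a::euclidean_space \<Rightarrow> 'b::euclidean_space"
 assumes K: "kernel r K" and h: "continuous_on UNIV h" and B: "\<And>x. norm (h x) \<le> B"
 shows "(\<And>y. norm y \<le> r \<Longrightarrow> norm (h (x - y) - h x) \<le> e) \<Longrightarrow> norm (conv K h x - h x) \<le> e"
  and "norm (conv K h x) \<le> B"
proof -
 have [measurable]: "K \<in> Borel" and K0: "\<And>y. 0 \<le> K y" "\<And>y. y \<notin> cball 0 r \<Longrightarrow> K y = 0"
  and Ki: "L1 K" and K1: "(LBINT y. K y) = 1" using K by (auto simp: kernel_def)
 have [measurable]: "h \<in> Borel" by (rule borel_measurable_continuous_onI[OF h])
 have hb: "norm (K y *\<^sub>R h z) \<le> norm (K y * B)" for y z
  using K0(1)[of y] order_trans[OF norm_ge_zero B] B[of z] by (auto simp: abs_mult intro!: mult_left_mono)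
 have i1: "L1 (\<lambda>y. K y *\<^sub>R h (x - y))"
  by (rule Bochner_Integration.integrable_bound[OF integrable_mult_left[OF Ki, of B]]) (use hb in auto)
 have i2: "L1 (\<lambda>y. K y *\<^sub>R h x)" using Ki by simp
 show "norm (conv K h x) \<le> B"
 proof -
  have "norm (conv K h x) \<le> (LBINT y. K y * B)" unfolding conv_def
   by (rule Bochner_Integration.integral_norm_bound_integral[OF i1 integrable_mult_left[OF Ki]]) (use K0 B in \<open>auto intro: mult_left_mono\<close>)
  then show ?thesis using K1 by simp
 qed
 show "norm (conv K h x - h x) \<le> e" if e: "\<And>y. norm y \<le> r \<Longrightarrow> norm (h (x - y) - h x) \<le> e"
 proof -
  have "conv K h x - h x = conv K h x - (LBINT y. K y *\<^sub>R h x)" using Ki K1 by simp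
  also have "\<dots> = (LBINT y. K y *\<^sub>R h (x - y) - K y *\<^sub>R h x)"
   unfolding conv_def by (rule Bochner_Integration.integral_diff[OF i1 i2, symmetric])
  also have "norm \<dots> \<le> (LBINT y. K y * e)"
  proof (rule Bochner_Integration.integral_norm_bound_integral[OF Bochner_Integration.integrable_diff[OF i1 i2] integrable_mult_left[OF Ki]])
   show "norm (K y *\<^sub>R h (x - y) - K y *\<^sub>R h x) \<le> K y * e" for y
   proof (cases "y \<in> cball 0 r")
    case True
    then show ?thesis using e[of y] K0(1)[of y] by (simp add: scaleR_diff_right[symmetric] mult_left_mono)
   qed (simp add: K0)
  qed
  also have "\<dots> = e" using K1 by simp
  finally show ?thesis .
 qed
qed

text \<open>Mollifications of a test function stay in a fixed compact subset of \<open>S\<close>,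
  are bounded together with their gradients, and converge pointwise; dominated convergence
  concludes. The shape \<open>F \<bullet> g + c * f\<close> covers the divergence condition, the
  weak gradient and the transport equation at once.\<close>

lemma smooth_tests_suffice:
 fixes F :: "'a::euclidean_space \<Rightarrow> 'a" and c :: "'a \<Rightarrow> real"
 assumes S: "open S" and [measurable]: "F \<in> Borel" "c \<in> Borel"
  and int: "\<And>K. compact K \<Longrightarrow> K \<subseteq> S \<Longrightarrow> L1 (\<lambda>x. indicator K x * (norm (F x) + \<bar>c x\<bar>))"
  and id: "\<And>f g K. smooth f \<Longrightarrow> C1 f g \<Longrightarrow> compact K \<Longrightarrow> K \<subseteq> S \<Longrightarrow> (\<And>x. x \<notin> K \<Longrightarrow> f x = 0) \<Longrightarrow>
   (LBINT x. F x \<bullet> g x + c x * f x) = 0"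
  and f: "C1 f g" "compact K" "K \<subseteq> S" "\<And>x. x \<notin> K \<Longrightarrow> f x = 0"
 shows "(LBINT x. F x \<bullet> g x + c x * f x) = 0"
proof -
 have g0: "g x = 0" if "x \<notin> K" for x using C1_grad_support[OF f(1) compact_imp_closed[OF f(2)] f(4) that] .
 have fc: "continuous_on UNIV f" "continuous_on UNIV g" using C1_continuous C1_grad_continuous f(1) by auto
 have [measurable]: "f \<in> Borel" "g \<in> Borel" using C1_borel C1_grad_borel f(1) by auto
 obtain r K' where K': "r > 0" "compact K'" "K' \<subseteq> S" "\<And>x y. x \<in> K \<Longrightarrow> dist x y \<le> r \<Longrightarrow> y \<in> K'"
  using compact_neighbourhood[OF f(2) S f(3)] by metis
 obtain R where R: "K \<subseteq> cball 0 R" using compact_subset_cball[OF f(2)] by blast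
 have fR: "f x = 0" if "x \<notin> cball 0 R" for x using f(4) R that by blast
 obtain B1 where B1: "\<And>x. norm (f x) \<le> B1" using compact_support_bounded[OF fc(1) f(2,4)] by metis
 obtain B2 where B2: "\<And>x. norm (g x) \<le> B2" using compact_support_bounded[OF fc(2) f(2) g0] by metis
 have B0: "B1 \<ge> 0" "B2 \<ge> 0" using B1 B2 norm_ge_zero order_trans by blast+
 define e where "e n = r / (real n + 1)" for n
 have e: "0 < e n" "e n \<le> r" for n using K'(1) by (auto simp: e_def field_simps)
 have e0: "e \<longlonglongrightarrow> 0" unfolding e_def
  using tendsto_mult_right_zero[OF LIMSEQ_inverse_real_of_nat, of r] by (simp add: divide_inverse add.commute)
 have "\<exists>\<kappa> :: 'a \<Rightarrow> real. mollifier (e n) \<kappa>" for n by (rule mollifier_exists[OF e(1)]) blast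
 then obtain \<kappa> :: "nat \<Rightarrow> 'a \<Rightarrow> real" where \<kappa>: "\<And>n. mollifier (e n) (\<kappa> n)" by metis
 note k = mollifier_kernel[OF \<kappa>]
 have [measurable]: "\<kappa> n \<in> Borel" and \<kappa>0: "\<And>y. y \<notin> cball 0 (e n) \<Longrightarrow> \<kappa> n y = 0"
  and \<kappa>i: "L1 (\<kappa> n)" for n using k[of n] by (auto simp: kernel_def)
 \<comment> \<open>The mollification is read in two ways: as \<open>conv (\<kappa> n) f\<close> its
   gradient falls on \<open>f\<close>, while as \<open>conv f (\<kappa> n)\<close> it inherits
   smoothness from \<open>\<kappa> n\<close>.\<close>
 define fn gn where "fn n = conv (\<kappa> n) f" and "gn n = conv (\<kappa> n) g" for n
 have sm: "smooth (fn n)" for n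
 proof -
  have "smooth (conv f (\<kappa> n))"
  proof (rule conv_smooth[OF _ _ \<kappa>0])
   show "L1 (\<lambda>y. indicator (cball 0 Q) y * f y)" for Q
    by (rule integrable_mult_bounded(1)[OF integrable_indicator_compact[OF compact_cball] _, of _ B1]) (use B1 in auto)
   show "smooth (\<kappa> n)" using \<kappa>[of n] by (simp add: mollifier_def)
  qed
  moreover have "conv f (\<kappa> n) = fn n"
  proof
   fix x show "conv f (\<kappa> n) x = fn n x"
    by (subst conv_swap) (simp_all add: fn_def conv_def mult.commute)
  qed
  ultimately show ?thesis by simp
 qed
 have c1: "C1 (fn n) (gn n)" for n unfolding fn_def gn_def
 proof (rule conv_C1[OF _ f(1) fR])
  show "L1 (\<lambda>y. indicator (cball 0 Q) y * \<kappa> n y)" for Q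
   by (rule integrable_mult_bounded(2)[OF \<kappa>i, of _ 1]) (auto simp: indicator_def)
 qed
 have z: "fn n x = 0" "gn n x = 0" if "x \<notin> K'" for n x
 proof -
  have "x - y \<notin> K" if "y \<in> cball 0 (e n)" for y
  proof
   assume "x - y \<in> K"
   moreover have "dist (x - y) x \<le> r" using that e(2)[of n] by (simp add: dist_norm)
   ultimately show False using K'(4) \<open>x \<notin> K'\<close> by blast
  qed
  then have "\<kappa> n y *\<^sub>R f (x - y) = 0" "\<kappa> n y *\<^sub>R g (x - y) = 0" for y
   using \<kappa>0[of y n] f(4)[of "x - y"] g0[of "x - y"] by (cases "y \<in> cball 0 (e n)"; force)+
  then show "fn n x = 0" "gn n x = 0" by (simp_all only: fn_def gn_def conv_def Bochner_Integration.integral_zero)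
 qed
 have lim: "(\<lambda>n. conv (\<kappa> n) h x) \<longlonglongrightarrow> h x" if h: "continuous_on UNIV h" "\<And>x. norm (h x) \<le> B"
  for h :: "'a \<Rightarrow> 'c::euclidean_space" and B x
 proof (rule LIMSEQ_I)
  fix \<epsilon> :: real assume \<epsilon>: "\<epsilon> > 0"
  have "isCont h x" using h(1) by (simp add: continuous_on_eq_continuous_at)
  then obtain d where d: "d > 0" "\<And>y. dist y x < d \<Longrightarrow> dist (h y) (h x) < \<epsilon> / 2"
   using \<epsilon> unfolding continuous_at_eps_delta by (metis half_gt_zero)
  have "\<forall>\<^sub>F n in sequentially. norm (conv (\<kappa> n) h x - h x) < \<epsilon>"
   using order_tendstoD(2)[OF e0 d(1)]
  proof eventually_elim
   case (elim n)
   have "norm (conv (\<kappa> n) h x - h x) \<le> \<epsilon> / 2"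
   proof (rule kernel_conv(1)[OF k[of n] h])
    fix y :: 'a assume "norm y \<le> e n"
    then have "dist (x - y) x < d" using elim by (simp add: dist_norm)
    from d(2)[OF this] show "norm (h (x - y) - h x) \<le> \<epsilon> / 2" by (simp add: dist_norm)
   qed
   then show ?case using \<epsilon> by simp
  qed
  then show "\<exists>N. \<forall>n\<ge>N. norm (conv (\<kappa> n) h x - h x) < \<epsilon>" by (simp add: eventually_sequentially)
 qed
 have [measurable]: "fn n \<in> Borel" "gn n \<in> Borel" for n
  using C1_borel[OF c1] C1_grad_borel[OF c1] by auto
 have [measurable]: "K' \<in> sets borel" using K'(2) borel_compact by blast
 have "(\<lambda>n. (LBINT x. F x \<bullet> gn n x + c x * fn n x)) \<longlonglongrightarrow> (LBINT x. F x \<bullet> g x + c x * f x)"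
 proof (rule integral_dominated_convergence[where w="\<lambda>x. (B1 + B2) * (indicator K' x * (norm (F x) + \<bar>c x\<bar>))"])
  show "AE x in lborel. (\<lambda>n. F x \<bullet> gn n x + c x * fn n x) \<longlonglongrightarrow> F x \<bullet> g x + c x * f x"
   unfolding fn_def gn_def by (intro AE_I2 tendsto_intros lim[OF fc(1) B1] lim[OF fc(2) B2])
  show "AE x in lborel. norm (F x \<bullet> gn n x + c x * fn n x) \<le> (B1 + B2) * (indicator K' x * (norm (F x) + \<bar>c x\<bar>))" for n
  proof (intro AE_I2)
   fix x
   show "norm (F x \<bullet> gn n x + c x * fn n x) \<le> (B1 + B2) * (indicator K' x * (norm (F x) + \<bar>c x\<bar>))"
   proof (cases "x \<in> K'")
    case True
    have b: "norm (gn n x) \<le> B2" "\<bar>fn n x\<bar> \<le> B1"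
     using kernel_conv(2)[OF k fc(2) B2, of n x] kernel_conv(2)[OF k fc(1) B1, of n x] by (auto simp: fn_def gn_def)
    have "\<bar>F x \<bullet> gn n x\<bar> \<le> norm (F x) * B2"
     by (rule order_trans[OF Cauchy_Schwarz_ineq2 mult_left_mono[OF b(1)]]) simp
    moreover have "\<bar>c x * fn n x\<bar> \<le> \<bar>c x\<bar> * B1" using b(2) by (simp add: abs_mult mult_left_mono)
    moreover have "0 \<le> norm (F x) * B1" "0 \<le> \<bar>c x\<bar> * B2" using B0 by auto
    ultimately show ?thesis using True by (simp add: algebra_simps)
   qed (simp add: z)
  qed
 qed (use int[OF K'(2,3)] in auto)
 moreover have "(LBINT x. F x \<bullet> gn n x + c x * fn n x) = 0" for n
  by (rule id[OF sm c1 K'(2,3) z(1)])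
 ultimately have "(\<lambda>n::nat. 0) \<longlonglongrightarrow> (LBINT x. F x \<bullet> g x + c x * f x)" by (simp only:)
 then show ?thesis using LIMSEQ_unique[OF _ tendsto_const] by blast
qed

section \<open>Periodization\<close>

text \<open>A lattice with a fundamental cell. It is instantiated by the integer lattice of the
  plane and by the same lattice acting on the space factor of space-time. The 2 in
  \<open>near\<close> is a bound for the norm in the unit square.\<close>

locale tiling =
 fixes \<Lambda> C :: "'a::euclidean_space set"
 assumes finite_lattice: "finite (\<Lambda> \<inter> cball 0 r)" and lattice_diff: "l \<in> \<Lambda> \<Longrightarrow> m \<in> \<Lambda> \<Longrightarrow> l - m \<in> \<Lambda>"
  and C_borel [measurable]: "C \<in> sets borel" and tile: "\<exists>!l. l \<in> \<Lambda> \<and> y - l \<in> C"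
  and near: "l \<in> \<Lambda> \<Longrightarrow> y - l \<in> C \<Longrightarrow> norm l \<le> norm y + 2"
begin

lemma lattice_zero: "0 \<in> \<Lambda>"
 using tile[of 0] lattice_diff by (metis diff_self)

lemma lattice_uminus: "l \<in> \<Lambda> \<Longrightarrow> - l \<in> \<Lambda>"
 using lattice_diff[OF lattice_zero] by simp

lemma lattice_add: "l \<in> \<Lambda> \<Longrightarrow> m \<in> \<Lambda> \<Longrightarrow> l + m \<in> \<Lambda>"
 using lattice_diff[OF _ lattice_uminus, of l m] by simp

text \<open>The sum is restricted to the nonvanishing terms so that it is finite for bounded supports.\<close>

definition per :: "('a \<Rightarrow> 'b::real_vector) \<Rightarrow> 'a \<Rightarrow> 'b" where
 "per f x = (\<Sum>l\<in>{l \<in> \<Lambda>. f (x + l) \<noteq> 0}. f (x + l))"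

lemma per_eq:
 assumes "\<And>x. x \<notin> cball 0 R \<Longrightarrow> f x = 0" "R + norm x \<le> \<rho>"
 shows "per f x = (\<Sum>l\<in>\<Lambda> \<inter> cball 0 \<rho>. f (x + l))"
 unfolding per_def
proof (rule sum.mono_neutral_left[OF finite_lattice])
 show "{l \<in> \<Lambda>. f (x + l) \<noteq> 0} \<subseteq> \<Lambda> \<inter> cball 0 \<rho>"
 proof
  fix l assume l: "l \<in> {l \<in> \<Lambda>. f (x + l) \<noteq> 0}"
  then have "norm (x + l) \<le> R" using assms(1)[of "x + l"] by force
  then show "l \<in> \<Lambda> \<inter> cball 0 \<rho>" using norm_triangle_ineq4[of "x + l" x] assms(2) l by simp
 qed
qed auto

text \<open>By \<open>near\<close>, the lattice vectors that contribute are bounded in terms of the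
  support alone, so a single finite sum serves for all points of the cell.\<close>

lemma per_tile:
 assumes "\<And>x. x \<notin> cball 0 R \<Longrightarrow> f x = 0" "x \<in> C"
 shows "per f x = (\<Sum>l\<in>\<Lambda> \<inter> cball 0 (R + 2). f (x + l))"
 unfolding per_def
proof (rule sum.mono_neutral_left[OF finite_lattice])
 show "{l \<in> \<Lambda>. f (x + l) \<noteq> 0} \<subseteq> \<Lambda> \<inter> cball 0 (R + 2)"
 proof
  fix l assume l: "l \<in> {l \<in> \<Lambda>. f (x + l) \<noteq> 0}"
  then have "norm (x + l) \<le> R" using assms(1)[of "x + l"] by force
  moreover have "norm l \<le> norm (x + l) + 2" using near[of l "x + l"] l assms(2) by simp
  ultimately show "l \<in> \<Lambda> \<inter> cball 0 (R + 2)" using l by simp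
 qed
qed auto

lemma per_shift: "m \<in> \<Lambda> \<Longrightarrow> per f (x + m) = per f x"
 unfolding per_def
 by (rule sum.reindex_bij_witness[of _ "\<lambda>l. l - m" "\<lambda>l. l + m"])
  (auto simp: lattice_diff lattice_add algebra_simps)

text \<open>On a whole ball around each point the periodization is one fixed finite sum of
  translates.\<close>

lemma per_C1:
 assumes f: "C1 f g" and R: "\<And>x. x \<notin> cball 0 R \<Longrightarrow> f x = 0"
 shows "C1 (per f) (per g)"
proof -
 have gR: "g x = 0" if "x \<notin> cball 0 R" for x using C1_grad_support[OF f closed_cball R that] .
 have per: "per h y = (\<Sum>l\<in>\<Lambda> \<inter> cball 0 (R + norm x + 1). h (y + l))"
  if "y \<in> ball x 1" "\<And>x. x \<notin> cball 0 R \<Longrightarrow> h x = 0" for h :: "'a \<Rightarrow> 'c::real_vector" and x y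
 proof (rule per_eq[OF that(2)])
  have "norm y \<le> norm x + 1" using that(1) norm_triangle_ineq2[of y x] by (simp add: dist_norm norm_minus_commute)
  then show "R + norm y \<le> R + norm x + 1" by simp
 qed auto
 have s: "C1 (\<lambda>y. \<Sum>l\<in>\<Lambda> \<inter> cball 0 \<rho>. f (y + l)) (\<lambda>y. \<Sum>l\<in>\<Lambda> \<inter> cball 0 \<rho>. g (y + l))" for \<rho>
  using finite_lattice[of \<rho>]
 proof (induction rule: finite_induct)
  case empty then show ?case using C1_const[of 0] by simp
 next
  case (insert l F) then show ?case by (simp add: C1_add[OF C1_shift[OF f]])
 qed
 show ?thesis unfolding C1_def
 proof (intro conjI allI)
  fix x
  show "(per f has_derivative (\<bullet>) (per g x)) (at x)"
  proof (rule has_derivative_transform_within_open[of _ _ _ _ "ball x 1"])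
   show "((\<lambda>y. \<Sum>l\<in>\<Lambda> \<inter> cball 0 (R + norm x + 1). f (y + l)) has_derivative (\<bullet>) (per g x)) (at x)"
    using C1_D[OF s] by (subst per[of x x g]) (auto simp: gR)
   show "(\<Sum>l\<in>\<Lambda> \<inter> cball 0 (R + norm x + 1). f (y + l)) = per f y" if "y \<in> ball x 1" for y
    by (rule per[OF that R, symmetric])
  qed auto
 next
  show "continuous_on UNIV (per g)"
  proof (intro continuous_at_imp_continuous_on ballI)
   fix x
   have c: "isCont (\<lambda>y. \<Sum>l\<in>\<Lambda> \<inter> cball 0 (R + norm x + 1). g (y + l)) x"
    using C1_grad_continuous[OF s, of UNIV] by (simp add: continuous_on_eq_continuous_at)
   have ev: "\<forall>\<^sub>F y in nhds x. (\<Sum>l\<in>\<Lambda> \<inter> cball 0 (R + norm x + 1). g (y + l)) = per g y"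
    unfolding eventually_nhds by (intro exI[of _ "ball x 1"] conjI ballI per[OF _ gR, symmetric]) auto
   show "isCont (per g) x" by (rule isCont_cong[OF ev, THEN iffD1, OF c])
  qed
 qed
qed

lemma per_inner:
 assumes "\<And>x. x \<notin> cball 0 R \<Longrightarrow> g x = 0"
 shows "per (\<lambda>x. g x \<bullet> e) x = per g x \<bullet> e"
proof -
 have "per g x \<bullet> e = (\<Sum>l\<in>\<Lambda> \<inter> cball 0 (R + norm x). g (x + l)) \<bullet> e"
  by (subst per_eq[OF assms order_refl]) auto
 also have "\<dots> = per (\<lambda>x. g x \<bullet> e) x"
  by (subst per_eq[of R "\<lambda>x. g x \<bullet> e", OF _ order_refl]) (auto simp: assms inner_sum_left)
 finally show ?thesis by simp
qed

text \<open>Periodization commutes with partial derivatives, so periodizations of smooth functions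
  with bounded support are a family closed under differentiation.\<close>

lemma per_smooth:
 assumes "smooth f" "\<And>x. x \<notin> cball 0 R \<Longrightarrow> f x = 0"
 shows "smooth (per f)"
proof (rule smooth_coinduct[of _ "per ` {f. smooth f \<and> (\<exists>R. \<forall>x. x \<notin> cball 0 R \<longrightarrow> f x = 0)}"])
 show "per f \<in> per ` {f. smooth f \<and> (\<exists>R. \<forall>x. x \<notin> cball 0 R \<longrightarrow> f x = 0)}" using assms by blast
next
 fix h x assume "h \<in> per ` {f. smooth f \<and> (\<exists>R. \<forall>x. x \<notin> cball 0 R \<longrightarrow> f x = 0)}"
 then obtain f R where "h = per f" "smooth f" "\<And>x. x \<notin> cball 0 R \<Longrightarrow> f x = 0" by blast
 from C1_D[OF per_C1[OF smooth_C1[OF this(2)] this(3)]] this(1) show "h differentiable at x"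
  unfolding differentiable_def by blast
next
 fix h and e :: 'a assume e: "e \<in> Basis" and "h \<in> per ` {f. smooth f \<and> (\<exists>R. \<forall>x. x \<notin> cball 0 R \<longrightarrow> f x = 0)}"
 then obtain f R where f: "h = per f" "smooth f" and R: "\<And>x. x \<notin> cball 0 R \<Longrightarrow> f x = 0" by blast
 obtain g where g: "C1 f g" using smooth_C1[OF f(2)] by blast
 have gR: "g x = 0" if "x \<notin> cball 0 R" for x using C1_grad_support[OF g closed_cball R that] .
 have "(\<lambda>x. frechet_derivative h (at x) e) = per (\<lambda>x. frechet_derivative f (at x) e)"
 proof
  fix x
  have "frechet_derivative h (at x) e = per g x \<bullet> e" unfolding f(1) by (rule C1_frechet[OF per_C1[OF g R]])
  also have "\<dots> = per (\<lambda>x. g x \<bullet> e) x" by (rule per_inner[OF gR, symmetric])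
  finally show "frechet_derivative h (at x) e = per (\<lambda>x. frechet_derivative f (at x) e) x"
   unfolding C1_frechet[OF g] .
 qed
 moreover have "smooth (\<lambda>x. frechet_derivative f (at x) e)" by (rule smooth_partial[OF f(2) e])
 moreover have "\<forall>x. x \<notin> cball 0 R \<longrightarrow> frechet_derivative f (at x) e = 0" using C1_frechet[OF g] gR by auto
 ultimately show "(\<lambda>x. frechet_derivative h (at x) e) \<in> per ` {f. smooth f \<and> (\<exists>R. \<forall>x. x \<notin> cball 0 R \<longrightarrow> f x = 0)}"
  by blast
qed

text \<open>Each point of the support lies in exactly one translate of the cell. Splitting the
  integral accordingly and translating every piece back into the cell gives the sum.\<close>

lemma integral_fold:
 fixes J :: "'a \<Rightarrow> real"
 assumes J: "L1 J" and R: "\<And>x. x \<notin> cball 0 R \<Longrightarrow> J x = 0"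
 shows "(LBINT x. J x) = (LBINT x. indicator C x * (\<Sum>l\<in>\<Lambda> \<inter> cball 0 (R + 2). J (x + l)))"
proof -
 let ?F = "\<Lambda> \<inter> cball 0 (R + 2)"
 have [measurable]: "J \<in> Borel" using borel_measurable_integrable[OF J] by simp
 have J_sum: "J y = (\<Sum>l\<in>?F. indicator C (y - l) * J y)" for y
 proof (cases "y \<in> cball 0 R")
  case True
  obtain l where l: "l \<in> \<Lambda>" "y - l \<in> C" "\<And>m. m \<in> \<Lambda> \<Longrightarrow> y - m \<in> C \<Longrightarrow> m = l" using tile[of y] by blast
  have "l \<in> ?F" using near[OF l(1,2)] l(1) True by simp
  have "(\<Sum>m\<in>?F. indicator C (y - m) * J y) = (\<Sum>m\<in>?F. if m = l then J y else 0)"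
  proof (rule sum.cong[OF refl])
   fix m assume "m \<in> ?F"
   then have "y - m \<in> C \<longleftrightarrow> m = l" using l by blast
   then show "indicator C (y - m) * J y = (if m = l then J y else 0)" using l(2) by simp
  qed
  then show ?thesis using \<open>l \<in> ?F\<close> finite_lattice by (simp add: sum.delta)
 qed (simp add: R)
 have i: "L1 (\<lambda>y. indicator C (y - l) * J y)" for l
  by (rule integrable_mult_bounded(2)[OF J, of _ 1]) (auto simp: indicator_def)
 have i': "L1 (\<lambda>x. indicator C x * J (x + l))" for l
  using i[of l] integrable_translate_lborel[of "\<lambda>y. indicator C (y - l) * J y" l] by simp
 have "(LBINT y. J y) = (LBINT y. (\<Sum>l\<in>?F. indicator C (y - l) * J y))"
  by (rule Bochner_Integration.integral_cong[OF refl J_sum])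
 also have "\<dots> = (\<Sum>l\<in>?F. (LBINT y. indicator C (y - l) * J y))" using i by (rule Bochner_Integration.integral_sum)
 also have "\<dots> = (\<Sum>l\<in>?F. (LBINT x. indicator C x * J (x + l)))"
 proof (rule sum.cong[OF refl])
  fix l
  show "(LBINT y. indicator C (y - l) * J y) = (LBINT x. indicator C x * J (x + l))"
   using integral_translate_lborel[of "\<lambda>y. indicator C (y - l) * J y" l] by simp
 qed
 also have "\<dots> = (LBINT x. (\<Sum>l\<in>?F. indicator C x * J (x + l)))"
  using i' by (rule Bochner_Integration.integral_sum[symmetric])
 finally show ?thesis by (simp add: sum_distrib_left)
qed

text \<open>Periodic coefficients may be taken at the point of the cell instead of its translates,
  which leaves the periodized test function. Periodicity is asked for almost everywhere, as Borel
  representatives have no more.\<close>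

lemma test_integral_fold:
 fixes F :: "'a \<Rightarrow> 'a" and c :: "'a \<Rightarrow> real"
 assumes f: "C1 f g" and R: "\<And>x. x \<notin> cball 0 R \<Longrightarrow> f x = 0"
  and [measurable]: "F \<in> Borel" "c \<in> Borel"
  and per: "\<And>l. l \<in> \<Lambda> \<Longrightarrow> AE x in lborel. F (x + l) = F x \<and> c (x + l) = c x"
  and J: "L1 (\<lambda>x. F x \<bullet> g x + c x * f x)"
 shows "(LBINT x. F x \<bullet> g x + c x * f x) = (LBINT x. indicator C x * (F x \<bullet> per g x + c x * per f x))"
proof -
 have gR: "g x = 0" if "x \<notin> cball 0 R" for x using C1_grad_support[OF f closed_cball R that] .
 have [measurable]: "f \<in> Borel" "g \<in> Borel"
  "per f \<in> Borel" "per g \<in> Borel"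
  using C1_borel[OF f] C1_grad_borel[OF f] C1_borel[OF per_C1[OF f R]] C1_grad_borel[OF per_C1[OF f R]] by auto
 let ?F = "\<Lambda> \<inter> cball 0 (R + 2)"
 have "AE x in lborel. \<forall>l\<in>?F. F (x + l) = F x \<and> c (x + l) = c x"
  using per by (subst AE_ball_countable) (auto intro: countable_finite finite_lattice)
 then have "AE x in lborel. indicator C x * (\<Sum>l\<in>?F. F (x + l) \<bullet> g (x + l) + c (x + l) * f (x + l))
  = indicator C x * (F x \<bullet> per g x + c x * per f x)"
 proof eventually_elim
  case (elim x)
  show ?case
  proof (cases "x \<in> C")
   case True
   have "F x \<bullet> per g x + c x * per f x = (\<Sum>l\<in>?F. F x \<bullet> g (x + l) + c x * f (x + l))"
    using per_tile[of R g, OF gR True] per_tile[of R f, OF R True] by (simp add: inner_sum_right sum_distrib_left sum.distrib)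
   also have "\<dots> = (\<Sum>l\<in>?F. F (x + l) \<bullet> g (x + l) + c (x + l) * f (x + l))" using elim by (intro sum.cong) auto
   finally show ?thesis by simp
  qed simp
 qed
 then show ?thesis
  by (subst integral_fold[OF J, of R]) (auto simp: R gR intro!: integral_cong_AE)
qed

end

section \<open>The integer lattice\<close>

definition lattice2 :: "(real^2) set" where "lattice2 = {l. \<forall>i. l $ i \<in> \<int>}"

lemma norm_cell: "x \<in> cell Torus \<Longrightarrow> norm x \<le> 2"
proof -
 assume "x \<in> cell Torus"
 then have "\<bar>x $ i\<bar> \<le> 1" for i by (auto simp: abs_le_iff less_imp_le intro: order_trans[of _ 0])
 then have "norm x \<le> (\<Sum>i\<in>(UNIV :: 2 set). 1)" by (intro order_trans[OF norm_le_l1_cart sum_mono]) auto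
 then show ?thesis by simp
qed

lemma cell_Torus_borel [measurable]: "cell Torus \<in> sets borel"
proof -
 have "cell Torus = (\<Inter>i. {x. 0 \<le> x $ i \<and> x $ i < 1})" by auto
 also have "\<dots> \<in> sets borel" by (intro sets.countable_INT'') auto
 finally show ?thesis .
qed

lemma finite_lattice2: "finite (lattice2 \<inter> cball 0 r)"
proof -
 define I where "I = real_of_int ` {-\<lceil>\<bar>r\<bar>\<rceil>..\<lceil>\<bar>r\<bar>\<rceil>}"
 have "lattice2 \<inter> cball 0 r \<subseteq> (\<lambda>f. vec_lambda f) ` (UNIV \<rightarrow>\<^sub>E I)"
 proof
  fix l assume l: "l \<in> lattice2 \<inter> cball 0 r"
  have "l $ i \<in> I" for i
  proof -
   obtain k where k: "l $ i = of_int k" using l by (auto simp: lattice2_def Ints_def)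
   have "\<bar>l $ i\<bar> \<le> \<bar>r\<bar>" using component_le_norm_cart[of l i] l by (simp, linarith)
   then have "\<bar>k\<bar> \<le> \<lceil>\<bar>r\<bar>\<rceil>" using k by linarith
   then show ?thesis unfolding I_def k by (intro imageI) auto
  qed
  then have "(\<lambda>i. l $ i) \<in> UNIV \<rightarrow>\<^sub>E I" by auto
  moreover have "l = vec_lambda (\<lambda>i. l $ i)" by simp
  ultimately show "l \<in> (\<lambda>f. vec_lambda f) ` (UNIV \<rightarrow>\<^sub>E I)" by blast
 qed
 moreover have "finite (UNIV \<rightarrow>\<^sub>E I :: (2 \<Rightarrow> real) set)" by (intro finite_PiE) (auto simp: I_def)
 ultimately show ?thesis by (meson finite_imageI finite_subset)
qed

lemma tile2: "\<exists>!l. l \<in> lattice2 \<and> y - l \<in> cell Torus"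
proof (rule ex1I[of _ "\<chi> i. of_int \<lfloor>y $ i\<rfloor>"])
 show "(\<chi> i. of_int \<lfloor>y $ i\<rfloor>) \<in> lattice2 \<and> y - (\<chi> i. of_int \<lfloor>y $ i\<rfloor>) \<in> cell Torus"
  by (auto simp: lattice2_def) linarith
 fix l assume l: "l \<in> lattice2 \<and> y - l \<in> cell Torus"
 show "l = (\<chi> i. of_int \<lfloor>y $ i\<rfloor>)"
 proof (rule vec_eq_iff[THEN iffD2], rule allI)
  fix i
  obtain k where k: "l $ i = of_int k" using l by (auto simp: lattice2_def Ints_def)
  moreover have "0 \<le> y $ i - l $ i" "y $ i - l $ i < 1" using l by auto
  ultimately have "\<lfloor>y $ i\<rfloor> = k" by linarith
  then show "l $ i = (\<chi> i. of_int \<lfloor>y $ i\<rfloor>) $ i" using k by simp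
 qed
qed

lemma near2: "y - l \<in> cell Torus \<Longrightarrow> norm l \<le> norm y + 2"
 using norm_triangle_ineq4[of y "y - l"] norm_cell[of "y - l"] by simp

interpretation space: tiling lattice2 "cell Torus"
proof
 show "l - m \<in> lattice2" if "l \<in> lattice2" "m \<in> lattice2" for l m using that by (auto simp: lattice2_def)
qed (rule finite_lattice2 cell_Torus_borel tile2 near2; assumption?)+

text \<open>Time is not periodized, so the lattice is trivial in that direction.\<close>

definition lattice3 :: "(real \<times> (real^2)) set" where "lattice3 = {0} \<times> lattice2"

lemma lattice3_ball: "lattice3 \<inter> cball 0 r = (\<lambda>l. (0, l)) ` (lattice2 \<inter> cball 0 r)"
 by (auto simp: lattice3_def norm_Pair)

interpretation spacetime: tiling lattice3 "UNIV \<times> cell Torus"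
proof
 show "finite (lattice3 \<inter> cball 0 r)" for r unfolding lattice3_ball using finite_lattice2 by blast
 show "l - m \<in> lattice3" if "l \<in> lattice3" "m \<in> lattice3" for l m
  using that space.lattice_diff by (auto simp: lattice3_def)
 show "(UNIV :: real set) \<times> cell Torus \<in> sets borel" unfolding borel_prod[symmetric] by (rule pair_measureI) auto
 show "\<exists>!l. l \<in> lattice3 \<and> y - l \<in> UNIV \<times> cell Torus" for y :: "real \<times> (real^2)"
 proof -
  obtain l where l: "l \<in> lattice2" "snd y - l \<in> cell Torus" "\<And>m. m \<in> lattice2 \<Longrightarrow> snd y - m \<in> cell Torus \<Longrightarrow> m = l"
   using tile2[of "snd y"] by blast
  show ?thesis
  proof (rule ex1I[of _ "(0, l)"])
   show "(0, l) \<in> lattice3 \<and> y - (0, l) \<in> UNIV \<times> cell Torus" using l(1,2) by (simp add: lattice3_def mem_Times_iff del: cell.simps)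
   fix m assume "m \<in> lattice3 \<and> y - m \<in> UNIV \<times> cell Torus"
   then show "m = (0, l)" using l(3)[of "snd m"] by (cases m) (simp add: lattice3_def mem_Times_iff del: cell.simps)
  qed
 qed
 show "norm l \<le> norm y + 2" if l: "l \<in> lattice3" "y - l \<in> UNIV \<times> cell Torus" for l y
 proof -
  have "norm (snd l) \<le> norm (snd y) + 2" using l(2) near2[of "snd y" "snd l"] by (simp add: mem_Times_iff del: cell.simps)
  moreover have "norm l = norm (snd l)" using l(1) by (auto simp: lattice3_def norm_Pair)
  ultimately show ?thesis using norm_snd_le[of "snd y" "fst y"] by simp
 qed
qed

text \<open>The translates of the unit cell cover the plane exactly once, so their indicators sum to
  1, and mollification preserves the sum. The radius 3 is the bound 2 for the cell plus the radius 1
  of the mollifier. Multiplication by \<open>\<theta>\<close> will turn a periodic test function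
  into one with compact support that periodizes to it.\<close>

lemma lattice_partition_of_unity:
 obtains \<theta> \<theta>' :: "real^2 \<Rightarrow> _" where "C1 \<theta> \<theta>'" "\<And>x. x \<notin> cball 0 3 \<Longrightarrow> \<theta> x = 0" "\<And>x. space.per \<theta> x = 1"
proof -
 let ?C = "cell Torus" and ?\<chi> = "indicator (cell Torus) :: real^2 \<Rightarrow> real"
 obtain K :: "real^2 \<Rightarrow> real" where K: "mollifier 1 K" using mollifier_exists[of 1] by auto
 obtain k where k: "C1 K k" using mollifier_C1[OF K] by blast
 have [measurable]: "K \<in> Borel" using C1_borel[OF k] .
 have K0: "K y = 0" if "y \<notin> cball 0 1" for y using K that unfolding mollifier_def by blast
 have Ki: "L1 K" and K1: "(LBINT y. K y) = 1" using K by (auto simp: mollifier_def)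
 define \<theta> where "\<theta> = conv ?\<chi> K"
 have \<theta>: "C1 \<theta> (conv ?\<chi> k)" unfolding \<theta>_def
 proof (rule conv_C1[OF _ k K0])
  show "L1 (\<lambda>y. indicator (cball 0 R) y * ?\<chi> y)" for R
   by (rule integrable_mult_bounded(1)[OF integrable_indicator_compact[OF compact_cball], of _ 1])
    (auto simp: indicator_def simp del: cell.simps)
 qed
 have \<theta>s: "\<theta> x = (LBINT y. ?\<chi> (x - y) * K y)" for x unfolding \<theta>_def by (subst conv_swap) auto
 have \<theta>0: "\<theta> x = 0" if "x \<notin> cball 0 3" for x
 proof -
  have "?\<chi> (x - y) * K y = 0" for y
  proof (cases "y \<in> cball 0 1")
   case True
   then have "\<not> norm (x - y) \<le> 2" using that norm_triangle_ineq[of "x - y" y] by simp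
   then show ?thesis using norm_cell[of "x - y"] by (auto simp: indicator_def simp del: cell.simps)
  qed (simp add: K0)
  then show ?thesis unfolding \<theta>s by (simp only: Bochner_Integration.integral_zero)
 qed
 have "space.per \<theta> x = 1" for x
 proof -
  let ?F = "lattice2 \<inter> cball 0 (3 + norm x)"
  have i: "L1 (\<lambda>y. ?\<chi> (x + l - y) * K y)" for l
   by (rule integrable_mult_bounded(2)[OF Ki, of _ 1]) (auto simp: indicator_def simp del: cell.simps)
  have "space.per \<theta> x = (\<Sum>l\<in>?F. \<theta> (x + l))" by (rule space.per_eq[OF \<theta>0]) auto
  also have "\<dots> = (LBINT y. (\<Sum>l\<in>?F. ?\<chi> (x + l - y) * K y))"
   unfolding \<theta>s using i by (rule Bochner_Integration.integral_sum[symmetric])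
  also have "\<dots> = (LBINT y. K y)"
  proof (rule Bochner_Integration.integral_cong[OF refl])
   fix y
   show "(\<Sum>l\<in>?F. ?\<chi> (x + l - y) * K y) = K y"
   proof (cases "y \<in> cball 0 1")
    case True
    obtain l where l: "l \<in> lattice2" "x - y - l \<in> ?C" "\<And>m. m \<in> lattice2 \<Longrightarrow> x - y - m \<in> ?C \<Longrightarrow> m = l"
     using tile2[of "x - y"] by blast
    have "norm l \<le> norm (x - y) + 2" using near2[OF l(2)] .
    then have "- l \<in> ?F" using l(1) True norm_triangle_ineq4[of x y] space.lattice_uminus[of l] by simp
    moreover have "?\<chi> (x + m - y) = (if m = - l then 1 else 0)" if "m \<in> ?F" for m
    proof -
     have "x + m - y \<in> ?C \<longleftrightarrow> m = - l"
      using l(2) l(3)[of "- m"] space.lattice_uminus[of m] that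
      by (auto simp: algebra_simps simp del: cell.simps)
     then show ?thesis by (simp add: indicator_def del: cell.simps)
    qed
    ultimately have "(\<Sum>m\<in>?F. ?\<chi> (x + m - y) * K y) = (\<Sum>m\<in>?F. if m = - l then K y else 0)"
     by (intro sum.cong) auto
    then show ?thesis using \<open>- l \<in> ?F\<close> finite_lattice2 by (simp add: sum.delta)
   qed (simp add: K0)
  qed
  finally show ?thesis using K1 by simp
 qed
 then show ?thesis using that \<theta> \<theta>0 by blast
qed

section \<open>Borel representatives\<close>

lemma AE_lebesgue_on:
 assumes "S \<in> sets borel"
 shows "(AE x in lebesgue_on S. P x) \<longleftrightarrow> (AE x in lborel. x \<in> S \<longrightarrow> P x)"
 using assms by (subst AE_restrict_space_iff) (auto simp: AE_completion_iff)

lemma lebesgue_measurable_AE_eq: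
 fixes g g' :: "'a::euclidean_space \<Rightarrow> 'b::topological_space"
 assumes [measurable]: "g' \<in> Borel" and eq: "AE x in lborel. g x = g' x"
 shows "g \<in> borel_measurable lebesgue"
proof (rule measurableI)
 obtain N where N: "\<And>x. x \<in> space lborel - N \<Longrightarrow> g x = g' x" "N \<in> null_sets lborel"
  by (rule AE_E3[OF eq]) blast
 fix A :: "'b set" assume A [measurable]: "A \<in> sets borel"
 have "g' -` A \<inter> space borel \<in> sets borel" by measurable
 then have "g' -` A - N \<in> sets lebesgue" using N(2) by (auto intro!: sets.Diff)
 moreover have "g -` A \<inter> N \<in> sets lebesgue" by (rule null_sets_completion[OF N(2)]) simp
 moreover have "g -` A \<inter> space lebesgue = (g' -` A - N) \<union> (g -` A \<inter> N)" using N(1) by auto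
 ultimately show "g -` A \<inter> space lebesgue \<in> sets lebesgue" by (metis sets.Un)
qed simp

text \<open>Completeness of Lebesgue measure makes \<open>f\<close> measurable on \<open>S\<close>,
  being almost everywhere equal to a Borel function. Integrals over subsets become integrals over
  the whole space, where Fubini is available.\<close>

lemma lebesgue_on_integral:
 fixes f f' :: "'a::euclidean_space \<Rightarrow> real"
 assumes S [measurable]: "S \<in> sets borel" and [measurable]: "f' \<in> Borel"
  and eq: "AE x in lborel. x \<in> S \<longrightarrow> f x = f' x"
 shows "(LINT x|lebesgue_on S. f x) = (LBINT x. indicator S x * f' x)"
  and "integrable (lebesgue_on S) f \<longleftrightarrow> L1 (\<lambda>x. indicator S x * f' x)"
proof -
 have ae: "AE x in lborel. indicator S x *\<^sub>R f x = indicator S x * f' x"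
  using eq by eventually_elim (auto simp: indicator_def)
 have m: "(\<lambda>x. indicator S x *\<^sub>R f x) \<in> borel_measurable lebesgue"
  by (rule lebesgue_measurable_AE_eq[OF _ ae]) measurable
 have m': "(\<lambda>x. indicator S x * f' x) \<in> borel_measurable lborel" by measurable
 note ml = measurable_completion[OF m']
 have "(LINT x|lebesgue_on S. f x) = integral\<^sup>L lebesgue (\<lambda>x. indicator S x *\<^sub>R f x)"
  by (rule integral_restrict_space) simp
 also have "\<dots> = integral\<^sup>L lebesgue (\<lambda>x. indicator S x * f' x)"
  by (rule integral_cong_AE[OF m ml AE_completion[OF ae]])
 finally show "(LINT x|lebesgue_on S. f x) = (LBINT x. indicator S x * f' x)"
  using integral_completion[OF m'] by simp
 have "integrable (lebesgue_on S) f \<longleftrightarrow> integrable lebesgue (\<lambda>x. indicator S x *\<^sub>R f x)"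
  by (rule integrable_restrict_space) simp
 also have "\<dots> \<longleftrightarrow> integrable lebesgue (\<lambda>x. indicator S x * f' x)"
  by (rule integrable_cong_AE[OF m ml AE_completion[OF ae]])
 finally show "integrable (lebesgue_on S) f \<longleftrightarrow> L1 (\<lambda>x. indicator S x * f' x)"
  using integrable_completion[OF m'] by simp
qed

lemma borel_representative:
 fixes f :: "'a::euclidean_space \<Rightarrow> 'b::euclidean_space"
 assumes S [measurable]: "S \<in> sets borel" and f: "f \<in> borel_measurable (lebesgue_on S)"
 obtains f' where "f' \<in> Borel" "AE x in lborel. x \<in> S \<longrightarrow> f x = f' x"
proof -
 have m: "(\<lambda>x. indicator S x *\<^sub>R f x) \<in> borel_measurable lebesgue"
  using f by (subst (asm) borel_measurable_restrict_space_iff) auto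
 have "\<exists>g\<in>borel_measurable lborel. AE x in lborel. (indicator S x *\<^sub>R f x) \<bullet> e = g x" for e
  by (rule completion_ex_borel_measurable_real) (intro borel_measurable_inner m borel_measurable_const)
 then obtain g where g: "\<And>e. g e \<in> borel_measurable lborel" "\<And>e. AE x in lborel. (indicator S x *\<^sub>R f x) \<bullet> e = g e x" by metis
 have [measurable]: "g e \<in> Borel" for e using g(1)[of e] by simp
 have "AE x in lborel. \<forall>e\<in>Basis. (indicator S x *\<^sub>R f x) \<bullet> e = g e x"
  using g(2) by (subst AE_ball_countable) (auto intro: countable_finite)
 then have "AE x in lborel. x \<in> S \<longrightarrow> f x = (\<Sum>e\<in>Basis. g e x *\<^sub>R e)"
 proof eventually_elim
  case (elim x)
  have "f x = (\<Sum>e\<in>Basis. (f x \<bullet> e) *\<^sub>R e)" by (simp add: euclidean_representation)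
  moreover have "(\<Sum>e\<in>Basis. (f x \<bullet> e) *\<^sub>R e) = (\<Sum>e\<in>Basis. g e x *\<^sub>R e)" if "x \<in> S"
   using elim that by (intro sum.cong refl) auto
  ultimately show ?case by simp
 qed
 then show ?thesis by (rule that[rotated]) measurable
qed

lemma bounded_representative:
 assumes S: "S \<in> sets borel" and f: "ess_bounded S f"
 obtains f' C where "f' \<in> Borel" "\<And>x. \<bar>f' x\<bar> \<le> C" "AE x in lborel. x \<in> S \<longrightarrow> f x = f' x"
proof -
 obtain C where "AE x in lebesgue_on S. \<bar>f x\<bar> \<le> C" using f unfolding ess_bounded_def by blast
 then have C: "AE x in lborel. x \<in> S \<longrightarrow> \<bar>f x\<bar> \<le> C" unfolding AE_lebesgue_on[OF S] .
 obtain g where g [measurable]: "g \<in> Borel" and ae: "AE x in lborel. x \<in> S \<longrightarrow> f x = g x"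
  using borel_representative[OF S, of f] f unfolding ess_bounded_def by blast
 define f' where "f' x = max (- \<bar>C\<bar>) (min \<bar>C\<bar> (g x))" for x
 show ?thesis
 proof (rule that[of f' "\<bar>C\<bar>"])
  show "f' \<in> Borel" unfolding f'_def by measurable
  show "\<bar>f' x\<bar> \<le> \<bar>C\<bar>" for x by (auto simp: f'_def)
  show "AE x in lborel. x \<in> S \<longrightarrow> f x = f' x"
   using ae C by eventually_elim (auto simp: f'_def)
 qed
qed

lemma AE_translate_lborel:
 fixes P :: "'a::euclidean_space \<Rightarrow> bool"
 assumes "AE x in lborel. P x"
 shows "AE x in lborel. P (x + l)"
proof -
 obtain N where N: "\<And>x. x \<in> space lborel - N \<Longrightarrow> P x" "N \<in> null_sets lborel"
  by (rule AE_E3[OF assms]) blast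
 have [measurable]: "N \<in> sets borel" using N(2) by auto
 have "emeasure lborel {x. x + l \<in> N} = (\<integral>\<^sup>+x. indicator N (x + l) \<partial>lborel)"
  using nn_integral_indicator[of "{x. x + l \<in> N}" lborel] by (simp add: indicator_def)
 also have "\<dots> = (\<integral>\<^sup>+x. indicator N x \<partial>lborel)" by (rule nn_integral_translate_lborel) measurable
 also have "\<dots> = 0" using N(2) by auto
 finally have "{x. x + l \<in> N} \<in> null_sets lborel" by (simp add: null_sets_def)
 then show ?thesis by (rule AE_I') (use N(1) in auto)
qed

section \<open>Test functions on the domain\<close>

lemma test_pair_integrable:
 fixes F :: "'a::euclidean_space \<Rightarrow> 'a" and c :: "'a \<Rightarrow> real"
 assumes f: "C1 f g" "compact K" "\<And>x. x \<notin> K \<Longrightarrow> f x = 0"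
  and [measurable]: "F \<in> Borel" "c \<in> Borel"
  and i: "L1 (\<lambda>x. indicator K x * (norm (F x) + \<bar>c x\<bar>))"
 shows "L1 (\<lambda>x. F x \<bullet> g x + c x * f x)"
proof -
 have g0: "g x = 0" if "x \<notin> K" for x using C1_grad_support[OF f(1) compact_imp_closed[OF f(2)] f(3) that] .
 have [measurable]: "f \<in> Borel" "g \<in> Borel" using C1_borel C1_grad_borel f(1) by auto
 obtain B1 where B1: "\<And>x. norm (f x) \<le> B1" using compact_support_bounded[OF C1_continuous[OF f(1)] f(2,3)] by metis
 obtain B2 where B2: "\<And>x. norm (g x) \<le> B2" using compact_support_bounded[OF C1_grad_continuous[OF f(1)] f(2) g0] by metis
 have B0: "B1 \<ge> 0" "B2 \<ge> 0" using B1 B2 norm_ge_zero order_trans by blast+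
 show ?thesis
 proof (rule Bochner_Integration.integrable_bound[OF integrable_mult_right[OF i, of "B1 + B2"]])
  show "AE x in lborel. norm (F x \<bullet> g x + c x * f x) \<le> norm ((B1 + B2) * (indicator K x * (norm (F x) + \<bar>c x\<bar>)))"
  proof (intro AE_I2)
   fix x
   show "norm (F x \<bullet> g x + c x * f x) \<le> norm ((B1 + B2) * (indicator K x * (norm (F x) + \<bar>c x\<bar>)))"
   proof (cases "x \<in> K")
    case True
    have "\<bar>F x \<bullet> g x\<bar> \<le> norm (F x) * B2"
     by (rule order_trans[OF Cauchy_Schwarz_ineq2 mult_left_mono[OF B2]]) simp
    moreover have "\<bar>c x * f x\<bar> \<le> \<bar>c x\<bar> * B1" using B1[of x] by (simp add: abs_mult mult_left_mono)
    moreover have "0 \<le> norm (F x) * B1" "0 \<le> \<bar>c x\<bar> * B2" using B0 by auto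
    ultimately have "\<bar>F x \<bullet> g x + c x * f x\<bar> \<le> (B1 + B2) * (norm (F x) + \<bar>c x\<bar>)"
     by (simp add: algebra_simps)
    then show ?thesis using True by (auto intro: order_trans[OF _ abs_ge_self])
   qed (simp add: f(3) g0)
  qed
 qed measurable
qed

lemma (in tiling) periodic_tests_suffice:
 fixes F :: "'a \<Rightarrow> 'a" and c :: "'a \<Rightarrow> real"
 assumes m [measurable]: "F \<in> Borel" "c \<in> Borel"
  and int: "\<And>K. compact K \<Longrightarrow> L1 (\<lambda>x. indicator K x * (norm (F x) + \<bar>c x\<bar>))"
  and per: "\<And>l. l \<in> \<Lambda> \<Longrightarrow> AE x in lborel. F (x + l) = F x \<and> c (x + l) = c x"
  and id: "\<And>f g R. smooth f \<Longrightarrow> C1 f g \<Longrightarrow> (\<And>x. x \<notin> cball 0 R \<Longrightarrow> f x = 0) \<Longrightarrow>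
   (LBINT x. indicator C x * (F x \<bullet> per g x + c x * per f x)) = 0"
  and f: "C1 f g" "compact K" "\<And>x. x \<notin> K \<Longrightarrow> f x = 0"
 shows "(LBINT x. F x \<bullet> g x + c x * f x) = 0"
proof (rule smooth_tests_suffice[OF open_UNIV m int _ f(1,2) subset_UNIV f(3)])
 fix f g and K :: "'a set" assume f: "smooth f" "C1 f g" "compact K" "\<And>x. x \<notin> K \<Longrightarrow> f x = 0"
 obtain R where "K \<subseteq> cball 0 R" using compact_subset_cball[OF f(3)] by blast
 then have R: "f x = 0" if "x \<notin> cball 0 R" for x using f(4) that by blast
 show "(LBINT x. F x \<bullet> g x + c x * f x) = 0"
  using test_integral_fold[OF f(2) R m per test_pair_integrable[OF f(2-4) m int[OF f(3)]]] id[OF f(1,2) R] by simp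
qed

lemma periodic_lattice:
 assumes f: "periodic f" and l: "l \<in> lattice2"
 shows "f (x + l) = f x"
proof -
 have nat: "f (x + real n *\<^sub>R axis i 1) = f x" for n i x
 proof (induction n)
  case (Suc n)
  have "x + real (Suc n) *\<^sub>R axis i 1 = (x + real n *\<^sub>R axis i 1) + axis i 1" by (simp add: algebra_simps)
  then show ?case using f Suc by (simp only: periodic_def)
 qed simp
 have int: "f (x + of_int k *\<^sub>R axis i 1) = f x" for k i x
 proof (cases "k \<ge> 0")
  case True
  then show ?thesis using nat[of x "nat k" i] by simp
 next
  case False
  then show ?thesis using nat[of "x + of_int k *\<^sub>R axis i 1" "nat (- k)" i] by simp
 qed
 obtain j k where jk: "l $ 1 = of_int j" "l $ 2 = of_int k" using l unfolding lattice2_def by (metis Ints_cases mem_Collect_eq)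
 have eq: "x + l = (x + of_int j *\<^sub>R axis 1 1) + of_int k *\<^sub>R axis 2 1"
  by (simp add: vec_eq_iff forall_2 axis_def jk)
 show ?thesis unfolding eq int ..
qed

lemma axis_lattice: "axis i 1 \<in> lattice2"
 by (auto simp: lattice2_def axis_def)

lemma compact_supp:
 fixes f :: "'a::euclidean_space \<Rightarrow> real"
 assumes "compact K" "\<And>x. x \<notin> K \<Longrightarrow> f x = 0"
 shows "compact (supp f)" "supp f \<subseteq> K"
proof -
 have "{x. f x \<noteq> 0} \<subseteq> K" using assms(2) by auto
 then show "supp f \<subseteq> K" unfolding supp_def using compact_imp_closed[OF assms(1)] by (rule closure_minimal)
 then show "compact (supp f)" using assms(1) by (metis closed_closure compact_Int_closed inf.absorb_iff2 supp_def)
qed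

lemma supp_zero: "x \<notin> supp f \<Longrightarrow> f x = 0"
 using closure_subset[of "{x. f x \<noteq> 0}"] by (auto simp: supp_def)

lemma C1_grad: "C1 f g \<Longrightarrow> grad f x = g x"
 by (simp add: grad_def C1_frechet vec_eq_iff inner_axis)

locale domain =
 fixes \<Omega> :: planar_domain
 assumes points_open: "open (points \<Omega>)"
begin

lemma cell_points: "cell \<Omega> \<subseteq> points \<Omega>"
 by (cases \<Omega>) auto

lemma points_borel [measurable]: "points \<Omega> \<in> sets borel"
 using points_open by simp

lemma cell_borel [measurable]: "cell \<Omega> \<in> sets borel"
 using cell_Torus_borel points_borel by (cases \<Omega>) (auto simp del: cell.simps(1))

lemma cell_not_torus: "\<Omega> \<noteq> Torus \<Longrightarrow> cell \<Omega> = points \<Omega>"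
 by (cases \<Omega>) auto

text \<open>Passes from the test functions of the domain to all \<open>C1\<close> functions with
  compact support in it. On the torus a compactly supported function is periodized and its integral
  folds onto the cell; in the other cases it is smoothed inside the domain.\<close>

lemma space_tests:
 fixes F :: "real^2 \<Rightarrow> real^2" and c :: "real^2 \<Rightarrow> real"
 assumes m: "F \<in> Borel" "c \<in> Borel"
  and int: "\<And>K. compact K \<Longrightarrow> K \<subseteq> points \<Omega> \<Longrightarrow> L1 (\<lambda>x. indicator K x * (norm (F x) + \<bar>c x\<bar>))"
  and per: "\<And>l. \<Omega> = Torus \<Longrightarrow> l \<in> lattice2 \<Longrightarrow> AE x in lborel. F (x + l) = F x \<and> c (x + l) = c x"
  and id: "\<And>f g. test_function \<Omega> f \<Longrightarrow> C1 f g \<Longrightarrow>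
   (LBINT x. indicator (cell \<Omega>) x * (F x \<bullet> g x + c x * f x)) = 0"
  and f: "C1 f g" "compact K" "K \<subseteq> points \<Omega>" "\<And>x. x \<notin> K \<Longrightarrow> f x = 0"
 shows "(LBINT x. F x \<bullet> g x + c x * f x) = 0"
proof (cases "\<Omega> = Torus")
 case T: True
 show ?thesis
 proof (rule space.periodic_tests_suffice[OF m int per _ f(1,2,4)])
  fix f :: "real^2 \<Rightarrow> real" and g R assume f: "smooth f" "C1 f g" "\<And>x. x \<notin> cball 0 R \<Longrightarrow> f x = 0"
  have "test_function \<Omega> (space.per f)"
   using space.per_smooth[OF f(1,3)] T space.per_shift[OF axis_lattice]
   by (auto simp: test_function_def function_on_def periodic_def)
  from id[OF this space.per_C1[OF f(2,3)]]
  show "(LBINT x. indicator (cell Torus) x * (F x \<bullet> space.per g x + c x * space.per f x)) = 0"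
   by (simp add: T del: cell.simps)
 qed (use T in auto)
next
 case T: False
 show ?thesis
 proof (rule smooth_tests_suffice[OF points_open m int _ f])
  fix f g and K :: "(real^2) set"
  assume f: "smooth f" "C1 f g" "compact K" "K \<subseteq> points \<Omega>" "\<And>x. x \<notin> K \<Longrightarrow> f x = 0"
  have g0: "g x = 0" if "x \<notin> K" for x using C1_grad_support[OF f(2) compact_imp_closed[OF f(3)] f(5) that] .
  have "test_function \<Omega> f"
   using f(1) T compact_supp[OF f(3), of f, OF f(5)] f(4) by (auto simp: test_function_def function_on_def)
  from id[OF this f(2)] show "(LBINT x. F x \<bullet> g x + c x * f x) = 0"
  proof (rule back_subst[where P="\<lambda>x. x = 0"], intro Bochner_Integration.integral_cong refl)
   fix x
   show "indicator (cell \<Omega>) x * (F x \<bullet> g x + c x * f x) = F x \<bullet> g x + c x * f x"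
    using f(4,5) g0 cell_not_torus[OF T] by (cases "x \<in> K") auto
  qed
 qed
qed

lemma spacetime_tests:
 fixes F :: "real \<times> (real^2) \<Rightarrow> real \<times> (real^2)"
 assumes m: "F \<in> Borel"
  and int: "\<And>K. compact K \<Longrightarrow> K \<subseteq> UNIV \<times> points \<Omega> \<Longrightarrow> L1 (\<lambda>p. indicator K p * norm (F p))"
  and per: "\<And>l. \<Omega> = Torus \<Longrightarrow> l \<in> lattice3 \<Longrightarrow> AE p in lborel. F (p + l) = F p"
  and id: "\<And>f g. spacetime_test_function \<Omega> f \<Longrightarrow> C1 f g \<Longrightarrow>
   (LBINT p. indicator (UNIV \<times> cell \<Omega>) p * (F p \<bullet> g p)) = 0"
  and f: "C1 f g" "compact K" "K \<subseteq> UNIV \<times> points \<Omega>" "\<And>x. x \<notin> K \<Longrightarrow> f x = 0"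
 shows "(LBINT p. F p \<bullet> g p) = 0"
proof -
 have "(LBINT p. F p \<bullet> g p + (\<lambda>_. 0) p * f p) = 0"
 proof (cases "\<Omega> = Torus")
  case T: True
  show ?thesis
  proof (rule spacetime.periodic_tests_suffice[OF m _ _ _ _ f(1,2,4)])
   fix f :: "real \<times> (real^2) \<Rightarrow> real" and g R assume f: "smooth f" "C1 f g" "\<And>x. x \<notin> cball 0 R \<Longrightarrow> f x = 0"
   have "spacetime.per f (t, x) = 0" if "R < \<bar>t\<bar>" for t x
   proof -
    have "f ((t, x) + l) = 0" if "l \<in> lattice3" for l
    proof (rule f(3))
     have "\<bar>t\<bar> \<le> norm ((t, x) + l)" using that norm_fst_le[of t "x + snd l"] by (auto simp: lattice3_def)
     then show "(t, x) + l \<notin> cball 0 R" using \<open>R < \<bar>t\<bar>\<close> by simp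
    qed
    then show ?thesis unfolding spacetime.per_def by (simp add: sum.neutral)
   qed
   moreover have "spacetime.per f (t, x + axis i 1) = spacetime.per f (t, x)" for t x i
    using spacetime.per_shift[of "(0, axis i 1)" f "(t, x)"] axis_lattice by (simp add: lattice3_def)
   ultimately have "spacetime_test_function \<Omega> (spacetime.per f)"
    using spacetime.per_smooth[OF f(1,3)] T
    by (auto simp: spacetime_test_function_def function_on_def periodic_def)
   from id[OF this spacetime.per_C1[OF f(2,3)]]
   show "(LBINT p. indicator (UNIV \<times> cell Torus) p * (F p \<bullet> spacetime.per g p + 0 * spacetime.per f p)) = 0"
    by (simp add: T del: cell.simps)
  qed (use T int per in auto)
 next
  case T: False
  have o: "open ((UNIV :: real set) \<times> points \<Omega>)" by (intro open_Times points_open open_UNIV)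
  show ?thesis
  proof (rule smooth_tests_suffice[OF o m _ _ _ f])
   fix f g and K :: "(real \<times> (real^2)) set"
   assume f: "smooth f" "C1 f g" "compact K" "K \<subseteq> UNIV \<times> points \<Omega>" "\<And>x. x \<notin> K \<Longrightarrow> f x = 0"
   have g0: "g x = 0" if "x \<notin> K" for x using C1_grad_support[OF f(2) compact_imp_closed[OF f(3)] f(5) that] .
   have "spacetime_test_function \<Omega> f"
    using f(1) T compact_supp[OF f(3), of f, OF f(5)] f(4) by (auto simp: spacetime_test_function_def function_on_def)
   from id[OF this f(2)] have "(LBINT p. F p \<bullet> g p) = 0"
   proof (rule back_subst[where P="\<lambda>x. x = 0"], intro Bochner_Integration.integral_cong refl)
    fix p
    show "indicator (UNIV \<times> cell \<Omega>) p * (F p \<bullet> g p) = F p \<bullet> g p"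
     using f(4) g0[of p] cell_not_torus[OF T] by (cases "p \<in> K") auto
   qed
   then show "(LBINT p. F p \<bullet> g p + 0 * f p) = 0" by simp
  qed (use int in auto)
 qed
 then show ?thesis by simp
qed

text \<open>On the torus the support is periodic and so not compact in the plane in general; but
  only values on the bounded cell enter the integrals, and a ball around the cell serves.\<close>

lemma test_function_compact:
 assumes f: "test_function \<Omega> f" and g: "C1 f g"
 obtains K where "compact K" "K \<subseteq> points \<Omega>" "\<And>x. x \<in> cell \<Omega> - K \<Longrightarrow> f x = 0 \<and> g x = 0"
proof (cases "\<Omega> = Torus")
 case True
 then show ?thesis using that[of "cball 0 2"] norm_cell by (auto simp del: cell.simps)
next
 case False
 then have "compact (supp f)" "supp f \<subseteq> points \<Omega>" using f by (auto simp: test_function_def)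
 then show ?thesis
  using that[of "supp f"] supp_zero[of _ f] C1_grad_support[OF g compact_imp_closed supp_zero[of _ f]] by blast
qed

lemma spacetime_test_compact:
 assumes f: "spacetime_test_function \<Omega> f" and g: "C1 f g"
 obtains K where "compact K" "K \<subseteq> UNIV \<times> points \<Omega>" "\<And>p. p \<in> UNIV \<times> cell \<Omega> - K \<Longrightarrow> f p = 0 \<and> g p = 0"
proof (cases "\<Omega> = Torus")
 case True
 then obtain T where T: "\<And>t x. T < \<bar>t\<bar> \<Longrightarrow> f (t, x) = 0" using f by (auto simp: spacetime_test_function_def)
 have o: "open {p :: real \<times> (real^2). T < \<bar>fst p\<bar>}" by (intro open_Collect_less continuous_intros)
 have g0: "g p = 0" if "T < \<bar>fst p\<bar>" for p
  by (rule C1_zero_on_open[OF g o]) (use that T in auto)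
 show ?thesis
 proof (rule that[of "{-T..T} \<times> cball 0 2"])
  show "compact ({-T..T} \<times> cball (0 :: real^2) 2)" by (intro compact_Times compact_Icc compact_cball)
  fix p :: "real \<times> (real^2)" assume p: "p \<in> UNIV \<times> cell \<Omega> - {-T..T} \<times> cball 0 2"
  then have "norm (snd p) \<le> 2" using norm_cell[of "snd p"] True by (auto simp: mem_Times_iff simp del: cell.simps)
  then have "T < \<bar>fst p\<bar>" using p by (cases p) auto
  then show "f p = 0 \<and> g p = 0" using T[of "fst p" "snd p"] g0[of p] by simp
 qed (use True in auto)
next
 case False
 then have "compact (supp f)" "supp f \<subseteq> UNIV \<times> points \<Omega>" using f by (auto simp: spacetime_test_function_def)
 then show ?thesis
  using that[of "supp f"] supp_zero[of _ f] C1_grad_support[OF g compact_imp_closed supp_zero[of _ f]] by blast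
qed

end

section \<open>The transport equation on the domain\<close>

lemma borel_measurable_vec_nth [measurable (raw)]:
 fixes f :: "'a \<Rightarrow> real^2"
 assumes [measurable]: "f \<in> borel_measurable M"
 shows "(\<lambda>x. f x $ i) \<in> borel_measurable M"
proof -
 have "(\<lambda>x. f x \<bullet> axis i 1) \<in> borel_measurable M" by measurable
 then show ?thesis by (simp add: inner_axis)
qed

text \<open>\<open>b'\<close> is a Borel representative of \<open>b\<close>. Slicing and changes of
  variables are carried out with \<open>b'\<close>, and the conclusions return to \<open>b\<close>
  almost everywhere.\<close>

locale problem = domain +
 fixes b :: "real^2 \<Rightarrow> real^2" and H :: "real^2 \<Rightarrow> real" and b' :: "real^2 \<Rightarrow> real^2"
 assumes b_L2_loc: "L2_loc \<Omega> b" and b_divergence: "divergence_free \<Omega> b"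
  and b_hamiltonian: "hamiltonian \<Omega> H b" and H_function: "function_on \<Omega> H"
  and H_continuous: "continuous_on (points \<Omega>) H"
  and b'_borel [measurable]: "b' \<in> Borel"
  and b'_eq: "AE x in lborel. x \<in> points \<Omega> \<longrightarrow> b x = b' x"
begin

text \<open>Replacing the arbitrary values outside the domain by 0 gives a function that is Borel on
  the whole plane.\<close>

definition H' :: "real^2 \<Rightarrow> real" where "H' x = indicator (points \<Omega>) x *\<^sub>R H x"

lemma H'_eq: "x \<in> points \<Omega> \<Longrightarrow> H' x = H x"
 by (simp add: H'_def)

lemma H'_borel [measurable]: "H' \<in> Borel"
 unfolding H'_def[abs_def] by (rule borel_measurable_continuous_on_indicator[OF points_borel H_continuous])

lemma b'_L2:
 assumes "compact K" "K \<subseteq> points \<Omega>"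
 shows "L1 (\<lambda>x. indicator K x * (norm (b' x))\<^sup>2)"
proof -
 have K: "K \<in> sets borel" using assms(1) borel_compact by blast
 have ae: "AE x in lborel. x \<in> K \<longrightarrow> (norm (b x))\<^sup>2 = (norm (b' x))\<^sup>2"
  using b'_eq by eventually_elim (use assms(2) in auto)
 have m: "(\<lambda>x. (norm (b' x))\<^sup>2) \<in> Borel" by measurable
 show ?thesis
  using b_L2_loc assms lebesgue_on_integral(2)[OF K m ae] unfolding L2_loc_def by blast
qed

lemma b'_L1:
 assumes "compact K" "K \<subseteq> points \<Omega>"
 shows "L1 (\<lambda>x. indicator K x * norm (b' x))"
 by (rule integrable_norm_of_square[OF assms(1) _ b'_L2[OF assms]]) measurable

lemma b'_periodic:
 assumes T: "\<Omega> = Torus" and l: "l \<in> lattice2"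
 shows "AE x in lborel. b' (x + l) = b' x"
proof -
 have "periodic b" using b_L2_loc T by (simp add: L2_loc_def function_on_def)
 then have per: "b (x + l) = b x" for x using periodic_lattice[OF _ l] by blast
 have e: "AE x in lborel. b x = b' x" using b'_eq by (simp add: T)
 show ?thesis using e AE_translate_lborel[OF e, of l] by eventually_elim (use per in simp)
qed

lemma H'_loc:
 assumes "compact K" "K \<subseteq> points \<Omega>"
 shows "L1 (\<lambda>x. indicator K x * \<bar>H' x\<bar>)"
proof -
 have [measurable]: "K \<in> sets borel" using assms(1) borel_compact by blast
 have "bounded (H ` K)"
  by (intro compact_imp_bounded compact_continuous_image assms(1) continuous_on_subset[OF H_continuous assms(2)])
 then obtain B where B: "\<And>x. x \<in> K \<Longrightarrow> \<bar>H x\<bar> \<le> B" by (auto simp: bounded_iff)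
 show ?thesis
 proof (rule integrable_bounded_support[OF _ _ assms(1)])
  show "\<bar>indicator K x * \<bar>H' x\<bar>\<bar> \<le> max B 0" for x
   using B[of x] H'_eq[of x] assms(2) by (auto simp: indicator_def max_def)
 qed (use assms(1) in auto)
qed

lemma rot_loc:
 assumes "compact K" "K \<subseteq> points \<Omega>"
 shows "L1 (\<lambda>x. indicator K x * \<bar>rot (b' x) $ i\<bar>)"
proof (rule Bochner_Integration.integrable_bound[OF b'_L1[OF assms]])
 have [measurable]: "K \<in> sets borel" using assms(1) borel_compact by blast
 show "(\<lambda>x. indicator K x * \<bar>rot (b' x) $ i\<bar>) \<in> borel_measurable lborel" by measurable
 show "AE x in lborel. norm (indicator K x * \<bar>rot (b' x) $ i\<bar>) \<le> norm (indicator K x * norm (b' x))"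
  using component_le_norm_cart[of "rot (b' _)" i] by (intro AE_I2) (auto simp: indicator_def norm_rot)
qed

lemma b'_divfree: "divfree (points \<Omega>) b'"
 unfolding divfree_def
proof (intro allI impI)
 fix f g and K :: "(real^2) set" assume f: "C1 f g" "compact K" "K \<subseteq> points \<Omega>" "\<forall>x. x \<notin> K \<longrightarrow> f x = 0"
 have "(LBINT x. b' x \<bullet> g x + (\<lambda>_. 0) x * f x) = 0"
 proof (rule space_tests[OF _ _ _ _ _ f(1-3)])
  show "L1 (\<lambda>x. indicator K x * (norm (b' x) + \<bar>0\<bar>))" if "compact K" "K \<subseteq> points \<Omega>" for K
   using b'_L1[OF that] by simp
  show "AE x in lborel. b' (x + l) = b' x \<and> (0::real) = 0" if "\<Omega> = Torus" "l \<in> lattice2" for l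
   using b'_periodic[OF that] by simp
  fix f g assume f: "test_function \<Omega> f" "C1 f g"
  have [measurable]: "g \<in> Borel" using C1_grad_borel[OF f(2)] .
  have m: "(\<lambda>x. b' x \<bullet> g x) \<in> Borel" by measurable
  have ae: "AE x in lborel. x \<in> cell \<Omega> \<longrightarrow> b x \<bullet> grad f x = b' x \<bullet> g x"
   using b'_eq by eventually_elim (use cell_points C1_grad[OF f(2)] in auto)
  have "(LINT x|lebesgue_on (cell \<Omega>). b x \<bullet> grad f x) = 0" using b_divergence f(1) by (simp add: divergence_free_def)
  then show "(LBINT x. indicator (cell \<Omega>) x * (b' x \<bullet> g x + 0 * f x)) = 0"
   using lebesgue_on_integral(1)[OF cell_borel m ae] by simp
 qed (use f(4) in auto)
 then show "(LBINT x. b' x \<bullet> g x) = 0" by simp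
qed

lemma cell_integrable:
 fixes m h :: "real^2 \<Rightarrow> real"
 assumes K: "compact K" and i: "L1 (\<lambda>x. indicator K x * \<bar>m x\<bar>)" and [measurable]: "m \<in> Borel"
  and h: "continuous_on UNIV h" "\<And>x. x \<in> cell \<Omega> - K \<Longrightarrow> h x = 0"
 shows "L1 (\<lambda>x. indicator (cell \<Omega>) x * (m x * h x))"
proof -
 have [measurable]: "h \<in> Borel" by (rule borel_measurable_continuous_onI[OF h(1)])
 obtain R where R: "K \<subseteq> cball 0 R" using compact_subset_cball[OF K] by blast
 obtain B where B: "B > 0" "\<And>x. x \<in> cball 0 R \<Longrightarrow> norm (h x) \<le> B"
  using continuous_bounded_on_cball[OF h(1)] by metis
 show ?thesis
 proof (rule Bochner_Integration.integrable_bound[OF integrable_mult_left[OF i, of B]])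
  show "AE x in lborel. norm (indicator (cell \<Omega>) x * (m x * h x)) \<le> norm (indicator K x * \<bar>m x\<bar> * B)"
  proof (intro AE_I2)
   fix x show "norm (indicator (cell \<Omega>) x * (m x * h x)) \<le> norm (indicator K x * \<bar>m x\<bar> * B)"
   proof (cases "x \<in> cell \<Omega> \<and> x \<in> K")
    case True
    then have "\<bar>h x\<bar> \<le> B" using B R by auto
    then show ?thesis using True B(1) by (simp add: abs_mult mult_left_mono)
   qed (use h(2)[of x] in \<open>auto simp: indicator_def\<close>)
  qed
 qed measurable
qed

text \<open>One coordinate at a time, in the shape of \<open>space_tests\<close>: the field
  \<open>H'\<close> times \<open>axis i 1\<close> produces the partial derivative, and the
  zeroth-order coefficient is the component of \<open>rot b'\<close>, since \<open>rot\<close>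
  undoes \<open>perp\<close>.\<close>

lemma H_weak_component:
 assumes f: "C1 f g" "compact K" "K \<subseteq> points \<Omega>" "\<And>x. x \<notin> K \<Longrightarrow> f x = 0"
 shows "(LBINT x. H' x * g x $ i + rot (b' x) $ i * f x) = 0"
proof -
 have "(LBINT x. (H' x *\<^sub>R axis i 1) \<bullet> g x + rot (b' x) $ i * f x) = 0"
 proof (rule space_tests[OF _ _ _ _ _ f])
  show "L1 (\<lambda>x. indicator K x * (norm (H' x *\<^sub>R axis i (1::real)) + \<bar>rot (b' x) $ i\<bar>))"
   if "compact K" "K \<subseteq> points \<Omega>" for K
   using Bochner_Integration.integrable_add[OF H'_loc[OF that] rot_loc[OF that]] by (simp add: distrib_left)
  show "AE x in lborel. H' (x + l) *\<^sub>R axis i 1 = H' x *\<^sub>R axis i (1::real) \<and> rot (b' (x + l)) $ i = rot (b' x) $ i"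
   if T: "\<Omega> = Torus" and l: "l \<in> lattice2" for l
  proof -
   have "periodic H" using H_function T by (simp add: function_on_def)
   then have "H (x + l) = H x" for x using periodic_lattice[OF _ l] by blast
   moreover have "points \<Omega> = UNIV" by (simp add: T)
   ultimately have "H' (x + l) = H' x" for x using H'_eq[of "x + l"] H'_eq[of x] by simp
   then show ?thesis using b'_periodic[OF that] by (auto elim!: eventually_mono)
  qed
  fix f g assume f: "test_function \<Omega> f" "C1 f g"
  have [measurable]: "f \<in> Borel" "g \<in> Borel" using C1_borel C1_grad_borel f(2) by auto
  obtain K where K: "compact K" "K \<subseteq> points \<Omega>" "\<And>x. x \<in> cell \<Omega> - K \<Longrightarrow> f x = 0 \<and> g x = 0"
   using test_function_compact[OF f] by metis
  obtain G where G: "weak_gradient \<Omega> H G" "AE x in lborel. x \<in> points \<Omega> \<longrightarrow> b x = perp (G x)"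
   using b_hamiltonian unfolding hamiltonian_def AE_lebesgue_on[OF points_borel] by blast
  have rp: "rot (perp v) = v" for v by (simp add: rot_def perp_def vec_eq_iff forall_2)
  have 1: "(LINT x|lebesgue_on (cell \<Omega>). H x * grad f x $ i) = (LBINT x. indicator (cell \<Omega>) x * (H' x * g x $ i))"
  proof (rule lebesgue_on_integral(1)[OF cell_borel])
   show "AE x in lborel. x \<in> cell \<Omega> \<longrightarrow> H x * grad f x $ i = H' x * g x $ i"
    using cell_points by (intro AE_I2) (auto simp: H'_eq C1_grad[OF f(2)])
  qed measurable
  have 2: "(LINT x|lebesgue_on (cell \<Omega>). G x $ i * f x) = (LBINT x. indicator (cell \<Omega>) x * (rot (b' x) $ i * f x))"
  proof (rule lebesgue_on_integral(1)[OF cell_borel])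
   show "AE x in lborel. x \<in> cell \<Omega> \<longrightarrow> G x $ i * f x = rot (b' x) $ i * f x"
    using b'_eq G(2)
   proof eventually_elim
    case (elim x)
    show ?case
    proof
     assume "x \<in> cell \<Omega>"
     then have "b' x = perp (G x)" using elim cell_points by auto
     then show "G x $ i * f x = rot (b' x) $ i * f x" using rp by simp
    qed
   qed
  qed measurable
  have "L1 (\<lambda>x. indicator (cell \<Omega>) x * (H' x * g x $ i))"
   by (rule cell_integrable[OF K(1) H'_loc[OF K(1,2)]]) (use K(3) in \<open>auto intro!: continuous_intros C1_grad_continuous[OF f(2)]\<close>)
  moreover have "L1 (\<lambda>x. indicator (cell \<Omega>) x * (rot (b' x) $ i * f x))"
   by (rule cell_integrable[OF K(1) rot_loc[OF K(1,2)]]) (use K(3) in \<open>auto intro!: C1_continuous[OF f(2)]\<close>)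
  moreover have "(LBINT x. indicator (cell \<Omega>) x * (H' x * g x $ i)) = - (LBINT x. indicator (cell \<Omega>) x * (rot (b' x) $ i * f x))"
   using G(1) f(1) unfolding weak_gradient_def 1[symmetric] 2[symmetric] by blast
  moreover have "indicator (cell \<Omega>) x * ((H' x *\<^sub>R axis i 1) \<bullet> g x + rot (b' x) $ i * f x)
   = indicator (cell \<Omega>) x * (H' x * g x $ i) + indicator (cell \<Omega>) x * (rot (b' x) $ i * f x)" for x
   by (simp add: inner_commute[of "axis i 1"] inner_axis distrib_left)
  ultimately show "(LBINT x. indicator (cell \<Omega>) x * ((H' x *\<^sub>R axis i 1) \<bullet> g x + rot (b' x) $ i * f x)) = 0"
   by simp
 qed measurable
 then show ?thesis by (simp add: inner_commute[of "axis i 1"] inner_axis)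
qed

sublocale ham_field "points \<Omega>" b' H'
proof
 show "continuous_on (points \<Omega>) H'"
  using H_continuous continuous_on_cong[of "points \<Omega>" "points \<Omega>" H' H] H'_eq by blast
 show "(LBINT x. H' x * (g x \<bullet> v)) = - (LBINT x. (rot (b' x) \<bullet> v) * f x)"
  if f: "C1 f g" "compact K" "K \<subseteq> points \<Omega>" "\<And>x. x \<notin> K \<Longrightarrow> f x = 0" for f g K v
 proof -
  have g0: "g x = 0" if "x \<notin> K" for x using C1_grad_support[OF f(1) compact_imp_closed[OF f(2)] f(4) that] .
  have [measurable]: "f \<in> Borel" "g \<in> Borel" using C1_borel C1_grad_borel f(1) by auto
  have i1: "L1 (\<lambda>x. H' x * g x $ i)" for i
  proof -
   have "L1 (\<lambda>x. (H' x *\<^sub>R axis i 1) \<bullet> g x + (\<lambda>_. 0) x * f x)"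
    by (rule test_pair_integrable[OF f(1,2,4)]) (use H'_loc[OF f(2,3)] in auto)
   then show ?thesis by (simp add: inner_commute[of "axis i 1"] inner_axis)
  qed
  have i2: "L1 (\<lambda>x. rot (b' x) $ i * f x)" for i
  proof -
   have "L1 (\<lambda>x. (\<lambda>_. 0) x \<bullet> g x + rot (b' x) $ i * f x)"
    by (rule test_pair_integrable[OF f(1,2,4)]) (use rot_loc[OF f(2,3)] in auto)
   then show ?thesis by simp
  qed
  have c: "(LBINT x. H' x * g x $ i) = - (LBINT x. rot (b' x) $ i * f x)" for i
   using H_weak_component[OF f, of i] i1[of i] i2[of i] by simp
  have "(LBINT x. H' x * (g x \<bullet> v)) = (LBINT x. (\<Sum>i\<in>UNIV. H' x * g x $ i * v $ i))"
   by (simp add: inner_vec_def sum_distrib_left mult.assoc)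
  also have "\<dots> = (\<Sum>i\<in>UNIV. (LBINT x. H' x * g x $ i) * v $ i)"
   using i1 by (subst Bochner_Integration.integral_sum) auto
  also have "\<dots> = - (\<Sum>i\<in>UNIV. (LBINT x. rot (b' x) $ i * f x) * v $ i)"
   unfolding c by (simp add: sum_negf)
  also have "(\<Sum>i\<in>UNIV. (LBINT x. rot (b' x) $ i * f x) * v $ i) = (LBINT x. (\<Sum>i\<in>UNIV. rot (b' x) $ i * f x * v $ i))"
   using i2 by (subst Bochner_Integration.integral_sum) auto
  also have "\<dots> = (LBINT x. (rot (b' x) \<bullet> v) * f x)"
   by (intro Bochner_Integration.integral_cong refl) (simp add: inner_vec_def sum_distrib_left sum_distrib_right mult_ac)
  finally show ?thesis .
 qed
qed (use points_open b'_L2 b'_divfree in auto)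

lemma local_AE:
 assumes "open U" "U \<subseteq> points \<Omega>"
 shows "(AE y in lebesgue_on U. Q (b y)) \<longleftrightarrow> (AE y in lborel. y \<in> U \<longrightarrow> Q (b' y))"
proof -
 have "AE y in lborel. (y \<in> U \<longrightarrow> Q (b y)) \<longleftrightarrow> (y \<in> U \<longrightarrow> Q (b' y))"
  using b'_eq by eventually_elim (use assms(2) in auto)
 then have "(AE y in lborel. y \<in> U \<longrightarrow> Q (b y)) \<longleftrightarrow> (AE y in lborel. y \<in> U \<longrightarrow> Q (b' y))"
  by (rule eventually_subst)
 then show ?thesis using assms(1) by (subst AE_lebesgue_on) auto
qed

lemma Opts_eq: "Opts = vanishing_points \<Omega> b"
 unfolding Opts_def vanishing_points_def using local_AE[of _ "\<lambda>y. y = 0"] by blast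

lemma Ppts_eq: "Ppts = directed_points \<Omega> b"
 unfolding Ppts_def directed_points_def using local_AE[OF open_ball, of _ _ "\<lambda>y. _ \<le> y \<bullet> _"] by blast

lemma critical_eq: "points \<Omega> - (Opts \<union> Ppts) = critical_points \<Omega> b"
 unfolding critical_points_def Opts_eq Ppts_eq ..

text \<open>
 \<open>w\<close> extends a Borel representative of \<open>u\<close> by the initial value at negative times, so that the
 initial condition becomes part of the equation.
\<close>

definition extension :: "(real^2 \<Rightarrow> real) \<Rightarrow> (real \<times> (real^2) \<Rightarrow> real) \<Rightarrow> (real \<times> (real^2) \<Rightarrow> real) \<Rightarrow> bool" where
 "extension u0 u w \<longleftrightarrow> w \<in> Borel \<and> (\<exists>C. \<forall>p. \<bar>w p\<bar> \<le> C) \<and> (\<forall>t z. t < 0 \<longrightarrow> w (t, z) = w (-1, z)) \<and>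
   (AE p in lborel. p \<in> {0..} \<times> points \<Omega> \<longrightarrow> u p = w p) \<and> (AE x in lborel. x \<in> points \<Omega> \<longrightarrow> u0 x = w (-1, x))"

lemma extensionD:
 assumes "extension u0 u w"
 shows "w \<in> Borel" "\<exists>C. \<forall>p. \<bar>w p\<bar> \<le> C" "t < 0 \<Longrightarrow> w (t, z) = w (-1, z)"
  "AE p in lborel. p \<in> {0..} \<times> points \<Omega> \<longrightarrow> u p = w p" "AE x in lborel. x \<in> points \<Omega> \<longrightarrow> u0 x = w (-1, x)"
 using assms unfolding extension_def by blast+

lemma extension_exists:
 assumes "Linf \<Omega> u0" "spacetime_Linf \<Omega> u"
 obtains w where "extension u0 u w"
proof -
 have S: "{0::real..} \<times> points \<Omega> \<in> sets borel"
  unfolding borel_prod[symmetric] by (rule pair_measureI) auto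
 obtain g0 C0 where [measurable]: "g0 \<in> Borel" and g0: "\<And>x. \<bar>g0 x\<bar> \<le> C0" "AE x in lborel. x \<in> points \<Omega> \<longrightarrow> u0 x = g0 x"
  by (rule bounded_representative[OF points_borel assms(1)[unfolded Linf_def, THEN conjunct2]]) (rule that)
 obtain g C where [measurable]: "g \<in> Borel" and g: "\<And>p. \<bar>g p\<bar> \<le> C" "AE p in lborel. p \<in> {0..} \<times> points \<Omega> \<longrightarrow> u p = g p"
  by (rule bounded_representative[OF S assms(2)[unfolded spacetime_Linf_def, THEN conjunct2]]) (rule that)
 have "extension u0 u (\<lambda>p. if 0 \<le> fst p then g p else g0 (snd p))"
  unfolding extension_def
 proof (intro conjI)
  show "(\<lambda>p. if 0 \<le> fst p then g p else g0 (snd p)) \<in> Borel" by measurable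
  show "\<exists>B. \<forall>p. \<bar>if 0 \<le> fst p then g p else g0 (snd p)\<bar> \<le> B"
   using g(1) g0(1) by (intro exI[of _ "max C C0"]) (auto simp: le_max_iff_disj)
  show "AE p in lborel. p \<in> {0..} \<times> points \<Omega> \<longrightarrow> u p = (if 0 \<le> fst p then g p else g0 (snd p))"
   using g(2) by eventually_elim (auto simp: mem_Times_iff)
  show "AE x in lborel. x \<in> points \<Omega> \<longrightarrow> u0 x = (if 0 \<le> fst (- 1 :: real, x) then g (-1, x) else g0 (snd (- 1 :: real, x)))"
   using g0(2) by simp
 qed simp
 then show ?thesis using that by blast
qed

lemma extension_comp:
 assumes w: "extension u0 u w" and \<beta>: "continuous_on UNIV \<beta>"
 shows "extension (\<beta> \<circ> u0) (\<beta> \<circ> u) (\<lambda>p. \<beta> (w p))"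
proof -
 have [measurable]: "\<beta> \<in> Borel" by (rule borel_measurable_continuous_onI[OF \<beta>])
 have [measurable]: "w \<in> Borel" using extensionD(1)[OF w] .
 obtain C where C: "\<And>p. \<bar>w p\<bar> \<le> C" using extensionD(2)[OF w] by blast
 obtain B where "\<And>x. x \<in> cball 0 C \<Longrightarrow> norm (\<beta> x) \<le> B" using continuous_bounded_on_cball[OF \<beta>] by metis
 then have "\<bar>\<beta> (w p)\<bar> \<le> B" for p using C[of p] by simp
 moreover have "(\<lambda>p. \<beta> (w p)) \<in> Borel" by measurable
 moreover have "\<beta> (w (t, z)) = \<beta> (w (-1, z))" if "t < 0" for t z using extensionD(3)[OF w that] by simp
 moreover have "AE p in lborel. p \<in> {0..} \<times> points \<Omega> \<longrightarrow> (\<beta> \<circ> u) p = \<beta> (w p)"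
  using extensionD(4)[OF w] by eventually_elim simp
 moreover have "AE x in lborel. x \<in> points \<Omega> \<longrightarrow> (\<beta> \<circ> u0) x = \<beta> (w (-1, x))"
  using extensionD(5)[OF w] by eventually_elim simp
 ultimately show ?thesis unfolding extension_def by blast
qed

text \<open>At negative times \<open>w\<close> is constant in time and \<open>cfield\<close> is the
  pure time derivative, so this half of the integral is the initial value times
  \<open>\<phi>(0, x)\<close>. The initial term thus moves to the other side as the missing half of
  a homogeneous equation.\<close>

lemma extension_identity:
 assumes w: "extension u0 u w" and \<phi>: "spacetime_test_function \<Omega> \<phi>" "C1 \<phi> \<phi>'"
 shows "(LINT (t, x)|lebesgue_on ({0..} \<times> cell \<Omega>). u (t, x) * (deriv (\<lambda>s. \<phi> (s, x)) t + b x \<bullet> grad (\<lambda>y. \<phi> (t, y)) x)) =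
   - (LINT x|lebesgue_on (cell \<Omega>). u0 x * \<phi> (0, x)) \<longleftrightarrow>
  (LBINT p. indicator (UNIV \<times> cell \<Omega>) p * (w p * (\<phi>' p \<bullet> cfield b' p))) = 0"
proof -
 have [measurable]: "w \<in> Borel" "\<phi> \<in> Borel" "\<phi>' \<in> Borel"
  using extensionD(1)[OF w] C1_borel[OF \<phi>(2)] C1_grad_borel[OF \<phi>(2)] by auto
 have \<phi>_slice [measurable]: "(\<lambda>x. \<phi> (0, x)) \<in> Borel" by measurable
 have [measurable]: "{0::real..} \<times> cell \<Omega> \<in> sets borel" "{..<0::real} \<times> cell \<Omega> \<in> sets borel" "(UNIV :: real set) \<times> cell \<Omega> \<in> sets borel"
  unfolding borel_prod[symmetric] by (rule pair_measureI; simp)+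
 obtain C where C: "\<And>p. \<bar>w p\<bar> \<le> C" using extensionD(2)[OF w] by blast
 have C0: "C \<ge> 0" using C[of undefined] by linarith
 have neg: "w (t, z) = w (-1, z)" if "t < 0" for t z using extensionD(3)[OF w that] by simp
 have ae: "AE p in lborel. p \<in> {0..} \<times> points \<Omega> \<longrightarrow> u p = w p" "AE x in lborel. x \<in> points \<Omega> \<longrightarrow> u0 x = w (-1, x)"
  by (rule extensionD(4,5)[OF w])+
 obtain K where K: "compact K" "K \<subseteq> UNIV \<times> points \<Omega>" "\<And>p. p \<in> UNIV \<times> cell \<Omega> - K \<Longrightarrow> \<phi> p = 0 \<and> \<phi>' p = 0"
  using spacetime_test_compact[OF \<phi>] by metis
 obtain Q where Q: "K \<subseteq> cball 0 Q" using compact_subset_cball[OF K(1)] by blast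
 obtain A' where A': "A' > 0" "\<And>p. p \<in> cball 0 Q \<Longrightarrow> norm (\<phi>' p) \<le> A'"
  using continuous_bounded_on_cball[OF C1_grad_continuous[OF \<phi>(2)]] by metis
 have int: "L1 (\<lambda>p. indicator (S \<times> cell \<Omega>) p * (w p * (\<phi>' p \<bullet> cfield b' p)))"
  if [measurable]: "S \<times> cell \<Omega> \<in> sets borel" for S :: "real set"
 proof (rule integrable_cfield[OF K(1,2), of _ "C * A'"])
  show "indicator (S \<times> cell \<Omega>) p * (w p * (\<phi>' p \<bullet> cfield b' p)) = 0" if "p \<notin> K" for p
   using K(3)[of p] that by (cases "p \<in> UNIV \<times> cell \<Omega>") (auto simp: indicator_def)
  fix p :: "real \<times> (real^2)" assume "p \<in> K"
  then have n: "norm (\<phi>' p) \<le> A'" using A'(2)[of p] Q by blast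
  have "\<bar>\<phi>' p \<bullet> cfield b' p\<bar> \<le> A' * (1 + norm (b' (snd p)))"
   by (rule order_trans[OF Cauchy_Schwarz_ineq2 mult_mono]) (use A'(1) n norm_cfield[of b' p] in auto)
  then have "\<bar>w p\<bar> * \<bar>\<phi>' p \<bullet> cfield b' p\<bar> \<le> C * (A' * (1 + norm (b' (snd p))))"
   using C C0 by (intro mult_mono) auto
  moreover have "0 \<le> C * (A' * (1 + norm (b' (snd p))))" using C0 A'(1) by (intro mult_nonneg_nonneg) auto
  ultimately show "\<bar>indicator (S \<times> cell \<Omega>) p * (w p * (\<phi>' p \<bullet> cfield b' p))\<bar> \<le> C * A' * (1 + norm (b' (snd p)))"
   by (auto simp: indicator_def abs_mult mult.assoc)
 qed measurable
 have pos: "(LINT (t, x)|lebesgue_on ({0..} \<times> cell \<Omega>). u (t, x) * (deriv (\<lambda>s. \<phi> (s, x)) t + b x \<bullet> grad (\<lambda>y. \<phi> (t, y)) x)) =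
  (LBINT p. indicator ({0..} \<times> cell \<Omega>) p * (w p * (\<phi>' p \<bullet> cfield b' p)))"
 proof (rule lebesgue_on_integral(1))
  have bs: "AE p in (lborel :: (real \<times> (real^2)) measure). snd p \<in> points \<Omega> \<longrightarrow> b (snd p) = b' (snd p)"
   by (rule AE_snd[OF b'_eq])
  show "AE p in lborel. p \<in> {0..} \<times> cell \<Omega> \<longrightarrow>
   (case p of (t, x) \<Rightarrow> u (t, x) * (deriv (\<lambda>s. \<phi> (s, x)) t + b x \<bullet> grad (\<lambda>y. \<phi> (t, y)) x)) = w p * (\<phi>' p \<bullet> cfield b' p)"
   using ae(1) bs
  proof eventually_elim
   case (elim p)
   obtain t x where p: "p = (t, x)" by (cases p)
   have d: "deriv (\<lambda>s. \<phi> (s, x)) t = \<phi>' (t, x) \<bullet> (1, 0)" by (rule DERIV_imp_deriv[OF C1_slice_time(1)[OF \<phi>(2)]])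
   have g: "grad (\<lambda>y. \<phi> (t, y)) x = snd (\<phi>' (t, x))" by (rule C1_grad[OF C1_slice_space[OF \<phi>(2)]])
   show ?case unfolding p prod.case d g
    using elim cell_points by (auto simp: p cfield_def inner_prod_def inner_commute)
  qed
 qed measurable
 have ini: "(LINT x|lebesgue_on (cell \<Omega>). u0 x * \<phi> (0, x)) = (LBINT x. indicator (cell \<Omega>) x * (w (-1, x) * \<phi> (0, x)))"
 proof (rule lebesgue_on_integral(1)[OF cell_borel])
  show "AE x in lborel. x \<in> cell \<Omega> \<longrightarrow> u0 x * \<phi> (0, x) = w (-1, x) * \<phi> (0, x)"
   using ae(2) by eventually_elim (use cell_points in auto)
 qed measurable
 obtain R0 where R0: "fst ` K \<subseteq> cball 0 R0" using compact_subset_cball[OF compact_fst_image[OF K(1)]] by blast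
 define R where "R = max R0 0 + 1"
 have R: "R > 0" "\<And>t z. t \<le> - R \<Longrightarrow> (t, z) \<notin> K" using R0 by (force simp: R_def)+
 have slice: "(LBINT t. indicator ({..<0} \<times> cell \<Omega>) (t, z) * (w (t, z) * (\<phi>' (t, z) \<bullet> cfield b' (t, z))))
  = indicator (cell \<Omega>) z * (w (-1, z) * \<phi> (0, z))" for z
 proof (cases "z \<in> cell \<Omega>")
  case True
  have "(LBINT t. indicator {..<0} t * (\<phi>' (t, z) \<bullet> (1, 0))) = \<phi> (0, z)"
  proof (rule FTC_negative[of "\<lambda>t. \<phi> (t, z)"])
   show "\<phi> (t, z) = 0" if "t \<le> - R" for t using R(2)[OF that] K(3)[of "(t, z)"] True by simp
   show "\<phi>' (t, z) \<bullet> (1, 0) = 0" if "t < - R" for t using R(2)[of t z] that K(3)[of "(t, z)"] True by simp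
  qed (intro C1_slice_time[OF \<phi>(2)] R)+
  moreover have "indicator ({..<0} \<times> cell \<Omega>) (t, z) * (w (t, z) * (\<phi>' (t, z) \<bullet> cfield b' (t, z)))
   = w (-1, z) * (indicator {..<0} t * (\<phi>' (t, z) \<bullet> (1, 0)))" for t
   using True neg[of t z] by (cases "t < 0") (auto simp: cfield_def)
  ultimately show ?thesis using True by simp
 qed simp
 have "(LBINT p. indicator ({..<0} \<times> cell \<Omega>) p * (w p * (\<phi>' p \<bullet> cfield b' p)))
  = (LBINT x. indicator (cell \<Omega>) x * (w (-1, x) * \<phi> (0, x)))"
  by (subst integral_slices(2)[OF int]) (simp_all add: slice)
 moreover have "indicator (UNIV \<times> cell \<Omega>) p * (w p * (\<phi>' p \<bullet> cfield b' p)) =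
  indicator ({0..} \<times> cell \<Omega>) p * (w p * (\<phi>' p \<bullet> cfield b' p)) + indicator ({..<0} \<times> cell \<Omega>) p * (w p * (\<phi>' p \<bullet> cfield b' p))" for p
  by (cases p) (auto simp: indicator_def)
 moreover have "L1 (\<lambda>p. indicator ({0..} \<times> cell \<Omega>) p * (w p * (\<phi>' p \<bullet> cfield b' p)))"
  "L1 (\<lambda>p. indicator ({..<0} \<times> cell \<Omega>) p * (w p * (\<phi>' p \<bullet> cfield b' p)))"
  by (rule int; measurable)+
 ultimately show ?thesis unfolding pos ini by simp linarith
qed

text \<open>The representative inherits periodicity almost everywhere, from \<open>u\<close> at
  nonnegative times and from \<open>u0\<close> at negative ones; translated null sets are
  null.\<close>

lemma extension_periodic:
 assumes w: "extension u0 u w" and Linf: "Linf \<Omega> u0" "spacetime_Linf \<Omega> u"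
  and T: "\<Omega> = Torus" and l: "l \<in> lattice3"
 shows "AE p in lborel. w (p + l) *\<^sub>R cfield b' (p + l) = w p *\<^sub>R cfield b' p"
proof -
 have l2: "fst l = 0" "snd l \<in> lattice2" using l by (auto simp: lattice3_def)
 have per: "u (t, x + snd l) = u (t, x)" if "t \<ge> 0" for t x
  using Linf T that periodic_lattice[OF _ l2(2), of "\<lambda>x. u (t, x)"] by (auto simp: spacetime_Linf_def function_on_def)
 have per0: "u0 (x + snd l) = u0 x" for x
  using Linf T periodic_lattice[OF _ l2(2), of u0] by (auto simp: Linf_def function_on_def)
 have a1: "AE p in lborel. p \<in> {0..} \<times> points \<Omega> \<longrightarrow> u p = w p" and a0: "AE x in lborel. x \<in> points \<Omega> \<longrightarrow> u0 x = w (-1, x)"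
  and neg: "\<And>t z. t < 0 \<Longrightarrow> w (t, z) = w (-1, z)"
  using extensionD(3-5)[OF w] by blast+
 have "AE x in lborel. w (-1, x + snd l) = w (-1, x)"
  using a0 AE_translate_lborel[OF a0, of "snd l"] by eventually_elim (use per0 T in simp)
 from AE_snd[where 'a=real, OF this] AE_snd[where 'a=real, OF b'_periodic[OF T l2(2)]] a1 AE_translate_lborel[OF a1, of l]
 show ?thesis
 proof eventually_elim
  case (elim p)
  obtain t x where p: "p = (t, x)" by (cases p)
  have pl: "p + l = (t, x + snd l)" using l2(1) by (cases l) (simp add: p)
  have "w (t, x + snd l) = w (t, x)"
  proof (cases "t < 0")
   case True then show ?thesis using elim(1) neg[of t x] neg[of t "x + snd l"] by (simp add: p)
  next
   case False then show ?thesis using elim(3,4) per[of t x] T unfolding pl by (simp add: p)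
  qed
  then show ?case using elim(2) unfolding pl by (simp add: p cfield_def)
 qed
qed

lemma solution_transp:
 assumes s: "solution \<Omega> b u0 u" and w: "extension u0 u w"
 shows "transp (points \<Omega>) b' w"
 unfolding transp_iff
proof (intro allI impI)
 fix \<phi> \<phi>' and K :: "(real \<times> (real^2)) set"
 assume \<phi>: "C1 \<phi> \<phi>'" "compact K" "K \<subseteq> UNIV \<times> points \<Omega>" "\<forall>p. p \<notin> K \<longrightarrow> \<phi> p = 0"
 have [measurable]: "w \<in> Borel" using extensionD(1)[OF w] .
 obtain C where C: "\<And>p. \<bar>w p\<bar> \<le> C" using extensionD(2)[OF w] by blast
 have C0: "C \<ge> 0" using C[of undefined] by linarith
 have "(LBINT p. (w p *\<^sub>R cfield b' p) \<bullet> \<phi>' p) = 0"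
 proof (rule spacetime_tests[OF _ _ _ _ \<phi>(1-3)])
  show "L1 (\<lambda>p. indicator K p * norm (w p *\<^sub>R cfield b' p))"
   if K: "compact K" "K \<subseteq> UNIV \<times> points \<Omega>" for K
  proof (rule integrable_cfield[OF K, of _ C])
   have [measurable]: "K \<in> sets borel" using K(1) borel_compact by blast
   show "(\<lambda>p. indicator K p * norm (w p *\<^sub>R cfield b' p)) \<in> Borel" by measurable
   show "\<bar>indicator K p * norm (w p *\<^sub>R cfield b' p)\<bar> \<le> C * (1 + norm (b' (snd p)))" if "p \<in> K" for p
    using that C[of p] C0 norm_cfield[of b' p] by (auto intro!: mult_mono)
  qed auto
  show "AE p in lborel. w (p + l) *\<^sub>R cfield b' (p + l) = w p *\<^sub>R cfield b' p" if "\<Omega> = Torus" "l \<in> lattice3" for l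
   using extension_periodic[OF w _ _ that] s by (simp add: solution_def)
  fix f g assume f: "spacetime_test_function \<Omega> f" "C1 f g"
  have "(LBINT p. indicator (UNIV \<times> cell \<Omega>) p * (w p * (g p \<bullet> cfield b' p))) = 0"
   using s f(1) extension_identity[OF w f] unfolding solution_def by blast
  then show "(LBINT p. indicator (UNIV \<times> cell \<Omega>) p * ((w p *\<^sub>R cfield b' p) \<bullet> g p)) = 0"
   by (simp add: inner_commute)
 qed (use \<phi>(4) in auto)
 then show "(LBINT p. w p * (\<phi>' p \<bullet> cfield b' p)) = 0" by (simp add: inner_commute)
qed

text \<open>The way back from compactly supported tests to those of the domain. On the torus,
  \<open>\<phi>\<close> times the partition of unity \<open>\<theta>\<close> is compactly supported
  and periodizes to \<open>\<phi>\<close>, so folding its integral yields the integral over the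
  cell.\<close>

lemma transp_test:
 assumes t: "transp (points \<Omega>) b' w" and [measurable]: "w \<in> Borel" and C: "\<And>p. \<bar>w p\<bar> \<le> C"
  and per: "\<And>l. \<Omega> = Torus \<Longrightarrow> l \<in> lattice3 \<Longrightarrow> AE p in lborel. w (p + l) *\<^sub>R cfield b' (p + l) = w p *\<^sub>R cfield b' p"
  and \<phi>: "spacetime_test_function \<Omega> \<phi>" "C1 \<phi> \<phi>'"
 shows "(LBINT p. indicator (UNIV \<times> cell \<Omega>) p * (w p * (\<phi>' p \<bullet> cfield b' p))) = 0"
proof (cases "\<Omega> = Torus")
 case T: False
 then have K: "compact (supp \<phi>)" "supp \<phi> \<subseteq> UNIV \<times> points \<Omega>" using \<phi>(1) by (auto simp: spacetime_test_function_def)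
 have \<phi>'0: "\<phi>' p = 0" if "p \<notin> supp \<phi>" for p
  by (rule C1_grad_support[OF \<phi>(2) compact_imp_closed[OF K(1)] _ that]) (rule supp_zero)
 have "(LBINT p. w p * (\<phi>' p \<bullet> cfield b' p)) = 0" by (rule transpD[OF t \<phi>(2) K]) (rule supp_zero)
 moreover have "indicator (UNIV \<times> cell \<Omega>) p * (w p * (\<phi>' p \<bullet> cfield b' p)) = w p * (\<phi>' p \<bullet> cfield b' p)" for p
  using \<phi>'0[of p] K(2) cell_not_torus[OF T] by (cases "p \<in> supp \<phi>") auto
 ultimately show ?thesis by (simp only:)
next
 case T: True
 obtain T0 where T0: "\<And>t x. T0 < \<bar>t\<bar> \<Longrightarrow> \<phi> (t, x) = 0" using \<phi>(1) T by (auto simp: spacetime_test_function_def)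
 obtain \<theta> \<theta>' where \<theta>: "C1 \<theta> \<theta>'" "\<And>x. x \<notin> cball 0 3 \<Longrightarrow> \<theta> x = 0" "\<And>x. space.per \<theta> x = 1"
  using lattice_partition_of_unity by metis
 define \<psi> where "\<psi> p = \<theta> (snd p) * \<phi> p" for p :: "real \<times> (real^2)"
 have c: "C1 (\<lambda>p::real \<times> (real^2). \<theta> (snd p)) (\<lambda>p. (0, \<theta>' (snd p)))"
  by (rule C1_linear[OF \<theta>(1), of snd "\<lambda>w. (0, w)"]) (auto intro!: bounded_linear_snd continuous_intros simp: inner_prod_def)
 obtain \<psi>' where \<psi>: "C1 \<psi> \<psi>'" unfolding \<psi>_def[abs_def] using C1_mult[OF c \<phi>(2)] by blast
 let ?K = "{-T0..T0} \<times> cball (0 :: real^2) 3"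
 have K: "compact ?K" by (intro compact_Times compact_Icc compact_cball)
 have \<psi>0: "\<psi> p = 0" if "p \<notin> ?K" for p
 proof -
  have "\<bar>fst p\<bar> > T0 \<or> snd p \<notin> cball 0 3" using that by (cases p) auto
  then show ?thesis using T0[of "fst p" "snd p"] \<theta>(2)[of "snd p"] by (auto simp: \<psi>_def)
 qed
 obtain R where "?K \<subseteq> cball 0 R" using compact_subset_cball[OF K] by blast
 then have R: "\<psi> p = 0" if "p \<notin> cball 0 R" for p using \<psi>0 that by blast
 have per_\<psi>: "spacetime.per \<psi> = \<phi>"
 proof
  fix p :: "real \<times> (real^2)"
  obtain t x where p: "p = (t, x)" by (cases p)
  define \<rho> where "\<rho> = max (R + norm p) (3 + norm x)"
  have "spacetime.per \<psi> p = (\<Sum>l\<in>lattice3 \<inter> cball 0 \<rho>. \<psi> (p + l))"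
   by (rule spacetime.per_eq[OF R]) (auto simp: \<rho>_def)
  also have "\<dots> = (\<Sum>l\<in>lattice2 \<inter> cball 0 \<rho>. \<psi> (p + (0, l)))"
   unfolding lattice3_ball by (subst sum.reindex) (auto simp: inj_on_def)
  also have "\<dots> = (\<Sum>l\<in>lattice2 \<inter> cball 0 \<rho>. \<theta> (x + l) * \<phi> p)"
  proof (rule sum.cong[OF refl])
   fix l assume "l \<in> lattice2 \<inter> cball 0 \<rho>"
   then have "\<phi> (t, x + l) = \<phi> (t, x)"
    using \<phi>(1) T periodic_lattice[of "\<lambda>x. \<phi> (t, x)" l x] by (auto simp: spacetime_test_function_def function_on_def)
   then show "\<psi> (p + (0, l)) = \<theta> (x + l) * \<phi> p" by (simp add: \<psi>_def p)
  qed
  also have "\<dots> = space.per \<theta> x * \<phi> p"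
   by (subst space.per_eq[of 3 \<theta> x \<rho>]) (auto simp: \<theta>(2) \<rho>_def sum_distrib_right)
  finally show "spacetime.per \<psi> p = \<phi> p" by (simp add: \<theta>(3))
 qed
 have c1: "C1 \<phi> (spacetime.per \<psi>')" using spacetime.per_C1[OF \<psi> R] unfolding per_\<psi> .
 \<comment> \<open>The prescribed gradient and the periodized one belong to the same function, so
   they agree by uniqueness of the derivative.\<close>
 have g: "spacetime.per \<psi>' = \<phi>'"
 proof
  fix p
  have "\<phi>' p \<bullet> v = spacetime.per \<psi>' p \<bullet> v" for v by (rule C1_unique[OF c1 C1_D[OF \<phi>(2)]])
  then show "spacetime.per \<psi>' p = \<phi>' p" using vector_eq_rdot[of "spacetime.per \<psi>' p" "\<phi>' p"] by simp
 qed
 have "(LBINT p. w p * (\<psi>' p \<bullet> cfield b' p)) = 0"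
  by (rule transpD[OF t \<psi> K _ \<psi>0]) (simp_all add: T)
 then have z: "(LBINT p. (w p *\<^sub>R cfield b' p) \<bullet> \<psi>' p + (\<lambda>_. 0) p * \<psi> p) = 0" by (simp add: inner_commute)
 have i: "L1 (\<lambda>p. (w p *\<^sub>R cfield b' p) \<bullet> \<psi>' p + (\<lambda>_. 0) p * \<psi> p)"
  using test_integrable[OF \<psi> K _ \<psi>0 _ C] by (simp add: T inner_commute)
 have "(LBINT p. (w p *\<^sub>R cfield b' p) \<bullet> \<psi>' p + (\<lambda>_. 0) p * \<psi> p)
  = (LBINT p. indicator (UNIV \<times> cell Torus) p * ((w p *\<^sub>R cfield b' p) \<bullet> spacetime.per \<psi>' p + (\<lambda>_. 0) p * spacetime.per \<psi> p))"
  by (rule spacetime.test_integral_fold[OF \<psi> R _ _ _ i]) (use per T in auto)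
 then show ?thesis unfolding z g by (simp add: T inner_commute del: cell.simps)
qed

end

section \<open>Renormalization on the domain\<close>

lemma ess_bounded_comp:
 fixes \<beta> :: "real \<Rightarrow> real"
 assumes f: "ess_bounded S f" and \<beta>: "continuous_on UNIV \<beta>"
 shows "ess_bounded S (\<beta> \<circ> f)"
proof -
 have [measurable]: "\<beta> \<in> Borel" by (rule borel_measurable_continuous_onI[OF \<beta>])
 have [measurable]: "f \<in> borel_measurable (lebesgue_on S)" using f by (simp add: ess_bounded_def)
 obtain C where C: "AE x in lebesgue_on S. \<bar>f x\<bar> \<le> C" using f by (auto simp: ess_bounded_def)
 obtain B where B: "\<And>x. x \<in> cball 0 C \<Longrightarrow> norm (\<beta> x) \<le> B" using continuous_bounded_on_cball[OF \<beta>] by metis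
 have "AE x in lebesgue_on S. \<bar>(\<beta> \<circ> f) x\<bar> \<le> B" using C by eventually_elim (use B in simp)
 moreover have "\<beta> \<circ> f \<in> borel_measurable (lebesgue_on S)" unfolding comp_def by measurable
 ultimately show ?thesis unfolding ess_bounded_def by blast
qed

lemma function_on_comp: "function_on \<Omega> f \<Longrightarrow> function_on \<Omega> (\<lambda>x. \<beta> (f x))"
 by (simp add: function_on_def periodic_def)

context problem
begin

lemma renormalized:
 assumes Z: "critical_points \<Omega> b \<in> null_sets lebesgue" and HZ: "H ` critical_points \<Omega> b \<in> null_sets lebesgue"
  and s: "solution \<Omega> b u0 u"
 shows "renormalized_solution \<Omega> b u0 u"
 unfolding renormalized_solution_def
proof (intro allI impI)
 fix \<beta> assume "C1_b \<beta>"
 then have \<beta>: "continuous_on UNIV \<beta>" by (auto simp: C1_b_def intro: differentiable_imp_continuous_on)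
 have Linf: "Linf \<Omega> u0" "spacetime_Linf \<Omega> u" using s by (auto simp: solution_def)
 obtain w where w: "extension u0 u w" by (rule extension_exists[OF Linf])
 obtain C where C: "\<And>p. \<bar>w p\<bar> \<le> C" using extensionD(2)[OF w] by blast
 interpret global_solution "points \<Omega>" b' H' w C \<beta>
  by unfold_locales (rule solution_transp[OF s w] extensionD(1,3)[OF w] C \<beta>; assumption?)+
 have "points \<Omega> - (Opts \<union> Ppts) \<in> sets lborel" using Opts_open Ppts_open points_open by auto
 then have Z': "points \<Omega> - (Opts \<union> Ppts) \<in> null_sets lborel"
  using Z unfolding critical_eq[symmetric] by (simp add: null_sets_completion_iff)
 have "H' ` (points \<Omega> - (Opts \<union> Ppts)) = H ` critical_points \<Omega> b"
  unfolding critical_eq by (rule image_cong) (auto simp: critical_points_def H'_eq)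
 then have t: "transp (points \<Omega>) b' (\<lambda>p. \<beta> (w p))" using renormalize_global[OF Z'] HZ by simp
 note ext = extension_comp[OF w \<beta>]
 obtain B where B: "\<And>p. \<bar>\<beta> (w p)\<bar> \<le> B" using extensionD(2)[OF ext] by blast
 have L: "Linf \<Omega> (\<beta> \<circ> u0)" "spacetime_Linf \<Omega> (\<beta> \<circ> u)"
  using Linf ess_bounded_comp[OF _ \<beta>] function_on_comp[of \<Omega> _ \<beta>]
  unfolding Linf_def spacetime_Linf_def comp_def by blast+
 show "solution \<Omega> b (\<beta> \<circ> u0) (\<beta> \<circ> u)"
  unfolding solution_def
 proof (intro conjI L allI impI)
  fix \<phi> assume \<phi>: "spacetime_test_function \<Omega> \<phi>"
  then obtain \<phi>' where \<phi>': "C1 \<phi> \<phi>'" using smooth_C1 by (auto simp: spacetime_test_function_def)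
  show "(LINT (t, x)|lebesgue_on ({0..} \<times> cell \<Omega>). (\<beta> \<circ> u) (t, x) * (deriv (\<lambda>s. \<phi> (s, x)) t + b x \<bullet> grad (\<lambda>y. \<phi> (t, y)) x)) =
    - (LINT x|lebesgue_on (cell \<Omega>). (\<beta> \<circ> u0) x * \<phi> (0, x))"
   unfolding extension_identity[OF ext \<phi> \<phi>']
   by (rule transp_test[OF t extensionD(1)[OF ext] B extension_periodic[OF ext L] \<phi> \<phi>'])
 qed
qed

end

theorem corollary2:
  fixes \<Omega> :: planar_domain
    and b :: "real^2 \<Rightarrow> real^2"
    and H :: "real^2 \<Rightarrow> real"
  assumes "admissible \<Omega>"
    and "L2_loc \<Omega> b"
    and "divergence_free \<Omega> b"
    and "tangent_to_boundary \<Omega> b"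
    and "W12_loc \<Omega> H"
    and "hamiltonian \<Omega> H b"
    and "continuous_on (points \<Omega>) H"
    and "critical_points \<Omega> b \<in> null_sets lebesgue"
    and "H ` critical_points \<Omega> b \<in> null_sets lebesgue"
  shows "\<forall>u0. Linf \<Omega> u0 \<longrightarrow>
    (\<forall>u. spacetime_Linf \<Omega> u \<and> solution \<Omega> b u0 u \<longrightarrow> renormalized_solution \<Omega> b u0 u)"
proof -
 have o: "open (points \<Omega>)" using assms(1) by (cases \<Omega>) auto
 then have S: "points \<Omega> \<in> sets borel" by simp
 obtain b' where b': "b' \<in> Borel" "AE x in lborel. x \<in> points \<Omega> \<longrightarrow> b x = b' x"
  using borel_representative[OF S, of b] assms(2) unfolding L2_loc_def by blast
 interpret problem \<Omega> b H b'
  by unfold_locales (use o assms b' in \<open>auto simp: W12_loc_def L2_loc_def\<close>)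
 show ?thesis using renormalized[OF assms(8,9)] by blast
qed

end
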